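(* For any fixed $s\in\mathbb{R}$, let $B_\varepsilon(\cdot)$ be defined by $B_\varepsilon(t)=\varepsilon^{-1/2}\left(\mathcal{A}_1(s+\varepsilon t)-\mathcal{A}_1(s)\right)$, $t>0$. Then, as $\varepsilon\to0$ ($\varepsilon>0$), $B_\varepsilon(\cdot)$ converges to Brownian motion $B$ (started at $0$, with diffusion coefficient $2$, i.e. $\mathrm{Var}(B(t))=2t$) in the sense of convergence of finite-dimensional distributions. The same holds for $\tilde B_\varepsilon(\cdot)$ defined by $\tilde B_\varepsilon(t)=B_\varepsilon(-t)=\varepsilon^{-1/2}\left(\mathcal{A}_1(s-\varepsilon t)-\mathcal{A}_1(s)\right)$, $t>0$.
   Context: The Airy$_1$ process $\mathcal{A}_1$ is the stationary real-valued process indexed by $\mathbb{R}$ defined through its finite-dimensional distributions: for $x_1,\dots,x_n\in\mathbb{R}$ and $t_1<\dots<t_n$ in $\mathbb{R}$, $$\mathbb{P}\left(\mathcal{A}_1(t_1)\le x_1,\dots,\mathcal{A}_1(t_n)\le x_n\right)=\det(I-\mathrm{f}^{1/2}K_1^{\mathrm{ext}}\mathrm{f}^{1/2})_{L^2(\{t_1,\dots,t_n\}\times\mathbb{R})},$$ with counting measure on $\{t_1,\dots,t_n\}$ and Lebesgue measure on $\mathbb{R}$, $\mathrm{f}(t_j,x)=\mathbf{1}_{x\in(x_j,\infty)}$, and $$K_1^{\mathrm{ext}}(t,x;t',x')=-\frac{1}{\sqrt{4\pi(t'-t)}}\exp\left(-\frac{(x'-x)^2}{4(t'-t)}\right)\mathbf{1}_{t'>t}+\mathrm{Ai}(x+x'+(t'-t)^2)\exp\left((t'-t)(x+x')+\tfrac23(t'-t)^3\right),$$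 where $\mathrm{Ai}$ is the Airy function. The operator is not trace class; the determinant is understood through its Fredholm expansion series, or equivalently as the Fredholm determinant of the trace class operator obtained by conjugating with the multiplication operator by $(t_i,x)\mapsto(1+x^2)^{-2i}$. *)

theory Defs
  imports "HOL-Probability.Probability" "Jordan_Normal_Form.Determinant"
begin

text \<open>The integral defining \<open>Ai\<close> is only conditionally convergent, hence the limit of
  truncated integrals.\<close>

definition airy_Ai :: "real \<Rightarrow> real" where
  "airy_Ai x = Lim at_top (\<lambda>R. 1 / pi * integral {0..R} (\<lambda>u. cos (u ^ 3 / 3 + x * u)))"

text \<open>The Fredholm expansion of \<open>det (I - K)\<close> on \<open>L\<^sup>2(\<mu>)\<close>.
  Each summand is unchanged when \<open>K z z'\<close> is replaced by
  \<open>g z * K z z' / g z'\<close> for a nowhere vanishing function \<open>g\<close>.\<close>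

definition fredholm_det :: "'a measure \<Rightarrow> ('a \<Rightarrow> 'a \<Rightarrow> real) \<Rightarrow> real" where
  "fredholm_det \<mu> K =
     (\<Sum>m. (- 1) ^ m / fact m *
        (\<integral>z. Determinant.det (mat m m (\<lambda>(i, j). K (z i) (z j))) \<partial>(\<Pi>\<^sub>M i\<in>{..<m}. \<mu>)))"

definition K1_ext :: "real \<times> real \<Rightarrow> real \<times> real \<Rightarrow> real" where
  "K1_ext = (\<lambda>(t, x) (t', x').
     - (if t' > t
        then 1 / sqrt (4 * pi * (t' - t)) * exp (- ((x' - x)\<^sup>2 / (4 * (t' - t))))
        else 0)
     + airy_Ai (x + x' + (t' - t)\<^sup>2) * exp ((t' - t) * (x + x') + 2 / 3 * (t' - t) ^ 3))"

text \<open>The finite set \<open>T\<close> plays the role of the times \<open>t\<^sub>1 < \<dots> < t\<^sub>n\<close>, and \<open>\<xi> t\<^sub>j\<close> that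
  of the level \<open>x\<^sub>j\<close>.  Stationarity need not be required: the kernel only depends on
  time differences.\<close>

definition airy1_process :: "'a measure \<Rightarrow> (real \<Rightarrow> 'a \<Rightarrow> real) \<Rightarrow> bool" where
  "airy1_process M A \<longleftrightarrow>
     prob_space M \<and>
     (\<forall>t. A t \<in> borel_measurable M) \<and>
     (\<forall>T \<xi>. finite T \<longrightarrow> T \<noteq> {} \<longrightarrow>
        measure M {\<omega> \<in> space M. \<forall>t\<in>T. A t \<omega> \<le> \<xi> t} =
        (let f = (\<lambda>(t, x). indicator {\<xi> t<..} x :: real)
         in fredholm_det (count_space T \<Otimes>\<^sub>M lborel)
              (\<lambda>z z'. sqrt (f z) * K1_ext z z' * sqrt (f z'))))"

text \<open>Brownian motion started at \<open>0\<close> with diffusion coefficient \<open>D\<close>, i.e. with variance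
  \<open>D * t\<close> at time \<open>t\<close>.  The second argument of \<^const>\<open>normal_density\<close> is
  the standard deviation.\<close>

definition brownian_motion :: "real \<Rightarrow> 'a measure \<Rightarrow> (real \<Rightarrow> 'a \<Rightarrow> real) \<Rightarrow> bool" where
  "brownian_motion D M B \<longleftrightarrow>
     prob_space M \<and>
     (\<forall>t\<ge>0. B t \<in> borel_measurable M) \<and>
     (AE \<omega> in M. B 0 \<omega> = 0) \<and>
     (\<forall>r\<ge>0. \<forall>t>r. distributed M lborel (\<lambda>\<omega>. B t \<omega> - B r \<omega>)
        (\<lambda>x. ennreal (normal_density 0 (sqrt (D * (t - r))) x))) \<and>
     (\<forall>n (\<tau> :: nat \<Rightarrow> real). 0 \<le> \<tau> 0 \<longrightarrow> (\<forall>i<n. \<tau> i < \<tau> (Suc i)) \<longrightarrow>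
        prob_space.indep_vars M (\<lambda>_. borel) (\<lambda>i \<omega>. B (\<tau> (Suc i)) \<omega> - B (\<tau> i) \<omega>) {..<n}) \<and>
     (AE \<omega> in M. continuous_on {0..} (\<lambda>t. B t \<omega>))"

text \<open>Convergence of finite-dimensional distributions, on the index set \<open>I\<close> and along the
  filter \<open>F\<close>: the random vectors indexed by each finite \<open>J \<subseteq> I\<close> converge weakly, i.e. the
  expectations of all bounded continuous functions on \<open>\<real>\<^sup>J\<close> converge.\<close>

definition fdd_converges ::
  "'e filter \<Rightarrow> 'i set \<Rightarrow> 'a measure \<Rightarrow> ('e \<Rightarrow> 'i \<Rightarrow> 'a \<Rightarrow> real) \<Rightarrow>
   'b measure \<Rightarrow> ('i \<Rightarrow> 'b \<Rightarrow> real) \<Rightarrow> bool" where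
  "fdd_converges F I M X N Y \<longleftrightarrow>
     (\<forall>J (f :: ('i \<Rightarrow> real) \<Rightarrow> real).
        finite J \<longrightarrow> J \<subseteq> I \<longrightarrow>
        continuous_map (product_topology (\<lambda>_. euclideanreal) J) euclideanreal f \<longrightarrow>
        bounded (f ` (\<Pi>\<^sub>E j\<in>J. UNIV)) \<longrightarrow>
        ((\<lambda>\<epsilon>. \<integral>\<omega>. f (\<lambda>j\<in>J. X \<epsilon> j \<omega>) \<partial>M) \<longlongrightarrow> (\<integral>\<omega>. f (\<lambda>j\<in>J. Y j \<omega>) \<partial>N)) F)"

definition rescaled_increment ::
  "(real \<Rightarrow> 'a \<Rightarrow> real) \<Rightarrow> real \<Rightarrow> real \<Rightarrow> real \<Rightarrow> 'a \<Rightarrow> real" where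
  "rescaled_increment A s \<epsilon> t \<omega> = \<epsilon> powr (- 1 / 2) * (A (s + \<epsilon> * t) \<omega> - A s \<omega>)"

end

theory Submission
  imports Defs "HOL-Complex_Analysis.Complex_Analysis" "HOL-Real_Asymp.Real_Asymp"
begin

text \<open>Near a base time the process is compared with Brownian motion at the level of Fredholm
  determinants. Consider the times \<open>s + \<epsilon> \<tau>\<close>, where \<open>\<tau> = 0\<close> or \<open>\<tau> > 0\<close>, and levels that differ by
  multiples of \<open>sqrt \<epsilon>\<close>. The kernel \<open>K1_ext\<close> is the sum of a smooth part, which varies slowly on these
  scales, and of heat kernels, which do not become small. The heat kernels are strictly triangular in
  time and can be removed by row operations (\<open>fredholm_row_operation\<close>). The resulting rows are
  expectations over a Brownian path \<open>W\<close>: the smooth part is caloric, that is, preserved by the heat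
  flow (\<open>airy_shift_heat\<close>), and decomposing the path at the last time at which it exceeds its level
  identifies row \<open>t\<close> as the smooth part carried along paths that stay below all later levels
  (\<open>last_exceedance\<close>, \<open>fredholm_elimination\<close>).

  Over short times the smooth part is nearly \<open>Ai (x + y)\<close>, whatever the times. So the determinant is that
  of the kernel \<open>w x * Ai (x + y)\<close> on the line, up to an error of order \<open>\<epsilon>\<close>, where \<open>w x\<close> is the sum over
  the times of the probabilities that the path started above its level stays below the later levels
  (\<open>fredholm_line_approx\<close>). Raising the level at time \<open>s\<close> by \<open>h * sqrt \<epsilon>\<close> removes from \<open>w\<close> a piece on an
  interval of this length, whose height is the probability \<open>q\<close> that the increments of \<open>W\<close> respect the
  levels. For the process at the single time \<open>s\<close> the same interval is removed with height \<open>1\<close>. Hence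
  the increments of the two determinants have the ratio \<open>q\<close>, up to terms of order \<open>\<epsilon>\<close>
  (\<open>first_order_comparison\<close>, \<open>level_increment\<close>). In probabilistic terms: given that the process at \<open>s\<close> lies
  in a short interval, its rescaled increments are nearly distributed like those of Brownian motion
  (\<open>local_increment_estimate\<close>).

  Summing over a partition of a large bounded interval into pieces of length \<open>h * sqrt \<epsilon>\<close> gives the
  convergence of the orthant probabilities (\<open>orthant_limit\<close>), and weak convergence follows by
  approximating continuous functions by step functions on a grid of cubes (\<open>weak_convergence\<close>). Negative
  times reduce to positive ones, since reversing time transposes the kernel
  (\<open>airy1_process_reverse\<close>).

  The analytic input is a uniform exponential bound for \<open>Ai\<close> and its modulus of continuity, obtained by
  moving the contour of the Airy integral to a horizontal line in the upper half-plane
  (\<open>airy_contour\<close>), together with Hadamard's inequality, which yields Lipschitz estimates for Fredholm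
  series of kernels that are dominated by products (\<open>fredholm_lipschitz\<close>).\<close>

section \<open>Leibniz sums and Hadamard's inequality\<close>

lemma sum_square_reflection:
  fixes v u :: "nat \<Rightarrow> real"
  and n :: nat
  defines "c \<equiv> 2 / (\<Sum>k<n. (u k)\<^sup>2)"
  shows "(\<Sum>j<n. (v j - c * (\<Sum>k<n. v k * u k) * u j)\<^sup>2) = (\<Sum>j<n. (v j)\<^sup>2)"
proof -
  define s where "s = (\<Sum>k<n. v k * u k)"
  define q where "q = (\<Sum>k<n. (u k)\<^sup>2)"
  have "(\<Sum>j<n. (v j - c * s * u j)\<^sup>2) =
      (\<Sum>j<n. (v j)\<^sup>2 - 2 * c * s * (v j * u j) + c\<^sup>2 * s\<^sup>2 * (u j)\<^sup>2)"
    by (intro sum.cong refl) (simp add: power2_eq_square algebra_simps)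
  also have "\<dots> = (\<Sum>j<n. (v j)\<^sup>2) - 2 * c * s * s + c\<^sup>2 * s\<^sup>2 * q"
    by (simp add: sum.distrib sum_subtractf sum_distrib_left s_def q_def)
  also have "\<dots> = (\<Sum>j<n. (v j)\<^sup>2) + c * s\<^sup>2 * (c * q - 2)"
    by (simp add: power2_eq_square algebra_simps)
  also have "c * s\<^sup>2 * (c * q - 2) = 0"
    by (cases "q = 0") (simp_all add: c_def q_def[symmetric])
  finally show ?thesis by (simp add: s_def)
qed

text \<open>A Householder reflection acting on the columns maps the first row to a multiple of the first
  unit vector. It preserves the norms of all rows and the absolute value of the determinant, so
  that expanding along the first row reduces the dimension.\<close>

lemma hadamard_mat:
  fixes A :: "real mat"
  assumes "A \<in> carrier_mat n n"
  shows "(Determinant.det A)\<^sup>2 \<le> (\<Prod>i<n. \<Sum>j<n. (A $$ (i, j))\<^sup>2)"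
  using assms
proof (induction n arbitrary: A)
  case 0
  then show ?case by (simp add: Determinant.det_def)
next
  case (Suc n)
  define v where "v j = A $$ (0, j)" for j
  define r where "r = sqrt (\<Sum>j<Suc n. (v j)\<^sup>2)"
  have r2: "r\<^sup>2 = (\<Sum>j<Suc n. (v j)\<^sup>2)"
    unfolding r_def by (rule real_sqrt_pow2) (intro sum_nonneg, simp)
  define u where "u j = v j - (if j = 0 then r else 0)" for j
  define c where "c = 2 / (\<Sum>k<Suc n. (u k)\<^sup>2)"
  define H where "H = mat (Suc n) (Suc n) (\<lambda>(i, j). (if i = j then 1 else 0) - c * u i * u j)"
  have H: "H \<in> carrier_mat (Suc n) (Suc n)" by (simp add: H_def)
  have HH: "H * H = 1\<^sub>m (Suc n)"
  proof (rule eq_matI)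
    fix i j assume ij: "i < dim_row (1\<^sub>m (Suc n) :: real mat)" "j < dim_col (1\<^sub>m (Suc n) :: real mat)"
    have "(H * H) $$ (i, j) = (\<Sum>k<Suc n. ((if i = k then 1 else 0) - c * u i * u k) *
        ((if k = j then 1 else 0) - c * u k * u j))"
      using ij H by (simp add: H_def scalar_prod_def lessThan_atLeast0 del: sum.lessThan_Suc sum.op_ivl_Suc)
    also have "\<dots> = (\<Sum>k<Suc n. (if k = i then (if i = j then 1 else 0) else 0)
        - (if k = i then c * u i * u j else 0) - (if k = j then c * u i * u j else 0)
        + c\<^sup>2 * u i * u j * (u k)\<^sup>2)"
      by (intro sum.cong refl) (auto simp: power2_eq_square algebra_simps)
    also have "\<dots> = (if i = j then 1 else 0) + c * u i * u j * (c * (\<Sum>k<Suc n. (u k)\<^sup>2) - 2)"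
      using ij by (simp add: sum.distrib sum_subtractf sum_distrib_left[symmetric] power2_eq_square
          right_diff_distrib mult.assoc del: sum.lessThan_Suc)
    also have "c * u i * u j * (c * (\<Sum>k<Suc n. (u k)\<^sup>2) - 2) = 0"
      by (cases "(\<Sum>k<Suc n. (u k)\<^sup>2) = 0") (simp_all add: c_def del: sum.lessThan_Suc)
    finally show "(H * H) $$ (i, j) = 1\<^sub>m (Suc n) $$ (i, j)" using ij by simp
  qed (use H in auto)
  define A' where "A' = A * H"
  have A': "A' \<in> carrier_mat (Suc n) (Suc n)" using Suc.prems H by (simp add: A'_def)
  have entry: "A' $$ (i, j) = A $$ (i, j) - c * (\<Sum>k<Suc n. A $$ (i, k) * u k) * u j"
    if "i < Suc n" "j < Suc n" for i j
  proof -
    have "A' $$ (i, j) = (\<Sum>k<Suc n. A $$ (i, k) * ((if k = j then 1 else 0) - c * u k * u j))"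
      using that Suc.prems H
      by (simp add: A'_def H_def scalar_prod_def lessThan_atLeast0 del: sum.lessThan_Suc sum.op_ivl_Suc)
    also have "\<dots> = (\<Sum>k<Suc n. (if k = j then A $$ (i, j) else 0) - c * (A $$ (i, k) * u k) * u j)"
      by (intro sum.cong refl) (auto simp: algebra_simps)
    finally show ?thesis using that
      by (simp add: sum_subtractf sum_distrib_left sum_distrib_right del: sum.lessThan_Suc)
  qed
  have rows: "(\<Sum>j<Suc n. (A' $$ (i, j))\<^sup>2) = (\<Sum>j<Suc n. (A $$ (i, j))\<^sup>2)" if "i < Suc n" for i
    using sum_square_reflection[where v = "\<lambda>j. A $$ (i, j)" and n = "Suc n" and u = u] that
    by (simp add: entry c_def del: sum.lessThan_Suc)
  have su: "(\<Sum>k<Suc n. (u k)\<^sup>2) = 2 * (\<Sum>k<Suc n. v k * u k)"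
  proof -
    have "(\<Sum>k<Suc n. (u k)\<^sup>2) = (\<Sum>k<Suc n. (if k = 0 then r\<^sup>2 else 0) - (v k)\<^sup>2 + 2 * (v k * u k))"
      by (intro sum.cong refl) (auto simp: u_def power2_eq_square algebra_simps)
    also have "\<dots> = r\<^sup>2 - (\<Sum>k<Suc n. (v k)\<^sup>2) + 2 * (\<Sum>k<Suc n. v k * u k)"
      by (simp add: sum.distrib sum_subtractf sum_distrib_left[symmetric] del: sum.lessThan_Suc)
    finally show ?thesis by (simp add: r2)
  qed
  have row0: "A' $$ (0, j) = (if j = 0 then r else 0)" if "j < Suc n" for j
  proof (cases "(\<Sum>k<Suc n. (u k)\<^sup>2) = 0")
    case True
    then have "u j = 0" using that by (subst (asm) sum_nonneg_eq_0_iff) auto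
    then show ?thesis using that by (simp add: entry) (simp add: u_def v_def split: if_splits)
  next
    case False
    then have "c * (\<Sum>k<Suc n. v k * u k) = 1" using su by (simp add: c_def del: sum.lessThan_Suc)
    then show ?thesis using that by (simp add: entry u_def v_def del: sum.lessThan_Suc)
  qed
  define D where "D = mat_delete A' 0 0"
  have D: "D \<in> carrier_mat n n" using mat_delete_carrier[OF A'] by (simp add: D_def)
  have Dij: "D $$ (i, j) = A' $$ (Suc i, Suc j)" if "i < n" "j < n" for i j
    using that A' by (simp add: D_def mat_delete_def)
  have "Determinant.det A' = (\<Sum>j<Suc n. A' $$ (0, j) * cofactor A' 0 j)"
    by (rule laplace_expansion_row[OF A']) simp
  also have "\<dots> = (\<Sum>j<Suc n. if j = 0 then r * Determinant.det D else 0)"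
    by (intro sum.cong refl) (auto simp: row0 cofactor_def D_def)
  finally have detA': "Determinant.det A' = r * Determinant.det D" by (simp del: sum.lessThan_Suc)
  have "Determinant.det H * Determinant.det H = 1"
    using det_mult[OF H H] by (simp add: HH)
  then have "(Determinant.det A)\<^sup>2 = (Determinant.det A')\<^sup>2"
    unfolding A'_def det_mult[OF Suc.prems H] by (simp add: power2_eq_square algebra_simps)
  also have "\<dots> = r\<^sup>2 * (Determinant.det D)\<^sup>2" by (simp add: detA' power_mult_distrib)
  also have "\<dots> \<le> r\<^sup>2 * (\<Prod>i<n. \<Sum>j<n. (D $$ (i, j))\<^sup>2)"
    by (intro mult_left_mono Suc.IH D) simp
  also have "\<dots> \<le> r\<^sup>2 * (\<Prod>i<n. \<Sum>j<Suc n. (A' $$ (Suc i, j))\<^sup>2)"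
  proof (intro mult_left_mono prod_mono conjI)
    fix i assume i: "i \<in> {..<n}"
    show "(\<Sum>j<n. (D $$ (i, j))\<^sup>2) \<le> (\<Sum>j<Suc n. (A' $$ (Suc i, j))\<^sup>2)"
      unfolding sum.lessThan_Suc_shift using i by (simp add: Dij)
  qed (auto intro: sum_nonneg)
  also have "\<dots> = (\<Prod>i<Suc n. \<Sum>j<Suc n. (A $$ (i, j))\<^sup>2)"
    unfolding prod.lessThan_Suc_shift by (simp add: rows r2 v_def del: sum.lessThan_Suc)
  finally show ?case .
qed

lemma permutes_nat_less: "\<pi> permutes {..<m} \<Longrightarrow> i < m \<Longrightarrow> \<pi> i < m"
  using permutes_in_image[of \<pi> "{..<m}" i] by simp

text \<open>The determinant as a Leibniz sum over an arbitrary index set. Deleting or renaming indices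
  then needs no renumbering, and row \<open>i\<close> may come from a kernel that depends on \<open>i\<close>.\<close>

definition ldet :: "'i set \<Rightarrow> ('i \<Rightarrow> 'i \<Rightarrow> real) \<Rightarrow> real" where
  "ldet I k = (\<Sum>\<pi> | \<pi> permutes I. of_int (sign \<pi>) * (\<Prod>i\<in>I. k i (\<pi> i)))"

lemma det_mat_eq_ldet: "Determinant.det (mat m m (\<lambda>(i, j). k i j)) = ldet {..<m} k"
proof -
  have "of_int (sign p) = (signof p :: real)" for p :: "nat \<Rightarrow> nat"
    by (simp add: sign_def)
  then show ?thesis
    unfolding ldet_def
    by (subst det_def'[of _ m]) (auto simp: lessThan_atLeast0
        intro!: sum.cong prod.cong arg_cong2[of _ _ _ _ "(*)"] dest: permutes_nat_less)
qed

lemma ldet_cong: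
  assumes "\<And>i j. i \<in> I \<Longrightarrow> j \<in> I \<Longrightarrow> k i j = k' i j"
  shows "ldet I k = ldet I k'"
  unfolding ldet_def using assms
  by (auto intro!: sum.cong prod.cong arg_cong2[of _ _ _ _ "(*)"] simp: permutes_in_image)

lemma ldet_row_split:
  assumes "finite I" "p \<in> I"
  shows "ldet I (k(p := r)) =
    (\<Sum>\<pi> | \<pi> permutes I. r (\<pi> p) * (of_int (sign \<pi>) * (\<Prod>i\<in>I-{p}. k i (\<pi> i))))"
  unfolding ldet_def using assms
  by (intro sum.cong refl) (simp add: prod.remove)

lemma ldet_row_diff:
  assumes "finite I" "p \<in> I"
  shows "ldet I (k(p := \<lambda>j. r j - r' j)) = ldet I (k(p := r)) - ldet I (k(p := r'))"
  unfolding ldet_row_split[OF assms] by (simp add: sum_subtractf algebra_simps)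

lemma ldet_rows_scale:
  "ldet I (\<lambda>i j. w i * k i j) = (\<Prod>i\<in>I. w i) * ldet I k"
  unfolding ldet_def by (simp add: sum_distrib_left prod.distrib algebra_simps)

lemma ldet_reindex:
  assumes f: "bij_betw f I I'" and I: "finite I"
  shows "ldet I' k = ldet I (\<lambda>i j. k (f i) (f j))"
proof -
  have inj: "inj_on f I" and im: "f ` I = I'" using f by (auto simp: bij_betw_def)
  have "bij_betw (map_permutation I f) {\<pi>. \<pi> permutes I} {\<pi>. \<pi> permutes I'}"
  proof (rule bij_betw_byWitness[where f' = "map_permutation I' (inv_into I f)"])
    show "\<forall>a\<in>{\<pi>. \<pi> permutes I}. map_permutation I' (inv_into I f) (map_permutation I f a) = a"
      using map_permutation_compose_inv[OF f, of _ "inv_into I f"] inj by (auto simp: inv_into_f_f)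
    show "\<forall>a'\<in>{\<pi>. \<pi> permutes I'}. map_permutation I f (map_permutation I' (inv_into I f) a') = a'"
      using map_permutation_compose_inv[OF bij_betw_inv_into[OF f], of _ f] im
      by (auto simp: f_inv_into_f)
    show "map_permutation I f ` {\<pi>. \<pi> permutes I} \<subseteq> {\<pi>. \<pi> permutes I'}"
      using map_permutation_permutes[OF f] by auto
    show "map_permutation I' (inv_into I f) ` {\<pi>. \<pi> permutes I'} \<subseteq> {\<pi>. \<pi> permutes I}"
      using map_permutation_permutes[OF bij_betw_inv_into[OF f]] by auto
  qed
  then have "ldet I' k = (\<Sum>\<pi> | \<pi> permutes I. of_int (sign (map_permutation I f \<pi>)) *
      (\<Prod>i\<in>I'. k i (map_permutation I f \<pi> i)))"
    unfolding ldet_def by (rule sum.reindex_bij_betw[symmetric])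
  also have "\<dots> = ldet I (\<lambda>i j. k (f i) (f j))"
    unfolding ldet_def
  proof (intro sum.cong refl arg_cong2[of _ _ _ _ "(*)"])
    fix \<pi> assume p: "\<pi> \<in> {\<pi>. \<pi> permutes I}"
    show "real_of_int (sign (map_permutation I f \<pi>)) = of_int (sign \<pi>)"
      using p inj I by (simp add: sign_map_permutation)
    show "(\<Prod>i\<in>I'. k i (map_permutation I f \<pi> i)) = (\<Prod>i\<in>I. k (f i) (f (\<pi> i)))"
      unfolding im[symmetric] using inj
      by (subst prod.reindex) (auto intro!: prod.cong simp: map_permutation_apply)
  qed
  finally show ?thesis .
qed

text \<open>Laplace expansion along row \<open>p\<close>, with the cofactors written as determinants on \<open>I - {j}\<close>:
  the rows and columns are relabelled by the transposition of \<open>p\<close> and \<open>j\<close>, which produces the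
  sign and moves row \<open>j\<close> to the place of row \<open>p\<close>.\<close>

lemma ldet_laplace_swap:
  assumes I: "finite I" "p \<in> I"
  shows "ldet I k = k p p * ldet (I - {p}) k - (\<Sum>j\<in>I-{p}. k p j * ldet (I - {j}) (k(p := k j)))"
proof -
  let ?s = "\<lambda>\<pi>. of_int (sign \<pi>) * (\<Prod>i\<in>I. k i (\<pi> i))"
  have part: "{\<pi>. \<pi> permutes I} = (\<Union>j\<in>I. {\<pi>. \<pi> permutes I \<and> \<pi> p = j})"
    using I by (auto simp: permutes_in_image)
  have "ldet I k = (\<Sum>j\<in>I. \<Sum>\<pi> | \<pi> permutes I \<and> \<pi> p = j. ?s \<pi>)"
    unfolding ldet_def part using I
    by (intro sum.UNION_disjoint) (auto intro: finite_subset[OF _ finite_permutations[of I]])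
  also have "\<dots> = (\<Sum>\<pi> | \<pi> permutes I \<and> \<pi> p = p. ?s \<pi>) +
      (\<Sum>j\<in>I-{p}. \<Sum>\<pi> | \<pi> permutes I \<and> \<pi> p = j. ?s \<pi>)"
    by (rule sum.remove) (use I in auto)
  also have "(\<Sum>\<pi> | \<pi> permutes I \<and> \<pi> p = p. ?s \<pi>) = k p p * ldet (I - {p}) k"
  proof -
    have "{\<pi>. \<pi> permutes I \<and> \<pi> p = p} = {\<pi>. \<pi> permutes (I - {p})}"
      using I by (auto intro: permutes_subset permutes_superset simp: permutes_not_in)
    then show ?thesis
      unfolding ldet_def sum_distrib_left
      using I by (auto intro!: sum.cong simp: prod.remove permutes_not_in)
  qed
  also have "(\<Sum>j\<in>I-{p}. \<Sum>\<pi> | \<pi> permutes I \<and> \<pi> p = j. ?s \<pi>) =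
      - (\<Sum>j\<in>I-{p}. k p j * ldet (I - {j}) (k(p := k j)))"
    unfolding sum_negf[symmetric]
  proof (intro sum.cong refl)
    fix j assume j: "j \<in> I - {p}"
    let ?t = "Transposition.transpose p j"
    have bij: "bij_betw (\<lambda>\<pi>. \<pi> \<circ> ?t) {\<pi>. \<pi> permutes (I - {j})} {\<pi>. \<pi> permutes I \<and> \<pi> p = j}"
    proof (rule bij_betw_byWitness[where f' = "\<lambda>\<pi>. \<pi> \<circ> ?t"])
      have t: "?t permutes I" using j I by (intro permutes_swap_id) auto
      show "(\<lambda>\<pi>. \<pi> \<circ> ?t) ` {\<pi>. \<pi> permutes (I - {j})} \<subseteq> {\<pi>. \<pi> permutes I \<and> \<pi> p = j}"
        using t by (auto intro: permutes_compose permutes_subset simp: permutes_not_in)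
      show "(\<lambda>\<pi>. \<pi> \<circ> ?t) ` {\<pi>. \<pi> permutes I \<and> \<pi> p = j} \<subseteq> {\<pi>. \<pi> permutes (I - {j})}"
      proof safe
        fix \<pi> assume "\<pi> permutes I" "j = \<pi> p"
        then have "(\<pi> \<circ> ?t) permutes I" "(\<pi> \<circ> ?t) j = j" using t by (auto intro: permutes_compose)
        then have "(\<pi> \<circ> ?t) permutes (I - {j})"
          by (auto intro: permutes_superset)
        then show "\<pi> \<circ> Transposition.transpose p (\<pi> p) permutes I - {\<pi> p}" using \<open>j = \<pi> p\<close> by simp
      qed
    qed (auto simp: comp_assoc)
    have "(\<Sum>\<pi> | \<pi> permutes I \<and> \<pi> p = j. ?s \<pi>) = (\<Sum>\<pi> | \<pi> permutes (I - {j}). ?s (\<pi> \<circ> ?t))"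
      by (rule sum.reindex_bij_betw[OF bij, symmetric])
    also have "\<dots> = (\<Sum>\<pi> | \<pi> permutes (I - {j}). - k p j * (of_int (sign \<pi>) *
        (\<Prod>i\<in>I-{j}. (k(p := k j)) i (\<pi> i))))"
    proof (intro sum.cong refl)
      fix \<pi> assume p: "\<pi> \<in> {\<pi>. \<pi> permutes (I - {j})}"
      have "permutation \<pi>" using p I by (auto intro: permutes_imp_permutation[of "I - {j}"])
      then have s: "sign (\<pi> \<circ> ?t) = - sign \<pi>"
        using j by (subst sign_compose) (auto simp: permutation_swap_id sign_swap_id)
      have "(\<Prod>i\<in>I. k i ((\<pi> \<circ> ?t) i)) = k j (\<pi> p) * (\<Prod>i\<in>I-{j}. k i ((\<pi> \<circ> ?t) i))"
        using j I by (subst prod.remove[of I j]) auto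
      also have "(\<Prod>i\<in>I-{j}. k i ((\<pi> \<circ> ?t) i)) = k p j * (\<Prod>i\<in>I-{j}-{p}. k i ((\<pi> \<circ> ?t) i))"
        using j I p by (subst prod.remove[of _ p]) (auto simp: permutes_not_in)
      also have "(\<Prod>i\<in>I-{j}-{p}. k i ((\<pi> \<circ> ?t) i)) = (\<Prod>i\<in>I-{j}-{p}. k i (\<pi> i))"
        by (intro prod.cong refl) (auto simp: transpose_apply_other)
      also have "k j (\<pi> p) * (k p j * (\<Prod>i\<in>I-{j}-{p}. k i (\<pi> i))) =
          k p j * (\<Prod>i\<in>I-{j}. (k(p := k j)) i (\<pi> i))"
        using j I by (subst prod.remove[of "I - {j}" p]) (auto intro!: prod.cong)
      finally show "?s (\<pi> \<circ> ?t) = - k p j * (of_int (sign \<pi>) *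
        (\<Prod>i\<in>I-{j}. (k(p := k j)) i (\<pi> i)))"
        by (simp add: s)
    qed
    finally show "(\<Sum>\<pi> | \<pi> permutes I \<and> \<pi> p = j. ?s \<pi>) = - (k p j * ldet (I - {j}) (k(p := k j)))"
      by (simp add: ldet_def sum_distrib_left sum_negf)
  qed
  finally show ?thesis by simp
qed

lemma hadamard_ldet:
  assumes "\<And>i j. i < m \<Longrightarrow> j < m \<Longrightarrow> \<bar>k i j\<bar> \<le> a i * b j"
    and "\<And>i. i < m \<Longrightarrow> 0 \<le> a i" "\<And>i. i < m \<Longrightarrow> 0 \<le> b i"
  shows "\<bar>ldet {..<m} k\<bar> \<le> sqrt (real m) ^ m * (\<Prod>i<m. a i * b i)"
proof -
  \<comment> \<open>Dividing the columns by the \<open>b j\<close> leaves rows whose entries are bounded by \<open>a i\<close>.\<close>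
  define k' where "k' i j = k i j / b j" for i j
  have k': "\<bar>k' i j\<bar> \<le> a i" if "i < m" "j < m" for i j
    using assms(1)[OF that] assms(2,3)[of i] assms(3)[of j] that
    by (cases "b j = 0") (auto simp: k'_def field_simps)
  have kk': "k i j = k' i j * b j" if "i < m" "j < m" for i j
    using assms(1)[OF that] by (cases "b j = 0") (auto simp: k'_def)
  have "ldet {..<m} k = (\<Sum>\<pi> | \<pi> permutes {..<m}. of_int (sign \<pi>) * (\<Prod>i<m. k' i (\<pi> i) * b (\<pi> i)))"
    unfolding ldet_def
    by (intro sum.cong refl arg_cong2[of _ _ _ _ "(*)"] prod.cong)
      (use kk' permutes_in_image[of _ "{..<m}"] in auto)
  also have "\<dots> = ldet {..<m} k' * (\<Prod>i<m. b i)"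
    unfolding ldet_def sum_distrib_right
    by (intro sum.cong refl) (auto simp: prod.distrib prod.permute[of _ "{..<m}" b] comp_def)
  finally have eq: "ldet {..<m} k = ldet {..<m} k' * (\<Prod>i<m. b i)" .
  have sq: "real m ^ m = (sqrt (real m) ^ m)\<^sup>2"
    by (metis real_sqrt_pow2 of_nat_0_le_iff power_mult mult.commute)
  have "(ldet {..<m} k')\<^sup>2 \<le> (\<Prod>i<m. \<Sum>j<m. (k' i j)\<^sup>2)"
    using hadamard_mat[of "mat m m (\<lambda>(i, j). k' i j)" m] by (simp add: det_mat_eq_ldet)
  also have "\<dots> \<le> (\<Prod>i<m. real m * (a i)\<^sup>2)"
  proof (intro prod_mono conjI sum_nonneg)
    fix i assume i: "i \<in> {..<m}"
    have "(\<Sum>j<m. (k' i j)\<^sup>2) \<le> (\<Sum>j<m. (a i)\<^sup>2)"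
      using k' i assms(2) by (intro sum_mono) (auto simp: abs_le_square_iff[symmetric])
    then show "(\<Sum>j<m. (k' i j)\<^sup>2) \<le> real m * (a i)\<^sup>2" by simp
  qed auto
  also have "\<dots> = (sqrt (real m) ^ m * (\<Prod>i<m. a i))\<^sup>2"
    by (simp add: prod.distrib power_mult_distrib prod_power_distrib sq[symmetric])
  finally have "\<bar>ldet {..<m} k'\<bar> \<le> sqrt (real m) ^ m * (\<Prod>i<m. a i)"
    using prod_nonneg[of "{..<m}" a] assms(2)
    by (subst (asm) abs_le_square_iff[symmetric]) (auto simp: abs_mult)
  then have "\<bar>ldet {..<m} k'\<bar> * (\<Prod>i<m. b i) \<le> sqrt (real m) ^ m * (\<Prod>i<m. a i) * (\<Prod>i<m. b i)"
    using assms(3) by (intro mult_right_mono prod_nonneg) auto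
  then show ?thesis
    using prod_nonneg[of "{..<m}" b] assms(3) by (simp add: eq abs_mult prod.distrib mult.assoc)
qed

text \<open>The rows are exchanged one after the other; each exchange changes one row by at most
  \<open>\<eta> p * b j\<close>, and Hadamard's inequality applies to the difference.\<close>

lemma ldet_lipschitz:
  assumes k: "\<And>i j. i < m \<Longrightarrow> j < m \<Longrightarrow> \<bar>k i j\<bar> \<le> a i * b j"
    and k': "\<And>i j. i < m \<Longrightarrow> j < m \<Longrightarrow> \<bar>k' i j\<bar> \<le> a i * b j"
    and d: "\<And>i j. i < m \<Longrightarrow> j < m \<Longrightarrow> \<bar>k i j - k' i j\<bar> \<le> \<eta> i * b j"
    and pos: "\<And>i. i < m \<Longrightarrow> 0 \<le> a i" "\<And>i. i < m \<Longrightarrow> 0 \<le> b i" "\<And>i. i < m \<Longrightarrow> 0 \<le> \<eta> i"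
  shows "\<bar>ldet {..<m} k - ldet {..<m} k'\<bar> \<le>
    sqrt (real m) ^ m * (\<Sum>p<m. \<eta> p * b p * (\<Prod>i\<in>{..<m}-{p}. a i * b i))"
proof -
  define h where "h p = (\<lambda>i. if i < p then k i else k' i)" for p
  have step: "\<bar>ldet {..<m} (h (Suc p)) - ldet {..<m} (h p)\<bar> \<le>
      sqrt (real m) ^ m * (\<eta> p * b p * (\<Prod>i\<in>{..<m}-{p}. a i * b i))" if p: "p < m" for p
  proof -
    have "h (Suc p) = (h p)(p := k p)" "h p = (h p)(p := k' p)"
      by (auto simp: h_def fun_eq_iff)
    then have "ldet {..<m} (h (Suc p)) - ldet {..<m} (h p) =
        ldet {..<m} ((h p)(p := \<lambda>j. k p j - k' p j))"
      using ldet_row_diff[of "{..<m}" p "h p" "k p" "k' p"] p by simp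
    also have "\<bar>\<dots>\<bar> \<le> sqrt (real m) ^ m * (\<Prod>i<m. (a(p := \<eta> p)) i * b i)"
      by (rule hadamard_ldet) (auto simp: h_def k k' d pos p)
    also have "(\<Prod>i<m. (a(p := \<eta> p)) i * b i) = \<eta> p * b p * (\<Prod>i\<in>{..<m}-{p}. a i * b i)"
      using p by (subst prod.remove[of _ p]) auto
    finally show ?thesis .
  qed
  have "ldet {..<m} k - ldet {..<m} k' = ldet {..<m} (h m) - ldet {..<m} (h 0)"
    by (auto simp: h_def intro!: arg_cong2[of _ _ _ _ "(-)"] ldet_cong)
  also have "\<dots> = (\<Sum>p<m. ldet {..<m} (h (Suc p)) - ldet {..<m} (h p))"
    by (rule sum_lessThan_telescope[symmetric])
  also have "\<bar>\<dots>\<bar> \<le> (\<Sum>p<m. sqrt (real m) ^ m * (\<eta> p * b p * (\<Prod>i\<in>{..<m}-{p}. a i * b i)))"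
    by (intro order.trans[OF sum_abs] sum_mono step) auto
  finally show ?thesis by (simp add: sum_distrib_left)
qed

section \<open>Fredholm series of dominated kernels\<close>

lemma distr_PiM_reindex_map:
  fixes M :: "'a measure" and N :: "'b measure"
  assumes M: "sigma_finite_measure M" and N: "sigma_finite_measure (distr M N f)"
    and f: "f \<in> measurable M N" and I: "finite I" and g: "bij_betw g I' I"
  shows "distr (\<Pi>\<^sub>M i\<in>I. M) (\<Pi>\<^sub>M i\<in>I'. N) (\<lambda>z. \<lambda>i\<in>I'. f (z (g i))) = (\<Pi>\<^sub>M i\<in>I'. distr M N f)"
proof (rule product_sigma_finite.PiM_eqI)
  interpret M: product_sigma_finite "\<lambda>_. M" using M by (simp add: product_sigma_finite_def)
  show "product_sigma_finite (\<lambda>_. distr M N f)" using N by (simp add: product_sigma_finite_def)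
  show I': "finite I'" using I g bij_betw_finite by blast
  show "sets (distr (\<Pi>\<^sub>M i\<in>I. M) (\<Pi>\<^sub>M i\<in>I'. N) (\<lambda>z. \<lambda>i\<in>I'. f (z (g i)))) =
      sets (\<Pi>\<^sub>M i\<in>I'. distr M N f)"
    by (simp cong: sets_PiM_cong)
  have inj: "inj_on g I'" and im: "g ` I' = I" using g by (auto simp: bij_betw_def)
  have meas: "(\<lambda>z. \<lambda>i\<in>I'. f (z (g i))) \<in> measurable (\<Pi>\<^sub>M i\<in>I. M) (\<Pi>\<^sub>M i\<in>I'. N)"
  proof (rule measurable_restrict)
    fix i assume "i \<in> I'"
    then have "g i \<in> I" using im by auto
    then show "(\<lambda>z. f (z (g i))) \<in> measurable (\<Pi>\<^sub>M i\<in>I. M) N"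
      using f by measurable
  qed
  fix A assume A: "\<And>i. i \<in> I' \<Longrightarrow> A i \<in> sets (distr M N f)"
  have "(\<lambda>z. \<lambda>i\<in>I'. f (z (g i))) -` Pi\<^sub>E I' A \<inter> space (\<Pi>\<^sub>M i\<in>I. M) =
      (\<Pi>\<^sub>E i\<in>I. f -` A (inv_into I' g i) \<inter> space M)"
    using inj im by (auto simp: space_PiM PiE_iff)
  moreover have "Pi\<^sub>E I' A \<in> sets (\<Pi>\<^sub>M i\<in>I'. N)" using A I' by (auto intro!: sets_PiM_I_finite)
  ultimately have "distr (\<Pi>\<^sub>M i\<in>I. M) (\<Pi>\<^sub>M i\<in>I'. N) (\<lambda>z. \<lambda>i\<in>I'. f (z (g i))) (Pi\<^sub>E I' A) =
      (\<Pi>\<^sub>M i\<in>I. M) (\<Pi>\<^sub>E i\<in>I. f -` A (inv_into I' g i) \<inter> space M)"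
    by (subst emeasure_distr[OF meas]) auto
  also have "\<dots> = (\<Prod>i\<in>I. M (f -` A (inv_into I' g i) \<inter> space M))"
    using A im f I by (intro M.emeasure_PiM) (auto simp: inv_into_into)
  also have "\<dots> = (\<Prod>i\<in>I'. M (f -` A i \<inter> space M))"
    unfolding im[symmetric] using inj by (simp add: prod.reindex)
  also have "\<dots> = (\<Prod>i\<in>I'. emeasure (distr M N f) (A i))"
    using A f by (intro prod.cong refl) (simp add: emeasure_distr)
  finally show "distr (\<Pi>\<^sub>M i\<in>I. M) (\<Pi>\<^sub>M i\<in>I'. N) (\<lambda>z. \<lambda>i\<in>I'. f (z (g i))) (Pi\<^sub>E I' A) =
    (\<Prod>i\<in>I'. emeasure (distr M N f) (A i))" .
qed

lemma integral_abs_le: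
  fixes f g :: "'a \<Rightarrow> real"
  assumes "integrable M g" "\<And>x. x \<in> space M \<Longrightarrow> \<bar>f x\<bar> \<le> g x"
  shows "\<bar>\<integral>x. f x \<partial>M\<bar> \<le> (\<integral>x. g x \<partial>M)"
proof -
  have "(\<integral>x. \<bar>f x\<bar> \<partial>M) \<le> (\<integral>x. g x \<partial>M)"
    using assms by (intro integral_mono') (auto intro: order.trans[OF abs_ge_zero])
  then show ?thesis using integral_abs_bound[of M f] by linarith
qed

text \<open>A kernel with \<open>\<bar>k z z'\<bar> \<le> a z * b z'\<close> and \<open>a * b\<close> integrable has an absolutely convergent Fredholm
  series, by Hadamard's inequality. The weights \<open>a\<close> and \<open>b\<close> take over the role of the conjugation by
  a multiplication operator.\<close>

locale dominating_pair = sigma_finite_measure \<mu>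
  for \<mu> :: "'a measure" +
  fixes a b :: "'a \<Rightarrow> real"
  assumes a_meas[measurable]: "a \<in> borel_measurable \<mu>"
    and b_meas[measurable]: "b \<in> borel_measurable \<mu>"
    and a_nonneg: "\<And>z. 0 \<le> a z" and b_nonneg: "\<And>z. 0 \<le> b z"
    and ab_integrable: "integrable \<mu> (\<lambda>z. a z * b z)"
begin

definition dominated :: "('a \<Rightarrow> 'a \<Rightarrow> real) \<Rightarrow> bool" where
  "dominated k \<longleftrightarrow> case_prod k \<in> borel_measurable (\<mu> \<Otimes>\<^sub>M \<mu>) \<and>
     (\<forall>z\<in>space \<mu>. \<forall>z'\<in>space \<mu>. \<bar>k z z'\<bar> \<le> a z * b z')"

lemma dominated_measurable:
  assumes "dominated k" "f \<in> measurable N \<mu>" "g \<in> measurable N \<mu>"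
  shows "(\<lambda>x. k (f x) (g x)) \<in> borel_measurable N"
proof -
  have "case_prod k \<in> borel_measurable (\<mu> \<Otimes>\<^sub>M \<mu>)" using assms by (simp add: dominated_def)
  from measurable_compose[OF measurable_Pair[OF assms(2,3)] this] show ?thesis by simp
qed

lemma dominatedD: "dominated k \<Longrightarrow> z \<in> space \<mu> \<Longrightarrow> z' \<in> space \<mu> \<Longrightarrow> \<bar>k z z'\<bar> \<le> a z * b z'"
  by (simp add: dominated_def)

definition mass :: real where "mass = (\<integral>z. a z * b z \<partial>\<mu>)"

lemma mass_nonneg: "0 \<le> mass"
  unfolding mass_def by (intro integral_nonneg_AE AE_I2 mult_nonneg_nonneg a_nonneg b_nonneg)

sublocale P: product_sigma_finite "\<lambda>_::nat. \<mu>"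
  by (simp add: product_sigma_finite_def sigma_finite_measure_axioms)

text \<open>Row operations and comparisons of kernels proceed row by row, so that the rows of the
  intermediate determinants are drawn from different kernels.\<close>

definition mixed :: "nat set \<Rightarrow> (nat \<Rightarrow> 'a \<Rightarrow> 'a \<Rightarrow> real) \<Rightarrow> (nat \<Rightarrow> 'a) \<Rightarrow> real" where
  "mixed I \<kappa> z = ldet I (\<lambda>i j. \<kappa> i (z i) (z j))"

definition mixed_integral :: "nat set \<Rightarrow> (nat \<Rightarrow> 'a \<Rightarrow> 'a \<Rightarrow> real) \<Rightarrow> real" where
  "mixed_integral I \<kappa> = (\<integral>z. mixed I \<kappa> z \<partial>(\<Pi>\<^sub>M i\<in>I. \<mu>))"

lemma fredholm_det_eq:
  "fredholm_det \<mu> k = (\<Sum>m. (- 1) ^ m / fact m * mixed_integral {..<m} (\<lambda>_. k))"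
  unfolding fredholm_det_def mixed_integral_def mixed_def det_mat_eq_ldet ..

lemma space_component: "z \<in> space (\<Pi>\<^sub>M i\<in>I. \<mu>) \<Longrightarrow> i \<in> I \<Longrightarrow> z i \<in> space \<mu>"
  by (auto simp: space_PiM)

lemma mixed_measurable:
  assumes "finite I" "\<And>i. i \<in> I \<Longrightarrow> dominated (\<kappa> i)"
  shows "mixed I \<kappa> \<in> borel_measurable (\<Pi>\<^sub>M i\<in>I. \<mu>)"
  unfolding mixed_def ldet_def using assms
  by (intro borel_measurable_sum borel_measurable_times borel_measurable_const
      borel_measurable_prod dominated_measurable measurable_component_singleton)
    (auto simp: permutes_in_image)

lemma ab_product_integrable:
  fixes I :: "nat set"
  shows "finite I \<Longrightarrow> integrable (\<Pi>\<^sub>M i\<in>I. \<mu>) (\<lambda>z. \<Prod>i\<in>I. a (z i) * b (z i))"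
  using P.product_integrable_prod[of I "\<lambda>_ z. a z * b z"] ab_integrable by simp

lemma ab_product_integral:
  fixes I :: "nat set"
  shows "finite I \<Longrightarrow> (\<integral>z. (\<Prod>i\<in>I. a (z i) * b (z i)) \<partial>(\<Pi>\<^sub>M i\<in>I. \<mu>)) = mass ^ card I"
  using P.product_integral_prod[of I "\<lambda>_ z. a z * b z"] ab_integrable by (simp add: mass_def)

text \<open>The variables of the \<open>b\<close> factors are permuted, but they occur once each; hence the bound is
  the same for all permutations.\<close>

lemma permutation_product_bound:
  assumes "\<pi> permutes I" "\<And>i. i \<in> I \<Longrightarrow> \<bar>c i\<bar> \<le> a (z i) * b (z (\<pi> i))"
  shows "\<bar>\<Prod>i\<in>I. c i\<bar> \<le> (\<Prod>i\<in>I. a (z i) * b (z i))"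
proof -
  have "\<bar>\<Prod>i\<in>I. c i\<bar> \<le> (\<Prod>i\<in>I. a (z i) * b (z (\<pi> i)))"
    unfolding abs_prod using assms by (intro prod_mono) auto
  also have "\<dots> = (\<Prod>i\<in>I. a (z i) * b (z i))"
    using prod.permute[OF assms(1), of "\<lambda>i. b (z i)"] by (simp add: prod.distrib comp_def)
  finally show ?thesis .
qed

lemma permutation_product_integrable:
  fixes I :: "nat set"
  assumes "finite I" "\<pi> permutes I" "\<And>i. i \<in> I \<Longrightarrow> dominated (\<kappa> i)"
  shows "integrable (\<Pi>\<^sub>M i\<in>I. \<mu>) (\<lambda>z. \<Prod>i\<in>I. \<kappa> i (z i) (z (\<pi> i)))"
proof (rule Bochner_Integration.integrable_bound[OF ab_product_integrable[OF assms(1)]])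
    show "(\<lambda>z. \<Prod>i\<in>I. \<kappa> i (z i) (z (\<pi> i))) \<in> borel_measurable (\<Pi>\<^sub>M i\<in>I. \<mu>)"
      using assms by (intro borel_measurable_prod dominated_measurable measurable_component_singleton)
        (auto simp: permutes_in_image)
    show "AE z in \<Pi>\<^sub>M i\<in>I. \<mu>. norm (\<Prod>i\<in>I. \<kappa> i (z i) (z (\<pi> i))) \<le> norm (\<Prod>i\<in>I. a (z i) * b (z i))"
    proof (rule AE_I2)
      fix z assume z: "z \<in> space (\<Pi>\<^sub>M i\<in>I. \<mu>)"
      have "\<bar>\<Prod>i\<in>I. \<kappa> i (z i) (z (\<pi> i))\<bar> \<le> (\<Prod>i\<in>I. a (z i) * b (z i))"
        by (rule permutation_product_bound[of \<pi>])
          (use assms in \<open>auto intro!: dominatedD space_component[OF z] simp: permutes_in_image\<close>)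
      then show "norm (\<Prod>i\<in>I. \<kappa> i (z i) (z (\<pi> i))) \<le> norm (\<Prod>i\<in>I. a (z i) * b (z i))"
        by simp
    qed
qed

lemma mixed_integrable:
  assumes "finite I" "\<And>i. i \<in> I \<Longrightarrow> dominated (\<kappa> i)"
  shows "integrable (\<Pi>\<^sub>M i\<in>I. \<mu>) (mixed I \<kappa>)"
  unfolding mixed_def ldet_def
  by (intro Bochner_Integration.integrable_sum integrable_mult_right permutation_product_integrable)
    (use assms in auto)

lemma mixed_integral_bound:
  assumes "\<And>i. i < m \<Longrightarrow> dominated (\<kappa> i)"
  shows "\<bar>mixed_integral {..<m} \<kappa>\<bar> \<le> sqrt (real m) ^ m * mass ^ m"
proof -
  have "\<bar>mixed_integral {..<m} \<kappa>\<bar> \<le>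
      (\<integral>z. sqrt (real m) ^ m * (\<Prod>i<m. a (z i) * b (z i)) \<partial>(\<Pi>\<^sub>M i\<in>{..<m}. \<mu>))"
    unfolding mixed_integral_def
  proof (rule integral_abs_le)
    show "integrable (\<Pi>\<^sub>M i\<in>{..<m}. \<mu>) (\<lambda>z. sqrt (real m) ^ m * (\<Prod>i<m. a (z i) * b (z i)))"
      by (intro integrable_mult_right ab_product_integrable) simp
    fix z assume "z \<in> space (\<Pi>\<^sub>M i\<in>{..<m}. \<mu>)"
    then show "\<bar>mixed {..<m} \<kappa> z\<bar> \<le> sqrt (real m) ^ m * (\<Prod>i<m. a (z i) * b (z i))"
      unfolding mixed_def
      by (intro hadamard_ldet)
        (auto intro!: dominatedD[OF assms] space_component[of z "{..<m}"] a_nonneg b_nonneg)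
  qed
  then show ?thesis by (simp add: ab_product_integral)
qed

lemma mixed_integral_reindex:
  assumes f: "bij_betw f I I'" and I: "finite I" and k: "\<And>i. i \<in> I' \<Longrightarrow> dominated (\<kappa> i)"
  shows "mixed_integral I' \<kappa> = mixed_integral I (\<lambda>i. \<kappa> (f i))"
proof -
  have I': "finite I'" using f I bij_betw_finite by blast
  let ?g = "\<lambda>z. \<lambda>i\<in>I. (z (f i) :: 'a)"
  have d: "(\<Pi>\<^sub>M i\<in>I. \<mu>) = distr (\<Pi>\<^sub>M i\<in>I'. \<mu>) (\<Pi>\<^sub>M i\<in>I. \<mu>) ?g"
    using distr_PiM_reindex_map[of \<mu> \<mu> "\<lambda>x. x" I' f I] I' f sigma_finite_measure_axioms by simp
  have im: "f ` I = I'" using f by (simp add: bij_betw_def)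
  have "mixed_integral I (\<lambda>i. \<kappa> (f i)) = (\<integral>z. mixed I (\<lambda>i. \<kappa> (f i)) (?g z) \<partial>(\<Pi>\<^sub>M i\<in>I'. \<mu>))"
    unfolding mixed_integral_def using k im I
    by (subst d, subst integral_distr)
      (auto intro!: mixed_measurable measurable_restrict measurable_component_singleton)
  also have "\<dots> = mixed_integral I' \<kappa>"
    unfolding mixed_integral_def
  proof (intro Bochner_Integration.integral_cong refl)
    fix z
    have "mixed I (\<lambda>i. \<kappa> (f i)) (?g z) = ldet I (\<lambda>i j. \<kappa> (f i) (z (f i)) (z (f j)))"
      unfolding mixed_def by (intro ldet_cong) auto
    also have "\<dots> = mixed I' \<kappa> z"
      unfolding mixed_def using ldet_reindex[OF f I, of "\<lambda>i j. \<kappa> i (z i) (z j)"] by simp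
    finally show "mixed I (\<lambda>i. \<kappa> (f i)) (?g z) = mixed I' \<kappa> z" .
  qed
  finally show ?thesis by simp
qed

lemma mixed_integral_cong:
  assumes "\<And>i z z'. i \<in> I \<Longrightarrow> z \<in> space \<mu> \<Longrightarrow> z' \<in> space \<mu> \<Longrightarrow> \<kappa> i z z' = \<kappa>' i z z'"
  shows "mixed_integral I \<kappa> = mixed_integral I \<kappa>'"
  unfolding mixed_integral_def mixed_def
  by (intro Bochner_Integration.integral_cong refl ldet_cong) (auto intro!: assms simp: space_PiM)

lemma mixed_integral_row_diff:
  assumes "finite I" "p \<in> I" "\<And>i. i \<in> I \<Longrightarrow> dominated (\<kappa> i)" "dominated r" "dominated r'"
  shows "mixed_integral I (\<kappa>(p := \<lambda>z z'. r z z' - r' z z')) =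
    mixed_integral I (\<kappa>(p := r)) - mixed_integral I (\<kappa>(p := r'))"
proof -
  have "mixed I (\<kappa>(p := \<lambda>z z'. r z z' - r' z z')) z =
      mixed I (\<kappa>(p := r)) z - mixed I (\<kappa>(p := r')) z" for z
  proof -
    have upd: "(\<lambda>i j. (\<kappa>(p := s)) i (z i) (z j)) = (\<lambda>i j. \<kappa> i (z i) (z j))(p := \<lambda>j. s (z p) (z j))" for s
      by auto
    show ?thesis
      unfolding mixed_def upd using ldet_row_diff[OF assms(1,2)] by simp
  qed
  then show ?thesis
    unfolding mixed_integral_def using assms
    by (subst Bochner_Integration.integral_diff[symmetric])
      (auto intro!: mixed_integrable Bochner_Integration.integral_cong)
qed

end

text \<open>\<open>m ^ (m / 2)\<close> from Hadamard's inequality is compared with \<open>m!\<close>, which is at least \<open>(m / e) ^ m\<close>.\<close>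

lemma sqrt_power_over_fact: "sqrt (real m) ^ m / fact m \<le> (exp 1 / sqrt (real m)) ^ m"
proof (cases "m = 0")
  case False
  have "real m ^ m / fact m \<le> exp (real m)"
  proof -
    have "(\<lambda>n. inverse (fact n) * real m ^ n) sums exp (real m)"
      using exp_converges[of "real m"] by (simp add: scaleR_conv_of_real)
    from sum_le_suminf[OF sums_summable[OF this], of "{m}"] sums_unique[OF this]
    show ?thesis by (simp add: field_simps)
  qed
  also have "exp (real m) = exp 1 ^ m" by (simp add: exp_of_nat_mult[symmetric])
  finally have "real m ^ m \<le> exp 1 ^ m * fact m" by (simp add: field_simps)
  moreover have "real m ^ m = sqrt (real m) ^ m * sqrt (real m) ^ m"
    by (simp add: power_mult_distrib[symmetric])
  ultimately show ?thesis using False by (simp add: field_simps power_divide)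
qed simp

lemma summable_hadamard:
  fixes A :: real
  assumes "0 \<le> A"
  shows "summable (\<lambda>m. real m * (sqrt (real m) ^ m * A ^ m) / fact m)"
proof (rule summable_comparison_test_ev)
  show "summable (\<lambda>m. (1 / 2 :: real) ^ m)" by (simp add: summable_geometric)
  have "\<forall>\<^sub>F m in sequentially. 4 * exp 1 * A \<le> sqrt (real m)"
    by (rule filterlim_at_top[THEN iffD1, rule_format])
      (rule filterlim_compose[OF sqrt_at_top filterlim_real_sequentially])
  then show "\<forall>\<^sub>F m in sequentially. norm (real m * (sqrt (real m) ^ m * A ^ m) / fact m) \<le> (1 / 2) ^ m"
    using eventually_gt_at_top[of 0]
  proof eventually_elim
    case (elim m)
    have "real m * (sqrt (real m) ^ m * A ^ m) / fact m = real m * A ^ m * (sqrt (real m) ^ m / fact m)"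
      by simp
    also have "\<dots> \<le> 2 ^ m * A ^ m * (exp 1 / sqrt (real m)) ^ m"
      using assms less_exp[of m] by (intro mult_mono sqrt_power_over_fact mult_right_mono)
        (auto simp: of_nat_less_two_power less_imp_le)
    also have "\<dots> = (2 * exp 1 * A / sqrt (real m)) ^ m"
      by (simp add: power_mult_distrib power_divide)
    also have "\<dots> \<le> (1 / 2) ^ m"
      using elim assms by (intro power_mono) (auto simp: field_simps)
    finally show ?case using assms by simp
  qed
qed

lemma summable_hadamard':
  fixes A :: real
  assumes "0 \<le> A"
  shows "summable (\<lambda>m. sqrt (real m) ^ m * A ^ m / fact m)"
proof (rule summable_comparison_test_ev[OF _ summable_hadamard[OF assms]])
  show "\<forall>\<^sub>F m in sequentially. norm (sqrt (real m) ^ m * A ^ m / fact m) \<le>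
      real m * (sqrt (real m) ^ m * A ^ m) / fact m"
    using eventually_gt_at_top[of 0]
  proof eventually_elim
    case (elim m)
    then have "1 * (sqrt (real m) ^ m * A ^ m) / fact m \<le> real m * (sqrt (real m) ^ m * A ^ m) / fact m"
      using assms by (intro divide_right_mono mult_right_mono) auto
    then show ?case using assms by simp
  qed
qed

context dominating_pair
begin

lemma fredholm_sums:
  assumes "dominated k"
  shows "(\<lambda>m. (- 1) ^ m / fact m * mixed_integral {..<m} (\<lambda>_. k)) sums fredholm_det \<mu> k"
proof -
  have "summable (\<lambda>m. (- 1) ^ m / fact m * mixed_integral {..<m} (\<lambda>_. k))"
  proof (rule summable_comparison_test'[OF summable_hadamard'[OF mass_nonneg], of 0])
    fix m
    show "norm ((- 1) ^ m / fact m * mixed_integral {..<m} (\<lambda>_. k)) \<le>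
        sqrt (real m) ^ m * mass ^ m / fact m"
      using mixed_integral_bound[of m "\<lambda>_. k"] assms
      by (simp add: abs_mult divide_right_mono)
  qed
  then show ?thesis unfolding fredholm_det_eq by (rule summable_sums)
qed

end

text \<open>The constant in the Lipschitz estimates for Fredholm determinants.\<close>

definition fred_const :: "real \<Rightarrow> real" where
  "fred_const A = (\<Sum>m. real m * (sqrt (real m) ^ m * (1 + A) ^ m) / fact m)"

text \<open>The series are compared term by term with \<open>ldet_lipschitz\<close>. The bound involves the integral of
  the difference of the kernels and not its supremum, which matters because the kernels to be
  compared differ considerably on a small set.\<close>

lemma (in dominating_pair) fredholm_lipschitz:
  assumes k: "dominated k" and k': "dominated k'"
    and \<eta>: "\<And>z. z \<in> space \<mu> \<Longrightarrow> 0 \<le> \<eta> z" "integrable \<mu> (\<lambda>z. \<eta> z * b z)"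
    and d: "\<And>z z'. z \<in> space \<mu> \<Longrightarrow> z' \<in> space \<mu> \<Longrightarrow> \<bar>k z z' - k' z z'\<bar> \<le> \<eta> z * b z'"
  shows "\<bar>fredholm_det \<mu> k - fredholm_det \<mu> k'\<bar> \<le> fred_const mass * (\<integral>z. \<eta> z * b z \<partial>\<mu>)"
proof -
  let ?E = "\<integral>z. \<eta> z * b z \<partial>\<mu>"
  have E0: "0 \<le> ?E" using \<eta>(1) by (intro integral_nonneg_AE AE_I2 mult_nonneg_nonneg b_nonneg) auto
  let ?t = "\<lambda>k m. (- 1) ^ m / fact m * mixed_integral {..<m} (\<lambda>_. k)"
  let ?c = "\<lambda>m. real m * (sqrt (real m) ^ m * (1 + mass) ^ m) / fact m"
  have term_bd: "\<bar>?t k m - ?t k' m\<bar> \<le> ?c m * ?E" for m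
  proof -
    let ?g = "\<lambda>p z. \<Prod>i<m. (if i = p then \<eta> (z i) * b (z i) else a (z i) * b (z i))"
    have if_int: "integrable \<mu> (\<lambda>z. if i = p then \<eta> z * b z else a z * b z)" for i p :: nat
      using \<eta>(2) ab_integrable by (cases "i = p") auto
    have int: "integrable (\<Pi>\<^sub>M i\<in>{..<m}. \<mu>) (?g p)" for p
      using P.product_integrable_prod[of "{..<m}" "\<lambda>i z. if i = p then \<eta> z * b z else a z * b z"]
        if_int by simp
    have val: "(\<integral>z. ?g p z \<partial>(\<Pi>\<^sub>M i\<in>{..<m}. \<mu>)) = ?E * mass ^ (m - 1)" if "p < m" for p
    proof -
      have "(\<integral>z. ?g p z \<partial>(\<Pi>\<^sub>M i\<in>{..<m}. \<mu>)) = (\<Prod>i<m. \<integral>z. (if i = p then \<eta> z * b z else a z * b z) \<partial>\<mu>)"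
        using P.product_integral_prod[of "{..<m}" "\<lambda>i z. if i = p then \<eta> z * b z else a z * b z"]
          if_int by simp
      also have "\<dots> = (\<Prod>i<m. if i = p then ?E else mass)"
        by (intro prod.cong) (auto simp: mass_def)
      also have "\<dots> = ?E * mass ^ (m - 1)"
        using that by (subst prod.remove[of _ p]) (auto simp: card_Diff_singleton)
      finally show ?thesis .
    qed
    have mi: "integrable (\<Pi>\<^sub>M i\<in>{..<m}. \<mu>) (mixed {..<m} (\<lambda>_. k))"
      "integrable (\<Pi>\<^sub>M i\<in>{..<m}. \<mu>) (mixed {..<m} (\<lambda>_. k'))"
      using k k' by (auto intro!: mixed_integrable)
    have "\<bar>mixed_integral {..<m} (\<lambda>_. k) - mixed_integral {..<m} (\<lambda>_. k')\<bar> =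
        \<bar>\<integral>z. mixed {..<m} (\<lambda>_. k) z - mixed {..<m} (\<lambda>_. k') z \<partial>(\<Pi>\<^sub>M i\<in>{..<m}. \<mu>)\<bar>"
      unfolding mixed_integral_def by (subst Bochner_Integration.integral_diff[OF mi]) simp
    also have "\<dots> \<le> (\<integral>z. sqrt (real m) ^ m * (\<Sum>p<m. ?g p z) \<partial>(\<Pi>\<^sub>M i\<in>{..<m}. \<mu>))"
    proof (rule integral_abs_le)
      show "integrable (\<Pi>\<^sub>M i\<in>{..<m}. \<mu>) (\<lambda>z. sqrt (real m) ^ m * (\<Sum>p<m. ?g p z))"
        by (intro integrable_mult_right Bochner_Integration.integrable_sum int)
      fix z assume z: "z \<in> space (\<Pi>\<^sub>M i\<in>{..<m}. \<mu>)"
      have "\<bar>mixed {..<m} (\<lambda>_. k) z - mixed {..<m} (\<lambda>_. k') z\<bar> \<le>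
        sqrt (real m) ^ m * (\<Sum>p<m. \<eta> (z p) * b (z p) * (\<Prod>i\<in>{..<m}-{p}. a (z i) * b (z i)))"
        unfolding mixed_def
        by (intro ldet_lipschitz) (use z in \<open>auto intro!: dominatedD[OF k] dominatedD[OF k'] d
          space_component[OF z] a_nonneg b_nonneg \<eta>\<close>)
      also have "(\<Sum>p<m. \<eta> (z p) * b (z p) * (\<Prod>i\<in>{..<m}-{p}. a (z i) * b (z i))) = (\<Sum>p<m. ?g p z)"
        by (intro sum.cong refl, subst prod.remove) (auto intro!: prod.cong)
      finally show "\<bar>mixed {..<m} (\<lambda>_. k) z - mixed {..<m} (\<lambda>_. k') z\<bar> \<le>
        sqrt (real m) ^ m * (\<Sum>p<m. ?g p z)" by simp
    qed
    also have "\<dots> = sqrt (real m) ^ m * (real m * (?E * mass ^ (m - 1)))"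
      using int by (simp add: val)
    also have "\<dots> \<le> sqrt (real m) ^ m * (real m * (?E * (1 + mass) ^ m))"
    proof (cases m)
      case (Suc n)
      have "mass ^ n \<le> (1 + mass) ^ n" using mass_nonneg by (intro power_mono) auto
      also have "\<dots> \<le> (1 + mass) ^ Suc n" using mass_nonneg by (intro power_increasing) auto
      finally show ?thesis using Suc E0 by (auto intro!: mult_left_mono)
    qed simp
    finally have "\<bar>mixed_integral {..<m} (\<lambda>_. k) - mixed_integral {..<m} (\<lambda>_. k')\<bar> \<le>
      real m * (sqrt (real m) ^ m * (1 + mass) ^ m) * ?E" by (simp add: algebra_simps)
    then have "\<bar>mixed_integral {..<m} (\<lambda>_. k) - mixed_integral {..<m} (\<lambda>_. k')\<bar> / fact m \<le>
      real m * (sqrt (real m) ^ m * (1 + mass) ^ m) * ?E / fact m"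
      by (intro divide_right_mono) auto
    moreover have "?t k m - ?t k' m =
        (- 1) ^ m / fact m * (mixed_integral {..<m} (\<lambda>_. k) - mixed_integral {..<m} (\<lambda>_. k'))"
      by (simp add: right_diff_distrib)
    ultimately show ?thesis by (simp add: abs_mult)
  qed
  have sc: "summable ?c" using summable_hadamard[of "1 + mass"] mass_nonneg by simp
  have s: "(\<lambda>m. ?t k m - ?t k' m) sums (fredholm_det \<mu> k - fredholm_det \<mu> k')"
    by (intro sums_diff fredholm_sums k k')
  have "norm (fredholm_det \<mu> k - fredholm_det \<mu> k') \<le> (\<Sum>m. ?c m * ?E)"
    unfolding sums_unique[OF s]
    by (rule norm_suminf_le) (use term_bd summable_mult2[OF sc] in auto)
  then show ?thesis using sc by (simp add: fred_const_def suminf_mult2)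
qed

lemma fred_const_mono:
  assumes "0 \<le> A" "A \<le> A'"
  shows "fred_const A \<le> fred_const A'"
  unfolding fred_const_def using assms
  by (intro suminf_le summable_hadamard divide_right_mono mult_left_mono power_mono) auto

lemma fred_const_nonneg: "0 \<le> A \<Longrightarrow> 0 \<le> fred_const A"
  unfolding fred_const_def by (intro suminf_nonneg summable_hadamard) auto

section \<open>Row operations on Fredholm determinants\<close>

text \<open>The integrated form of one Laplace expansion: expanding the row \<open>p\<close> taken from \<open>N\<close> and
  integrating out the other variable that it involves produces the composition \<open>N K\<close>.\<close>

lemma (in dominating_pair) mixed_integral_expand_row:
  assumes K: "dominated K" and N: "dominated N" and NK: "dominated NK"
    and NK_eq: "\<And>z z'. z \<in> space \<mu> \<Longrightarrow> z' \<in> space \<mu> \<Longrightarrow> NK z z' = (\<integral>w. N z w * K w z' \<partial>\<mu>)"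
    and diag: "\<And>z. z \<in> space \<mu> \<Longrightarrow> N z z = 0"
    and h: "\<And>i. i \<in> I \<Longrightarrow> dominated (h i)"
    and same: "\<And>i z w z'. i \<in> I \<Longrightarrow> z \<in> space \<mu> \<Longrightarrow> w \<in> space \<mu> \<Longrightarrow> z' \<in> space \<mu> \<Longrightarrow>
      N z w \<noteq> 0 \<Longrightarrow> h i w z' = K w z'"
    and I: "finite I" "p \<in> I"
  shows "mixed_integral I (h(p := N)) = - (\<Sum>j\<in>I-{p}. mixed_integral (I - {j}) (h(p := NK)))"
proof -
  define G where "G j \<pi> z = N (z p) (z j) * K (z j) (z (\<pi> p)) * (\<Prod>i\<in>I-{j}-{p}. h i (z i) (z (\<pi> i)))"
    for j \<pi> z
  define Q where "Q j z = (\<Sum>\<pi> | \<pi> permutes (I - {j}). of_int (sign \<pi>) * G j \<pi> z)" for j z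
  have expand: "mixed I (h(p := N)) z = - (\<Sum>j\<in>I-{p}. Q j z)" if z: "z \<in> space (\<Pi>\<^sub>M i\<in>I. \<mu>)" for z
  proof -
    let ?k = "\<lambda>i j. (h(p := N)) i (z i) (z j)"
    have "N (z p) (z p) = 0" using I by (auto intro!: diag space_component[OF z])
    then have "mixed I (h(p := N)) z = - (\<Sum>j\<in>I-{p}. ?k p j * ldet (I - {j}) (?k(p := ?k j)))"
      unfolding mixed_def using ldet_laplace_swap[OF I, of ?k] by simp
    also have "(\<Sum>j\<in>I-{p}. ?k p j * ldet (I - {j}) (?k(p := ?k j))) = (\<Sum>j\<in>I-{p}. Q j z)"
    proof (intro sum.cong refl)
      fix j assume j: "j \<in> I - {p}"
      show "?k p j * ldet (I - {j}) (?k(p := ?k j)) = Q j z"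
      proof (cases "N (z p) (z j) = 0")
        case True
        then show ?thesis by (simp add: Q_def G_def)
      next
        case False
        have "ldet (I - {j}) (?k(p := ?k j)) = ldet (I - {j}) (?k(p := \<lambda>l. K (z j) (z l)))"
          by (intro ldet_cong)
            (use False j I in \<open>auto intro!: same[where z = "z p"] space_component[OF z]\<close>)
        also have "\<dots> = (\<Sum>\<pi> | \<pi> permutes (I - {j}). K (z j) (z (\<pi> p)) *
            (of_int (sign \<pi>) * (\<Prod>i\<in>I-{j}-{p}. ?k i (\<pi> i))))"
          using j I by (intro ldet_row_split) auto
        also have "?k p j * \<dots> = Q j z"
          unfolding Q_def G_def sum_distrib_left
          by (intro sum.cong refl) (auto simp: algebra_simps intro!: prod.cong)
        finally show ?thesis .
      qed
    qed
    finally show ?thesis .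
  qed
  have G_int: "integrable (\<Pi>\<^sub>M i\<in>I. \<mu>) (G j \<pi>)" if j: "j \<in> I - {p}" and \<pi>: "\<pi> permutes (I - {j})" for j \<pi>
  proof (rule Bochner_Integration.integrable_bound[OF ab_product_integrable[OF I(1)]])
    have \<pi>I: "\<pi> i \<in> I" if "i \<in> I - {j}" for i
      using permutes_in_image[OF \<pi>, of i] that by auto
    show "G j \<pi> \<in> borel_measurable (\<Pi>\<^sub>M i\<in>I. \<mu>)"
      unfolding G_def using j I \<pi>I
      by (intro borel_measurable_times borel_measurable_prod dominated_measurable[OF K]
          dominated_measurable[OF N] dominated_measurable[OF h] measurable_component_singleton) auto
    show "AE z in \<Pi>\<^sub>M i\<in>I. \<mu>. norm (G j \<pi> z) \<le> norm (\<Prod>i\<in>I. a (z i) * b (z i))"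
    proof (rule AE_I2)
      fix z assume z: "z \<in> space (\<Pi>\<^sub>M i\<in>I. \<mu>)"
      define c where "c i = (if i = p then a (z p) * b (z (\<pi> p)) else h i (z i) (z (\<pi> i)))" for i
      have "\<bar>G j \<pi> z\<bar> \<le> (a (z p) * b (z j)) * (a (z j) * b (z (\<pi> p))) * \<bar>\<Prod>i\<in>I-{j}-{p}. h i (z i) (z (\<pi> i))\<bar>"
        unfolding G_def abs_mult using j I \<pi>I
        by (intro mult_mono dominatedD[OF N] dominatedD[OF K] space_component[OF z] mult_nonneg_nonneg
            a_nonneg b_nonneg) auto
      also have "\<dots> = a (z j) * b (z j) * \<bar>\<Prod>i\<in>I-{j}. c i\<bar>"
      proof -
        have "(\<Prod>i\<in>I-{j}. c i) = a (z p) * b (z (\<pi> p)) * (\<Prod>i\<in>I-{j}-{p}. h i (z i) (z (\<pi> i)))"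
          using j I by (subst prod.remove[of _ p]) (auto simp: c_def intro!: prod.cong)
        then show ?thesis by (simp add: abs_mult a_nonneg b_nonneg)
      qed
      also have "\<bar>\<Prod>i\<in>I-{j}. c i\<bar> \<le> (\<Prod>i\<in>I-{j}. a (z i) * b (z i))"
        by (rule permutation_product_bound[OF \<pi>])
          (use \<pi>I in \<open>auto simp: c_def a_nonneg b_nonneg intro!: dominatedD[OF h] space_component[OF z]\<close>)
      also have "a (z j) * b (z j) * (\<Prod>i\<in>I-{j}. a (z i) * b (z i)) = (\<Prod>i\<in>I. a (z i) * b (z i))"
        using j I by (subst (2) prod.remove[of _ j]) auto
      finally show "norm (G j \<pi> z) \<le> norm (\<Prod>i\<in>I. a (z i) * b (z i))"
        by (simp add: mult_left_mono a_nonneg b_nonneg)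
    qed
  qed
  have G_val: "(\<integral>z. G j \<pi> z \<partial>(\<Pi>\<^sub>M i\<in>I. \<mu>)) =
      (\<integral>z. (\<Prod>i\<in>I-{j}. (h(p := NK)) i (z i) (z (\<pi> i))) \<partial>(\<Pi>\<^sub>M i\<in>I-{j}. \<mu>))"
    if j: "j \<in> I - {p}" and \<pi>: "\<pi> permutes (I - {j})" for j \<pi>
  proof -
    have \<pi>I: "\<pi> i \<in> I - {j}" if "i \<in> I - {j}" for i
      using permutes_in_image[OF \<pi>, of i] that by auto
    have ins: "insert j (I - {j}) = I" using j by auto
    have "(\<integral>z. G j \<pi> z \<partial>(\<Pi>\<^sub>M i\<in>I. \<mu>)) =
        (\<integral>z. (\<integral>y. G j \<pi> (z(j := y)) \<partial>\<mu>) \<partial>(\<Pi>\<^sub>M i\<in>I-{j}. \<mu>))"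
      using P.product_integral_insert[of "I - {j}" j "G j \<pi>"] I G_int[OF j \<pi>] unfolding ins by simp
    also have "\<dots> = (\<integral>z. (\<Prod>i\<in>I-{j}. (h(p := NK)) i (z i) (z (\<pi> i))) \<partial>(\<Pi>\<^sub>M i\<in>I-{j}. \<mu>))"
    proof (intro Bochner_Integration.integral_cong refl)
      fix z assume z: "z \<in> space (\<Pi>\<^sub>M i\<in>I-{j}. \<mu>)"
      have pj: "p \<in> I - {j}" using j I by auto
      have "G j \<pi> (z(j := y)) = N (z p) y * K y (z (\<pi> p)) * (\<Prod>i\<in>I-{j}-{p}. h i (z i) (z (\<pi> i)))" for y
        unfolding G_def using \<pi>I[OF pj] \<pi>I j pj
        by (intro arg_cong2[of _ _ _ _ "(*)"] prod.cong refl) auto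
      then have "(\<integral>y. G j \<pi> (z(j := y)) \<partial>\<mu>) =
          (\<integral>y. N (z p) y * K y (z (\<pi> p)) \<partial>\<mu>) * (\<Prod>i\<in>I-{j}-{p}. h i (z i) (z (\<pi> i)))"
        by simp
      also have "(\<integral>y. N (z p) y * K y (z (\<pi> p)) \<partial>\<mu>) = NK (z p) (z (\<pi> p))"
        using \<pi>I[OF pj] pj by (intro NK_eq[symmetric] space_component[OF z])
      also have "NK (z p) (z (\<pi> p)) * (\<Prod>i\<in>I-{j}-{p}. h i (z i) (z (\<pi> i))) =
          (\<Prod>i\<in>I-{j}. (h(p := NK)) i (z i) (z (\<pi> i)))"
        using pj I by (subst prod.remove[of "I - {j}" p]) (auto intro!: prod.cong)
      finally show "(\<integral>y. G j \<pi> (z(j := y)) \<partial>\<mu>) = (\<Prod>i\<in>I-{j}. (h(p := NK)) i (z i) (z (\<pi> i)))" .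
    qed
    finally show ?thesis .
  qed
  have fin: "finite {\<pi>. \<pi> permutes (I - {j})}" for j using I by (simp add: finite_permutations)
  have Q_int: "integrable (\<Pi>\<^sub>M i\<in>I. \<mu>) (Q j)" if "j \<in> I - {p}" for j
    unfolding Q_def using that by (intro Bochner_Integration.integrable_sum integrable_mult_right G_int) auto
  have Q_val: "(\<integral>z. Q j z \<partial>(\<Pi>\<^sub>M i\<in>I. \<mu>)) = mixed_integral (I - {j}) (h(p := NK))" if j: "j \<in> I - {p}" for j
  proof -
    have "(\<integral>z. Q j z \<partial>(\<Pi>\<^sub>M i\<in>I. \<mu>)) = (\<Sum>\<pi> | \<pi> permutes (I - {j}). of_int (sign \<pi>) *
        (\<integral>z. (\<Prod>i\<in>I-{j}. (h(p := NK)) i (z i) (z (\<pi> i))) \<partial>(\<Pi>\<^sub>M i\<in>I-{j}. \<mu>)))"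
      unfolding Q_def using j G_int G_val
      by (subst Bochner_Integration.integral_sum) (auto intro!: sum.cong)
    also have "\<dots> = mixed_integral (I - {j}) (h(p := NK))"
      unfolding mixed_integral_def mixed_def ldet_def
      using I NK h permutation_product_integrable[of "I - {j}" _ "h(p := NK)"]
      by (subst Bochner_Integration.integral_sum) (auto intro!: sum.cong)
    finally show ?thesis .
  qed
  have "mixed_integral I (h(p := N)) = (\<integral>z. - (\<Sum>j\<in>I-{p}. Q j z) \<partial>(\<Pi>\<^sub>M i\<in>I. \<mu>))"
    unfolding mixed_integral_def by (intro Bochner_Integration.integral_cong refl expand)
  also have "\<dots> = - (\<Sum>j\<in>I-{p}. mixed_integral (I - {j}) (h(p := NK)))"
    using Q_int Q_val by (simp add: Bochner_Integration.integral_sum)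
  finally show ?thesis .
qed

text \<open>Formally \<open>I - K' = (I + N) (I - K)\<close> for \<open>K' = K - N + N K\<close>, and \<open>det (I + N) = 1\<close> because \<open>N\<close> is
  strictly triangular with respect to the rows: it maps only into rows that are not changed. The
  kernels need not be trace class, so the identity is proved on the level of the series. Exchanging the rows one by one, and expanding the rows taken from \<open>N\<close>,
  shows that the terms of order \<open>m\<close> of the two series differ by \<open>e m - e (m - 1)\<close> for a null
  sequence \<open>e\<close>; so the partial sums have the same limit.\<close>

lemma (in dominating_pair) fredholm_row_operation:
  assumes K: "dominated K" and K': "dominated K'" and N: "dominated N" and NK: "dominated NK"
    and NK_eq: "\<And>z z'. z \<in> space \<mu> \<Longrightarrow> z' \<in> space \<mu> \<Longrightarrow> NK z z' = (\<integral>w. N z w * K w z' \<partial>\<mu>)"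
    and eq: "\<And>z z'. z \<in> space \<mu> \<Longrightarrow> z' \<in> space \<mu> \<Longrightarrow> K' z z' = K z z' - N z z' + NK z z'"
    and diag: "\<And>z. z \<in> space \<mu> \<Longrightarrow> N z z = 0"
    and same: "\<And>z w z'. z \<in> space \<mu> \<Longrightarrow> w \<in> space \<mu> \<Longrightarrow> z' \<in> space \<mu> \<Longrightarrow>
      N z w \<noteq> 0 \<Longrightarrow> K' w z' = K w z'"
  shows "fredholm_det \<mu> K' = fredholm_det \<mu> K"
proof -
  define h where "h p = (\<lambda>i::nat. if i < p then K' else K)" for p :: nat
  have h: "dominated (h p i)" for p i using K K' by (simp add: h_def)
  \<comment> \<open>One row from \<open>NK\<close> after \<open>p\<close> rows from \<open>K'\<close> and before \<open>q\<close> rows from \<open>K\<close>; the order of the rows is immaterial.\<close>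
  define \<tau> where "\<tau> p q = mixed_integral {..<p + q + 1} ((h p)(p := NK))" for p q
  have relabel: "mixed_integral I (\<lambda>i. if i = p then NK else if i \<in> P then K' else K) =
      \<tau> (card P) (card I - 1 - card P)"
    if I: "finite I" "p \<in> I" "P \<subseteq> I - {p}" for I p P
  proof -
    have finP: "finite P" using I finite_subset by blast
    define xs where "xs = sorted_list_of_set P @ [p] @ sorted_list_of_set (I - P - {p})"
    have "set xs = I" "distinct xs" using I finP by (auto simp: xs_def)
    then have len: "length xs = card I" by (metis distinct_card)
    have lenP: "length (sorted_list_of_set P) = card P" by simp
    have cI: "card I = card P + (card I - 1 - card P) + 1"
    proof -
      have "card P \<le> card I - 1" using card_mono[of "I - {p}" P] I by simp
      moreover have "0 < card I" using I by (auto simp: card_gt_0_iff)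
      ultimately show ?thesis by linarith
    qed
    have bij: "bij_betw ((!) xs) {..<card P + (card I - 1 - card P) + 1} I"
      using \<open>distinct xs\<close> \<open>set xs = I\<close> len cI by (intro bij_betw_nth) auto
    have "mixed_integral I (\<lambda>i. if i = p then NK else if i \<in> P then K' else K) =
        mixed_integral {..<card P + (card I - 1 - card P) + 1}
          (\<lambda>i. if xs ! i = p then NK else if xs ! i \<in> P then K' else K)"
      by (rule mixed_integral_reindex[OF bij]) (auto simp: K K' NK)
    also have "\<dots> = \<tau> (card P) (card I - 1 - card P)"
      unfolding \<tau>_def
    proof (rule mixed_integral_cong)
      fix i z z' assume i: "i \<in> {..<card P + (card I - 1 - card P) + 1}"
      have "xs ! i \<in> P \<and> xs ! i \<noteq> p" if "i < card P"
      proof -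
        have "xs ! i = sorted_list_of_set P ! i" using that lenP by (simp add: xs_def nth_append)
        also have "\<dots> \<in> P" using that lenP finP by (metis nth_mem set_sorted_list_of_set)
        finally show ?thesis using I by auto
      qed
      moreover have "xs ! card P = p" by (simp add: xs_def nth_append)
      moreover have "xs ! i \<notin> P \<and> xs ! i \<noteq> p" if "i > card P"
      proof -
        have "xs ! i = sorted_list_of_set (I - P - {p}) ! (i - card P - 1)"
          using that by (simp add: xs_def nth_append nth_Cons')
        moreover have "card P + 1 + length (sorted_list_of_set (I - P - {p})) = card I"
          using len lenP by (simp add: xs_def)
        then have "i - card P - 1 < length (sorted_list_of_set (I - P - {p}))"
          using that i cI by simp
        then have "sorted_list_of_set (I - P - {p}) ! (i - card P - 1) \<in> set (sorted_list_of_set (I - P - {p}))"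
          by (rule nth_mem)
        then have "sorted_list_of_set (I - P - {p}) ! (i - card P - 1) \<in> I - P - {p}"
          using I by simp
        ultimately show ?thesis by auto
      qed
      ultimately show "(if xs ! i = p then NK else if xs ! i \<in> P then K' else K) z z' =
          ((h (card P))(card P := NK)) i z z'"
        by (cases i "card P" rule: linorder_cases) (auto simp: h_def)
    qed
    finally show ?thesis .
  qed
  have row_NK: "mixed_integral {..<m} ((h p)(p := NK)) = \<tau> p (m - 1 - p)" if "p < m" for m p
    using that by (simp add: \<tau>_def)
  have row_N: "mixed_integral {..<m} ((h p)(p := N)) =
      - (real p * \<tau> (p - 1) (m - 1 - p) + real (m - 1 - p) * \<tau> p (m - 2 - p))" if p: "p < m" for m p
  proof -
    have eqj: "mixed_integral ({..<m} - {j}) ((h p)(p := NK)) =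
        (if j < p then \<tau> (p - 1) (m - 1 - p) else \<tau> p (m - 2 - p))" if j: "j \<in> {..<m} - {p}" for j
    proof -
      have "mixed_integral ({..<m} - {j}) ((h p)(p := NK)) =
          mixed_integral ({..<m} - {j}) (\<lambda>i. if i = p then NK else if i \<in> {..<p} - {j} then K' else K)"
        by (intro mixed_integral_cong) (auto simp: h_def)
      also have "\<dots> = \<tau> (card ({..<p} - {j})) (card ({..<m} - {j}) - 1 - card ({..<p} - {j}))"
        using p j by (intro relabel) auto
      also have "\<dots> = (if j < p then \<tau> (p - 1) (m - 1 - p) else \<tau> p (m - 2 - p))"
        using p j by (auto simp: card_Diff_singleton_if intro!: arg_cong2[of _ _ _ _ \<tau>])
      finally show ?thesis .
    qed
    have "mixed_integral {..<m} ((h p)(p := N)) =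
        - (\<Sum>j\<in>{..<m}-{p}. mixed_integral ({..<m} - {j}) ((h p)(p := NK)))"
      by (rule mixed_integral_expand_row[OF K N NK NK_eq diag h])
        (use p same in \<open>auto simp: h_def\<close>)
    also have "(\<Sum>j\<in>{..<m}-{p}. mixed_integral ({..<m} - {j}) ((h p)(p := NK))) =
        (\<Sum>j\<in>{..<p} \<union> {p<..<m}. if j < p then \<tau> (p - 1) (m - 1 - p) else \<tau> p (m - 2 - p))"
      using p by (intro sum.cong eqj) auto
    also have "\<dots> = real p * \<tau> (p - 1) (m - 1 - p) + real (m - 1 - p) * \<tau> p (m - 2 - p)"
      by (subst sum.union_disjoint) auto
    finally show ?thesis .
  qed
  define \<sigma> where "\<sigma> m = (\<Sum>p<m. \<tau> p (m - 1 - p))" for m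
  have second: "(\<Sum>p<m. real p * \<tau> (p - 1) (m - 1 - p) + real (m - 1 - p) * \<tau> p (m - 2 - p)) =
      real m * \<sigma> (m - 1)" for m
  proof (cases m)
    case (Suc n)
    have "(\<Sum>p<Suc n. real p * \<tau> (p - 1) (n - p)) = (\<Sum>p<n. real (Suc p) * \<tau> p (n - 1 - p))"
      unfolding sum.lessThan_Suc_shift by simp
    moreover have "(\<Sum>p<Suc n. real (n - p) * \<tau> p (n - 1 - p)) = (\<Sum>p<n. real (n - p) * \<tau> p (n - 1 - p))"
      by simp
    moreover have "(\<Sum>p<n. real (Suc p) * \<tau> p (n - 1 - p)) + (\<Sum>p<n. real (n - p) * \<tau> p (n - 1 - p)) =
        (\<Sum>p<n. real (Suc n) * \<tau> p (n - 1 - p))"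
      unfolding sum.distrib[symmetric] distrib_right[symmetric]
      by (intro sum.cong refl arg_cong2[of _ _ _ _ "(*)"]) auto
    ultimately show ?thesis
      unfolding Suc sum.distrib \<sigma>_def by (simp add: sum_distrib_left numeral_2_eq_2 del: sum.lessThan_Suc of_nat_Suc)
  qed simp
  have diff: "mixed_integral {..<m} (\<lambda>_. K') - mixed_integral {..<m} (\<lambda>_. K) = \<sigma> m + real m * \<sigma> (m - 1)" for m
  proof -
    have "mixed_integral {..<m} (\<lambda>_. K') - mixed_integral {..<m} (\<lambda>_. K) =
        mixed_integral {..<m} (h m) - mixed_integral {..<m} (h 0)"
      by (auto simp: h_def intro!: arg_cong2[of _ _ _ _ "(-)"] mixed_integral_cong)
    also have "\<dots> = (\<Sum>p<m. mixed_integral {..<m} (h (Suc p)) - mixed_integral {..<m} (h p))"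
      by (rule sum_lessThan_telescope[symmetric])
    also have "\<dots> = (\<Sum>p<m. mixed_integral {..<m} ((h p)(p := NK)) - mixed_integral {..<m} ((h p)(p := N)))"
    proof (intro sum.cong refl)
      fix p assume p: "p \<in> {..<m}"
      have "h (Suc p) = (h p)(p := K')" "h p = (h p)(p := K)" by (auto simp: h_def)
      then have "mixed_integral {..<m} (h (Suc p)) - mixed_integral {..<m} (h p) =
          mixed_integral {..<m} ((h p)(p := \<lambda>z z'. K' z z' - K z z'))"
        using mixed_integral_row_diff[of "{..<m}" p "h p" K' K] p h K K' by simp
      also have "\<dots> = mixed_integral {..<m} ((h p)(p := \<lambda>z z'. NK z z' - N z z'))"
        by (intro mixed_integral_cong) (auto simp: eq)
      also have "\<dots> = mixed_integral {..<m} ((h p)(p := NK)) - mixed_integral {..<m} ((h p)(p := N))"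
        using p h N NK by (intro mixed_integral_row_diff) auto
      finally show "mixed_integral {..<m} (h (Suc p)) - mixed_integral {..<m} (h p) =
          mixed_integral {..<m} ((h p)(p := NK)) - mixed_integral {..<m} ((h p)(p := N))" .
    qed
    also have "\<dots> = \<sigma> m + real m * \<sigma> (m - 1)"
      unfolding second[symmetric] unfolding \<sigma>_def sum.distrib[symmetric] by (intro sum.cong refl) (simp add: row_NK row_N)
    finally show ?thesis .
  qed
  define e where "e m = (- 1) ^ m / fact m * \<sigma> m" for m
  have \<sigma>_bound: "\<bar>\<sigma> m\<bar> \<le> real m * (sqrt (real m) ^ m * mass ^ m)" for m
  proof -
    have "\<bar>\<sigma> m\<bar> \<le> (\<Sum>p<m. sqrt (real m) ^ m * mass ^ m)"
      unfolding \<sigma>_def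
    proof (intro order.trans[OF sum_abs] sum_mono)
      fix p assume "p \<in> {..<m}"
      then show "\<bar>\<tau> p (m - 1 - p)\<bar> \<le> sqrt (real m) ^ m * mass ^ m"
        by (subst row_NK[symmetric]) (auto simp: h NK intro!: mixed_integral_bound)
    qed
    then show ?thesis by simp
  qed
  have "e \<longlonglongrightarrow> 0"
  proof (rule Lim_null_comparison[OF always_eventually summable_LIMSEQ_zero[OF summable_hadamard[OF mass_nonneg]]])
    show "\<forall>m. norm (e m) \<le> real m * (sqrt (real m) ^ m * mass ^ m) / fact m"
      using \<sigma>_bound by (auto simp: e_def abs_mult divide_right_mono)
  qed
  \<comment> \<open>The term of order \<open>m\<close> of the two expansions differs by \<open>e m - e (m - 1)\<close>.\<close>
  from telescope_sums[OF this] have "(\<lambda>m. e (Suc m) - e m) sums 0" by (simp add: e_def \<sigma>_def)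
  moreover have "e (Suc m) - e m = (- 1) ^ Suc m / fact (Suc m) * mixed_integral {..<Suc m} (\<lambda>_. K') -
      (- 1) ^ Suc m / fact (Suc m) * mixed_integral {..<Suc m} (\<lambda>_. K)" for m
  proof -
    have "(- 1) ^ Suc m / fact (Suc m) * mixed_integral {..<Suc m} (\<lambda>_. K') -
        (- 1) ^ Suc m / fact (Suc m) * mixed_integral {..<Suc m} (\<lambda>_. K) =
        (- 1) ^ Suc m / fact (Suc m) * (\<sigma> (Suc m) + real (Suc m) * \<sigma> m)"
      unfolding right_diff_distrib[symmetric] diff by simp
    also have "\<dots> = e (Suc m) - e m"
      by (simp add: e_def field_simps del: of_nat_Suc)
    finally show ?thesis by simp
  qed
  ultimately have "(\<lambda>m. (- 1) ^ Suc m / fact (Suc m) * mixed_integral {..<Suc m} (\<lambda>_. K') -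
      (- 1) ^ Suc m / fact (Suc m) * mixed_integral {..<Suc m} (\<lambda>_. K)) sums 0" by simp
  moreover have "mixed_integral {..<0} (\<lambda>_. K') = mixed_integral {..<0} (\<lambda>_. K)"
    by (rule mixed_integral_cong) simp
  ultimately have "(\<lambda>m. (- 1) ^ m / fact m * mixed_integral {..<m} (\<lambda>_. K') -
      (- 1) ^ m / fact m * mixed_integral {..<m} (\<lambda>_. K)) sums 0"
    by (subst (asm) sums_Suc_iff) simp
  moreover have "(\<lambda>m. (- 1) ^ m / fact m * mixed_integral {..<m} (\<lambda>_. K') -
      (- 1) ^ m / fact m * mixed_integral {..<m} (\<lambda>_. K)) sums (fredholm_det \<mu> K' - fredholm_det \<mu> K)"
    by (intro sums_diff fredholm_sums K K')
  ultimately have "fredholm_det \<mu> K' - fredholm_det \<mu> K = 0" using sums_unique2 by blast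
  then show ?thesis by simp
qed

section \<open>The Airy function and the smooth part of the kernel\<close>

lemma integrable_gaussian:
  assumes "0 < c"
  shows "integrable lborel (\<lambda>s::real. exp (- (c * s\<^sup>2)))"
    and "integrable lborel (\<lambda>s::real. (1 + s\<^sup>2) * exp (- (c * s\<^sup>2)))"
proof -
  define \<sigma> where "\<sigma> = 1 / sqrt (2 * c)"
  have \<sigma>: "0 < \<sigma>" "\<sigma>\<^sup>2 = 1 / (2 * c)" using assms by (simp_all add: \<sigma>_def power_divide)
  have eq: "exp (- (c * s\<^sup>2)) = sqrt (2 * pi * \<sigma>\<^sup>2) * normal_density 0 \<sigma> s" for s
    using assms \<sigma> by (simp add: normal_density_def)
  show 1: "integrable lborel (\<lambda>s::real. exp (- (c * s\<^sup>2)))"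
    unfolding eq using \<sigma> by simp
  have "integrable lborel (\<lambda>s. exp (- (c * s\<^sup>2)) +
      sqrt (2 * pi * \<sigma>\<^sup>2) * (normal_density 0 \<sigma> s * (s - 0)\<^sup>2))"
    by (intro Bochner_Integration.integrable_add 1 integrable_mult_right integrable_normal_moment \<sigma>)
  then show "integrable lborel (\<lambda>s::real. (1 + s\<^sup>2) * exp (- (c * s\<^sup>2)))"
    unfolding eq by (rule back_subst[of "integrable lborel"]) (simp add: algebra_simps)
qed

lemma Re_airy_exponent:
  "Re (\<i> * (of_real s + \<i> * of_real k) ^ 3 / 3 + \<i> * of_real x * (of_real s + \<i> * of_real k)) =
    - (k * s\<^sup>2) + k ^ 3 / 3 - k * x"
  by (simp add: power3_eq_cube power2_eq_square) (simp add: field_simps)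

lemma Re_airy_phase_even:
  "Re (exp (\<i> * (of_real (- s) + \<i> * of_real k) ^ 3 / 3 + \<i> * of_real x * (of_real (- s) + \<i> * of_real k))) =
   Re (exp (\<i> * (of_real s + \<i> * of_real k) ^ 3 / 3 + \<i> * of_real x * (of_real s + \<i> * of_real k)))"
proof -
  have "\<i> * (of_real (- s) + \<i> * of_real k) ^ 3 / 3 + \<i> * of_real x * (of_real (- s) + \<i> * of_real k) =
      cnj (\<i> * (of_real s + \<i> * of_real k) ^ 3 / 3 + \<i> * of_real x * (of_real s + \<i> * of_real k))"
    by (simp add: complex_eq_iff power3_eq_cube algebra_simps)
  moreover have "Re (exp (cnj w)) = Re (exp w)" for w by (simp add: Re_exp)
  ultimately show ?thesis by (simp only:)
qed

text \<open>The integrand is entire, so the contour may be moved from the real line, where the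
  integral converges only conditionally, to the line \<open>Im z = k\<close>, where it is Gaussian.\<close>

lemma airy_contour:
  assumes k: "0 < k"
  shows "airy_Ai x = 1 / (2 * pi) * (\<integral>s. Re (exp (\<i> * (of_real s + \<i> * of_real k) ^ 3 / 3 +
    \<i> * of_real x * (of_real s + \<i> * of_real k))) \<partial>lborel)"
proof -
  define E where "E z = exp (\<i> * z ^ 3 / 3 + \<i> * of_real x * z)" for z
  define g where "g s = Re (E (of_real s + \<i> * of_real k))" for s
  have "(E has_field_derivative E z * (\<i> * z\<^sup>2 + \<i> * of_real x)) (at z)" for z
    unfolding E_def by (auto intro!: derivative_eq_intros simp: field_simps)
  then have "E holomorphic_on UNIV"
    unfolding holomorphic_on_def field_differentiable_def by auto
  then obtain F where F: "\<And>z. (F has_field_derivative E z) (at z)"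
    using holomorphic_convex_primitive'[of UNIV E] by auto
  have line: "((\<lambda>s. b * E (a + b * of_real s)) has_integral F (a + b * of_real R) - F a) {0..R}"
    if "0 \<le> R" for a b :: complex and R :: real
  proof -
    have "((\<lambda>s. b * E (a + b * of_real s)) has_integral
        F (a + b * of_real R) - F (a + b * of_real 0)) {0..R}"
    proof (rule fundamental_theorem_of_calculus[OF that])
      fix s assume "s \<in> {0..R}"
      have "((\<lambda>s. a + b * complex_of_real s) has_vector_derivative b) (at s)"
        by (auto intro!: derivative_eq_intros)
      from field_vector_diff_chain_at[OF this F]
      have "((\<lambda>s. F (a + b * of_real s)) has_vector_derivative b * E (a + b * of_real s)) (at s)"
        by (simp add: comp_def)
      then show "((\<lambda>s. F (a + b * of_real s)) has_vector_derivative b * E (a + b * of_real s))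
          (at s within {0..R})"
        by (rule has_vector_derivative_at_within)
    qed
    then show ?thesis by simp
  qed
  have Re_line: "((\<lambda>s. Re (b * E (a + b * of_real s))) has_integral Re (F (a + b * of_real R) - F a)) {0..R}"
    if "0 \<le> R" for a b :: complex and R :: real
    using has_integral_linear[OF line[OF that] bounded_linear_Re] by (simp add: comp_def)
  have cosint: "integral {0..R} (\<lambda>u. cos (u ^ 3 / 3 + x * u)) = Re (F (of_real R) - F 0)" if "0 \<le> R" for R
  proof -
    have "Re (1 * E (0 + 1 * of_real u)) = cos (u ^ 3 / 3 + x * u)" for u
    proof -
      have "\<i> * of_real u ^ 3 / 3 + \<i> * of_real x * of_real u = \<i> * of_real (u ^ 3 / 3 + x * u)"
        by (simp add: algebra_simps)
      then show ?thesis unfolding E_def by (simp add: Re_exp)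
    qed
    then show ?thesis using integral_unique[OF Re_line[OF that, of 1 0]] by simp
  qed
  have g_abs: "\<bar>g s\<bar> \<le> exp (k ^ 3 / 3 - k * x) * exp (- (k * s\<^sup>2))" for s
  proof -
    have "\<bar>g s\<bar> \<le> norm (E (of_real s + \<i> * of_real k))" unfolding g_def by (rule abs_Re_le_cmod)
    also have "\<dots> = exp (- (k * s\<^sup>2) + k ^ 3 / 3 - k * x)"
      unfolding E_def norm_exp_eq_Re Re_airy_exponent ..
    finally show ?thesis by (simp add: exp_add[symmetric] algebra_simps)
  qed
  have g_cont: "continuous_on UNIV g" unfolding g_def E_def by (auto intro!: continuous_intros)
  have g_int: "integrable lborel g"
    by (rule Bochner_Integration.integrable_bound[OF integrable_mult_right[OF integrable_gaussian(1)[OF k],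
        of "exp (k ^ 3 / 3 - k * x)"]])
      (use g_abs g_cont in \<open>auto intro: borel_measurable_continuous_onI\<close>)
  define I where "I = (\<integral>s. indicator {0..} s *\<^sub>R g s \<partial>lborel)"
  have half: "integrable lborel (\<lambda>s. indicator {0..} s *\<^sub>R g s)"
    using integrable_mult_indicator[OF _ g_int, of "{0..}"] by simp
  \<comment> \<open>The contour from \<open>0\<close> to \<open>R\<close> is replaced by the path through \<open>i k\<close> and \<open>R + i k\<close>.\<close>
  have horiz: "((\<lambda>R. Re (F (\<i> * of_real k + of_real R) - F (\<i> * of_real k))) \<longlongrightarrow> I) at_top"
  proof -
    have "((\<lambda>R. \<integral>s. indicator {..R} s *\<^sub>R (indicator {0..} s *\<^sub>R g s) \<partial>lborel) \<longlongrightarrow> I) at_top"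
      unfolding I_def by (rule tendsto_integral_at_top[OF _ half]) simp
    moreover have "\<forall>\<^sub>F R in at_top. (\<integral>s. indicator {..R} s *\<^sub>R (indicator {0..} s *\<^sub>R g s) \<partial>lborel) =
        Re (F (\<i> * of_real k + of_real R) - F (\<i> * of_real k))"
      using eventually_ge_at_top[of 0]
    proof eventually_elim
      case (elim R)
      have "(\<integral>s. indicator {..R} s *\<^sub>R (indicator {0..} s *\<^sub>R g s) \<partial>lborel) = (LINT s:{0..R}|lborel. g s)"
        unfolding set_lebesgue_integral_def
        by (intro Bochner_Integration.integral_cong) (auto simp: indicator_def)
      also have "\<dots> = integral {0..R} g"
        by (rule set_borel_integral_eq_integral)
          (use integrable_mult_indicator[OF _ g_int, of "{0..R}"] in \<open>simp add: set_integrable_def\<close>)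
      also have "\<dots> = Re (F (\<i> * of_real k + of_real R) - F (\<i> * of_real k))"
        using integral_unique[OF Re_line[OF elim, of 1 "\<i> * of_real k"]]
        unfolding g_def by (simp add: add.commute)
      finally show ?case .
    qed
    ultimately show ?thesis by (rule Lim_transform_eventually)
  qed
  have imag: "Re (F (\<i> * of_real k) - F 0) = 0"
  proof -
    have "Re (\<i> * E (0 + \<i> * of_real y)) = 0" for y
    proof -
      have "\<i> * (\<i> * complex_of_real y) ^ 3 / 3 + \<i> * of_real x * (\<i> * of_real y) = of_real (y ^ 3 / 3 - x * y)"
        by (simp add: complex_eq_iff power3_eq_cube)
      then show ?thesis unfolding E_def by (simp add: Im_exp del: of_real_diff)
    qed
    then show ?thesis
      using has_integral_unique[OF Re_line[of k \<i> 0] has_integral_is_0] k by simp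
  qed
  \<comment> \<open>At height \<open>y\<close> above \<open>R\<close> the integrand is of order \<open>exp (- y R\<^sup>2)\<close>, hence the bound \<open>C / R\<^sup>2\<close>.\<close>
  have vert: "((\<lambda>R. Re (F (of_real R + \<i> * of_real k) - F (of_real R))) \<longlongrightarrow> 0) at_top"
  proof (rule Lim_null_comparison)
    define C where "C = exp (k ^ 3 / 3 + \<bar>x\<bar> * k)"
    show "((\<lambda>R::real. C / R\<^sup>2) \<longlongrightarrow> 0) at_top" by real_asymp
    show "\<forall>\<^sub>F R in at_top. norm (Re (F (of_real R + \<i> * of_real k) - F (of_real R))) \<le> C / R\<^sup>2"
      using eventually_gt_at_top[of 0]
    proof eventually_elim
      case (elim R)
      have h: "((\<lambda>y. C * exp (- (R\<^sup>2 * y))) has_integral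
          (- C / R\<^sup>2 * exp (- (R\<^sup>2 * k)) - (- C / R\<^sup>2 * exp (- (R\<^sup>2 * 0))))) {0..k}"
        using elim k
        by (intro fundamental_theorem_of_calculus)
          (auto intro!: derivative_eq_intros simp: has_real_derivative_iff_has_vector_derivative[symmetric]
            power2_eq_square)
      have "norm (F (of_real R + \<i> * of_real k) - F (of_real R)) \<le>
          - C / R\<^sup>2 * exp (- (R\<^sup>2 * k)) - (- C / R\<^sup>2 * exp (- (R\<^sup>2 * 0)))"
        unfolding integral_unique[OF line[OF less_imp_le[OF k]], symmetric] integral_unique[OF h, symmetric]
      proof (rule Henstock_Kurzweil_Integration.integral_norm_bound_integral)
        show "(\<lambda>y. \<i> * E (of_real R + \<i> * of_real y)) integrable_on {0..k}"
          using line[OF less_imp_le[OF k]] by (rule has_integral_integrable)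
        show "(\<lambda>y. C * exp (- (R\<^sup>2 * y))) integrable_on {0..k}" using h by (rule has_integral_integrable)
        fix y assume y: "y \<in> {0..k}"
        have "norm (\<i> * E (of_real R + \<i> * of_real y)) = exp (- (y * R\<^sup>2) + y ^ 3 / 3 - y * x)"
          unfolding E_def norm_mult norm_exp_eq_Re Re_airy_exponent by simp
        also have "\<dots> = exp (- (R\<^sup>2 * y)) * exp (y ^ 3 / 3 - y * x)"
          by (simp add: exp_add[symmetric] algebra_simps)
        also have "exp (y ^ 3 / 3 - y * x) \<le> C"
        proof -
          have "y ^ 3 \<le> k ^ 3" using y by (intro power_mono) auto
          moreover have "- (y * x) \<le> \<bar>x\<bar> * k"
          proof -
            have "- (y * x) \<le> \<bar>y * x\<bar>" by simp
            also have "\<dots> = \<bar>x\<bar> * y" using y by (simp add: abs_mult mult.commute)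
            also have "\<dots> \<le> \<bar>x\<bar> * k" using y by (intro mult_left_mono) auto
            finally show ?thesis .
          qed
          ultimately show ?thesis unfolding C_def by simp
        qed
        finally show "norm (\<i> * E (of_real R + \<i> * of_real y)) \<le> C * exp (- (R\<^sup>2 * y))"
          by (simp add: mult.commute)
      qed
      also have "\<dots> \<le> C / R\<^sup>2" unfolding C_def using elim by (simp add: field_simps)
      finally show ?case by (metis abs_Re_le_cmod order_trans real_norm_def)
    qed
  qed
  have "((\<lambda>R. Re (F (\<i> * of_real k + of_real R) - F (\<i> * of_real k)) -
      Re (F (of_real R + \<i> * of_real k) - F (of_real R)) + Re (F (\<i> * of_real k) - F 0)) \<longlongrightarrow> I - 0 + 0) at_top"
    unfolding imag by (intro tendsto_intros horiz vert)
  moreover have "\<forall>\<^sub>F R in at_top. Re (F (\<i> * of_real k + of_real R) - F (\<i> * of_real k)) -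
      Re (F (of_real R + \<i> * of_real k) - F (of_real R)) + Re (F (\<i> * of_real k) - F 0) =
      integral {0..R} (\<lambda>u. cos (u ^ 3 / 3 + x * u))"
    using eventually_ge_at_top[of 0]
    by eventually_elim (simp add: cosint add.commute[of "\<i> * of_real k"])
  ultimately have "((\<lambda>R. integral {0..R} (\<lambda>u. cos (u ^ 3 / 3 + x * u))) \<longlongrightarrow> I - 0 + 0) at_top"
    by (rule Lim_transform_eventually)
  from tendsto_mult[OF tendsto_const this, of "1 / pi"]
  have "((\<lambda>R. 1 / pi * integral {0..R} (\<lambda>u. cos (u ^ 3 / 3 + x * u))) \<longlongrightarrow> 1 / pi * I) at_top" by simp
  then have "airy_Ai x = 1 / pi * I"
    unfolding airy_Ai_def by (intro tendsto_Lim) simp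
  moreover have "(\<integral>s. g s \<partial>lborel) = 2 * I"
  proof -
    have "has_bochner_integral lborel (\<lambda>s. indicator {0..} s *\<^sub>R g s) I"
      using half unfolding I_def by (rule has_bochner_integral_integrable)
    from has_bochner_integral_even_function[OF this] have "has_bochner_integral lborel g (2 *\<^sub>R I)"
      unfolding g_def E_def using Re_airy_phase_even by blast
    then show ?thesis by (simp add: has_bochner_integral_integral_eq)
  qed
  ultimately show ?thesis by (simp add: g_def E_def)
qed

text \<open>The summand with the Airy function in \<open>K1_ext\<close>: it depends on the positions only through their
  sum \<open>u\<close> and on the times only through their difference \<open>\<delta>\<close>.\<close>

definition airy_shift :: "real \<Rightarrow> real \<Rightarrow> real" where
  "airy_shift \<delta> u = airy_Ai (u + \<delta>\<^sup>2) * exp (\<delta> * u + 2 / 3 * \<delta> ^ 3)"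

definition airy_phase :: "real \<Rightarrow> real \<Rightarrow> real \<Rightarrow> complex" where
  "airy_phase \<delta> u s = exp (\<i> * (of_real s + \<i>) ^ 3 / 3 + \<i> * of_real u * (of_real s + \<i>)
     - of_real \<delta> * (of_real s + \<i>)\<^sup>2)"

lemma norm_airy_phase: "norm (airy_phase \<delta> u s) = exp (1 / 3 + \<delta> - u) * exp (- ((1 + \<delta>) * s\<^sup>2))"
proof -
  have "Re (\<i> * (of_real s + \<i>) ^ 3 / 3 + \<i> * of_real u * (of_real s + \<i>) - of_real \<delta> * (of_real s + \<i>)\<^sup>2) =
      1 / 3 + \<delta> - u - (1 + \<delta>) * s\<^sup>2"
    by (simp add: power3_eq_cube power2_eq_square) (simp add: field_simps)
  then show ?thesis unfolding airy_phase_def norm_exp_eq_Re by (simp add: exp_add[symmetric] exp_diff[symmetric])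
qed

lemma norm_airy_phase_0: "norm (airy_phase 0 u s) = exp (- u) * exp (1 / 3) * exp (- s\<^sup>2)"
  by (simp add: norm_airy_phase exp_add[symmetric] exp_diff[symmetric])

lemma airy_phase_measurable[measurable]:
  assumes "f \<in> borel_measurable M" "g \<in> borel_measurable M"
  shows "(\<lambda>x. airy_phase \<delta> (f x) (g x)) \<in> borel_measurable M"
proof -
  have "continuous_on UNIV (\<lambda>(u, s). airy_phase \<delta> u s)"
    unfolding airy_phase_def case_prod_beta by (auto intro!: continuous_intros)
  then have "(\<lambda>(u, s). airy_phase \<delta> u s) \<in> borel_measurable (borel \<Otimes>\<^sub>M borel)"
    unfolding borel_prod by (rule borel_measurable_continuous_onI)
  from measurable_compose[OF measurable_Pair[OF assms] this] show ?thesis by simp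
qed

lemma airy_phase_integrable: "- 1 < \<delta> \<Longrightarrow> integrable lborel (airy_phase \<delta> u)"
  by (rule Bochner_Integration.integrable_bound[OF integrable_mult_right[OF
      integrable_gaussian(1)[of "1 + \<delta>"], of "exp (1 / 3 + \<delta> - u)"]])
    (auto simp: norm_airy_phase)

text \<open>Completing the cube: translating the line of integration by \<open>i \<delta>\<close> turns \<open>Ai (u + \<delta>\<^sup>2)\<close> and the
  exponential prefactor into the factor \<open>exp (- \<delta> z\<^sup>2)\<close>. In this form the dependence on \<open>\<delta>\<close> and \<open>u\<close> is
  exponential, and all estimates reduce to Gaussian integrals.\<close>

lemma airy_shift_eq:
  assumes "- 1 < \<delta>"
  shows "airy_shift \<delta> u = 1 / (2 * pi) * Re (\<integral>s. airy_phase \<delta> u s \<partial>lborel)"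
proof -
  have ph: "exp (\<delta> * u + 2 / 3 * \<delta> ^ 3) * Re (exp (\<i> * (of_real s + \<i> * of_real (1 + \<delta>)) ^ 3 / 3 +
    \<i> * of_real (u + \<delta>\<^sup>2) * (of_real s + \<i> * of_real (1 + \<delta>)))) = Re (airy_phase \<delta> u s)" for s
  proof -
    have "of_real (\<delta> * u + 2 / 3 * \<delta> ^ 3) + (\<i> * (of_real s + \<i> * of_real (1 + \<delta>)) ^ 3 / 3 +
        \<i> * of_real (u + \<delta>\<^sup>2) * (of_real s + \<i> * of_real (1 + \<delta>))) =
        \<i> * (of_real s + \<i>) ^ 3 / 3 + \<i> * of_real u * (of_real s + \<i>) - of_real \<delta> * (of_real s + \<i>)\<^sup>2"
      by (simp add: complex_eq_iff power3_eq_cube power2_eq_square) (simp add: field_simps)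
    then have "airy_phase \<delta> u s = of_real (exp (\<delta> * u + 2 / 3 * \<delta> ^ 3)) *
        exp (\<i> * (of_real s + \<i> * of_real (1 + \<delta>)) ^ 3 / 3 +
        \<i> * of_real (u + \<delta>\<^sup>2) * (of_real s + \<i> * of_real (1 + \<delta>)))"
      unfolding airy_phase_def exp_of_real[symmetric] exp_add[symmetric] by simp
    then show ?thesis by simp
  qed
  have "airy_shift \<delta> u = 1 / (2 * pi) * (\<integral>s. exp (\<delta> * u + 2 / 3 * \<delta> ^ 3) *
      Re (exp (\<i> * (of_real s + \<i> * of_real (1 + \<delta>)) ^ 3 / 3 +
    \<i> * of_real (u + \<delta>\<^sup>2) * (of_real s + \<i> * of_real (1 + \<delta>)))) \<partial>lborel)"
    unfolding airy_shift_def using assms by (subst airy_contour[of "1 + \<delta>"]) auto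
  also have "\<dots> = 1 / (2 * pi) * Re (\<integral>s. airy_phase \<delta> u s \<partial>lborel)"
    unfolding ph using airy_phase_integrable[OF assms] by (subst integral_Re) auto
  finally show ?thesis .
qed

lemma norm_exp_minus_one: "norm (exp w - 1) \<le> norm w * exp \<bar>Re w\<bar>" for w :: complex
proof -
  have "norm (exp w - exp 0) \<le> exp \<bar>Re w\<bar> * norm (w - 0)"
    by (rule field_differentiable_bound[of "{z. Re z \<le> \<bar>Re w\<bar>}" exp exp])
      (auto intro!: convex_halfspace_Re_le derivative_eq_intros)
  then show ?thesis by (simp add: mult.commute)
qed

lemma norm_shifted_line: "(norm (complex_of_real s + \<i>))\<^sup>2 = 1 + s\<^sup>2"
  "norm (complex_of_real s + \<i>) \<le> 1 + s\<^sup>2"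
proof -
  show 1: "(norm (complex_of_real s + \<i>))\<^sup>2 = 1 + s\<^sup>2" by (simp add: cmod_power2)
  have "norm (complex_of_real s + \<i>) \<le> sqrt ((1 + s\<^sup>2)\<^sup>2)"
    unfolding real_sqrt_unique[OF 1, symmetric, OF norm_ge_zero] 
    by (intro real_sqrt_le_mono self_le_power) auto
  then show "norm (complex_of_real s + \<i>) \<le> 1 + s\<^sup>2" by simp
qed

definition airy_const :: real where
  "airy_const = exp 1 * (\<integral>s. (1 + s\<^sup>2) * exp (- (1 / 2 * s\<^sup>2)) \<partial>lborel)"

lemma airy_const_nonneg: "0 \<le> airy_const"
  unfolding airy_const_def by (intro mult_nonneg_nonneg integral_nonneg_AE) auto

lemma airy_const_estimate:
  assumes "\<And>s. norm (f s) \<le> c * exp 1 * ((1 + s\<^sup>2) * exp (- (1 / 2 * s\<^sup>2)))"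
  shows "\<bar>1 / (2 * pi) * Re (\<integral>s. f s \<partial>lborel)\<bar> \<le> c * airy_const"
proof -
  have c: "0 \<le> c * airy_const"
    using order.trans[OF norm_ge_zero assms[of 0]] airy_const_nonneg by (simp add: zero_le_mult_iff)
  have "\<bar>Re (\<integral>s. f s \<partial>lborel)\<bar> \<le> norm (\<integral>s. f s \<partial>lborel)" by (rule abs_Re_le_cmod)
  also have "\<dots> \<le> (\<integral>s. norm (f s) \<partial>lborel)" by simp
  also have "\<dots> \<le> (\<integral>s. c * exp 1 * ((1 + s\<^sup>2) * exp (- (1 / 2 * s\<^sup>2))) \<partial>lborel)"
    using order.trans[OF norm_ge_zero assms]
    by (intro integral_mono' integrable_mult_right integrable_gaussian(2) assms) auto
  also have "\<dots> = c * airy_const" by (simp add: airy_const_def)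
  finally have "\<bar>Re (\<integral>s. f s \<partial>lborel)\<bar> \<le> c * airy_const" .
  moreover have "1 / (2 * pi) * (c * airy_const) \<le> 1 * (c * airy_const)"
    using c pi_gt3 by (intro mult_right_mono) (auto simp: field_simps)
  moreover have "\<bar>1 / (2 * pi) * Re (\<integral>s. f s \<partial>lborel)\<bar> = 1 / (2 * pi) * \<bar>Re (\<integral>s. f s \<partial>lborel)\<bar>"
    by (simp add: abs_mult)
  ultimately show ?thesis
    by (smt (verit) mult_left_mono[of _ _ "1 / (2 * pi)"] divide_nonneg_nonneg pi_ge_zero)
qed

lemma airy_shift_bound:
  assumes "\<bar>\<delta>\<bar> \<le> 1 / 2"
  shows "\<bar>airy_shift \<delta> u\<bar> \<le> airy_const * exp (- u)"
proof -
  have "norm (airy_phase \<delta> u s) \<le> exp (- u) * exp 1 * ((1 + s\<^sup>2) * exp (- (1 / 2 * s\<^sup>2)))" for s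
  proof -
    have "norm (airy_phase \<delta> u s) = exp (- u) * exp (1 / 3 + \<delta>) * (1 * exp (- ((1 + \<delta>) * s\<^sup>2)))"
      by (simp add: norm_airy_phase exp_add[symmetric] exp_diff[symmetric])
    also have "\<dots> \<le> exp (- u) * exp 1 * ((1 + s\<^sup>2) * exp (- (1 / 2 * s\<^sup>2)))"
    proof -
      have "1 / 2 * s\<^sup>2 \<le> (1 + \<delta>) * s\<^sup>2" using assms by (intro mult_right_mono) auto
      then show ?thesis using assms by (intro mult_mono) auto
    qed
    finally show ?thesis .
  qed
  from airy_const_estimate[OF this] show ?thesis
    using assms by (subst airy_shift_eq) (auto simp: mult.commute)
qed

lemma airy_shift_0 [simp]: "airy_shift 0 = airy_Ai"
  by (simp add: airy_shift_def fun_eq_iff)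

lemma airy_Ai_bound: "\<bar>airy_Ai u\<bar> \<le> airy_const * exp (- u)"
  using airy_shift_bound[of 0 u] by simp

lemma airy_shift_time_lipschitz:
  assumes "\<bar>\<delta>\<bar> \<le> 1 / 4"
  shows "\<bar>airy_shift \<delta> u - airy_Ai u\<bar> \<le> \<bar>\<delta>\<bar> * airy_const * exp (- u)"
proof -
  have "norm (airy_phase \<delta> u s - airy_phase 0 u s) \<le>
      \<bar>\<delta>\<bar> * exp (- u) * exp 1 * ((1 + s\<^sup>2) * exp (- (1 / 2 * s\<^sup>2)))" for s
  proof -
    define z where "z = complex_of_real s + \<i>"
    have nz: "norm (z\<^sup>2) = 1 + s\<^sup>2" using norm_shifted_line(1)[of s] by (simp add: z_def norm_power)
    have "airy_phase \<delta> u s - airy_phase 0 u s = airy_phase 0 u s * (exp (- (of_real \<delta> * z\<^sup>2)) - 1)"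
      unfolding airy_phase_def z_def right_diff_distrib exp_add[symmetric] by simp
    then have "norm (airy_phase \<delta> u s - airy_phase 0 u s) =
        norm (airy_phase 0 u s) * norm (exp (- (of_real \<delta> * z\<^sup>2)) - 1)"
      by (simp add: norm_mult)
    also have "norm (exp (- (of_real \<delta> * z\<^sup>2)) - 1) \<le>
        norm (- (of_real \<delta> * z\<^sup>2)) * exp \<bar>Re (- (of_real \<delta> * z\<^sup>2))\<bar>"
      by (rule norm_exp_minus_one)
    also have "\<dots> \<le> (\<bar>\<delta>\<bar> * (1 + s\<^sup>2)) * exp (\<bar>\<delta>\<bar> * (1 + s\<^sup>2))"
    proof -
      have "norm (- (of_real \<delta> * z\<^sup>2)) = \<bar>\<delta>\<bar> * (1 + s\<^sup>2)" by (simp add: norm_mult nz)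
      then show ?thesis using abs_Re_le_cmod[of "- (of_real \<delta> * z\<^sup>2)"] by (simp add: mult_left_mono)
    qed
    also have "exp (\<bar>\<delta>\<bar> * (1 + s\<^sup>2)) \<le> exp (1 / 4 * (1 + s\<^sup>2))"
    proof -
      have "\<bar>\<delta>\<bar> * (1 + s\<^sup>2) \<le> 1 / 4 * (1 + s\<^sup>2)" using assms by (intro mult_right_mono) auto
      then show ?thesis by simp
    qed
    also have "norm (airy_phase 0 u s) * (\<bar>\<delta>\<bar> * (1 + s\<^sup>2) * exp (1 / 4 * (1 + s\<^sup>2))) =
        \<bar>\<delta>\<bar> * exp (- u) * exp (1 / 3 + 1 / 4) * ((1 + s\<^sup>2) * exp (- (3 / 4 * s\<^sup>2)))"
    proof -
      have h: "exp (1 / 3) * exp (- s\<^sup>2) * exp (1 / 4 * (1 + s\<^sup>2)) = exp (1 / 3 + 1 / 4) * exp (- (3 / 4 * s\<^sup>2))"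
        unfolding exp_add[symmetric] by (intro arg_cong[of _ _ exp]) (simp add: field_simps)
      have "norm (airy_phase 0 u s) * (\<bar>\<delta>\<bar> * (1 + s\<^sup>2) * exp (1 / 4 * (1 + s\<^sup>2))) =
          \<bar>\<delta>\<bar> * exp (- u) * (1 + s\<^sup>2) * (exp (1 / 3) * exp (- s\<^sup>2) * exp (1 / 4 * (1 + s\<^sup>2)))"
        unfolding norm_airy_phase_0 by (simp only: mult_ac)
      then show ?thesis unfolding h by (simp only: mult_ac)
    qed
    also have "\<dots> \<le> \<bar>\<delta>\<bar> * exp (- u) * exp 1 * ((1 + s\<^sup>2) * exp (- (1 / 2 * s\<^sup>2)))"
      by (intro mult_mono mult_left_mono) auto
    finally show ?thesis by (simp add: mult_left_mono)
  qed
  from airy_const_estimate[OF this] show ?thesis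
    using assms airy_shift_eq[of \<delta> u] airy_shift_eq[of 0 u] airy_phase_integrable[of \<delta> u]
      airy_phase_integrable[of 0 u]
    by (simp add: right_diff_distrib mult_ac)
qed

lemma airy_Ai_lipschitz:
  "\<bar>airy_Ai v - airy_Ai u\<bar> \<le> \<bar>v - u\<bar> * exp \<bar>v - u\<bar> * airy_const * exp (- u)"
proof -
  have "norm (airy_phase 0 v s - airy_phase 0 u s) \<le>
      \<bar>v - u\<bar> * exp \<bar>v - u\<bar> * exp (- u) * exp 1 * ((1 + s\<^sup>2) * exp (- (1 / 2 * s\<^sup>2)))" for s
  proof -
    define z where "z = complex_of_real s + \<i>"
    define w where "w = \<i> * of_real (v - u) * z"
    have "airy_phase 0 v s - airy_phase 0 u s = airy_phase 0 u s * (exp w - 1)"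
      unfolding airy_phase_def w_def z_def right_diff_distrib exp_add[symmetric] by (simp add: algebra_simps)
    then have "norm (airy_phase 0 v s - airy_phase 0 u s) = norm (airy_phase 0 u s) * norm (exp w - 1)"
      by (simp add: norm_mult)
    also have "norm (exp w - 1) \<le> norm w * exp \<bar>Re w\<bar>" by (rule norm_exp_minus_one)
    also have "\<dots> \<le> (\<bar>v - u\<bar> * (1 + s\<^sup>2)) * exp \<bar>v - u\<bar>"
    proof -
      have "norm w \<le> \<bar>v - u\<bar> * (1 + s\<^sup>2)"
        using norm_shifted_line(2)[of s]
        unfolding w_def norm_mult z_def[symmetric] norm_of_real by (simp add: mult_left_mono del: of_real_diff)
      moreover have "Re w = u - v" by (simp add: w_def z_def)
      ultimately show ?thesis by (simp add: abs_minus_commute mult_right_mono)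
    qed
    also have "norm (airy_phase 0 u s) * (\<bar>v - u\<bar> * (1 + s\<^sup>2) * exp \<bar>v - u\<bar>) =
        \<bar>v - u\<bar> * exp \<bar>v - u\<bar> * exp (- u) * exp (1 / 3) * ((1 + s\<^sup>2) * exp (- s\<^sup>2))"
      unfolding norm_airy_phase_0 by (simp only: mult_ac)
    also have "\<dots> \<le> \<bar>v - u\<bar> * exp \<bar>v - u\<bar> * exp (- u) * exp 1 * ((1 + s\<^sup>2) * exp (- (1 / 2 * s\<^sup>2)))"
      by (intro mult_mono mult_left_mono) auto
    finally show ?thesis by (simp add: mult_left_mono)
  qed
  from airy_const_estimate[OF this] show ?thesis
    using airy_shift_eq[of 0 v] airy_shift_eq[of 0 u] airy_phase_integrable[of 0 v]
      airy_phase_integrable[of 0 u]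
    by (simp add: right_diff_distrib mult_ac)
qed

lemma airy_Ai_measurable[measurable]: "airy_Ai \<in> borel_measurable borel"
proof -
  have "isCont airy_Ai u" for u
  proof -
    have "((\<lambda>v. airy_Ai v - airy_Ai u) \<longlongrightarrow> 0) (at u)"
    proof (rule Lim_null_comparison)
      show "\<forall>\<^sub>F v in at u. norm (airy_Ai v - airy_Ai u) \<le> \<bar>v - u\<bar> * exp \<bar>v - u\<bar> * airy_const * exp (- u)"
        using airy_Ai_lipschitz by (intro always_eventually) auto
      have "((\<lambda>v. \<bar>v - u\<bar> * exp \<bar>v - u\<bar> * airy_const * exp (- u)) \<longlongrightarrow>
          \<bar>u - u\<bar> * exp \<bar>u - u\<bar> * airy_const * exp (- u)) (at u)"
        by (intro tendsto_intros)
      then show "((\<lambda>v. \<bar>v - u\<bar> * exp \<bar>v - u\<bar> * airy_const * exp (- u)) \<longlongrightarrow> 0) (at u)" by simp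
    qed
    then show ?thesis by (simp add: isCont_def LIM_zero_iff)
  qed
  then show ?thesis by (intro borel_measurable_continuous_onI continuous_at_imp_continuous_on) auto
qed

lemma airy_shift_measurable[measurable]: "airy_shift \<delta> \<in> borel_measurable borel"
  unfolding airy_shift_def by measurable

subsection \<open>Gaussian integrals\<close>

lemma normal_density_exp_tilt:
  assumes "0 < \<sigma>"
  shows "normal_density m \<sigma> v * exp (p * v) =
    exp (p * m + p\<^sup>2 * \<sigma>\<^sup>2 / 2) * normal_density (m + p * \<sigma>\<^sup>2) \<sigma> v"
proof -
  have "- (v - m)\<^sup>2 / (2 * \<sigma>\<^sup>2) + p * v =
      (p * m + p\<^sup>2 * \<sigma>\<^sup>2 / 2) + - (v - (m + p * \<sigma>\<^sup>2))\<^sup>2 / (2 * \<sigma>\<^sup>2)"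
    using assms by (simp add: field_simps power2_eq_square)
  then show ?thesis
    unfolding normal_density_def by (simp add: exp_add[symmetric] mult.left_commute)
qed

lemma normal_density_exp_integrable:
  "0 < \<sigma> \<Longrightarrow> integrable lborel (\<lambda>v. normal_density m \<sigma> v * exp (p * v))"
  by (simp add: normal_density_exp_tilt)

lemma normal_density_exp_integral:
  "0 < \<sigma> \<Longrightarrow> (\<integral>v. normal_density m \<sigma> v * exp (p * v) \<partial>lborel) = exp (p * m + p\<^sup>2 * \<sigma>\<^sup>2 / 2)"
  by (simp add: normal_density_exp_tilt)

lemma normal_density_iexp_integral:
  assumes \<sigma>: "0 < \<sigma>"
  shows "(\<integral>v. normal_density m \<sigma> v *\<^sub>R iexp (q * v) \<partial>lborel) = exp (\<i> * of_real (q * m) - of_real (q\<^sup>2 * \<sigma>\<^sup>2 / 2))"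
proof -
  have nd: "\<sigma> * normal_density m \<sigma> (m + \<sigma> * y) = std_normal_density y" for y
    using \<sigma> by (simp add: normal_density_def real_sqrt_mult power_mult_distrib)
  have "(\<integral>v. normal_density m \<sigma> v *\<^sub>R iexp (q * v) \<partial>lborel) =
      \<bar>\<sigma>\<bar> *\<^sub>R (\<integral>y. normal_density m \<sigma> (m + \<sigma> * y) *\<^sub>R iexp (q * (m + \<sigma> * y)) \<partial>lborel)"
    using \<sigma> by (intro lborel_integral_real_affine) auto
  also have "\<dots> = (\<integral>y. iexp (q * m) * (std_normal_density y *\<^sub>R iexp (q * \<sigma> * y)) \<partial>lborel)"
  proof -
    have "\<bar>\<sigma>\<bar> *\<^sub>R (normal_density m \<sigma> (m + \<sigma> * y) *\<^sub>R iexp (q * (m + \<sigma> * y))) =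
        iexp (q * m) * (std_normal_density y *\<^sub>R iexp (q * \<sigma> * y))" for y
      unfolding nd[symmetric] using \<sigma>
      by (simp add: exp_add[symmetric] scaleR_conv_of_real algebra_simps)
    then show ?thesis unfolding integral_scaleR_right[symmetric] by (simp only:)
  qed
  also have "\<dots> = iexp (q * m) * (\<integral>y. std_normal_density y *\<^sub>R iexp (q * \<sigma> * y) \<partial>lborel)"
    by (rule integral_mult_right_zero)
  also have "(\<integral>y. std_normal_density y *\<^sub>R iexp (q * \<sigma> * y) \<partial>lborel) = char std_normal_distribution (q * \<sigma>)"
    unfolding char_def by (subst integral_density) auto
  also have "char std_normal_distribution (q * \<sigma>) = of_real (exp (- ((q * \<sigma>)\<^sup>2) / 2))"
    by (simp add: char_std_normal_distribution)
  finally show ?thesis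
    by (simp add: exp_of_real[symmetric] exp_add[symmetric] power_mult_distrib algebra_simps exp_diff)
qed

lemma normal_density_cexp_integral:
  fixes w :: complex
  assumes \<sigma>: "0 < \<sigma>"
  shows "(\<integral>v. normal_density m \<sigma> v *\<^sub>R exp (w * of_real v) \<partial>lborel) = exp (w * of_real m + w\<^sup>2 * of_real (\<sigma>\<^sup>2 / 2))"
proof -
  define p q where "p = Re w" and "q = Im w"
  have w: "w = of_real p + \<i> * of_real q" by (simp add: p_def q_def complex_eq)
  have "normal_density m \<sigma> v *\<^sub>R exp (w * of_real v) =
      of_real (exp (p * m + p\<^sup>2 * \<sigma>\<^sup>2 / 2)) * (normal_density (m + p * \<sigma>\<^sup>2) \<sigma> v *\<^sub>R iexp (q * v))" for v
  proof -
    have "exp (w * of_real v) = of_real (exp (p * v)) * iexp (q * v)"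
      by (simp add: w exp_of_real[symmetric] exp_add[symmetric] algebra_simps)
    then have "normal_density m \<sigma> v *\<^sub>R exp (w * of_real v) =
        of_real (normal_density m \<sigma> v * exp (p * v)) * iexp (q * v)"
      by (simp add: scaleR_conv_of_real)
    then show ?thesis unfolding normal_density_exp_tilt[OF \<sigma>] by (simp add: scaleR_conv_of_real)
  qed
  then have "(\<integral>v. normal_density m \<sigma> v *\<^sub>R exp (w * of_real v) \<partial>lborel) =
      of_real (exp (p * m + p\<^sup>2 * \<sigma>\<^sup>2 / 2)) *
      exp (\<i> * of_real (q * (m + p * \<sigma>\<^sup>2)) - of_real (q\<^sup>2 * \<sigma>\<^sup>2 / 2))"
    by (simp only: integral_mult_right_zero normal_density_iexp_integral[OF \<sigma>])
  also have "\<dots> = exp (w * of_real m + w\<^sup>2 * of_real (\<sigma>\<^sup>2 / 2))"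
    unfolding exp_of_real[symmetric] exp_add[symmetric] w
    by (intro arg_cong[of _ _ exp]) (simp add: complex_eq_iff power2_eq_square, simp add: field_simps)
  finally show ?thesis .
qed

text \<open>In \<open>airy_phase\<close> the position enters through a plane wave of complex frequency, on
  which the heat semigroup acts by a scalar; this scalar is a shift of the time \<open>\<delta>\<close>.\<close>

lemma airy_shift_heat:
  assumes t: "0 < t" and \<delta>: "- 1 < \<delta>"
  shows "(\<integral>v. normal_density x (sqrt (2 * t)) v * airy_shift \<delta> (v + y) \<partial>lborel) = airy_shift (\<delta> + t) (x + y)"
proof -
  define n where "n = normal_density x (sqrt (2 * t))"
  have \<sigma>: "0 < sqrt (2 * t)" "(sqrt (2 * t))\<^sup>2 = 2 * t" using t by auto
  define f where "f v s = n v *\<^sub>R airy_phase \<delta> (v + y) s" for v s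
  have f_norm: "norm (f v s) = exp (1 / 3 + \<delta> - y) * (n v * exp (- 1 * v)) * exp (- ((1 + \<delta>) * s\<^sup>2))" for v s
    by (simp add: f_def n_def norm_airy_phase exp_add[symmetric] exp_diff[symmetric] mult_exp_exp algebra_simps)
  have n_exp: "integrable lborel (\<lambda>v. n v * exp (- 1 * v))"
    unfolding n_def by (rule normal_density_exp_integrable[OF \<sigma>(1)])
  have g: "integrable lborel (\<lambda>s. exp (- ((1 + \<delta>) * s\<^sup>2)))" using \<delta> by (intro integrable_gaussian) auto
  have meas: "(\<lambda>(v, s). f v s) \<in> borel_measurable (lborel \<Otimes>\<^sub>M lborel)"
    unfolding f_def n_def by measurable
  have f_int: "integrable (lborel \<Otimes>\<^sub>M lborel) (\<lambda>(v, s). f v s)"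
  proof (rule lborel_pair.Fubini_integrable[OF meas])
    have "integrable lborel (\<lambda>v. exp (1 / 3 + \<delta> - y) * (n v * exp (- 1 * v)) * (\<integral>s. exp (- ((1 + \<delta>) * s\<^sup>2)) \<partial>lborel))"
      by (intro integrable_mult_left integrable_mult_right n_exp)
    then show "integrable lborel (\<lambda>v. \<integral>s. norm (case (v, s) of (v, s) \<Rightarrow> f v s) \<partial>lborel)"
      by (simp add: f_norm)
    show "AE v in lborel. integrable lborel (\<lambda>s. case (v, s) of (v, s) \<Rightarrow> f v s)"
      using airy_phase_integrable[OF \<delta>] by (simp add: f_def)
  qed
  have inner: "(\<integral>v. f v s \<partial>lborel) = airy_phase (\<delta> + t) (x + y) s" for s
  proof -
    define z where "z = complex_of_real s + \<i>"
    have "f v s = airy_phase \<delta> y s * (n v *\<^sub>R exp (\<i> * z * of_real v))" for v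
      unfolding f_def airy_phase_def z_def scaleR_conv_of_real
      by (simp add: exp_add[symmetric] mult.left_commute) (simp add: algebra_simps)
    then have "(\<integral>v. f v s \<partial>lborel) = airy_phase \<delta> y s * (\<integral>v. n v *\<^sub>R exp (\<i> * z * of_real v) \<partial>lborel)"
      by (simp only: integral_mult_right_zero)
    also have "\<dots> = airy_phase \<delta> y s * exp (\<i> * z * of_real x + (\<i> * z)\<^sup>2 * of_real (2 * t / 2))"
      unfolding n_def normal_density_cexp_integral[OF \<sigma>(1)] \<sigma>(2) ..
    also have "\<dots> = airy_phase (\<delta> + t) (x + y) s"
      unfolding airy_phase_def z_def exp_add[symmetric]
      by (intro arg_cong[of _ _ exp]) (simp add: complex_eq_iff power2_eq_square power3_eq_cube algebra_simps)
    finally show ?thesis .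
  qed
  have "(\<integral>v. n v * airy_shift \<delta> (v + y) \<partial>lborel) =
      (\<integral>v. 1 / (2 * pi) * Re (\<integral>s. f v s \<partial>lborel) \<partial>lborel)"
    unfolding f_def using \<delta>
    by (intro Bochner_Integration.integral_cong refl) (simp add: airy_shift_eq)
  also have "\<dots> = 1 / (2 * pi) * Re (\<integral>v. \<integral>s. f v s \<partial>lborel \<partial>lborel)"
    using lborel_pair.integrable_fst'[OF f_int] by (simp add: integral_Re)
  also have "(\<integral>v. \<integral>s. f v s \<partial>lborel \<partial>lborel) = (\<integral>s. \<integral>v. f v s \<partial>lborel \<partial>lborel)"
    using lborel_pair.Fubini_integral[OF f_int] by simp
  also have "1 / (2 * pi) * Re \<dots> = airy_shift (\<delta> + t) (x + y)"
    unfolding inner using t \<delta> by (simp add: airy_shift_eq)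
  finally show ?thesis by (simp add: n_def)
qed

section \<open>Eliminating the heat kernel by the last exceedance of a random walk\<close>

lemma (in prob_space) indep_density_expectation:
  fixes X :: "'a \<Rightarrow> real" and \<Phi> :: "real \<Rightarrow> 'c \<Rightarrow> real"
  assumes rv: "random_variable borel X" "random_variable S Y"
    and prod: "distr M (borel \<Otimes>\<^sub>M S) (\<lambda>\<omega>. (X \<omega>, Y \<omega>)) = distr M borel X \<Otimes>\<^sub>M distr M S Y"
    and X: "distributed M lborel X (\<lambda>x. ennreal (f x))" "\<And>x. 0 \<le> f x" "f \<in> borel_measurable borel"
    and \<Phi>: "case_prod \<Phi> \<in> borel_measurable (borel \<Otimes>\<^sub>M S)"
    and int: "integrable M (\<lambda>\<omega>. \<Phi> (X \<omega>) (Y \<omega>))"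
  shows "expectation (\<lambda>\<omega>. \<Phi> (X \<omega>) (Y \<omega>)) = (\<integral>v. f v * expectation (\<lambda>\<omega>. \<Phi> v (Y \<omega>)) \<partial>lborel)"
    and "integrable lborel (\<lambda>v. f v * expectation (\<lambda>\<omega>. \<Phi> v (Y \<omega>)))"
proof -
  interpret dX: prob_space "distr M borel X" by (rule prob_space_distr[OF rv(1)])
  interpret dY: prob_space "distr M S Y" by (rule prob_space_distr[OF rv(2)])
  interpret P: pair_prob_space "distr M borel X" "distr M S Y" ..
  have pairm: "(\<lambda>x. (X x, Y x)) \<in> measurable M (borel \<Otimes>\<^sub>M S)" using rv by measurable
  have int': "integrable (distr M borel X \<Otimes>\<^sub>M distr M S Y) (case_prod \<Phi>)"
    unfolding prod[symmetric] using int by (subst integrable_distr_eq[OF pairm \<Phi>]) simp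
  have dens: "distr M borel X = density lborel (\<lambda>x. ennreal (f x))"
  proof -
    have "distr M borel X = distr M lborel X" by (rule distr_cong) auto
    also have "\<dots> = density lborel (\<lambda>x. ennreal (f x))" by (rule distributed_distr_eq_density[OF X(1)])
    finally show ?thesis .
  qed
  have inner: "(\<integral>y. \<Phi> v y \<partial>distr M S Y) = expectation (\<lambda>\<omega>. \<Phi> v (Y \<omega>))" for v
    using measurable_Pair2[OF \<Phi>, of v] by (intro integral_distr[OF rv(2)]) simp
  have m: "(\<lambda>v. expectation (\<lambda>\<omega>. \<Phi> v (Y \<omega>))) \<in> borel_measurable borel"
  proof -
    have "borel_measurable (borel \<Otimes>\<^sub>M distr M S Y) = (borel_measurable (borel \<Otimes>\<^sub>M S) :: (real \<times> 'c \<Rightarrow> real) set)"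
      by (intro measurable_cong_sets sets_pair_measure_cong) auto
    then show ?thesis
      unfolding inner[symmetric] using \<Phi> by (intro dY.borel_measurable_lebesgue_integral) auto
  qed
  have "expectation (\<lambda>\<omega>. \<Phi> (X \<omega>) (Y \<omega>)) = (\<integral>z. case_prod \<Phi> z \<partial>(distr M borel X \<Otimes>\<^sub>M distr M S Y))"
    unfolding prod[symmetric] by (subst integral_distr[OF pairm \<Phi>]) simp
  also have "\<dots> = (\<integral>v. (\<integral>y. \<Phi> v y \<partial>distr M S Y) \<partial>distr M borel X)"
    using P.integral_fst'[OF int'] by simp
  also have "\<dots> = (\<integral>v. f v * expectation (\<lambda>\<omega>. \<Phi> v (Y \<omega>)) \<partial>lborel)"
    unfolding inner dens using X m by (subst integral_density) auto
  finally show "expectation (\<lambda>\<omega>. \<Phi> (X \<omega>) (Y \<omega>)) = (\<integral>v. f v * expectation (\<lambda>\<omega>. \<Phi> v (Y \<omega>)) \<partial>lborel)" .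
  have "integrable (distr M borel X) (\<lambda>v. \<integral>y. \<Phi> v y \<partial>distr M S Y)"
    using P.integrable_fst'[OF int'] by simp
  then show "integrable lborel (\<lambda>v. f v * expectation (\<lambda>\<omega>. \<Phi> v (Y \<omega>)))"
    unfolding inner dens using X m by (subst (asm) integrable_density) auto
qed

lemma last_true_cases:
  fixes S :: "'i::linorder set"
  assumes "finite S"
  shows "of_bool (\<forall>m\<in>S. \<not> P m) + (\<Sum>l\<in>S. of_bool (P l \<and> (\<forall>m\<in>S. l < m \<longrightarrow> \<not> P m))) = (1::real)"
  using assms
proof (induction S rule: finite_linorder_min_induct)
  case (insert b A)
  have 1: "(\<Sum>l\<in>A. of_bool (P l \<and> (\<forall>m\<in>insert b A. l < m \<longrightarrow> \<not> P m))) =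
      (\<Sum>l\<in>A. of_bool (P l \<and> (\<forall>m\<in>A. l < m \<longrightarrow> \<not> P m)) :: real)"
    using insert.hyps by (intro sum.cong refl) (auto dest: less_asym)
  have 2: "(\<forall>m\<in>insert b A. b < m \<longrightarrow> \<not> P m) = (\<forall>m\<in>A. \<not> P m)"
    using insert.hyps by auto
  have b: "b \<notin> A" using insert.hyps by auto
  have "(\<Sum>l\<in>insert b A. of_bool (P l \<and> (\<forall>m\<in>insert b A. l < m \<longrightarrow> \<not> P m))) =
      of_bool (P b \<and> (\<forall>m\<in>A. \<not> P m)) + (\<Sum>l\<in>A. of_bool (P l \<and> (\<forall>m\<in>A. l < m \<longrightarrow> \<not> P m)) :: real)"
    unfolding sum.insert[OF insert.hyps(1) b] 1 2 by (rule refl)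
  moreover have "of_bool (\<forall>m\<in>insert b A. \<not> P m) + of_bool (P b \<and> (\<forall>m\<in>A. \<not> P m)) =
      (of_bool (\<forall>m\<in>A. \<not> P m) :: real)"
    by (cases "P b") auto
  ultimately show ?case using insert.IH by linarith
qed simp

text \<open>The heat kernels in \<open>K1_ext\<close> are the transition densities of Brownian motion with diffusion
  coefficient \<open>2\<close>; \<open>W\<close> is such a motion, of which only the values at the times in \<open>T\<close> matter. The
  independence of an increment from the family of all later ones is stated through their joint law,
  since their values have different types. The bound on the diameter of \<open>T\<close> keeps the time shifts in the
  range of the estimates for \<open>airy_shift\<close>.\<close>

locale airy_walk = prob_space N for N :: "'b measure" +
  fixes T :: "real set" and W :: "real \<Rightarrow> 'b \<Rightarrow> real" and \<xi> :: "real \<Rightarrow> real"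
  assumes finite_T: "finite T" and T_nonempty: "T \<noteq> {}"
    and T_diam: "\<And>t t'. t \<in> T \<Longrightarrow> t' \<in> T \<Longrightarrow> \<bar>t' - t\<bar> \<le> 1 / 4"
    and W_measurable[measurable]: "\<And>t. t \<in> T \<Longrightarrow> W t \<in> borel_measurable N"
    and W_density: "\<And>t l. t \<in> T \<Longrightarrow> l \<in> T \<Longrightarrow> t < l \<Longrightarrow>
      distributed N lborel (\<lambda>\<omega>. W l \<omega> - W t \<omega>) (\<lambda>x. ennreal (normal_density 0 (sqrt (2 * (l - t))) x))"
    and W_indep: "\<And>t l. t \<in> T \<Longrightarrow> l \<in> T \<Longrightarrow> t < l \<Longrightarrow>
      distr N (borel \<Otimes>\<^sub>M (\<Pi>\<^sub>M m\<in>{m\<in>T. l < m}. borel))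
        (\<lambda>\<omega>. (W l \<omega> - W t \<omega>, \<lambda>m\<in>{m\<in>T. l < m}. W m \<omega> - W l \<omega>)) =
      distr N borel (\<lambda>\<omega>. W l \<omega> - W t \<omega>) \<Otimes>\<^sub>M
        distr N (\<Pi>\<^sub>M m\<in>{m\<in>T. l < m}. borel) (\<lambda>\<omega>. \<lambda>m\<in>{m\<in>T. l < m}. W m \<omega> - W l \<omega>)"
begin

definition last_time :: real where "last_time = Max T"

lemma last_time: "last_time \<in> T" "\<And>t. t \<in> T \<Longrightarrow> t \<le> last_time"
  using finite_T T_nonempty by (auto simp: last_time_def)

definition stays :: "real \<Rightarrow> real \<Rightarrow> 'b \<Rightarrow> bool" where
  "stays t x \<omega> \<longleftrightarrow> (\<forall>m\<in>T. t < m \<longrightarrow> x + (W m \<omega> - W t \<omega>) \<le> \<xi> m)"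

text \<open>What is left of row \<open>t\<close> of the kernel after the heat kernels have been removed: the walk
  carries \<open>airy_shift\<close> from time \<open>t\<close> to the last time, but only along paths below the levels.\<close>

definition reduced :: "real \<Rightarrow> real \<Rightarrow> real \<Rightarrow> real \<Rightarrow> real" where
  "reduced t t' x y = expectation (\<lambda>\<omega>.
     airy_shift (t' - last_time) (x + (W last_time \<omega> - W t \<omega>) + y) * of_bool (stays t x \<omega>))"

lemma stays_pred[measurable (raw)]:
  assumes t: "t \<in> T" and [measurable]: "f \<in> borel_measurable M" "g \<in> measurable M N"
  shows "Measurable.pred M (\<lambda>z. stays t (f z) (g z))"
  unfolding stays_def
proof (intro pred_intros_finite finite_T)
  fix m assume m: "m \<in> T"
  note [measurable] = W_measurable[OF m] W_measurable[OF t]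
  show "Measurable.pred M (\<lambda>z. t < m \<longrightarrow> f z + (W m (g z) - W t (g z)) \<le> \<xi> m)"
    by measurable
qed

lemma W_diff_measurable:
  assumes "t \<in> T" "l \<in> T"
  shows "(\<lambda>\<omega>. W l \<omega> - W t \<omega>) \<in> borel_measurable N"
  using W_measurable[OF assms(1)] W_measurable[OF assms(2)] by measurable

lemma W_exp_integrable:
  assumes "t \<in> T" "l \<in> T" "t \<le> l"
  shows "integrable N (\<lambda>\<omega>. exp (- (W l \<omega> - W t \<omega>)))"
    and "expectation (\<lambda>\<omega>. exp (- (W l \<omega> - W t \<omega>))) = exp (l - t)"
proof -
  have "integrable N (\<lambda>\<omega>. exp (- (W l \<omega> - W t \<omega>))) \<and>
      expectation (\<lambda>\<omega>. exp (- (W l \<omega> - W t \<omega>))) = exp (l - t)"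
  proof (cases "t = l")
    case False
    then have tl: "t < l" using assms by simp
    note d = W_density[OF assms(1,2) tl]
    have s: "0 < sqrt (2 * (l - t))" using tl by simp
    have "integrable N (\<lambda>\<omega>. exp (- (W l \<omega> - W t \<omega>)))"
      using normal_density_exp_integrable[OF s, of 0 "-1"]
      by (subst distributed_integrable[OF d, symmetric]) auto
    moreover have "expectation (\<lambda>\<omega>. exp (- (W l \<omega> - W t \<omega>))) = exp (l - t)"
      using normal_density_exp_integral[OF s, of 0 "-1"] tl
      by (subst distributed_integral[OF d, symmetric]) auto
    ultimately show ?thesis by simp
  qed (simp add: prob_space)
  then show "integrable N (\<lambda>\<omega>. exp (- (W l \<omega> - W t \<omega>)))"
    "expectation (\<lambda>\<omega>. exp (- (W l \<omega> - W t \<omega>))) = exp (l - t)" by auto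
qed

lemma airy_walk_integrable:
  assumes t: "t \<in> T" and t': "t' \<in> T" and l: "l \<in> T" "t \<le> l"
    and P: "Measurable.pred N P"
  shows "integrable N (\<lambda>\<omega>. airy_shift (t' - last_time) (x + (W l \<omega> - W t \<omega>) + y) * of_bool (P \<omega>))"
proof (rule Bochner_Integration.integrable_bound)
  show "integrable N (\<lambda>\<omega>. airy_const * exp (- (x + y)) * exp (- (W l \<omega> - W t \<omega>)))"
    by (intro integrable_mult_right W_exp_integrable t l)
  note [measurable] = W_measurable[OF t] W_measurable[OF l(1)] P
  show "(\<lambda>\<omega>. airy_shift (t' - last_time) (x + (W l \<omega> - W t \<omega>) + y) * of_bool (P \<omega>)) \<in> borel_measurable N"
    unfolding of_bool_def by measurable
  have d: "\<bar>t' - last_time\<bar> \<le> 1 / 2" using T_diam[OF last_time(1) t'] by linarith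
  show "AE \<omega> in N. norm (airy_shift (t' - last_time) (x + (W l \<omega> - W t \<omega>) + y) * of_bool (P \<omega>))
      \<le> norm (airy_const * exp (- (x + y)) * exp (- (W l \<omega> - W t \<omega>)))"
  proof (rule AE_I2)
    fix \<omega>
    have "\<bar>airy_shift (t' - last_time) (x + (W l \<omega> - W t \<omega>) + y)\<bar> \<le>
        airy_const * exp (- (x + (W l \<omega> - W t \<omega>) + y))"
      by (rule airy_shift_bound[OF d])
    also have "\<dots> = airy_const * exp (- (x + y)) * exp (- (W l \<omega> - W t \<omega>))"
      by (simp add: mult_exp_exp)
    finally show "norm (airy_shift (t' - last_time) (x + (W l \<omega> - W t \<omega>) + y) * of_bool (P \<omega>))
        \<le> norm (airy_const * exp (- (x + y)) * exp (- (W l \<omega> - W t \<omega>)))"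
      using airy_const_nonneg by (simp add: abs_mult)
  qed
qed

lemma reduced_bound:
  assumes t: "t \<in> T" and t': "t' \<in> T"
  shows "\<bar>reduced t t' x y\<bar> \<le> 2 * airy_const * exp (- x) * exp (- y)"
proof -
  have d: "\<bar>t' - last_time\<bar> \<le> 1 / 2" using T_diam[OF last_time(1) t'] by linarith
  have "\<bar>reduced t t' x y\<bar> \<le> expectation (\<lambda>\<omega>. airy_const * exp (- (x + y)) * exp (- (W last_time \<omega> - W t \<omega>)))"
    unfolding reduced_def
  proof (rule integral_abs_le)
    show "integrable N (\<lambda>\<omega>. airy_const * exp (- (x + y)) * exp (- (W last_time \<omega> - W t \<omega>)))"
      by (intro integrable_mult_right W_exp_integrable t last_time)
    fix \<omega>
    have "\<bar>airy_shift (t' - last_time) (x + (W last_time \<omega> - W t \<omega>) + y) * of_bool (stays t x \<omega>)\<bar> \<le>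
        \<bar>airy_shift (t' - last_time) (x + (W last_time \<omega> - W t \<omega>) + y)\<bar>"
      by (simp add: abs_mult)
    also have "\<dots> \<le> airy_const * exp (- (x + (W last_time \<omega> - W t \<omega>) + y))"
      by (rule airy_shift_bound[OF d])
    also have "\<dots> = airy_const * exp (- (x + y)) * exp (- (W last_time \<omega> - W t \<omega>))"
      by (simp add: mult_exp_exp)
    finally show "\<bar>airy_shift (t' - last_time) (x + (W last_time \<omega> - W t \<omega>) + y) * of_bool (stays t x \<omega>)\<bar> \<le>
      airy_const * exp (- (x + y)) * exp (- (W last_time \<omega> - W t \<omega>))" .
  qed
  also have "\<dots> = airy_const * exp (- (x + y)) * exp (last_time - t)"
    using W_exp_integrable[OF t last_time(1) last_time(2)[OF t]] by simp
  also have "\<dots> \<le> airy_const * exp (- (x + y)) * 2"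
  proof (intro mult_left_mono mult_nonneg_nonneg airy_const_nonneg)
    have "exp (last_time - t) \<le> exp (1 / 2)"
    using T_diam[OF t last_time(1)] by (simp, linarith)
    also have "exp (1 / 2) \<le> (2::real)" using exp_bound_half[of "1 / 2 :: real"] by simp
    finally show "exp (last_time - t) \<le> 2" .
  qed simp
  also have "exp (- (x + y)) = exp (- x) * exp (- y)" by (simp add: mult_exp_exp)
  finally show ?thesis by (simp add: mult_ac)
qed

lemma reduced_measurable:
  assumes t: "t \<in> T" and [measurable]: "f \<in> borel_measurable M" "g \<in> borel_measurable M"
  shows "(\<lambda>z. reduced t t' (f z) (g z)) \<in> borel_measurable M"
  unfolding reduced_def
proof (rule borel_measurable_lebesgue_integral)
  note [measurable] = W_measurable[OF t] W_measurable[OF last_time(1)] stays_pred[OF t]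
  show "(\<lambda>(z, \<omega>). airy_shift (t' - last_time) (f z + (W last_time \<omega> - W t \<omega>) + g z) *
      of_bool (stays t (f z) \<omega>)) \<in> borel_measurable (M \<Otimes>\<^sub>M N)"
    unfolding of_bool_def by measurable
qed

text \<open>Decomposing at the last time at which the walk exceeds its level expresses the smooth
  kernel, which is preserved by the walk, through the reduced kernels of all later times.\<close>

lemma last_exceedance:
  assumes t: "t \<in> T" and t': "t' \<in> T"
  shows "airy_shift (t' - t) (x + y) = reduced t t' x y +
      (\<Sum>l | l \<in> T \<and> t < l. \<integral>u. normal_density x (sqrt (2 * (l - t))) u *
        (indicator {\<xi> l<..} u * reduced l t' u y) \<partial>lborel)"
    and "\<And>l. l \<in> T \<Longrightarrow> t < l \<Longrightarrow> integrable lborel (\<lambda>u. normal_density x (sqrt (2 * (l - t))) u *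
        (indicator {\<xi> l<..} u * reduced l t' u y))"
proof -
  define \<delta> where "\<delta> = t' - last_time"
  define S where "S = {l\<in>T. t < l}"
  define A where "A \<omega> = airy_shift \<delta> (x + (W last_time \<omega> - W t \<omega>) + y)" for \<omega>
  define above where "above l \<omega> \<longleftrightarrow> \<xi> l < x + (W l \<omega> - W t \<omega>)" for l \<omega>
  define lst where "lst l \<omega> \<longleftrightarrow> above l \<omega> \<and> (\<forall>m\<in>S. l < m \<longrightarrow> \<not> above m \<omega>)" for l \<omega>
  have \<delta>: "\<bar>\<delta>\<bar> \<le> 1 / 4" using T_diam[OF last_time(1) t'] by (simp add: \<delta>_def)
  have finS: "finite S" using finite_T by (simp add: S_def)
  have above_pred: "Measurable.pred N (above l)" if "l \<in> T" for l
    unfolding above_def using W_measurable[OF that] W_measurable[OF t] by measurable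
  have lst_pred: "Measurable.pred N (lst l)" if "l \<in> S" for l
    unfolding lst_def using above_pred that finS
    by (intro pred_intros_logic pred_intros_finite) (auto simp: S_def)
  have A_int: "integrable N (\<lambda>\<omega>. A \<omega> * of_bool (P \<omega>))" if "Measurable.pred N P" for P
    unfolding A_def \<delta>_def using airy_walk_integrable[OF t t' last_time(1) last_time(2)[OF t] that] .
  \<comment> \<open>By \<open>airy_shift_heat\<close> the smooth part is a martingale along the walk.\<close>
  have caloric: "expectation A = airy_shift (t' - t) (x + y)"
  proof (cases "t = last_time")
    case True
    then have "A = (\<lambda>_. airy_shift (t' - t) (x + y))" by (simp add: A_def \<delta>_def fun_eq_iff)
    then show ?thesis by (simp add: prob_space)
  next
    case False
    then have tl: "t < last_time" using last_time(2)[OF t] by simp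
    have "expectation A = (\<integral>v. normal_density 0 (sqrt (2 * (last_time - t))) v * airy_shift \<delta> (x + v + y) \<partial>lborel)"
      unfolding A_def by (subst distributed_integral[OF W_density[OF t last_time(1) tl], symmetric]) auto
    also have "\<dots> = (\<integral>u. normal_density x (sqrt (2 * (last_time - t))) u * airy_shift \<delta> (u + y) \<partial>lborel)"
      by (subst (2) lborel_integral_real_affine[of 1 _ x]) (auto simp: normal_density_def)
    also have "\<dots> = airy_shift (t' - t) (x + y)"
    proof -
      have "- 1 < \<delta>" using \<delta> by linarith
      then show ?thesis using airy_shift_heat[of "last_time - t" \<delta> x y] tl by (simp add: \<delta>_def)
    qed
    finally show ?thesis .
  qed
  have none: "expectation (\<lambda>\<omega>. A \<omega> * of_bool (\<forall>m\<in>S. \<not> above m \<omega>)) = reduced t t' x y"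
    unfolding reduced_def A_def \<delta>_def stays_def S_def above_def
    by (intro Bochner_Integration.integral_cong refl arg_cong2[of _ _ _ _ "(*)"] arg_cong[of _ _ of_bool])
      (auto simp: not_less)
  have last_l: "expectation (\<lambda>\<omega>. A \<omega> * of_bool (lst l \<omega>)) =
      (\<integral>u. normal_density x (sqrt (2 * (l - t))) u * (indicator {\<xi> l<..} u * reduced l t' u y) \<partial>lborel)
    \<and> integrable lborel (\<lambda>u. normal_density x (sqrt (2 * (l - t))) u * (indicator {\<xi> l<..} u * reduced l t' u y))"
    if l: "l \<in> S" for l
  proof -
    have lT: "l \<in> T" and tl: "t < l" using l by (auto simp: S_def)
    define J where "J = {m\<in>T. l < m}"
    define Y where "Y \<omega> = (\<lambda>m\<in>J. W m \<omega> - W l \<omega>)" for \<omega>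
    define X where "X \<omega> = W l \<omega> - W t \<omega>" for \<omega>
    define \<Phi> where "\<Phi> v f = airy_shift \<delta> (x + v + (if last_time = l then 0 else f last_time) + y) *
      of_bool (\<xi> l < x + v \<and> (\<forall>m\<in>J. x + v + f m \<le> \<xi> m))" for v and f :: "real \<Rightarrow> real"
    have finJ: "finite J" using finite_T by (simp add: J_def)
    have lastJ: "last_time \<in> J" if "last_time \<noteq> l"
      using that last_time lT by (auto simp: J_def less_le)
    have comp: "(\<lambda>f. f m) \<in> borel_measurable (\<Pi>\<^sub>M m\<in>J. borel :: real measure)" if "m \<in> J" for m
      using that by (rule measurable_component_singleton)
    have comp': "(\<lambda>z. snd z m) \<in> borel_measurable (borel \<Otimes>\<^sub>M (\<Pi>\<^sub>M m\<in>J. borel :: real measure))"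
      if "m \<in> J" for m
      using measurable_compose[OF measurable_snd comp[OF that]] .
    have \<Phi>m: "case_prod \<Phi> \<in> borel_measurable (borel \<Otimes>\<^sub>M (\<Pi>\<^sub>M m\<in>J. borel))"
    proof -
      have 1: "(\<lambda>z. (if last_time = l then 0 else snd z last_time)) \<in>
          borel_measurable (borel \<Otimes>\<^sub>M (\<Pi>\<^sub>M m\<in>J. borel :: real measure))"
        using comp'[OF lastJ] by (cases "last_time = l") auto
      have 2: "Measurable.pred (borel \<Otimes>\<^sub>M (\<Pi>\<^sub>M m\<in>J. borel)) (\<lambda>z. \<forall>m\<in>J. x + fst z + snd z m \<le> \<xi> m)"
      proof (intro pred_intros_finite finJ)
        fix m assume "m \<in> J"
        note [measurable] = comp'[OF this]
        show "Measurable.pred (borel \<Otimes>\<^sub>M (\<Pi>\<^sub>M m\<in>J. borel)) (\<lambda>z. x + fst z + snd z m \<le> \<xi> m)"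
          by measurable
      qed
      note [measurable] = 1 2
      show ?thesis unfolding \<Phi>_def case_prod_beta of_bool_def by measurable
    qed
    have eq: "A \<omega> * of_bool (lst l \<omega>) = \<Phi> (X \<omega>) (Y \<omega>)" for \<omega>
    proof -
      have "(\<forall>m\<in>S. l < m \<longrightarrow> \<not> above m \<omega>) = (\<forall>m\<in>J. x + X \<omega> + Y \<omega> m \<le> \<xi> m)"
        using tl by (auto simp: S_def J_def above_def X_def Y_def not_less)
      moreover have "above l \<omega> = (\<xi> l < x + X \<omega>)" by (simp add: above_def X_def)
      moreover have "x + X \<omega> + (if last_time = l then 0 else Y \<omega> last_time) = x + (W last_time \<omega> - W t \<omega>)"
        using lastJ by (auto simp: X_def Y_def)
      ultimately show ?thesis by (simp only: \<Phi>_def lst_def A_def)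
    qed
    have rvX: "X \<in> borel_measurable N" unfolding X_def[abs_def] by (rule W_diff_measurable[OF t lT])
    have rvY: "Y \<in> measurable N (\<Pi>\<^sub>M m\<in>J. borel)"
      unfolding Y_def[abs_def] using W_diff_measurable[OF lT] by (intro measurable_restrict) (auto simp: J_def)
    have ind: "distr N (borel \<Otimes>\<^sub>M (\<Pi>\<^sub>M m\<in>J. borel)) (\<lambda>\<omega>. (X \<omega>, Y \<omega>)) =
        distr N borel X \<Otimes>\<^sub>M distr N (\<Pi>\<^sub>M m\<in>J. borel) Y"
      using W_indep[OF t lT tl] unfolding X_def[abs_def] Y_def[abs_def] J_def .
    have inner: "expectation (\<lambda>\<omega>. \<Phi> v (Y \<omega>)) = indicator {\<xi> l<..} (x + v) * reduced l t' (x + v) y" for v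
    proof -
      have "\<Phi> v (Y \<omega>) = indicator {\<xi> l<..} (x + v) *
          (airy_shift (t' - last_time) (x + v + (W last_time \<omega> - W l \<omega>) + y) * of_bool (stays l (x + v) \<omega>))" for \<omega>
      proof -
        have "(\<forall>m\<in>J. x + v + Y \<omega> m \<le> \<xi> m) = stays l (x + v) \<omega>"
          by (auto simp: stays_def J_def Y_def)
        moreover have "(if last_time = l then 0 else Y \<omega> last_time) = W last_time \<omega> - W l \<omega>"
          using lastJ by (auto simp: Y_def)
        ultimately show ?thesis by (auto simp: \<Phi>_def \<delta>_def indicator_def)
      qed
      then show ?thesis unfolding reduced_def by simp
    qed
    have intg: "integrable N (\<lambda>\<omega>. \<Phi> (X \<omega>) (Y \<omega>))"
      unfolding eq[symmetric] by (rule A_int[OF lst_pred[OF l]])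
    have dX: "distributed N lborel X (\<lambda>x. ennreal (normal_density 0 (sqrt (2 * (l - t))) x))"
      using W_density[OF t lT tl] unfolding X_def[abs_def] .
    note res = indep_density_expectation[where \<Phi> = \<Phi> and X = X and Y = Y and
        f = "normal_density 0 (sqrt (2 * (l - t)))" and S = "\<Pi>\<^sub>M m\<in>J. borel", OF rvX rvY ind dX normal_density_nonneg
        borel_measurable_normal_density \<Phi>m intg, unfolded inner]
    have shift: "normal_density 0 s v = normal_density x s (x + 1 * v)" for s v
      by (simp add: normal_density_def)
    have 1: "expectation (\<lambda>\<omega>. A \<omega> * of_bool (lst l \<omega>)) = (\<integral>v. normal_density x (sqrt (2 * (l - t))) (x + 1 * v) *
        (indicator {\<xi> l<..} (x + 1 * v) * reduced l t' (x + 1 * v) y) \<partial>lborel)"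
      unfolding eq using res(1) by (simp add: shift)
    have 2: "integrable lborel (\<lambda>v. normal_density x (sqrt (2 * (l - t))) (x + 1 * v) *
        (indicator {\<xi> l<..} (x + 1 * v) * reduced l t' (x + 1 * v) y))"
      using res(2) by (simp add: shift)
    show ?thesis
      using 1 2 lborel_integral_real_affine[of 1 "\<lambda>u. normal_density x (sqrt (2 * (l - t))) u *
          (indicator {\<xi> l<..} u * reduced l t' u y)" x]
        lborel_integrable_real_affine_iff[of 1 "\<lambda>u. normal_density x (sqrt (2 * (l - t))) u *
          (indicator {\<xi> l<..} u * reduced l t' u y)" x]
      by simp
  qed
  have split: "A \<omega> = A \<omega> * of_bool (\<forall>m\<in>S. \<not> above m \<omega>) + (\<Sum>l\<in>S. A \<omega> * of_bool (lst l \<omega>))" for \<omega>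
  proof -
    have "A \<omega> * 1 = A \<omega> * (of_bool (\<forall>m\<in>S. \<not> above m \<omega>) + (\<Sum>l\<in>S. of_bool (lst l \<omega>)))"
      unfolding lst_def last_true_cases[OF finS, of "\<lambda>m. above m \<omega>"] ..
    then show ?thesis by (simp only: distrib_left sum_distrib_left mult_1_right)
  qed
  have "expectation A = expectation (\<lambda>\<omega>. A \<omega> * of_bool (\<forall>m\<in>S. \<not> above m \<omega>) +
      (\<Sum>l\<in>S. A \<omega> * of_bool (lst l \<omega>)))"
    by (rule Bochner_Integration.integral_cong[OF refl split])
  also have "\<dots> = reduced t t' x y + (\<Sum>l\<in>S. expectation (\<lambda>\<omega>. A \<omega> * of_bool (lst l \<omega>)))"
  proof -
    have "Measurable.pred N (\<lambda>\<omega>. \<forall>m\<in>S. \<not> above m \<omega>)"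
      using above_pred finS by (intro pred_intros_logic pred_intros_finite) (auto simp: S_def)
    then show ?thesis
      unfolding none[symmetric] using lst_pred A_int
      by (subst Bochner_Integration.integral_add)
        (auto intro!: Bochner_Integration.integrable_sum Bochner_Integration.integral_sum)
  qed
  finally show "airy_shift (t' - t) (x + y) = reduced t t' x y +
      (\<Sum>l | l \<in> T \<and> t < l. \<integral>u. normal_density x (sqrt (2 * (l - t))) u *
        (indicator {\<xi> l<..} u * reduced l t' u y) \<partial>lborel)"
    unfolding caloric using last_l by (simp add: S_def)
  show "\<And>l. l \<in> T \<Longrightarrow> t < l \<Longrightarrow> integrable lborel (\<lambda>u. normal_density x (sqrt (2 * (l - t))) u *
        (indicator {\<xi> l<..} u * reduced l t' u y))"
    using last_l by (auto simp: S_def)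
qed

end

section \<open>Elimination as a row operation\<close>

lemma K1_ext_eq:
  "K1_ext (t, x) (t', y) = airy_shift (t' - t) (x + y) -
     (if t < t' then normal_density x (sqrt (2 * (t' - t))) y else 0)"
proof -
  have "1 / sqrt (4 * pi * (t' - t)) * exp (- ((y - x)\<^sup>2 / (4 * (t' - t)))) =
      normal_density x (sqrt (2 * (t' - t))) y" if "t < t'"
  proof -
    have "(sqrt (2 * (t' - t)))\<^sup>2 = 2 * (t' - t)" using that by simp
    then show ?thesis unfolding normal_density_def by (simp add: mult.assoc mult.left_commute)
  qed
  then show ?thesis by (simp add: K1_ext_def airy_shift_def)
qed

lemma pair_sigma_finite_count: "finite T \<Longrightarrow> pair_sigma_finite (count_space T) (lborel :: real measure)"
  by (intro pair_sigma_finite.intro sigma_finite_measure_count_space_finite sigma_finite_lborel)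

lemma count_pair_sigma_finite: "finite T \<Longrightarrow> sigma_finite_measure (count_space T \<Otimes>\<^sub>M (lborel :: real measure))"
proof -
  assume "finite T"
  then interpret pair_sigma_finite "count_space T" "lborel :: real measure" by (rule pair_sigma_finite_count)
  show ?thesis by (rule sigma_finite_measure_axioms)
qed

lemma count_pair_measurable:
  assumes "finite T" "\<And>t. t \<in> T \<Longrightarrow> f t \<in> borel_measurable borel"
  shows "(\<lambda>(t, x). f t x :: real) \<in> borel_measurable (count_space T \<Otimes>\<^sub>M lborel)"
  using assms by (intro measurable_pair_measure_countable1) (auto intro: countable_finite)

lemma count_pair_integral:
  fixes g :: "'i \<Rightarrow> real \<Rightarrow> real"
  assumes T: "finite T" and g: "\<And>t. t \<in> T \<Longrightarrow> integrable lborel (g t)"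
  shows "integrable (count_space T \<Otimes>\<^sub>M lborel) (\<lambda>(t, x). g t x)"
    and "(\<integral>z. (case z of (t, x) \<Rightarrow> g t x) \<partial>(count_space T \<Otimes>\<^sub>M lborel)) = (\<Sum>t\<in>T. \<integral>x. g t x \<partial>lborel)"
proof -
  interpret pair_sigma_finite "count_space T" "lborel :: real measure" using T by (rule pair_sigma_finite_count)
  have "(\<lambda>(t, x). g t x) \<in> borel_measurable (count_space T \<Otimes>\<^sub>M lborel)"
    using T g by (intro count_pair_measurable) auto
  then show int: "integrable (count_space T \<Otimes>\<^sub>M lborel) (\<lambda>(t, x). g t x)"
    using T g by (intro Fubini_integrable) (auto intro!: integrable_count_space simp: AE_count_space)
  show "(\<integral>z. (case z of (t, x) \<Rightarrow> g t x) \<partial>(count_space T \<Otimes>\<^sub>M lborel)) = (\<Sum>t\<in>T. \<integral>x. g t x \<partial>lborel)"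
    using integral_fst'[OF int] T by (simp add: lebesgue_integral_count_space_finite)
qed

lemma count_pair_kernel_measurable:
  fixes f :: "'i \<Rightarrow> 'i \<Rightarrow> real \<Rightarrow> real \<Rightarrow> real"
  assumes T: "finite T"
    and f: "\<And>t t'. t \<in> T \<Longrightarrow> t' \<in> T \<Longrightarrow> (\<lambda>(x, y). f t t' x y) \<in> borel_measurable (borel \<Otimes>\<^sub>M borel)"
  shows "case_prod (\<lambda>(t, x) (t', y). f t t' x y) \<in>
    borel_measurable ((count_space T \<Otimes>\<^sub>M lborel) \<Otimes>\<^sub>M (count_space T \<Otimes>\<^sub>M lborel))" (is "_ \<in> borel_measurable ?M")
proof -
  have "(\<lambda>(z, z'). \<Sum>t\<in>T. \<Sum>t'\<in>T. indicator {t} (fst z) * indicator {t'} (fst z') * f t t' (snd z) (snd z')) \<in>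
      borel_measurable ?M"
    unfolding case_prod_beta
  proof (intro borel_measurable_sum borel_measurable_times)
    fix t t' assume t: "t \<in> T" and t': "t' \<in> T"
    have 1: "(\<lambda>z. fst (fst z)) \<in> measurable ?M (count_space T)"
      "(\<lambda>z. fst (snd z)) \<in> measurable ?M (count_space T)" by measurable
    show "(\<lambda>z. indicator {t} (fst (fst z)) :: real) \<in> borel_measurable ?M"
      using measurable_compose[OF 1(1), of "indicator {t}" borel] by (simp add: comp_def)
    show "(\<lambda>z. indicator {t'} (fst (snd z)) :: real) \<in> borel_measurable ?M"
      using measurable_compose[OF 1(2), of "indicator {t'}" borel] by (simp add: comp_def)
    have 2: "(\<lambda>z. (snd (fst z), snd (snd z))) \<in> measurable ?M (borel \<Otimes>\<^sub>M borel)"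
      by measurable
    from measurable_compose[OF 2 f[OF t t']]
    show "(\<lambda>z. f t t' (snd (fst z)) (snd (snd z))) \<in> borel_measurable ?M" by simp
  qed
  then show ?thesis
  proof (rule measurable_cong[THEN iffD1, rotated])
    fix w assume w: "w \<in> space ?M"
    obtain t x t' y where weq: "w = ((t, x), (t', y))" by (metis prod.collapse)
    have t: "t \<in> T" "t' \<in> T" using w by (auto simp: weq space_pair_measure)
    have "(\<Sum>s\<in>T. \<Sum>s'\<in>T. indicator {s} t * indicator {s'} t' * f s s' x y) =
        (\<Sum>s\<in>T. if s = t then (\<Sum>s'\<in>T. if s' = t' then f t t' x y else 0) else 0)"
      by (intro sum.cong refl) (auto simp: indicator_def intro!: sum.cong)
    also have "\<dots> = f t t' x y" using t T by simp
    finally show "(case w of (z, z') \<Rightarrow> \<Sum>t\<in>T. \<Sum>t'\<in>T. indicator {t} (fst z) * indicator {t'} (fst z') *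
        f t t' (snd z) (snd z')) = (case w of (z, z') \<Rightarrow> (\<lambda>(t, x) (t', y). f t t' x y) z z')"
      by (simp add: weq)
  qed
qed

lemma heat_kernel_bound:
  assumes \<sigma>: "0 < \<sigma>" and y: "- R \<le> y" and R: "0 \<le> R" and ab: "0 \<le> \<alpha>" "\<alpha> \<le> \<beta>" "\<beta> \<le> 1"
  shows "normal_density x \<sigma> y \<le>
    (1 / sqrt (2 * pi * \<sigma>\<^sup>2) * exp (\<sigma>\<^sup>2 / 2) * exp R) * (exp (- (\<alpha> * x)) * exp (\<beta> * y))"
proof -
  define v where "v = y - x"
  have "0 \<le> (\<bar>v\<bar> / \<sigma> - \<sigma>)\<^sup>2" by simp
  also have "\<dots> = v\<^sup>2 / \<sigma>\<^sup>2 - 2 * \<bar>v\<bar> + \<sigma>\<^sup>2"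
    using \<sigma> by (simp add: power2_diff power_divide)
  finally have 1: "- (v\<^sup>2 / (2 * \<sigma>\<^sup>2)) \<le> \<sigma>\<^sup>2 / 2 - \<bar>v\<bar>" by (simp add: field_simps)
  have "\<alpha> * \<bar>v\<bar> \<le> 1 * \<bar>v\<bar>" using ab by (intro mult_right_mono) auto
  then have "\<alpha> * v \<ge> - \<bar>v\<bar>" using abs_ge_minus_self[of "\<alpha> * v"] ab by (simp add: abs_mult)
  moreover have "(\<beta> - \<alpha>) * y \<ge> - R"
  proof -
    have "(\<beta> - \<alpha>) * y \<ge> (\<beta> - \<alpha>) * (- R)" using ab y by (intro mult_left_mono) auto
    moreover have "(\<beta> - \<alpha>) * R \<le> 1 * R" using ab R by (intro mult_right_mono) auto
    ultimately show ?thesis by simp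
  qed
  ultimately have "- (\<alpha> * x) + \<beta> * y \<ge> - \<bar>v\<bar> - R" by (simp add: v_def algebra_simps)
  with 1 have "- ((y - x)\<^sup>2) / (2 * \<sigma>\<^sup>2) \<le> \<sigma>\<^sup>2 / 2 + R + (- (\<alpha> * x) + \<beta> * y)"
    by (simp add: v_def)
  then have "exp (- ((y - x)\<^sup>2) / (2 * \<sigma>\<^sup>2)) \<le> exp (\<sigma>\<^sup>2 / 2) * exp R * (exp (- (\<alpha> * x)) * exp (\<beta> * y))"
    unfolding exp_add[symmetric] by (simp only: exp_le_cancel_iff)
  then show ?thesis
    unfolding normal_density_def mult.assoc by (intro mult_left_mono) (auto simp: mult.assoc)
qed

lemma exp_weight_bound:
  fixes x y R :: real
  assumes "- R \<le> x" "- R \<le> y" "0 \<le> R" "0 \<le> \<alpha>" "\<alpha> \<le> 1" "0 \<le> \<beta>" "\<beta> \<le> 1"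
  shows "exp (- x) * exp (- y) \<le> exp (3 * R) * (exp (- (\<alpha> * x)) * exp (\<beta> * y))"
proof -
  have "(1 - \<alpha>) * (- x) \<le> 1 * R"
    using assms by (intro order.trans[OF mult_left_mono[of "- x" R]] mult_right_mono) auto
  moreover have "(1 + \<beta>) * (- y) \<le> 2 * R"
    using assms by (intro order.trans[OF mult_left_mono[of "- y" R]] mult_right_mono) auto
  ultimately have "- x + - y \<le> 3 * R + (- (\<alpha> * x) + \<beta> * y)" by (simp add: algebra_simps)
  then show ?thesis unfolding exp_add[symmetric] by (simp only: exp_le_cancel_iff)
qed

lemma integrable_exp_half_line:
  assumes c: "0 < c"
  shows "integrable lborel (\<lambda>x::real. exp (- (c * x)) * indicator {\<xi><..} x)"
proof (rule Bochner_Integration.integrable_bound)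
  have "(\<integral>\<^sup>+x. ennreal (exp (- (c * x))) * indicator {\<xi>..} x \<partial>lborel) = 0 - (- exp (- (c * \<xi>)) / c)"
  proof (rule nn_integral_FTC_atLeast)
    show "\<And>x. \<xi> \<le> x \<Longrightarrow> DERIV (\<lambda>x. - exp (- (c * x)) / c) x :> exp (- (c * x))"
      using c by (auto intro!: derivative_eq_intros)
    show "((\<lambda>x. - exp (- (c * x)) / c) \<longlongrightarrow> 0) at_top" using c by real_asymp
  qed auto
  then have "(\<integral>\<^sup>+x. ennreal (exp (- (c * x)) * indicator {\<xi>..} x) \<partial>lborel) < \<infinity>"
    by (simp add: ennreal_mult' ennreal_indicator)
  then show "integrable lborel (\<lambda>x::real. exp (- (c * x)) * indicator {\<xi>..} x)"
    by (intro integrableI_nonneg) auto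
qed (auto simp: indicator_def)

context airy_walk
begin

definition chi :: "real \<Rightarrow> real \<Rightarrow> real" where
  "chi t x = indicator {\<xi> t<..} x"

lemma chi_simps[simp]: "0 \<le> chi t x" "chi t x * chi t x = chi t x" "\<bar>chi t x\<bar> = chi t x"
  by (auto simp: chi_def indicator_def)

lemma chi_measurable[measurable]: "chi t \<in> borel_measurable borel"
  unfolding chi_def[abs_def] by measurable

text \<open>Interpolates between the kernel of the process, for \<open>A = {}\<close>, and a kernel without heat kernels,
  for \<open>A = T\<close>.\<close>

definition elim_kernel :: "real set \<Rightarrow> real \<times> real \<Rightarrow> real \<times> real \<Rightarrow> real" where
  "elim_kernel A = (\<lambda>(t, x) (t', y).
     chi t x * (if t \<in> A then reduced t t' x y else K1_ext (t, x) (t', y)) * chi t' y)"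

definition heat_row :: "real \<Rightarrow> real \<times> real \<Rightarrow> real \<times> real \<Rightarrow> real" where
  "heat_row b = (\<lambda>(t, x) (t', y).
     if t = b \<and> t < t' then - (chi t x * normal_density x (sqrt (2 * (t' - t))) y * chi t' y) else 0)"

text \<open>Exponential weights that dominate all these kernels.  The weight exponents increase with
  time, since the heat kernel from \<open>t\<close> to \<open>l > t\<close> is bounded but does not decay along the
  diagonal.\<close>

definition col_weight :: "real \<Rightarrow> real" where
  "col_weight t = real (card {l\<in>T. l < t}) / real (card T)"

definition row_weight :: "real \<Rightarrow> real" where
  "row_weight t = col_weight t + 1 / real (card T)"

lemma card_T_pos: "0 < card T"
  using finite_T T_nonempty by (simp add: card_gt_0_iff)

lemma weights:
  assumes t: "t \<in> T"
  shows "0 \<le> col_weight t" "col_weight t \<le> 1" "0 \<le> row_weight t" "row_weight t \<le> 1"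
    and "\<And>l. l \<in> T \<Longrightarrow> t < l \<Longrightarrow> row_weight t \<le> col_weight l"
proof -
  have 1: "card {l\<in>T. l < t} + 1 \<le> card T"
  proof -
    have "card (insert t {l\<in>T. l < t}) \<le> card T" using finite_T t by (intro card_mono) auto
    then show ?thesis using finite_T by simp
  qed
  have eq: "row_weight t = real (card {l\<in>T. l < t} + 1) / real (card T)"
    by (simp add: row_weight_def col_weight_def add_divide_distrib)
  show "0 \<le> col_weight t" "0 \<le> row_weight t"
    by (auto simp: col_weight_def row_weight_def)
  show r1: "row_weight t \<le> 1" unfolding eq using 1 card_T_pos by (simp add: field_simps)
  have "col_weight t \<le> row_weight t" by (simp add: row_weight_def)
  then show "col_weight t \<le> 1" using r1 by linarith
  show "row_weight t \<le> col_weight l" if "l \<in> T" "t < l" for l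
  proof -
    have "card (insert t {l\<in>T. l < t}) \<le> card {m\<in>T. m < l}"
      using finite_T t that by (intro card_mono) auto
    then have "card {l\<in>T. l < t} + 1 \<le> card {m\<in>T. m < l}" using finite_T by simp
    then show ?thesis unfolding eq unfolding col_weight_def
      by (intro divide_right_mono) auto
  qed
qed

lemma kernel_bounds:
  assumes R: "0 \<le> R" "\<And>t. t \<in> T \<Longrightarrow> - R \<le> \<xi> t"
  obtains D where "0 \<le> D"
    and "\<And>t t' x y. t \<in> T \<Longrightarrow> t' \<in> T \<Longrightarrow> - R \<le> x \<Longrightarrow> - R \<le> y \<Longrightarrow>
      \<bar>reduced t t' x y\<bar> \<le> D * (exp (- (row_weight t * x)) * exp (col_weight t' * y))"
    and "\<And>t t' x y. t \<in> T \<Longrightarrow> t' \<in> T \<Longrightarrow> - R \<le> x \<Longrightarrow> - R \<le> y \<Longrightarrow>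
      \<bar>airy_shift (t' - t) (x + y)\<bar> \<le> D * (exp (- (row_weight t * x)) * exp (col_weight t' * y))"
    and "\<And>t t' x y. t \<in> T \<Longrightarrow> t' \<in> T \<Longrightarrow> t < t' \<Longrightarrow> - R \<le> x \<Longrightarrow> - R \<le> y \<Longrightarrow>
      normal_density x (sqrt (2 * (t' - t))) y \<le> D * (exp (- (row_weight t * x)) * exp (col_weight t' * y))"
proof -
  define h where "h t l = (let \<sigma> = sqrt (2 * (l - t)) in
    1 / sqrt (2 * pi * \<sigma>\<^sup>2) * exp (\<sigma>\<^sup>2 / 2) * exp R)" for t l :: real
  define D1 where "D1 = 2 * airy_const * exp (3 * R)"
  define D2 where "D2 = (\<Sum>t\<in>T. \<Sum>l\<in>T. \<bar>h t l\<bar>)"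
  have D12: "0 \<le> D1" "0 \<le> D2"
    using airy_const_nonneg by (auto simp: D1_def D2_def intro!: sum_nonneg)
  have w0: "0 \<le> exp (- (row_weight t * x)) * exp (col_weight t' * y)" for t t' x y by simp
  show thesis
  proof (rule that[of "D1 + D2"])
    show "0 \<le> D1 + D2" using D12 by simp
    fix t t' x y assume t: "t \<in> T" and t': "t' \<in> T" and x: "- R \<le> x" and y: "- R \<le> y"
    let ?w = "exp (- (row_weight t * x)) * exp (col_weight t' * y)"
    have w: "exp (- x) * exp (- y) \<le> exp (3 * R) * ?w"
      by (rule exp_weight_bound[OF x y R(1)]) (use weights[OF t] weights[OF t'] in auto)
    have "2 * airy_const * (exp (- x) * exp (- y)) \<le> 2 * airy_const * (exp (3 * R) * ?w)"
      using airy_const_nonneg by (intro mult_left_mono w) auto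
    also have "\<dots> = D1 * ?w" by (simp add: D1_def)
    also have "\<dots> \<le> (D1 + D2) * ?w" using D12 by (intro mult_right_mono) auto
    finally have D: "2 * airy_const * (exp (- x) * exp (- y)) \<le> (D1 + D2) * ?w" .
    show "\<bar>reduced t t' x y\<bar> \<le> (D1 + D2) * ?w"
      using reduced_bound[OF t t', of x y] D by (simp add: mult.assoc)
    have "\<bar>airy_shift (t' - t) (x + y)\<bar> \<le> airy_const * exp (- (x + y))"
      using T_diam[OF t t'] by (intro airy_shift_bound) simp
    also have "\<dots> = airy_const * (exp (- x) * exp (- y))" by (simp add: mult_exp_exp)
    also have "\<dots> \<le> 2 * airy_const * (exp (- x) * exp (- y))"
      using airy_const_nonneg by (intro mult_right_mono) auto
    finally show "\<bar>airy_shift (t' - t) (x + y)\<bar> \<le> (D1 + D2) * ?w" using D by linarith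
    assume tt': "t < t'"
    have "normal_density x (sqrt (2 * (t' - t))) y \<le> h t t' * ?w"
      unfolding h_def Let_def
      by (rule heat_kernel_bound[OF _ y R(1)]) (use tt' weights[OF t] weights[OF t'] t' in auto)
    also have "\<dots> \<le> (D1 + D2) * ?w"
    proof (rule mult_right_mono[OF _ w0])
      have "\<bar>h t t'\<bar> \<le> (\<Sum>l\<in>T. \<bar>h t l\<bar>)"
        using finite_T t' by (intro member_le_sum[of t' T "\<lambda>l. \<bar>h t l\<bar>"]) auto
      also have "\<dots> \<le> D2" unfolding D2_def
        using finite_T t by (intro member_le_sum[of t T "\<lambda>t. \<Sum>l\<in>T. \<bar>h t l\<bar>"]) (auto intro: sum_nonneg)
      finally show "h t t' \<le> D1 + D2" using D12 by simp
    qed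
    finally show "normal_density x (sqrt (2 * (t' - t))) y \<le> (D1 + D2) * ?w" .
  qed
qed

lemma elim_kernel_measurable:
  "case_prod (elim_kernel A) \<in>
    borel_measurable ((count_space T \<Otimes>\<^sub>M lborel) \<Otimes>\<^sub>M (count_space T \<Otimes>\<^sub>M lborel))"
  unfolding elim_kernel_def
proof (rule count_pair_kernel_measurable[OF finite_T])
  fix t t' assume t: "t \<in> T"
  note [measurable] = reduced_measurable[OF t]
  have [measurable]: "(\<lambda>z. normal_density (fst z) s (snd z)) \<in> borel_measurable (borel \<Otimes>\<^sub>M borel)" for s
    unfolding normal_density_def by measurable
  show "(\<lambda>(x, y). chi t x * (if t \<in> A then reduced t t' x y else K1_ext (t, x) (t', y)) * chi t' y)
      \<in> borel_measurable (borel \<Otimes>\<^sub>M borel)"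
    unfolding K1_ext_eq case_prod_beta by measurable
qed

lemma heat_row_measurable:
  "case_prod (heat_row b) \<in>
    borel_measurable ((count_space T \<Otimes>\<^sub>M lborel) \<Otimes>\<^sub>M (count_space T \<Otimes>\<^sub>M lborel))"
  unfolding heat_row_def
proof (rule count_pair_kernel_measurable[OF finite_T])
  fix t t'
  have [measurable]: "(\<lambda>z. normal_density (fst z) s (snd z)) \<in> borel_measurable (borel \<Otimes>\<^sub>M borel)" for s
    unfolding normal_density_def by measurable
  show "(\<lambda>(x, y). if t = b \<and> t < t' then - (chi t x * normal_density x (sqrt (2 * (t' - t))) y * chi t' y) else 0)
      \<in> borel_measurable (borel \<Otimes>\<^sub>M borel)"
    unfolding case_prod_beta by measurable
qed

text \<open>Composing the heat kernels in row \<open>b\<close> with the reduced rows of all later times is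
  \<open>last_exceedance\<close>: so the row operation with \<open>heat_row b\<close> replaces row \<open>b\<close> by its reduced form.\<close>

lemma heat_row_composition:
  assumes b: "b \<in> T" "b \<notin> A" and later: "\<And>l. l \<in> T \<Longrightarrow> b < l \<Longrightarrow> l \<in> A" and t: "t \<in> T" and t': "t' \<in> T"
  shows "(\<integral>w. heat_row b (t, x) w * elim_kernel A w (t', y) \<partial>(count_space T \<Otimes>\<^sub>M lborel)) =
    elim_kernel (insert b A) (t, x) (t', y) - elim_kernel A (t, x) (t', y) + heat_row b (t, x) (t', y)"
proof (cases "t = b")
  case False
  then show ?thesis by (simp add: heat_row_def elim_kernel_def)
next
  case True
  let ?g = "\<lambda>l u. - (chi b x * chi t' y) * (if b < l then normal_density x (sqrt (2 * (l - b))) u *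
    (indicator {\<xi> l<..} u * reduced l t' u y) else 0)"
  have eq: "heat_row b (b, x) (l, u) * elim_kernel A (l, u) (t', y) = ?g l u" if "l \<in> T" for l u
    using later[OF that] by (auto simp: heat_row_def elim_kernel_def chi_def indicator_def)
  have int: "integrable lborel (?g l)" if "l \<in> T" for l
    using last_exceedance(2)[OF b(1) t' that] by (cases "b < l") auto
  have "(\<integral>w. heat_row b (b, x) w * elim_kernel A w (t', y) \<partial>(count_space T \<Otimes>\<^sub>M lborel)) =
      (\<integral>w. (case w of (l, u) \<Rightarrow> ?g l u) \<partial>(count_space T \<Otimes>\<^sub>M lborel))"
    by (intro Bochner_Integration.integral_cong refl) (auto simp: space_pair_measure eq)
  also have "\<dots> = (\<Sum>l\<in>T. \<integral>u. ?g l u \<partial>lborel)"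
    by (rule count_pair_integral(2)[OF finite_T int])
  also have "\<dots> = (\<Sum>l\<in>T. if b < l then - (chi b x * chi t' y) * (\<integral>u. normal_density x (sqrt (2 * (l - b))) u *
      (indicator {\<xi> l<..} u * reduced l t' u y) \<partial>lborel) else 0)"
    by (intro sum.cong refl) auto
  also have "\<dots> = - (chi b x * chi t' y) * (\<Sum>l | l \<in> T \<and> b < l. \<integral>u. normal_density x (sqrt (2 * (l - b))) u *
      (indicator {\<xi> l<..} u * reduced l t' u y) \<partial>lborel)"
    unfolding sum.inter_filter[OF finite_T] sum_distrib_left by (intro sum.cong refl) simp
  also have "\<dots> = chi b x * chi t' y * (reduced b t' x y - airy_shift (t' - b) (x + y))"
    using last_exceedance(1)[OF b(1) t', of x y] by (simp add: algebra_simps)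
  also have "\<dots> = elim_kernel (insert b A) (b, x) (t', y) - elim_kernel A (b, x) (t', y) + heat_row b (b, x) (t', y)"
    using b by (auto simp: elim_kernel_def heat_row_def K1_ext_eq algebra_simps)
  finally show ?thesis using True by simp
qed

text \<open>Row operations remove the heat kernel one time after the other, the last one first.\<close>

lemma fredholm_elimination:
  assumes R: "0 \<le> R" "\<And>t. t \<in> T \<Longrightarrow> - R \<le> \<xi> t"
  shows "fredholm_det (count_space T \<Otimes>\<^sub>M lborel) (elim_kernel {}) =
    fredholm_det (count_space T \<Otimes>\<^sub>M lborel) (elim_kernel T)"
proof -
  let ?\<mu> = "count_space T \<Otimes>\<^sub>M (lborel :: real measure)"
  obtain D where D: "0 \<le> D"
    and Dr: "\<And>t t' x y. t \<in> T \<Longrightarrow> t' \<in> T \<Longrightarrow> - R \<le> x \<Longrightarrow> - R \<le> y \<Longrightarrow>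
      \<bar>reduced t t' x y\<bar> \<le> D * (exp (- (row_weight t * x)) * exp (col_weight t' * y))"
    and Da: "\<And>t t' x y. t \<in> T \<Longrightarrow> t' \<in> T \<Longrightarrow> - R \<le> x \<Longrightarrow> - R \<le> y \<Longrightarrow>
      \<bar>airy_shift (t' - t) (x + y)\<bar> \<le> D * (exp (- (row_weight t * x)) * exp (col_weight t' * y))"
    and Dh: "\<And>t t' x y. t \<in> T \<Longrightarrow> t' \<in> T \<Longrightarrow> t < t' \<Longrightarrow> - R \<le> x \<Longrightarrow> - R \<le> y \<Longrightarrow>
      normal_density x (sqrt (2 * (t' - t))) y \<le> D * (exp (- (row_weight t * x)) * exp (col_weight t' * y))"
    using kernel_bounds[OF R] by blast
  define a where "a = (\<lambda>(t, x). 5 * D * (exp (- (row_weight t * x)) * chi t x))"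
  define b where "b = (\<lambda>(t, x). exp (col_weight t * x) * chi t x)"
  have chi0: "chi t x = 0 \<or> chi t x = 1 \<and> - R \<le> x" if "t \<in> T" for t x
    using R(2)[OF that] by (auto simp: chi_def indicator_def)
  interpret dominating_pair ?\<mu> a b
  proof (intro dominating_pair.intro count_pair_sigma_finite finite_T dominating_pair_axioms.intro)
    show "a \<in> borel_measurable ?\<mu>" "b \<in> borel_measurable ?\<mu>"
      unfolding a_def b_def by (auto intro!: count_pair_measurable finite_T)
    show "0 \<le> a z" "0 \<le> b z" for z using D by (auto simp: a_def b_def split: prod.split)
    have "(\<lambda>z. a z * b z) = (\<lambda>(t, x). 5 * D * (exp (- (1 / real (card T) * x)) * indicator {\<xi> t<..} x))"
    proof -
      have "exp (- (row_weight t * x)) * exp (col_weight t * x) = exp (- (1 / real (card T) * x))" for t x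
        unfolding exp_add[symmetric] by (simp add: row_weight_def algebra_simps)
      then have "5 * D * (exp (- (row_weight t * x)) * chi t x) * (exp (col_weight t * x) * chi t x) =
          5 * D * (exp (- (1 / real (card T) * x)) * indicator {\<xi> t<..} x)" for t x
        by (auto simp: chi_def indicator_def mult.assoc)
      then show ?thesis unfolding a_def b_def by (auto simp only: fun_eq_iff split: prod.split)
    qed
    moreover have "integrable ?\<mu> \<dots>"
      using card_T_pos by (intro count_pair_integral(1) finite_T integrable_mult_right integrable_exp_half_line) auto
    ultimately show "integrable ?\<mu> (\<lambda>z. a z * b z)" by simp
  qed
  have ab: "a (t, x) * b (t', y) = 5 * (chi t x * (D * (exp (- (row_weight t * x)) * exp (col_weight t' * y))) * chi t' y)"
    for t x t' y by (simp add: a_def b_def)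
  have K_bound: "\<bar>elim_kernel A (t, x) (t', y)\<bar> \<le> 2 / 5 * (a (t, x) * b (t', y))"
    if t: "t \<in> T" "t' \<in> T" for A t x t' y
  proof -
    have "\<bar>if t \<in> A then reduced t t' x y else K1_ext (t, x) (t', y)\<bar> \<le>
        2 * (D * (exp (- (row_weight t * x)) * exp (col_weight t' * y)))" if "- R \<le> x" "- R \<le> y"
    proof -
      define w where "w = D * (exp (- (row_weight t * x)) * exp (col_weight t' * y))"
      have 1: "\<bar>reduced t t' x y\<bar> \<le> w" "\<bar>airy_shift (t' - t) (x + y)\<bar> \<le> w"
        unfolding w_def by (rule Dr[OF t that], rule Da[OF t that])
      have 2: "normal_density x (sqrt (2 * (t' - t))) y \<le> w" if "t < t'"
        unfolding w_def by (rule Dh[OF t that \<open>- R \<le> x\<close> \<open>- R \<le> y\<close>])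
      have 3: "0 \<le> normal_density x (sqrt (2 * (t' - t))) y" by (rule normal_density_nonneg)
      have "\<bar>K1_ext (t, x) (t', y)\<bar> \<le> 2 * w"
      proof (cases "t < t'")
        case True
        then have "K1_ext (t, x) (t', y) = airy_shift (t' - t) (x + y) - normal_density x (sqrt (2 * (t' - t))) y"
          by (simp add: K1_ext_eq)
        then show ?thesis using 1 2[OF True] 3 by linarith
      next
        case False
        then have "K1_ext (t, x) (t', y) = airy_shift (t' - t) (x + y)" by (simp add: K1_ext_eq)
        then show ?thesis using 1 by linarith
      qed
      with 1 show ?thesis unfolding w_def[symmetric] by (cases "t \<in> A") auto
    qed
    then show ?thesis
      unfolding ab using chi0[OF t(1), of x] chi0[OF t(2), of y]
      by (auto simp: elim_kernel_def abs_mult mult_ac)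
  qed
  have N_bound: "\<bar>heat_row c (t, x) (t', y)\<bar> \<le> 1 / 5 * (a (t, x) * b (t', y))"
    if t: "t \<in> T" "t' \<in> T" for c t x t' y
    unfolding ab using chi0[OF t(1), of x] chi0[OF t(2), of y] Dh[OF t] D
    by (auto simp: heat_row_def abs_mult)
  have K_dom: "dominated (elim_kernel A)" for A
    unfolding dominated_def
  proof (intro conjI elim_kernel_measurable ballI)
    fix z z' assume "z \<in> space ?\<mu>" "z' \<in> space ?\<mu>"
    then have "\<bar>elim_kernel A z z'\<bar> \<le> 2 / 5 * (a z * b z')"
      using K_bound[of "fst z" "fst z'" A "snd z" "snd z'"] by (auto simp: space_pair_measure)
    then show "\<bar>elim_kernel A z z'\<bar> \<le> a z * b z'"
      using mult_nonneg_nonneg[OF a_nonneg[of z] b_nonneg[of z']] by linarith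
  qed
  have N_dom: "dominated (heat_row c)" for c
    unfolding dominated_def
  proof (intro conjI heat_row_measurable ballI)
    fix z z' assume "z \<in> space ?\<mu>" "z' \<in> space ?\<mu>"
    then have "\<bar>heat_row c z z'\<bar> \<le> 1 / 5 * (a z * b z')"
      using N_bound[of "fst z" "fst z'" c "snd z" "snd z'"] by (auto simp: space_pair_measure)
    then show "\<bar>heat_row c z z'\<bar> \<le> a z * b z'"
      using mult_nonneg_nonneg[OF a_nonneg[of z] b_nonneg[of z']] by linarith
  qed
  have step: "fredholm_det ?\<mu> (elim_kernel (insert c A)) = fredholm_det ?\<mu> (elim_kernel A)"
    if c: "c \<in> T" "c \<notin> A" and later: "\<And>l. l \<in> T \<Longrightarrow> c < l \<Longrightarrow> l \<in> A" for c A
  proof -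
    let ?NK = "\<lambda>z z'. elim_kernel (insert c A) z z' - elim_kernel A z z' + heat_row c z z'"
    have NK_dom: "dominated ?NK"
    proof -
      have "case_prod ?NK \<in> borel_measurable (?\<mu> \<Otimes>\<^sub>M ?\<mu>)"
        using elim_kernel_measurable heat_row_measurable unfolding case_prod_beta by measurable
      moreover have "\<bar>?NK (t, x) (t', y)\<bar> \<le> a (t, x) * b (t', y)" if "t \<in> T" "t' \<in> T" for t x t' y
        using K_bound[OF that, of "insert c A" x y] K_bound[OF that, of A x y] N_bound[OF that, of c x y]
        by linarith
      ultimately show ?thesis unfolding dominated_def by (auto simp: space_pair_measure)
    qed
    show ?thesis
    proof (rule fredholm_row_operation[OF K_dom K_dom N_dom NK_dom])
      show "?NK z z' = (\<integral>w. heat_row c z w * elim_kernel A w z' \<partial>?\<mu>)" if "z \<in> space ?\<mu>" "z' \<in> space ?\<mu>" for z z'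
        using that heat_row_composition[OF c later, of "fst z" "fst z'" "snd z" "snd z'"]
        by (auto simp: space_pair_measure)
      show "heat_row c z z = 0" for z by (auto simp: heat_row_def split: prod.split)
      show "elim_kernel (insert c A) w z' = elim_kernel A w z'" if "heat_row c z w \<noteq> 0" for z w z'
        using that by (auto simp: heat_row_def elim_kernel_def split: prod.splits if_splits)
    qed simp
  qed
  have "finite S \<Longrightarrow> S \<subseteq> T \<Longrightarrow> (\<forall>s\<in>S. \<forall>l\<in>T. s \<le> l \<longrightarrow> l \<in> S) \<Longrightarrow>
      fredholm_det ?\<mu> (elim_kernel S) = fredholm_det ?\<mu> (elim_kernel {})" for S
  proof (induction S rule: finite_linorder_min_induct)
    case (insert c A)
    have "fredholm_det ?\<mu> (elim_kernel (insert c A)) = fredholm_det ?\<mu> (elim_kernel A)"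
      using insert.prems insert.hyps by (intro step) (auto dest: less_imp_le)
    also have "\<dots> = fredholm_det ?\<mu> (elim_kernel {})"
    proof (rule insert.IH)
      show "\<forall>s\<in>A. \<forall>l\<in>T. s \<le> l \<longrightarrow> l \<in> A"
      proof (intro ballI impI)
        fix s l assume s: "s \<in> A" and l: "l \<in> T" "s \<le> l"
        then have "l \<in> insert c A" using insert.prems(2) by blast
        moreover have "c < l" using insert.hyps(2) s l by (metis less_le_trans)
        ultimately show "l \<in> A" by auto
      qed
    qed (use insert.prems in auto)
    finally show ?case .
  qed simp
  from this[of T] show ?thesis using finite_T by simp
qed

end

section \<open>First-order comparison of weighted Airy kernels\<close>

locale airy_line =
  fixes R c :: real
  assumes R_nonneg: "0 \<le> R" and c_ge_2: "2 \<le> c"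
begin

definition line_a :: "real \<Rightarrow> real" where
  "line_a x = c * airy_const * (exp (- x) * indicator {- R<..} x)"

definition line_b :: "real \<Rightarrow> real" where
  "line_b x = exp (- x)"

lemma line_ab: "line_a x * line_b x = c * airy_const * (exp (- (2 * x)) * indicator {- R<..} x)"
  by (simp add: line_a_def line_b_def mult_exp_exp)

sublocale dominating_pair lborel line_a line_b
proof (intro dominating_pair.intro sigma_finite_lborel dominating_pair_axioms.intro)
  show "integrable lborel (\<lambda>x. line_a x * line_b x)"
    unfolding line_ab by (intro integrable_mult_right integrable_exp_half_line) simp
qed (use c_ge_2 airy_const_nonneg in \<open>auto simp: line_a_def[abs_def] line_b_def[abs_def]\<close>)

text \<open>Densities supported above \<open>- R\<close>, regarded as multiplication operators in front of the
  Airy kernel.\<close>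

definition weight :: "(real \<Rightarrow> real) \<Rightarrow> bool" where
  "weight w \<longleftrightarrow> w \<in> borel_measurable borel \<and> (\<forall>x. \<bar>w x\<bar> \<le> c * indicator {- R<..} x)"

definition weighted :: "(real \<Rightarrow> real) \<Rightarrow> real \<Rightarrow> real \<Rightarrow> real" where
  "weighted w = (\<lambda>x y. w x * airy_Ai (x + y))"

definition wnorm :: "(real \<Rightarrow> real) \<Rightarrow> real" where
  "wnorm w = airy_const * (\<integral>x. \<bar>w x\<bar> * exp (- (2 * x)) \<partial>lborel)"

lemma airy_Ai_sum_bound: "\<bar>airy_Ai (x + y)\<bar> \<le> airy_const * (exp (- x) * exp (- y))"
  using airy_Ai_bound[of "x + y"] by (simp add: mult_exp_exp)

lemma weight_measurable: "weight w \<Longrightarrow> w \<in> borel_measurable borel"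
  by (simp add: weight_def)

lemma weighted_bound: "\<bar>weighted w x y\<bar> \<le> airy_const * (\<bar>w x\<bar> * exp (- x)) * line_b y"
  using mult_left_mono[OF airy_Ai_sum_bound[of x y], of "\<bar>w x\<bar>"]
  by (simp add: weighted_def abs_mult line_b_def mult_ac)

lemma weight_line_a: "weight w \<Longrightarrow> airy_const * (\<bar>w x\<bar> * exp (- x)) \<le> line_a x"
proof -
  assume "weight w"
  then have "\<bar>w x\<bar> \<le> c * indicator {- R<..} x" by (simp add: weight_def)
  then have "airy_const * (\<bar>w x\<bar> * exp (- x)) \<le> airy_const * (c * indicator {- R<..} x * exp (- x))"
    by (intro mult_left_mono mult_right_mono airy_const_nonneg) auto
  then show ?thesis by (simp add: line_a_def mult_ac)
qed

lemma weight_dominated: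
  assumes w: "weight w"
  shows "dominated (weighted w)"
  unfolding dominated_def
proof (intro conjI ballI)
  note [measurable] = weight_measurable[OF w]
  show "case_prod (weighted w) \<in> borel_measurable (lborel \<Otimes>\<^sub>M lborel)"
    unfolding weighted_def by measurable
  fix x y
  show "\<bar>weighted w x y\<bar> \<le> line_a x * line_b y"
    using weighted_bound[of w x y] mult_right_mono[OF weight_line_a[OF w, of x] b_nonneg[of y]] by linarith
qed

lemma weight_exp_integrable:
  assumes w: "weight w"
  shows "integrable lborel (\<lambda>x. \<bar>w x\<bar> * exp (- (2 * x)))"
proof (rule Bochner_Integration.integrable_bound)
  show "integrable lborel (\<lambda>x. c * (exp (- (2 * x)) * indicator {- R<..} x))"
    by (intro integrable_mult_right integrable_exp_half_line) simp
  show "(\<lambda>x. \<bar>w x\<bar> * exp (- (2 * x))) \<in> borel_measurable lborel"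
    using weight_measurable[OF w] by measurable
  show "AE x in lborel. norm (\<bar>w x\<bar> * exp (- (2 * x))) \<le> norm (c * (exp (- (2 * x)) * indicator {- R<..} x))"
  proof (rule AE_I2)
    fix x
    have "\<bar>w x\<bar> \<le> c * indicator {- R<..} x" using w by (simp add: weight_def)
    then have "\<bar>w x\<bar> * exp (- (2 * x)) \<le> c * indicator {- R<..} x * exp (- (2 * x))"
      by (intro mult_right_mono) auto
    then show "norm (\<bar>w x\<bar> * exp (- (2 * x))) \<le> norm (c * (exp (- (2 * x)) * indicator {- R<..} x))"
      using c_ge_2 by (simp add: abs_mult mult_ac)
  qed
qed

lemma wnorm_nonneg: "0 \<le> wnorm w"
  unfolding wnorm_def by (intro mult_nonneg_nonneg airy_const_nonneg integral_nonneg_AE) auto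

lemma two_slot_product:
  fixes E D :: real and f g :: "real \<Rightarrow> real"
  assumes pq: "p < m" "q < m" "p \<noteq> q" and f: "integrable lborel f" and g: "integrable lborel g"
  shows "integrable (\<Pi>\<^sub>M i\<in>{..<m}. lborel) (\<lambda>z. \<Prod>i<m. (if i = q then f (z i) else if i = p then g (z i) else line_a (z i) * line_b (z i)))"
    and "(\<integral>z. (\<Prod>i<m. (if i = q then f (z i) else if i = p then g (z i) else line_a (z i) * line_b (z i))) \<partial>(\<Pi>\<^sub>M i\<in>{..<m}. lborel)) =
      (\<integral>x. f x \<partial>lborel) * (\<integral>x. g x \<partial>lborel) * mass ^ (m - 2)"
proof -
  let ?F = "\<lambda>i x. if i = q then f x else if i = p then g x else line_a x * line_b x"
  have int: "integrable lborel (?F i)" for i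
  proof (cases "i = q")
    case False
    then show ?thesis using g ab_integrable by (cases "i = p") simp_all
  qed (use f in simp)
  show "integrable (\<Pi>\<^sub>M i\<in>{..<m}. lborel) (\<lambda>z. \<Prod>i<m. (if i = q then f (z i) else if i = p then g (z i) else line_a (z i) * line_b (z i)))"
    by (rule P.product_integrable_prod[OF finite_lessThan int])
  have "(\<integral>z. (\<Prod>i<m. ?F i (z i)) \<partial>(\<Pi>\<^sub>M i\<in>{..<m}. lborel)) = (\<Prod>i<m. \<integral>x. ?F i x \<partial>lborel)"
    by (rule P.product_integral_prod[OF finite_lessThan int])
  also have "\<dots> = (\<Prod>i<m. if i = q then (\<integral>x. f x \<partial>lborel) else if i = p then (\<integral>x. g x \<partial>lborel) else mass)"
    by (intro prod.cong refl) (auto simp: mass_def)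
  also have "\<dots> = (\<integral>x. f x \<partial>lborel) * (\<integral>x. g x \<partial>lborel) * mass ^ (m - 2)"
  proof -
    have "card ({..<m} - {q} - {p}) = m - 2" using pq by (subst card_Diff_singleton) auto
    then show ?thesis
    proof -
      let ?h = "\<lambda>i. if i = q then (\<integral>x. f x \<partial>lborel) else if i = p then (\<integral>x. g x \<partial>lborel) else mass"
      have "(\<Prod>i<m. ?h i) = ?h q * (\<Prod>i\<in>{..<m} - {q}. ?h i)"
        by (rule prod.remove) (use pq in auto)
      also have "(\<Prod>i\<in>{..<m} - {q}. ?h i) = ?h p * (\<Prod>i\<in>{..<m} - {q} - {p}. ?h i)"
        by (rule prod.remove) (use pq in auto)
      also have "(\<Prod>i\<in>{..<m} - {q} - {p}. ?h i) = (\<Prod>i\<in>{..<m} - {q} - {p}. mass)"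
        by (intro prod.cong refl) auto
      also have "\<dots> = mass ^ (m - 2)" using \<open>card ({..<m} - {q} - {p}) = m - 2\<close> by simp
      finally show ?thesis using pq by simp
    qed
  qed
  finally show "(\<integral>z. (\<Prod>i<m. (if i = q then f (z i) else if i = p then g (z i) else line_a (z i) * line_b (z i))) \<partial>(\<Pi>\<^sub>M i\<in>{..<m}. lborel)) =
      (\<integral>x. f x \<partial>lborel) * (\<integral>x. g x \<partial>lborel) * mass ^ (m - 2)" .
qed

lemma mass_power_le: "mass ^ (m - k) \<le> (1 + mass) ^ m"
proof -
  have "mass ^ (m - k) \<le> (1 + mass) ^ (m - k)" using mass_nonneg by (intro power_mono) auto
  also have "\<dots> \<le> (1 + mass) ^ m" using mass_nonneg by (intro power_increasing) auto
  finally show ?thesis .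
qed

text \<open>One row carries the small weight \<open>\<delta>\<close> throughout, so that an error of size \<open>E\<close> in the other rows
  contributes only \<open>E * wnorm \<delta>\<close>.\<close>

lemma change_background:
  assumes w: "\<And>i. i < m \<Longrightarrow> weight (w i)" and v: "\<And>i. i < m \<Longrightarrow> weight (v i)"
    and p: "p < m" "w p = \<delta>" "v p = \<delta>"
    and E: "\<And>i. i < m \<Longrightarrow> i \<noteq> p \<Longrightarrow> wnorm (\<lambda>x. w i x - v i x) \<le> E" "0 \<le> E"
  shows "\<bar>mixed_integral {..<m} (\<lambda>i. weighted (w i)) - mixed_integral {..<m} (\<lambda>i. weighted (v i))\<bar> \<le>
    sqrt (real m) ^ m * (real m * (E * wnorm \<delta> * (1 + mass) ^ m))"
proof -
  have \<delta>: "weight \<delta>" using w[OF p(1)] p(2) by simp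
  define g where "g x = airy_const * (\<bar>\<delta> x\<bar> * exp (- (2 * x)))" for x
  define f where "f q x = airy_const * (\<bar>w q x - v q x\<bar> * exp (- (2 * x)))" for q x
  have g_int: "integrable lborel g" unfolding g_def by (intro integrable_mult_right weight_exp_integrable \<delta>)
  have f_int: "integrable lborel (f q)" if "q < m" for q
  proof (rule Bochner_Integration.integrable_bound)
    show "integrable lborel (\<lambda>x. airy_const * (\<bar>w q x\<bar> * exp (- (2 * x)) + \<bar>v q x\<bar> * exp (- (2 * x))))"
      using w v that by (intro integrable_mult_right Bochner_Integration.integrable_add weight_exp_integrable) auto
    show "f q \<in> borel_measurable lborel"
      unfolding f_def[abs_def] using weight_measurable[OF w[OF that]] weight_measurable[OF v[OF that]] by measurable
    show "AE x in lborel. norm (f q x) \<le>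
        norm (airy_const * (\<bar>w q x\<bar> * exp (- (2 * x)) + \<bar>v q x\<bar> * exp (- (2 * x))))"
    proof (rule AE_I2)
      fix x
      have "airy_const * (\<bar>w q x - v q x\<bar> * exp (- (2 * x))) \<le>
          airy_const * ((\<bar>w q x\<bar> + \<bar>v q x\<bar>) * exp (- (2 * x)))"
        by (intro mult_left_mono mult_right_mono airy_const_nonneg) auto
      then show "norm (f q x) \<le>
          norm (airy_const * (\<bar>w q x\<bar> * exp (- (2 * x)) + \<bar>v q x\<bar> * exp (- (2 * x))))"
        unfolding f_def using airy_const_nonneg by (simp add: abs_mult distrib_right)
    qed
  qed
  let ?P = "\<lambda>q z. \<Prod>i<m. (if i = q then f q (z i) else if i = p then g (z i) else line_a (z i) * line_b (z i))"
  have mi: "integrable (\<Pi>\<^sub>M i\<in>{..<m}. lborel) (mixed {..<m} (\<lambda>i. weighted (w i)))"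
    "integrable (\<Pi>\<^sub>M i\<in>{..<m}. lborel) (mixed {..<m} (\<lambda>i. weighted (v i)))"
    using w v by (auto intro!: mixed_integrable weight_dominated)
  have "\<bar>mixed_integral {..<m} (\<lambda>i. weighted (w i)) - mixed_integral {..<m} (\<lambda>i. weighted (v i))\<bar> =
      \<bar>\<integral>z. mixed {..<m} (\<lambda>i. weighted (w i)) z - mixed {..<m} (\<lambda>i. weighted (v i)) z \<partial>(\<Pi>\<^sub>M i\<in>{..<m}. lborel)\<bar>"
    unfolding mixed_integral_def by (subst Bochner_Integration.integral_diff[OF mi]) simp
  also have "\<dots> \<le> (\<integral>z. sqrt (real m) ^ m * (\<Sum>q\<in>{..<m}-{p}. ?P q z) \<partial>(\<Pi>\<^sub>M i\<in>{..<m}. lborel))"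
  proof (rule integral_abs_le)
    show "integrable (\<Pi>\<^sub>M i\<in>{..<m}. lborel) (\<lambda>z. sqrt (real m) ^ m * (\<Sum>q\<in>{..<m}-{p}. ?P q z))"
      using p f_int g_int by (intro integrable_mult_right Bochner_Integration.integrable_sum two_slot_product) auto
    fix z
    let ?a = "\<lambda>i. if i = p then airy_const * (\<bar>\<delta> (z p)\<bar> * exp (- z p)) else line_a (z i)"
    let ?\<eta> = "\<lambda>i. airy_const * (\<bar>w i (z i) - v i (z i)\<bar> * exp (- z i))"
    have "\<bar>mixed {..<m} (\<lambda>i. weighted (w i)) z - mixed {..<m} (\<lambda>i. weighted (v i)) z\<bar> \<le>
        sqrt (real m) ^ m * (\<Sum>q<m. ?\<eta> q * line_b (z q) * (\<Prod>i\<in>{..<m}-{q}. ?a i * line_b (z i)))"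
      unfolding mixed_def
    proof (rule ldet_lipschitz)
      fix i j assume "i < m" "j < m"
      show "\<bar>weighted (w i) (z i) (z j)\<bar> \<le> ?a i * line_b (z j)"
        using weighted_bound[of \<delta> "z p" "z j"] p dominatedD[OF weight_dominated[OF w[OF \<open>i < m\<close>]], of "z i" "z j"] by auto
      show "\<bar>weighted (v i) (z i) (z j)\<bar> \<le> ?a i * line_b (z j)"
        using weighted_bound[of \<delta> "z p" "z j"] p dominatedD[OF weight_dominated[OF v[OF \<open>i < m\<close>]], of "z i" "z j"] by auto
      have "weighted (w i) (z i) (z j) - weighted (v i) (z i) (z j) = weighted (\<lambda>x. w i x - v i x) (z i) (z j)"
        by (simp add: weighted_def left_diff_distrib)
      then show "\<bar>weighted (w i) (z i) (z j) - weighted (v i) (z i) (z j)\<bar> \<le> ?\<eta> i * line_b (z j)"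
        using weighted_bound[of "\<lambda>x. w i x - v i x" "z i" "z j"] by simp
    qed (auto simp: airy_const_nonneg a_nonneg b_nonneg)
    also have "(\<Sum>q<m. ?\<eta> q * line_b (z q) * (\<Prod>i\<in>{..<m}-{q}. ?a i * line_b (z i))) = (\<Sum>q\<in>{..<m}-{p}. ?P q z)"
    proof -
      have "(\<Sum>q<m. ?\<eta> q * line_b (z q) * (\<Prod>i\<in>{..<m}-{q}. ?a i * line_b (z i))) =
          (\<Sum>q\<in>{..<m}-{p}. ?\<eta> q * line_b (z q) * (\<Prod>i\<in>{..<m}-{q}. ?a i * line_b (z i)))"
        using p by (subst sum.remove[of _ p]) auto
      also have "\<dots> = (\<Sum>q\<in>{..<m}-{p}. ?P q z)"
      proof (intro sum.cong refl)
        fix q assume q: "q \<in> {..<m} - {p}"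
        show "?\<eta> q * line_b (z q) * (\<Prod>i\<in>{..<m}-{q}. ?a i * line_b (z i)) = ?P q z"
        proof -
          let ?h = "\<lambda>i. if i = q then f q (z i) else if i = p then g (z i) else line_a (z i) * line_b (z i)"
          have 2: "exp (- u) * exp (- u) = exp (- (2 * u))" for u :: real by (simp add: mult_exp_exp)
          have "?P q z = ?h q * (\<Prod>i\<in>{..<m}-{q}. ?h i)"
            by (rule prod.remove) (use q in auto)
          also have "?h q = ?\<eta> q * line_b (z q)"
            by (simp add: f_def line_b_def mult.assoc 2)
          also have "(\<Prod>i\<in>{..<m}-{q}. ?h i) = (\<Prod>i\<in>{..<m}-{q}. ?a i * line_b (z i))"
            by (intro prod.cong refl) (auto simp: g_def line_b_def mult.assoc 2)
          finally show ?thesis by (rule sym)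
        qed
      qed
      finally show ?thesis .
    qed
    finally show "\<bar>mixed {..<m} (\<lambda>i. weighted (w i)) z - mixed {..<m} (\<lambda>i. weighted (v i)) z\<bar> \<le>
      sqrt (real m) ^ m * (\<Sum>q\<in>{..<m}-{p}. ?P q z)" .
  qed
  also have "\<dots> = sqrt (real m) ^ m * (\<Sum>q\<in>{..<m}-{p}. wnorm (\<lambda>x. w q x - v q x) * wnorm \<delta> * mass ^ (m - 2))"
  proof -
    have fw: "integral\<^sup>L lborel (f q) = wnorm (\<lambda>x. w q x - v q x)" for q
      unfolding f_def[abs_def] wnorm_def by simp
    have gw: "integral\<^sup>L lborel g = wnorm \<delta>" unfolding g_def[abs_def] wnorm_def by simp
    show ?thesis
      using p f_int g_int two_slot_product[OF p(1), of _ _ g]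
      by (simp add: Bochner_Integration.integral_sum fw gw)
  qed
  also have "\<dots> \<le> sqrt (real m) ^ m * (\<Sum>q\<in>{..<m}-{p}. E * wnorm \<delta> * (1 + mass) ^ m)"
    using E wnorm_nonneg mass_nonneg
    by (intro mult_left_mono sum_mono mult_mono mass_power_le) auto
  also have "\<dots> \<le> sqrt (real m) ^ m * (real m * (E * wnorm \<delta> * (1 + mass) ^ m))"
    using E(2) wnorm_nonneg mass_nonneg
    by (auto intro!: mult_left_mono mult_right_mono simp: card_Diff_singleton_if)
  finally show ?thesis .
qed

lemma mixed_weighted: "mixed I (\<lambda>i. weighted (w i)) z = (\<Prod>i\<in>I. w i (z i)) * ldet I (\<lambda>i j. airy_Ai (z i + z j))"
  unfolding mixed_def weighted_def by (rule ldet_rows_scale)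

text \<open>A density that is concentrated near \<open>x0\<close> and has total mass zero contributes only to
  second order, since the determinant varies slowly in the corresponding variable.\<close>

lemma mean_zero_slot:
  assumes v: "weight v" and p: "p < m"
    and \<rho>: "\<rho> \<in> borel_measurable borel" "\<And>x. \<bar>\<rho> x\<bar> \<le> 2 * indicator {x0<..x0 + \<kappa>} x" "(\<integral>x. \<rho> x \<partial>lborel) = 0"
    and \<kappa>: "0 \<le> \<kappa>" "\<kappa> \<le> 1" and x0: "- R \<le> x0"
  shows "\<bar>mixed_integral {..<m} (\<lambda>i. weighted (if i = p then \<rho> else v))\<bar> \<le>
    sqrt (real m) ^ m * (real m * (36 * airy_const * exp (2 * R) * \<kappa>\<^sup>2) * (1 + 9 * mass) ^ m)"
proof -
  define W where "W i = (if i = p then \<rho> else v)" for i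
  define k where "k z = (\<lambda>i j. airy_Ai (z i + z j))" for z :: "nat \<Rightarrow> real"
  define h where "h i x = (if i = p then 9 * airy_const * exp (- (2 * x0)) * \<bar>\<rho> x\<bar> else 9 * (line_a x * line_b x))" for i x
  let ?M = "\<Pi>\<^sub>M i\<in>{..<m}. (lborel :: real measure)"
  note [measurable] = \<rho>(1) weight_measurable[OF v]
  have \<rho>_int: "integrable lborel \<rho>"
  proof (rule Bochner_Integration.integrable_bound)
    show "integrable lborel (\<lambda>x. 2 * indicator {x0<..x0 + \<kappa>} x :: real)"
      by (intro integrable_mult_right integrable_real_indicator) (use \<kappa> in auto)
  qed (use \<rho> in \<open>auto simp: abs_mult\<close>)
  have \<rho>_abs: "(\<integral>x. \<bar>\<rho> x\<bar> \<partial>lborel) \<le> 2 * \<kappa>"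
  proof -
    have "(\<integral>x. \<bar>\<rho> x\<bar> \<partial>lborel) \<le> (\<integral>x. 2 * indicator {x0<..x0 + \<kappa>} x \<partial>lborel)"
      using \<rho>_int \<rho>(2) \<kappa> by (intro integral_mono integrable_mult_right integrable_real_indicator) auto
    then show ?thesis using \<kappa> by simp
  qed
  have \<rho>_weight: "weight \<rho>"
    unfolding weight_def
  proof (intro conjI allI \<rho>(1))
    fix x
    have "\<bar>\<rho> x\<bar> \<le> 2 * indicator {x0<..x0 + \<kappa>} x" by (rule \<rho>(2))
    also have "\<dots> \<le> c * indicator {- R<..} x" using c_ge_2 x0 by (auto simp: indicator_def)
    finally show "\<bar>\<rho> x\<bar> \<le> c * indicator {- R<..} x" .
  qed
  have W: "weight (W i)" for i using v \<rho>_weight by (simp add: W_def)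
  note Wm[measurable] = weight_measurable[OF W]
  have h_int: "integrable lborel (h i)" for i
    unfolding h_def using \<rho>_int ab_integrable by (cases "i = p") auto
  have h0: "0 \<le> h i x" for i x
    using airy_const_nonneg mult_nonneg_nonneg[OF a_nonneg[of x] b_nonneg[of x]] by (simp add: h_def)
  have H_int: "integrable ?M (\<lambda>z. \<Prod>i<m. h i (z i))"
    by (rule P.product_integrable_prod[OF finite_lessThan h_int])
  have H_val: "(\<integral>z. (\<Prod>i<m. h i (z i)) \<partial>?M) \<le> 18 * airy_const * exp (2 * R) * \<kappa> * (1 + 9 * mass) ^ m"
  proof -
    have "(\<integral>z. (\<Prod>i<m. h i (z i)) \<partial>?M) = (\<Prod>i<m. \<integral>x. h i x \<partial>lborel)"
      by (rule P.product_integral_prod[OF finite_lessThan h_int])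
    also have "\<dots> = (\<integral>x. h p x \<partial>lborel) * (\<Prod>i\<in>{..<m}-{p}. \<integral>x. h i x \<partial>lborel)"
      by (rule prod.remove) (use p in auto)
    also have "(\<Prod>i\<in>{..<m}-{p}. \<integral>x. h i x \<partial>lborel) = (\<Prod>i\<in>{..<m}-{p}. 9 * mass)"
      by (intro prod.cong refl) (auto simp: h_def mass_def)
    also have "\<dots> = (9 * mass) ^ (m - 1)" using p by (simp add: card_Diff_singleton)
    also have "(\<integral>x. h p x \<partial>lborel) = 9 * airy_const * exp (- (2 * x0)) * (\<integral>x. \<bar>\<rho> x\<bar> \<partial>lborel)"
      by (simp add: h_def)
    also have "\<dots> * (9 * mass) ^ (m - 1) \<le> (9 * airy_const * exp (2 * R) * (2 * \<kappa>)) * (1 + 9 * mass) ^ m"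
    proof (intro mult_mono \<rho>_abs)
      have "(9 * mass) ^ (m - 1) \<le> (1 + 9 * mass) ^ (m - 1)" using mass_nonneg by (intro power_mono) auto
      also have "\<dots> \<le> (1 + 9 * mass) ^ m" using mass_nonneg by (intro power_increasing) auto
      finally show "(9 * mass) ^ (m - 1) \<le> (1 + 9 * mass) ^ m" .
    qed (use airy_const_nonneg \<kappa> x0 mass_nonneg in auto)
    finally show ?thesis by (simp add: mult_ac)
  qed
  define f where "f z = (\<Prod>i<m. W i (z i)) * ldet {..<m} (k z)" for z
  \<comment> \<open>\<open>G\<close> freezes the variable \<open>z p\<close> in the determinant; its integral is a multiple of the integral of \<open>\<rho>\<close>.\<close>
  define G where "G z = (\<Prod>i<m. W i (z i)) * ldet {..<m} (k (z(p := x0)))" for z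
  have f_mixed: "f = mixed {..<m} (\<lambda>i. weighted (W i))"
    by (simp add: f_def k_def mixed_weighted fun_eq_iff)
  have f_int: "integrable ?M f" unfolding f_mixed by (intro mixed_integrable weight_dominated W) auto
  \<comment> \<open>Weights and determinants are estimated together; off the support of \<open>\<rho>\<close> both sides vanish.\<close>
  have bounds: "\<bar>f z - G z\<bar> \<le> sqrt (real m) ^ m * (real m * (2 * \<kappa>)) * (\<Prod>i<m. h i (z i)) \<and>
      \<bar>G z\<bar> \<le> sqrt (real m) ^ m * (\<Prod>i<m. h i (z i))" for z
  proof (cases "z p \<in> {x0<..x0 + \<kappa>}")
    case False
    then have "W p (z p) = 0" using \<rho>(2)[of "z p"] by (simp add: W_def)
    then have pz: "(\<Prod>i<m. W i (z i)) = 0" using p by (intro prod_zero) auto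
    have "0 \<le> (\<Prod>i<m. h i (z i))" using h0 by (intro prod_nonneg) auto
    then show ?thesis unfolding f_def G_def pz using \<kappa> by simp
  next
    case True
    define z' where "z' = z(p := x0)"
    have zz: "z' i \<le> z i" "z i \<le> z' i + \<kappa>" for i using True \<kappa> by (auto simp: z'_def)
    define \<alpha> where "\<alpha> i = 9 * airy_const * exp (- z' i)" for i
    define \<beta> where "\<beta> j = exp (- z' j)" for j
    have \<alpha>\<beta>: "0 \<le> \<alpha> i" "0 \<le> \<beta> i" for i using airy_const_nonneg by (auto simp: \<alpha>_def \<beta>_def)
    have k_le: "\<bar>airy_Ai u\<bar> \<le> \<alpha> i * \<beta> j" if "z' i + z' j \<le> u" for u i j
    proof -
      have "\<bar>airy_Ai u\<bar> \<le> airy_const * exp (- u)" by (rule airy_Ai_bound)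
      also have "\<dots> \<le> 9 * airy_const * exp (- (z' i + z' j))"
        using that airy_const_nonneg by (intro mult_mono) auto
      also have "\<dots> = \<alpha> i * \<beta> j" by (simp add: \<alpha>_def \<beta>_def mult_exp_exp)
      finally show ?thesis .
    qed
    have kd: "\<bar>k z i j - k z' i j\<bar> \<le> (2 * \<kappa> * \<alpha> i) * \<beta> j" for i j
    proof -
      define u u' where "u = z i + z j" and "u' = z' i + z' j"
      have d: "\<bar>u - u'\<bar> \<le> 2 * \<kappa>" using zz[of i] zz[of j] \<kappa> by (simp add: u_def u'_def)
      have "\<bar>airy_Ai u - airy_Ai u'\<bar> \<le> \<bar>u - u'\<bar> * exp \<bar>u - u'\<bar> * airy_const * exp (- u')"
        by (rule airy_Ai_lipschitz)
      also have "\<dots> \<le> (2 * \<kappa>) * 9 * airy_const * exp (- u')"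
      proof (intro mult_right_mono mult_mono d airy_const_nonneg)
        have "exp \<bar>u - u'\<bar> \<le> exp (1 + 1 :: real)" using d \<kappa> by simp
        also have "\<dots> = exp 1 * exp (1::real)" by (rule exp_add)
        also have "\<dots> \<le> 3 * 3" by (intro mult_mono exp_le) auto
        finally show "exp \<bar>u - u'\<bar> \<le> 9" by simp
      qed (use \<kappa> in auto)
      also have "\<dots> = (2 * \<kappa> * \<alpha> i) * \<beta> j" by (simp add: u'_def \<alpha>_def \<beta>_def mult_exp_exp)
      finally show ?thesis by (simp add: k_def u_def u'_def)
    qed
    have ld: "\<bar>ldet {..<m} (k z) - ldet {..<m} (k z')\<bar> \<le>
        sqrt (real m) ^ m * (\<Sum>q<m. (2 * \<kappa> * \<alpha> q) * \<beta> q * (\<Prod>i\<in>{..<m}-{q}. \<alpha> i * \<beta> i))"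
    proof -
      have kb: "\<bar>k z i j\<bar> \<le> \<alpha> i * \<beta> j" "\<bar>k z' i j\<bar> \<le> \<alpha> i * \<beta> j" for i j
        using zz[of i] zz[of j] by (auto simp: k_def intro!: k_le)
      show ?thesis
        by (rule ldet_lipschitz) (use \<kappa> in \<open>auto intro!: kb kd \<alpha>\<beta> mult_nonneg_nonneg\<close>)
    qed
    also have "(\<Sum>q<m. (2 * \<kappa> * \<alpha> q) * \<beta> q * (\<Prod>i\<in>{..<m}-{q}. \<alpha> i * \<beta> i)) =
        (\<Sum>q<m. 2 * \<kappa> * (\<Prod>i<m. \<alpha> i * \<beta> i))"
    proof (intro sum.cong refl)
      fix q assume "q \<in> {..<m}"
      then have "(\<Prod>i<m. \<alpha> i * \<beta> i) = \<alpha> q * \<beta> q * (\<Prod>i\<in>{..<m}-{q}. \<alpha> i * \<beta> i)"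
        by (intro prod.remove) auto
      then show "(2 * \<kappa> * \<alpha> q) * \<beta> q * (\<Prod>i\<in>{..<m}-{q}. \<alpha> i * \<beta> i) = 2 * \<kappa> * (\<Prod>i<m. \<alpha> i * \<beta> i)" by simp
    qed
    finally have ld': "\<bar>ldet {..<m} (k z) - ldet {..<m} (k z')\<bar> \<le>
        sqrt (real m) ^ m * (real m * (2 * \<kappa>)) * (\<Prod>i<m. \<alpha> i * \<beta> i)" by simp
    have ldG: "\<bar>ldet {..<m} (k z')\<bar> \<le> sqrt (real m) ^ m * (\<Prod>i<m. \<alpha> i * \<beta> i)"
      by (rule hadamard_ldet) (auto intro!: k_le \<alpha>\<beta> simp: k_def)
    have Wab: "\<bar>\<Prod>i<m. W i (z i)\<bar> * (\<Prod>i<m. \<alpha> i * \<beta> i) \<le> (\<Prod>i<m. h i (z i))"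
      unfolding abs_prod prod.distrib[symmetric]
    proof (intro prod_mono conjI mult_nonneg_nonneg abs_ge_zero \<alpha>\<beta>)
      fix i assume "i \<in> {..<m}"
      have ee: "exp (- u) * exp (- u) = exp (- (2 * u))" for u :: real by (simp add: mult_exp_exp)
      show "\<bar>W i (z i)\<bar> * (\<alpha> i * \<beta> i) \<le> h i (z i)"
      proof (cases "i = p")
        case True
        then show ?thesis by (simp add: W_def \<alpha>_def \<beta>_def h_def z'_def mult.assoc ee)
      next
        case False
        have "\<bar>v (z i)\<bar> * (9 * airy_const * exp (- (2 * z i))) \<le>
            c * indicator {- R<..} (z i) * (9 * airy_const * exp (- (2 * z i)))"
          using v airy_const_nonneg by (intro mult_right_mono) (auto simp: weight_def)
        then show ?thesis using False
          by (simp add: W_def \<alpha>_def \<beta>_def h_def z'_def line_ab mult.assoc ee) (simp add: mult_ac)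
      qed
    qed
    have "\<bar>f z - G z\<bar> = \<bar>\<Prod>i<m. W i (z i)\<bar> * \<bar>ldet {..<m} (k z) - ldet {..<m} (k z')\<bar>"
      unfolding f_def G_def z'_def by (simp add: right_diff_distrib[symmetric] abs_mult)
    also have "\<dots> \<le> \<bar>\<Prod>i<m. W i (z i)\<bar> * (sqrt (real m) ^ m * (real m * (2 * \<kappa>)) * (\<Prod>i<m. \<alpha> i * \<beta> i))"
      by (intro mult_left_mono ld') simp
    also have "\<dots> = sqrt (real m) ^ m * (real m * (2 * \<kappa>)) * (\<bar>\<Prod>i<m. W i (z i)\<bar> * (\<Prod>i<m. \<alpha> i * \<beta> i))"
      by (simp only: mult_ac)
    also have "\<dots> \<le> sqrt (real m) ^ m * (real m * (2 * \<kappa>)) * (\<Prod>i<m. h i (z i))"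
      using \<kappa> by (intro mult_left_mono Wab) auto
    finally have 1: "\<bar>f z - G z\<bar> \<le> sqrt (real m) ^ m * (real m * (2 * \<kappa>)) * (\<Prod>i<m. h i (z i))" .
    have "\<bar>G z\<bar> = \<bar>\<Prod>i<m. W i (z i)\<bar> * \<bar>ldet {..<m} (k z')\<bar>"
      unfolding G_def z'_def by (simp add: abs_mult)
    also have "\<dots> \<le> \<bar>\<Prod>i<m. W i (z i)\<bar> * (sqrt (real m) ^ m * (\<Prod>i<m. \<alpha> i * \<beta> i))"
      by (intro mult_left_mono ldG) simp
    also have "\<dots> = sqrt (real m) ^ m * (\<bar>\<Prod>i<m. W i (z i)\<bar> * (\<Prod>i<m. \<alpha> i * \<beta> i))"
      by (simp only: mult_ac)
    also have "\<dots> \<le> sqrt (real m) ^ m * (\<Prod>i<m. h i (z i))"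
      by (intro mult_left_mono Wab) auto
    finally show ?thesis using 1 by simp
  qed
  have G_meas: "G \<in> borel_measurable ?M"
  proof -
    have c1: "(\<lambda>z. W i (z i)) \<in> borel_measurable ?M" if "i \<in> {..<m}" for i
      using measurable_compose[OF measurable_component_singleton[OF that] Wm[of i]] by simp
    have c2: "(\<lambda>z. (z(p := x0)) i) \<in> borel_measurable ?M" if "i \<in> {..<m}" for i
      using measurable_component_singleton[OF that, of "\<lambda>_. lborel"] by (cases "i = p") auto
    have c3: "(\<lambda>z. airy_Ai ((z(p := x0)) i + (z(p := x0)) j)) \<in> borel_measurable ?M"
      if "i \<in> {..<m}" "j \<in> {..<m}" for i j
      using measurable_compose[OF borel_measurable_add[OF c2[OF that(1)] c2[OF that(2)]] airy_Ai_measurable] by simp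
    show ?thesis
      unfolding G_def k_def ldet_def
      by (intro borel_measurable_times borel_measurable_prod borel_measurable_sum borel_measurable_const c1 c3)
        (auto simp: permutes_nat_less)
  qed
  have G_int: "integrable ?M G"
    by (rule Bochner_Integration.integrable_bound[OF integrable_mult_right[OF H_int] G_meas, of "sqrt (real m) ^ m"])
      (use bounds h0 in \<open>auto simp: abs_mult prod_nonneg\<close>)
  have G_zero: "(\<integral>z. G z \<partial>?M) = 0"
  proof -
    have ins: "insert p ({..<m} - {p}) = {..<m}" using p by auto
    have "(\<integral>z. G z \<partial>?M) = (\<integral>z. (\<integral>u. G (z(p := u)) \<partial>lborel) \<partial>(\<Pi>\<^sub>M i\<in>{..<m}-{p}. lborel))"
      using P.product_integral_insert[of "{..<m} - {p}" p G] G_int unfolding ins by simp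
    also have "\<dots> = (\<integral>z. 0 \<partial>(\<Pi>\<^sub>M i\<in>{..<m}-{p}. (lborel :: real measure)))"
    proof (intro Bochner_Integration.integral_cong refl)
      fix z :: "nat \<Rightarrow> real"
      have "G (z(p := u)) = ((\<Prod>i\<in>{..<m}-{p}. W i (z i)) * ldet {..<m} (k (z(p := x0)))) * \<rho> u" for u
      proof -
        have "(\<Prod>i<m. W i ((z(p := u)) i)) = W p u * (\<Prod>i\<in>{..<m}-{p}. W i ((z(p := u)) i))"
          using p by (subst prod.remove[of _ p]) auto
        also have "(\<Prod>i\<in>{..<m}-{p}. W i ((z(p := u)) i)) = (\<Prod>i\<in>{..<m}-{p}. W i (z i))"
          by (intro prod.cong) auto
        finally show ?thesis by (simp add: G_def W_def)
      qed
      then show "(\<integral>u. G (z(p := u)) \<partial>lborel) = 0" using \<rho>(3) by simp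
    qed
    finally show ?thesis by simp
  qed
  have "mixed_integral {..<m} (\<lambda>i. weighted (W i)) = (\<integral>z. f z - G z \<partial>?M)"
    unfolding mixed_integral_def f_mixed[symmetric] using f_int G_int G_zero by simp
  also have "\<bar>\<dots>\<bar> \<le> (\<integral>z. sqrt (real m) ^ m * (real m * (2 * \<kappa>)) * (\<Prod>i<m. h i (z i)) \<partial>?M)"
    by (rule integral_abs_le) (use bounds H_int in auto)
  also have "\<dots> \<le> sqrt (real m) ^ m * (real m * (2 * \<kappa>)) * (18 * airy_const * exp (2 * R) * \<kappa> * (1 + 9 * mass) ^ m)"
    unfolding integral_mult_right_zero using \<kappa> by (intro mult_left_mono H_val) auto
  finally show ?thesis by (simp add: W_def power2_eq_square mult_ac)
qed

lemma wnorm_short: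
  assumes d: "\<delta> \<in> borel_measurable borel" "\<And>x. \<bar>\<delta> x\<bar> \<le> indicator {x0<..x0 + \<kappa>} x"
    and \<kappa>: "0 \<le> \<kappa>" and x0: "- R \<le> x0"
  shows "wnorm \<delta> \<le> airy_const * exp (2 * R) * \<kappa>"
proof -
  have i: "integrable lborel (\<lambda>x. exp (2 * R) * indicator {x0<..x0 + \<kappa>} x)"
    by (intro integrable_mult_right integrable_real_indicator) (use \<kappa> in auto)
  have "(\<integral>x. \<bar>\<delta> x\<bar> * exp (- (2 * x)) \<partial>lborel) \<le> (\<integral>x. exp (2 * R) * indicator {x0<..x0 + \<kappa>} x \<partial>lborel)"
  proof (rule integral_mono'[OF i])
    fix x
    show "\<bar>\<delta> x\<bar> * exp (- (2 * x)) \<le> exp (2 * R) * indicator {x0<..x0 + \<kappa>} x"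
    proof (cases "x \<in> {x0<..x0 + \<kappa>}")
      case True
      then have "\<bar>\<delta> x\<bar> * exp (- (2 * x)) \<le> 1 * exp (2 * R)"
        using d(2)[of x] x0 by (intro mult_mono) auto
      then show ?thesis using True by simp
    next
      case False
      then show ?thesis using d(2)[of x] by simp
    qed
  qed (auto simp: indicator_def)
  also have "\<dots> = exp (2 * R) * \<kappa>" using \<kappa> by simp
  finally show ?thesis unfolding wnorm_def using airy_const_nonneg by (simp add: mult.assoc mult_left_mono)
qed

lemma weighted_diff: "weighted (\<lambda>x. f x - g x) = (\<lambda>x y. weighted f x y - weighted g x y)"
  by (simp add: weighted_def fun_eq_iff left_diff_distrib)

lemma mixed_weighted_scale:
  assumes "p < m"
  shows "mixed_integral {..<m} (\<lambda>i. weighted (if i = p then (\<lambda>x. q * d x) else f i)) =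
    q * mixed_integral {..<m} (\<lambda>i. weighted (if i = p then d else f i))"
proof -
  have "(\<Prod>i<m. (if i = p then (\<lambda>x. q * d x) else f i) (z i)) = q * (\<Prod>i<m. (if i = p then d else f i) (z i))" for z
  proof -
    have 1: "(\<Prod>i<m. (if i = p then d' else f i) (z i)) = d' (z p) * (\<Prod>i\<in>{..<m}-{p}. f i (z i))" for d'
      using assms by (subst prod.remove[of _ p]) (auto intro!: prod.cong)
    show ?thesis unfolding 1 by simp
  qed
  then show ?thesis
    unfolding mixed_integral_def mixed_weighted by (simp add: mult.assoc)
qed

text \<open>Exchanging the rows one by one writes each increment as a sum of determinants in which one row
  carries \<open>w1 - w0\<close> or \<open>v1 - v0\<close>. By \<open>change_background\<close> all other rows may be taken from \<open>v0\<close>. The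
  combination \<open>(w1 - w0) - q (v1 - v0)\<close> has mean zero and falls under \<open>mean_zero_slot\<close>. Both errors are
  of second order: \<open>\<kappa>\<close> times \<open>E\<close> and \<open>\<kappa>\<close> times \<open>\<kappa>\<close>.\<close>

lemma first_order_comparison:
  assumes w: "weight w0" "weight w1" and v: "weight v0" "weight v1"
    and dw: "\<And>x. \<bar>w1 x - w0 x\<bar> \<le> indicator {x0<..x0 + \<kappa>} x"
    and dv: "\<And>x. \<bar>v1 x - v0 x\<bar> \<le> indicator {x0<..x0 + \<kappa>} x"
    and q: "0 \<le> q" "q \<le> 1" "(\<integral>x. w1 x - w0 x \<partial>lborel) = q * (\<integral>x. v1 x - v0 x \<partial>lborel)"
    and \<kappa>: "0 \<le> \<kappa>" "\<kappa> \<le> 1" and x0: "- R \<le> x0"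
    and E: "wnorm (\<lambda>x. w0 x - v0 x) \<le> E" "wnorm (\<lambda>x. w1 x - v0 x) \<le> E" "wnorm (\<lambda>x. v1 x - v0 x) \<le> E"
  shows "\<bar>(fredholm_det lborel (weighted w1) - fredholm_det lborel (weighted w0)) -
      q * (fredholm_det lborel (weighted v1) - fredholm_det lborel (weighted v0))\<bar> \<le>
    fred_const (1 + 18 * mass) * (airy_const * exp (2 * R) * \<kappa> * (2 * E + 36 * \<kappa>))"
proof -
  have E0: "0 \<le> E" using E(1) wnorm_nonneg order_trans by blast
  define dW dV where "dW x = w1 x - w0 x" and "dV x = v1 x - v0 x" for x
  note wm[measurable] = weight_measurable[OF w(1)] weight_measurable[OF w(2)]
    weight_measurable[OF v(1)] weight_measurable[OF v(2)]
  have ind_c: "indicator {x0<..x0 + \<kappa>} x \<le> c * indicator {- R<..} x" for x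
    using c_ge_2 x0 by (auto simp: indicator_def)
  have short_weight: "weight d" if "d \<in> borel_measurable borel" "\<And>x. \<bar>d x\<bar> \<le> indicator {x0<..x0 + \<kappa>} x" for d
    unfolding weight_def using that order_trans[OF that(2) ind_c] by auto
  have short_int: "integrable lborel d" if "d \<in> borel_measurable borel" "\<And>x. \<bar>d x\<bar> \<le> indicator {x0<..x0 + \<kappa>} x" for d :: "real \<Rightarrow> real"
  proof (rule Bochner_Integration.integrable_bound)
    show "integrable lborel (\<lambda>x. indicator {x0<..x0 + \<kappa>} x :: real)"
      by (intro integrable_real_indicator) (use \<kappa> in auto)
  qed (use that in auto)
  have dWm: "dW \<in> borel_measurable borel" "dV \<in> borel_measurable borel"
    unfolding dW_def[abs_def] dV_def[abs_def] by measurable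
  have dW_bd: "\<bar>dW x\<bar> \<le> indicator {x0<..x0 + \<kappa>} x" and dV_bd: "\<bar>dV x\<bar> \<le> indicator {x0<..x0 + \<kappa>} x" for x
    using dw dv by (auto simp: dW_def dV_def)
  have dwt: "weight dW" "weight dV" using short_weight dWm dW_bd dV_bd by auto
  have qdV: "weight (\<lambda>x. q * dV x)"
  proof (rule short_weight)
    fix x
    have "q * \<bar>dV x\<bar> \<le> 1 * \<bar>dV x\<bar>" using q by (intro mult_right_mono) auto
    then show "\<bar>q * dV x\<bar> \<le> indicator {x0<..x0 + \<kappa>} x" using dV_bd[of x] q by (simp add: abs_mult)
  qed (use dWm in simp)
  define S where "S m p f g d = mixed_integral {..<m} (\<lambda>i. weighted (if i = p then d else if i < p then f else g))"
    for m p :: nat and f g d :: "real \<Rightarrow> real"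
  have tele: "mixed_integral {..<m} (\<lambda>_. weighted f) - mixed_integral {..<m} (\<lambda>_. weighted g) =
      (\<Sum>p<m. S m p f g (\<lambda>x. f x - g x))" if f: "weight f" and g: "weight g" for m f g
  proof -
    define h where "h p = (\<lambda>i::nat. if i < p then weighted f else weighted g)" for p :: nat
    have h: "dominated (h p i)" for p i using f g weight_dominated by (simp add: h_def)
    have "mixed_integral {..<m} (\<lambda>_. weighted f) - mixed_integral {..<m} (\<lambda>_. weighted g) =
        mixed_integral {..<m} (h m) - mixed_integral {..<m} (h 0)"
      by (auto simp: h_def intro!: arg_cong2[of _ _ _ _ "(-)"] mixed_integral_cong)
    also have "\<dots> = (\<Sum>p<m. mixed_integral {..<m} (h (Suc p)) - mixed_integral {..<m} (h p))"
      by (rule sum_lessThan_telescope[symmetric])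
    also have "\<dots> = (\<Sum>p<m. S m p f g (\<lambda>x. f x - g x))"
    proof (intro sum.cong refl)
      fix p assume p: "p \<in> {..<m}"
      have "h (Suc p) = (h p)(p := weighted f)" "h p = (h p)(p := weighted g)" by (auto simp: h_def)
      then have "mixed_integral {..<m} (h (Suc p)) - mixed_integral {..<m} (h p) =
          mixed_integral {..<m} ((h p)(p := \<lambda>z z'. weighted f z z' - weighted g z z'))"
        using mixed_integral_row_diff[of "{..<m}" p "h p" "weighted f" "weighted g"] p h weight_dominated f g
        by simp
      also have "\<dots> = S m p f g (\<lambda>x. f x - g x)"
        unfolding S_def by (intro mixed_integral_cong) (auto simp: h_def weighted_diff)
      finally show "mixed_integral {..<m} (h (Suc p)) - mixed_integral {..<m} (h p) = S m p f g (\<lambda>x. f x - g x)" .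
    qed
    finally show ?thesis .
  qed
  let ?X = "airy_const * exp (2 * R) * \<kappa>"
  have X0: "0 \<le> ?X" using airy_const_nonneg \<kappa> by auto
  have m9: "(1 + mass) ^ m \<le> (1 + 9 * mass) ^ m" for m :: nat using mass_nonneg by (intro power_mono) auto
  have wn0: "wnorm (\<lambda>x. f x - f x) \<le> E" for f using E0 by (simp add: wnorm_def)
  have A: "\<bar>S m p f g d - S m p v0 v0 d\<bar> \<le> sqrt (real m) ^ m * (real m * (E * ?X * (1 + 9 * mass) ^ m))"
    if p: "p < m" and f: "weight f" "wnorm (\<lambda>x. f x - v0 x) \<le> E" and g: "weight g" "wnorm (\<lambda>x. g x - v0 x) \<le> E"
      and d: "d \<in> borel_measurable borel" "\<And>x. \<bar>d x\<bar> \<le> indicator {x0<..x0 + \<kappa>} x" for m p f g d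
  proof -
    have dw: "weight d" by (rule short_weight[OF d])
    have "\<bar>S m p f g d - S m p v0 v0 d\<bar> \<le> sqrt (real m) ^ m * (real m * (E * wnorm d * (1 + mass) ^ m))"
      unfolding S_def
      by (rule change_background[OF _ _ p, where \<delta> = d]) (use f g v dw E0 in auto)
    also have "\<dots> \<le> sqrt (real m) ^ m * (real m * (E * ?X * (1 + 9 * mass) ^ m))"
      using wnorm_short[OF d \<kappa>(1) x0] E0 X0 mass_nonneg
      by (intro mult_left_mono mult_mono m9) auto
    finally show ?thesis .
  qed
  have B: "\<bar>S m p v0 v0 dW - q * S m p v0 v0 dV\<bar> \<le>
      sqrt (real m) ^ m * (real m * (36 * airy_const * exp (2 * R) * \<kappa>\<^sup>2) * (1 + 9 * mass) ^ m)" if p: "p < m" for m p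
  proof -
    have "q * S m p v0 v0 dV = S m p v0 v0 (\<lambda>x. q * dV x)"
      unfolding S_def if_cancel by (rule mixed_weighted_scale[OF p, symmetric])
    also have "S m p v0 v0 dW - \<dots> = S m p v0 v0 (\<lambda>x. dW x - q * dV x)"
    proof -
      let ?h = "\<lambda>i::nat. weighted v0"
      have "S m p v0 v0 d = mixed_integral {..<m} (?h(p := weighted d))" for d
        unfolding S_def by (intro mixed_integral_cong) auto
      then show ?thesis
        using mixed_integral_row_diff[of "{..<m}" p ?h "weighted dW" "weighted (\<lambda>x. q * dV x)"] p
          weight_dominated v dwt qdV by (simp add: weighted_diff)
    qed
    also have "\<bar>\<dots>\<bar> \<le> sqrt (real m) ^ m * (real m * (36 * airy_const * exp (2 * R) * \<kappa>\<^sup>2) * (1 + 9 * mass) ^ m)"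
      unfolding S_def if_cancel
    proof (rule mean_zero_slot[OF v(1) p _ _ _ \<kappa> x0])
      show "(\<lambda>x. dW x - q * dV x) \<in> borel_measurable borel" using dWm by simp
      show "\<bar>dW x - q * dV x\<bar> \<le> 2 * indicator {x0<..x0 + \<kappa>} x" for x
      proof -
        have "q * \<bar>dV x\<bar> \<le> 1 * \<bar>dV x\<bar>" using q by (intro mult_right_mono) auto
        then have "\<bar>q * dV x\<bar> \<le> indicator {x0<..x0 + \<kappa>} x" using dV_bd[of x] q by (simp add: abs_mult)
        then show ?thesis using dW_bd[of x] by linarith
      qed
      show "(\<integral>x. dW x - q * dV x \<partial>lborel) = 0"
        using q(3) short_int[OF dWm(1) dW_bd] short_int[OF dWm(2) dV_bd]
        by (simp add: dW_def dV_def)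
    qed
    finally show ?thesis .
  qed
  define Y where "Y = ?X * (2 * E + 36 * \<kappa>)"
  have Y0: "0 \<le> Y" unfolding Y_def using E0 \<kappa> by (intro mult_nonneg_nonneg[OF X0]) auto
  let ?J = "\<lambda>m f. mixed_integral {..<m} (\<lambda>_. weighted f)"
  have Q: "\<bar>(?J m w1 - ?J m w0) - q * (?J m v1 - ?J m v0)\<bar> \<le>
      real m * (real m * (sqrt (real m) ^ m * (1 + 9 * mass) ^ m * Y))" for m
  proof -
    have eq: "(?J m w1 - ?J m w0) - q * (?J m v1 - ?J m v0) =
        (\<Sum>p<m. S m p w1 w0 dW - q * S m p v1 v0 dV)"
      using tele[OF w(2) w(1), of m] tele[OF v(2) v(1), of m]
      by (simp add: dW_def[abs_def, symmetric] dV_def[abs_def, symmetric] sum_subtractf sum_distrib_left)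
    have each: "\<bar>S m p w1 w0 dW - q * S m p v1 v0 dV\<bar> \<le> real m * (sqrt (real m) ^ m * (1 + 9 * mass) ^ m * Y)"
      if p: "p < m" for p
    proof -
      let ?U = "sqrt (real m) ^ m * (real m * (E * ?X * (1 + 9 * mass) ^ m))"
      have 1: "\<bar>S m p w1 w0 dW - S m p v0 v0 dW\<bar> \<le> ?U"
        by (rule A[OF p w(2) E(2) w(1) E(1) dWm(1) dW_bd])
      have 2: "\<bar>S m p v1 v0 dV - S m p v0 v0 dV\<bar> \<le> ?U"
        by (rule A[OF p v(2) E(3) v(1) wn0 dWm(2) dV_bd])
      have 3: "\<bar>q * S m p v1 v0 dV - q * S m p v0 v0 dV\<bar> \<le> ?U"
      proof -
        have "\<bar>q * S m p v1 v0 dV - q * S m p v0 v0 dV\<bar> = q * \<bar>S m p v1 v0 dV - S m p v0 v0 dV\<bar>"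
          using q by (simp add: right_diff_distrib[symmetric] abs_mult)
        also have "\<dots> \<le> 1 * \<bar>S m p v1 v0 dV - S m p v0 v0 dV\<bar>" using q by (intro mult_right_mono) auto
        finally show ?thesis using 2 by simp
      qed
      have "\<bar>S m p w1 w0 dW - q * S m p v1 v0 dV\<bar> \<le> ?U + ?U +
          sqrt (real m) ^ m * (real m * (36 * airy_const * exp (2 * R) * \<kappa>\<^sup>2) * (1 + 9 * mass) ^ m)"
        using 1 3 B[OF p] by linarith
      also have "\<dots> = real m * (sqrt (real m) ^ m * (1 + 9 * mass) ^ m * Y)"
        by (simp add: Y_def power2_eq_square algebra_simps)
      finally show ?thesis .
    qed
    have "\<bar>\<Sum>p<m. S m p w1 w0 dW - q * S m p v1 v0 dV\<bar> \<le>
        (\<Sum>p<m. real m * (sqrt (real m) ^ m * (1 + 9 * mass) ^ m * Y))"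
      by (intro order.trans[OF sum_abs] sum_mono each) auto
    then show ?thesis unfolding eq by simp
  qed
  let ?c = "\<lambda>m. real m * (sqrt (real m) ^ m * (1 + (1 + 18 * mass)) ^ m) / fact m"
  let ?t = "\<lambda>m. (- 1) ^ m / fact m * ?J m w1 - (- 1) ^ m / fact m * ?J m w0 -
    q * ((- 1) ^ m / fact m * ?J m v1 - (- 1) ^ m / fact m * ?J m v0)"
  have sc: "summable ?c" by (rule summable_hadamard) (use mass_nonneg in simp)
  have t_bd: "norm (?t m) \<le> ?c m * Y" for m
  proof -
    have "?t m = (- 1) ^ m / fact m * ((?J m w1 - ?J m w0) - q * (?J m v1 - ?J m v0))"
      by (simp add: algebra_simps)
    then have "norm (?t m) = \<bar>(?J m w1 - ?J m w0) - q * (?J m v1 - ?J m v0)\<bar> / fact m"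
      by (simp add: abs_mult)
    also have "\<dots> \<le> real m * (real m * (sqrt (real m) ^ m * (1 + 9 * mass) ^ m * Y)) / fact m"
      by (intro divide_right_mono Q) simp
    \<comment> \<open>One of the two factors \<open>m\<close> is absorbed by \<open>2 ^ m\<close>, so that the series is the one in \<open>fred_const\<close>.\<close>
    also have "\<dots> \<le> real m * (2 ^ m * (sqrt (real m) ^ m * (1 + 9 * mass) ^ m * Y)) / fact m"
      using Y0 mass_nonneg of_nat_less_two_power[of m, where ?'a = real]
      by (intro divide_right_mono mult_left_mono mult_right_mono) (auto intro: less_imp_le)
    also have "2 ^ m * (sqrt (real m) ^ m * (1 + 9 * mass) ^ m * Y) = sqrt (real m) ^ m * (1 + (1 + 18 * mass)) ^ m * Y"
      by (simp add: mult_ac power_mult_distrib[symmetric] algebra_simps)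
    finally show ?thesis by simp
  qed
  have s: "?t sums ((fredholm_det lborel (weighted w1) - fredholm_det lborel (weighted w0)) -
      q * (fredholm_det lborel (weighted v1) - fredholm_det lborel (weighted v0)))"
    by (intro sums_diff sums_mult fredholm_sums weight_dominated w v)
  have "norm ((fredholm_det lborel (weighted w1) - fredholm_det lborel (weighted w0)) -
      q * (fredholm_det lborel (weighted v1) - fredholm_det lborel (weighted v0))) \<le> (\<Sum>m. ?c m * Y)"
    unfolding sums_unique[OF s] by (rule norm_suminf_le[OF t_bd summable_mult2[OF sc]])
  also have "\<dots> = fred_const (1 + 18 * mass) * Y"
    unfolding fred_const_def by (rule suminf_mult2[OF sc, symmetric])
  finally show ?thesis by (simp add: Y_def)
qed

end

section \<open>Superposition of the time layers, and transposition\<close>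

lemma ldet_columns_scale:
  "ldet I (\<lambda>i j. k i j * c j) = ldet I k * (\<Prod>i\<in>I. c i)"
proof -
  have "(\<Prod>i\<in>I. k i (\<pi> i) * c (\<pi> i)) = (\<Prod>i\<in>I. k i (\<pi> i)) * (\<Prod>i\<in>I. c i)" if "\<pi> permutes I" for \<pi>
    using prod.permute[OF that, of c] by (simp add: prod.distrib comp_def)
  then show ?thesis unfolding ldet_def sum_distrib_right by (intro sum.cong refl) simp
qed

lemma ldet_transpose:
  assumes "finite I"
  shows "ldet I (\<lambda>i j. k j i) = ldet I k"
proof -
  have "ldet I (\<lambda>i j. k j i) = (\<Sum>\<pi> | \<pi> permutes I. of_int (sign (Hilbert_Choice.inv \<pi>)) * (\<Prod>i\<in>I. k (Hilbert_Choice.inv \<pi> i) i))"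
    unfolding ldet_def by (rule sum_permutations_inverse)
  also have "\<dots> = ldet I k"
    unfolding ldet_def
  proof (intro sum.cong refl arg_cong2[of _ _ _ _ "(*)"])
    fix \<pi> assume "\<pi> \<in> {\<pi>. \<pi> permutes I}"
    then have p: "\<pi> permutes I" by simp
    show "real_of_int (sign (Hilbert_Choice.inv \<pi>)) = of_int (sign \<pi>)"
      using permutes_imp_permutation[OF assms p] by (simp add: sign_inverse)
    have "(\<Prod>i\<in>I. k (Hilbert_Choice.inv \<pi> i) i) = (\<Prod>i\<in>I. k (Hilbert_Choice.inv \<pi> (\<pi> i)) (\<pi> i))"
      using prod.permute[OF p, of "\<lambda>i. k (Hilbert_Choice.inv \<pi> i) i"] by (simp add: comp_def)
    then show "(\<Prod>i\<in>I. k (Hilbert_Choice.inv \<pi> i) i) = (\<Prod>i\<in>I. k i (\<pi> i))"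
      using permutes_inverses[OF p] by simp
  qed
  finally show ?thesis .
qed

lemma fredholm_det_ldet:
  "fredholm_det \<mu> k = (\<Sum>m. (- 1) ^ m / fact m *
     (\<integral>z. ldet {..<m} (\<lambda>i j. k (z i) (z j)) \<partial>(\<Pi>\<^sub>M i\<in>{..<m}. \<mu>)))"
  unfolding fredholm_det_def det_mat_eq_ldet ..

text \<open>The row factors and the column factors of a determinant have the same product.\<close>

lemma fredholm_det_drop_columns:
  assumes "\<And>z. c z * c z = c z"
  shows "fredholm_det \<mu> (\<lambda>z z'. c z * k z z' * c z') = fredholm_det \<mu> (\<lambda>z z'. c z * k z z')"
proof -
  have "ldet I (\<lambda>i j. c (z i) * k (z i) (z j) * c (z j)) = ldet I (\<lambda>i j. c (z i) * k (z i) (z j))"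
    for I :: "nat set" and z
  proof -
    have "(\<Prod>i\<in>I. c (z i)) * (\<Prod>i\<in>I. c (z i)) = (\<Prod>i\<in>I. c (z i))"
      unfolding prod.distrib[symmetric] assms ..
    then show ?thesis
      unfolding ldet_columns_scale[where c = "\<lambda>j. c (z j)"] ldet_rows_scale[where w = "\<lambda>i. c (z i)"]
      by (auto simp: mult_ac)
  qed
  then show ?thesis unfolding fredholm_det_ldet by simp
qed

lemma density_PiM:
  fixes f :: "'a \<Rightarrow> real"
  assumes M: "sigma_finite_measure M" and f[measurable]: "f \<in> borel_measurable M" and pos: "\<And>x. 0 \<le> f x"
    and I: "finite I"
  shows "(\<Pi>\<^sub>M i\<in>I. density M (\<lambda>x. ennreal (f x))) = density (\<Pi>\<^sub>M i\<in>I. M) (\<lambda>z. ennreal (\<Prod>i\<in>I. f (z i)))"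
proof (rule product_sigma_finite.PiM_eqI[symmetric])
  interpret M: sigma_finite_measure M by fact
  interpret P: product_sigma_finite "\<lambda>_. M" by (simp add: product_sigma_finite_def M)
  have "sigma_finite_measure (density M (\<lambda>x. ennreal (f x)))"
    using M.sigma_finite_iff_density_finite[of "\<lambda>x. ennreal (f x)"] by simp
  then show "product_sigma_finite (\<lambda>_. density M (\<lambda>x. ennreal (f x)))" by (simp add: product_sigma_finite_def)
  show "sets (density (\<Pi>\<^sub>M i\<in>I. M) (\<lambda>z. ennreal (\<Prod>i\<in>I. f (z i)))) = sets (\<Pi>\<^sub>M i\<in>I. density M (\<lambda>x. ennreal (f x)))"
    by (simp cong: sets_PiM_cong)
  fix A assume A: "\<And>i. i \<in> I \<Longrightarrow> A i \<in> sets (density M (\<lambda>x. ennreal (f x)))"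
  then have A': "\<And>i. i \<in> I \<Longrightarrow> A i \<in> sets M" by simp
  have meas: "(\<lambda>z. ennreal (\<Prod>i\<in>I. f (z i))) \<in> borel_measurable (\<Pi>\<^sub>M i\<in>I. M)"
  proof -
    have "(\<lambda>z. f (z i)) \<in> borel_measurable (\<Pi>\<^sub>M i\<in>I. M)" if "i \<in> I" for i
      using measurable_compose[OF measurable_component_singleton[OF that] f] .
    then show ?thesis by (intro measurable_compose[OF borel_measurable_prod measurable_ennreal]) auto
  qed
  have "emeasure (density (\<Pi>\<^sub>M i\<in>I. M) (\<lambda>z. ennreal (\<Prod>i\<in>I. f (z i)))) (Pi\<^sub>E I A) =
      (\<integral>\<^sup>+z. ennreal (\<Prod>i\<in>I. f (z i)) * indicator (Pi\<^sub>E I A) z \<partial>(\<Pi>\<^sub>M i\<in>I. M))"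
    using A' I by (intro emeasure_density meas) (auto intro!: sets_PiM_I_finite)
  also have "\<dots> = (\<integral>\<^sup>+z. (\<Prod>i\<in>I. ennreal (f (z i)) * indicator (A i) (z i)) \<partial>(\<Pi>\<^sub>M i\<in>I. M))"
  proof (intro nn_integral_cong)
    fix z assume z: "z \<in> space (\<Pi>\<^sub>M i\<in>I. M)"
    have "indicator (Pi\<^sub>E I A) z = (\<Prod>i\<in>I. indicator (A i) (z i) :: ennreal)"
    proof (cases "\<forall>i\<in>I. z i \<in> A i")
      case True
      then show ?thesis using z by (auto simp: space_PiM PiE_iff)
    next
      case False
      then obtain j where "j \<in> I" "z j \<notin> A j" by auto
      then have "(\<Prod>i\<in>I. indicator (A i) (z i) :: ennreal) = 0" using I by (intro prod_zero bexI[of _ j]) auto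
      moreover have "z \<notin> Pi\<^sub>E I A" using \<open>j \<in> I\<close> \<open>z j \<notin> A j\<close> by auto
      ultimately show ?thesis by simp
    qed
    then show "ennreal (\<Prod>i\<in>I. f (z i)) * indicator (Pi\<^sub>E I A) z =
        (\<Prod>i\<in>I. ennreal (f (z i)) * indicator (A i) (z i))"
      using pos by (simp add: prod.distrib prod_ennreal)
  qed
  also have "\<dots> = (\<Prod>i\<in>I. \<integral>\<^sup>+x. ennreal (f x) * indicator (A i) x \<partial>M)"
    using A' I by (intro P.product_nn_integral_prod) auto
  also have "\<dots> = (\<Prod>i\<in>I. emeasure (density M (\<lambda>x. ennreal (f x))) (A i))"
    using A' by (intro prod.cong refl emeasure_density[symmetric]) auto
  finally show "emeasure (density (\<Pi>\<^sub>M i\<in>I. M) (\<lambda>z. ennreal (\<Prod>i\<in>I. f (z i)))) (Pi\<^sub>E I A) =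
      (\<Prod>i\<in>I. emeasure (density M (\<lambda>x. ennreal (f x))) (A i))" .
qed (rule I)

lemma distr_density_count_pair:
  fixes w :: "'i \<Rightarrow> real \<Rightarrow> real"
  assumes T: "finite T" and w: "\<And>t. t \<in> T \<Longrightarrow> w t \<in> borel_measurable borel" and pos: "\<And>t x. 0 \<le> w t x"
  shows "distr (density (count_space T \<Otimes>\<^sub>M lborel) (\<lambda>z. ennreal (w (fst z) (snd z)))) lborel snd =
    density lborel (\<lambda>x. ennreal (\<Sum>t\<in>T. w t x))"
proof (rule measure_eqI)
  interpret pair_sigma_finite "count_space T" "lborel :: real measure" using T by (rule pair_sigma_finite_count)
  have wm: "(\<lambda>z. w (fst z) (snd z)) \<in> borel_measurable (count_space T \<Otimes>\<^sub>M lborel)"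
    using count_pair_measurable[OF T w] by (simp add: case_prod_beta)
  have Wm: "(\<lambda>x. \<Sum>t\<in>T. w t x) \<in> borel_measurable borel" using w by (intro borel_measurable_sum) auto
  fix A assume "A \<in> sets (distr (density (count_space T \<Otimes>\<^sub>M lborel) (\<lambda>z. ennreal (w (fst z) (snd z)))) lborel snd)"
  then have A[measurable]: "A \<in> sets borel" by simp
  have sA: "snd -` A \<inter> space (count_space T \<Otimes>\<^sub>M lborel) \<in> sets (count_space T \<Otimes>\<^sub>M lborel)"
    by measurable
  have "emeasure (distr (density (count_space T \<Otimes>\<^sub>M lborel) (\<lambda>z. ennreal (w (fst z) (snd z)))) lborel snd) A =
      (\<integral>\<^sup>+z. ennreal (w (fst z) (snd z)) * indicator (snd -` A \<inter> space (count_space T \<Otimes>\<^sub>M lborel)) z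
        \<partial>(count_space T \<Otimes>\<^sub>M lborel))"
    using sA wm by (subst emeasure_distr) (auto simp: emeasure_density)
  also have "\<dots> = (\<integral>\<^sup>+z. ennreal (w (fst z) (snd z)) * indicator A (snd z) \<partial>(count_space T \<Otimes>\<^sub>M lborel))"
    by (intro nn_integral_cong) (auto simp: indicator_def)
  also have "\<dots> = (\<integral>\<^sup>+t. \<integral>\<^sup>+x. ennreal (w t x) * indicator A x \<partial>lborel \<partial>count_space T)"
  proof -
    have "(\<lambda>z. ennreal (w (fst z) (snd z)) * indicator A (snd z)) \<in> borel_measurable (count_space T \<Otimes>\<^sub>M lborel)"
      using wm by measurable
    from lborel.nn_integral_fst[OF this] show ?thesis by simp
  qed
  also have "\<dots> = (\<Sum>t\<in>T. \<integral>\<^sup>+x. ennreal (w t x) * indicator A x \<partial>lborel)"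
    using T by (rule nn_integral_count_space_finite)
  also have "\<dots> = (\<integral>\<^sup>+x. (\<Sum>t\<in>T. ennreal (w t x) * indicator A x) \<partial>lborel)"
    using w by (intro nn_integral_sum[symmetric]) auto
  also have "\<dots> = (\<integral>\<^sup>+x. ennreal (\<Sum>t\<in>T. w t x) * indicator A x \<partial>lborel)"
    using pos by (intro nn_integral_cong) (simp add: sum_distrib_right[symmetric] sum_ennreal)
  also have "\<dots> = emeasure (density lborel (\<lambda>x. ennreal (\<Sum>t\<in>T. w t x))) A"
    using Wm by (subst emeasure_density) auto
  finally show "emeasure (distr (density (count_space T \<Otimes>\<^sub>M lborel) (\<lambda>z. ennreal (w (fst z) (snd z)))) lborel snd) A =
      emeasure (density lborel (\<lambda>x. ennreal (\<Sum>t\<in>T. w t x))) A" .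
qed simp

text \<open>The weights become densities of the integration measures; the projection to the positions
  maps the weighted sum of the time layers to the measure with the summed density.\<close>

lemma fredholm_det_collapse:
  fixes w :: "'i \<Rightarrow> real \<Rightarrow> real" and k :: "real \<Rightarrow> real \<Rightarrow> real"
  assumes T: "finite T" and w: "\<And>t. t \<in> T \<Longrightarrow> w t \<in> borel_measurable borel" and pos: "\<And>t x. 0 \<le> w t x"
    and k: "case_prod k \<in> borel_measurable (borel \<Otimes>\<^sub>M borel)"
  shows "fredholm_det (count_space T \<Otimes>\<^sub>M lborel) (\<lambda>(t, x) (t', y). w t x * k x y) =
    fredholm_det lborel (\<lambda>x y. (\<Sum>t\<in>T. w t x) * k x y)"
proof -
  let ?Z = "count_space T \<Otimes>\<^sub>M (lborel :: real measure)"
  let ?w = "\<lambda>z. w (fst z) (snd z)" and ?W = "\<lambda>x. \<Sum>t\<in>T. w t x"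
  have wm[measurable]: "?w \<in> borel_measurable ?Z"
    using count_pair_measurable[OF T w] by (simp add: case_prod_beta)
  have Wm[measurable]: "?W \<in> borel_measurable borel" using w by (intro borel_measurable_sum) auto
  have Wm': "?W \<in> borel_measurable lborel" using Wm by simp
  have Wpos: "0 \<le> ?W x" for x using pos by (intro sum_nonneg) auto
  have Zs: "sigma_finite_measure ?Z" using T by (rule count_pair_sigma_finite)
  interpret Z: sigma_finite_measure ?Z by (rule Zs)
  have Zw: "sigma_finite_measure (density ?Z (\<lambda>z. ennreal (?w z)))"
    using Z.sigma_finite_iff_density_finite[of "\<lambda>z. ennreal (?w z)"] by simp
  have dW: "distr (density ?Z (\<lambda>z. ennreal (?w z))) lborel snd = density lborel (\<lambda>x. ennreal (?W x))"
    by (rule distr_density_count_pair[OF T w pos])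
  have LW: "sigma_finite_measure (density lborel (\<lambda>x. ennreal (?W x)))"
    using sigma_finite_measure.sigma_finite_iff_density_finite[OF sigma_finite_lborel, of "\<lambda>x. ennreal (?W x)"] by simp
  have terms: "(\<integral>z. ldet {..<m} (\<lambda>i j. (\<lambda>(t, x) (t', y). w t x * k x y) (z i) (z j)) \<partial>(\<Pi>\<^sub>M i\<in>{..<m}. ?Z)) =
      (\<integral>x. ldet {..<m} (\<lambda>i j. ?W (x i) * k (x i) (x j)) \<partial>(\<Pi>\<^sub>M i\<in>{..<m}. lborel))" for m :: nat
  proof -
    let ?I = "{..<m}"
    define F where "F x = ldet ?I (\<lambda>i j. k (x i) (x j))" for x :: "nat \<Rightarrow> real"
    let ?p = "\<lambda>z. \<lambda>i\<in>?I. snd (z i) :: real"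
    have Fm: "F \<in> borel_measurable (\<Pi>\<^sub>M i\<in>?I. lborel)"
    proof -
      have "(\<lambda>x. k (x i) (x j)) \<in> borel_measurable (\<Pi>\<^sub>M i\<in>?I. lborel)" if "i \<in> ?I" "j \<in> ?I" for i j
      proof -
        have "(\<lambda>x. (x i, x j)) \<in> measurable (\<Pi>\<^sub>M i\<in>?I. lborel) (borel \<Otimes>\<^sub>M borel)"
          using measurable_component_singleton[OF that(1), of "\<lambda>_. lborel"]
            measurable_component_singleton[OF that(2), of "\<lambda>_. lborel"] by (intro measurable_Pair) auto
        from measurable_compose[OF this k] show ?thesis by simp
      qed
      then show ?thesis
        unfolding F_def ldet_def
        by (intro borel_measurable_sum borel_measurable_times borel_measurable_const borel_measurable_prod)
          (auto simp: permutes_nat_less)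
    qed
    have pm: "?p \<in> measurable (\<Pi>\<^sub>M i\<in>?I. ?Z) (\<Pi>\<^sub>M i\<in>?I. lborel)"
    proof (rule measurable_restrict)
      fix i assume "i \<in> ?I"
      from measurable_compose[OF measurable_component_singleton[OF this] measurable_snd]
      show "(\<lambda>z. snd (z i)) \<in> measurable (\<Pi>\<^sub>M i\<in>?I. ?Z) lborel" .
    qed
    have prodm: "(\<lambda>z. \<Prod>i\<in>?I. ?w (z i)) \<in> borel_measurable (\<Pi>\<^sub>M i\<in>?I. ?Z)"
    proof (intro borel_measurable_prod)
      fix i assume "i \<in> ?I"
      from measurable_component_singleton[OF this, of "\<lambda>_. ?Z"]
      have "(\<lambda>z. z i) \<in> measurable (\<Pi>\<^sub>M i\<in>?I. ?Z) ?Z" .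
      from measurable_compose[OF this wm] show "(\<lambda>z. ?w (z i)) \<in> borel_measurable (\<Pi>\<^sub>M i\<in>?I. ?Z)" .
    qed
    have prodW: "(\<lambda>x. \<Prod>i\<in>?I. ?W (x i)) \<in> borel_measurable (\<Pi>\<^sub>M i\<in>?I. lborel)"
    proof (intro borel_measurable_prod)
      fix i assume "i \<in> ?I"
      from measurable_component_singleton[OF this, of "\<lambda>_. lborel"]
      have "(\<lambda>x. x i) \<in> borel_measurable (\<Pi>\<^sub>M i\<in>?I. (lborel :: real measure))" by simp
      from measurable_compose[OF this Wm] show "(\<lambda>x. ?W (x i)) \<in> borel_measurable (\<Pi>\<^sub>M i\<in>?I. lborel)" .
    qed
    have meas: "distr (density (\<Pi>\<^sub>M i\<in>?I. ?Z) (\<lambda>z. ennreal (\<Prod>i\<in>?I. ?w (z i)))) (\<Pi>\<^sub>M i\<in>?I. lborel) ?p =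
        density (\<Pi>\<^sub>M i\<in>?I. lborel) (\<lambda>x. ennreal (\<Prod>i\<in>?I. ?W (x i)))"
    proof -
      have "distr (\<Pi>\<^sub>M i\<in>?I. density ?Z (\<lambda>z. ennreal (?w z))) (\<Pi>\<^sub>M i\<in>?I. lborel) ?p =
          (\<Pi>\<^sub>M i\<in>?I. distr (density ?Z (\<lambda>z. ennreal (?w z))) lborel snd)"
        by (rule distr_PiM_reindex_map[OF Zw, where g = "\<lambda>i. i"]) (auto simp: dW LW bij_betw_def)
      then show ?thesis
        unfolding dW density_PiM[OF Zs wm pos finite_lessThan]
          density_PiM[OF sigma_finite_lborel Wm' Wpos finite_lessThan] .
    qed
    have "(\<integral>z. ldet ?I (\<lambda>i j. (\<lambda>(t, x) (t', y). w t x * k x y) (z i) (z j)) \<partial>(\<Pi>\<^sub>M i\<in>?I. ?Z)) =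
        (\<integral>z. (\<Prod>i\<in>?I. ?w (z i)) * F (?p z) \<partial>(\<Pi>\<^sub>M i\<in>?I. ?Z))"
    proof (intro Bochner_Integration.integral_cong refl)
      fix z :: "nat \<Rightarrow> 'i \<times> real"
      have "F (?p z) = ldet ?I (\<lambda>i j. k (snd (z i)) (snd (z j)))"
        unfolding F_def by (intro ldet_cong) auto
      then show "ldet ?I (\<lambda>i j. (\<lambda>(t, x) (t', y). w t x * k x y) (z i) (z j)) =
          (\<Prod>i\<in>?I. ?w (z i)) * F (?p z)"
        by (simp add: case_prod_beta ldet_rows_scale)
    qed
    also have "\<dots> = (\<integral>z. F (?p z) \<partial>density (\<Pi>\<^sub>M i\<in>?I. ?Z) (\<lambda>z. ennreal (\<Prod>i\<in>?I. ?w (z i))))"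
      using measurable_compose[OF pm Fm] prodm pos by (subst integral_density) (auto intro!: prod_nonneg AE_I2)
    also have "\<dots> = (\<integral>x. F x \<partial>distr (density (\<Pi>\<^sub>M i\<in>?I. ?Z) (\<lambda>z. ennreal (\<Prod>i\<in>?I. ?w (z i)))) (\<Pi>\<^sub>M i\<in>?I. lborel) ?p)"
      using pm Fm by (subst integral_distr) auto
    also have "\<dots> = (\<integral>x. (\<Prod>i\<in>?I. ?W (x i)) * F x \<partial>(\<Pi>\<^sub>M i\<in>?I. lborel))"
      unfolding meas using Fm prodW Wpos by (subst integral_density) (auto intro!: prod_nonneg AE_I2)
    also have "\<dots> = (\<integral>x. ldet ?I (\<lambda>i j. ?W (x i) * k (x i) (x j)) \<partial>(\<Pi>\<^sub>M i\<in>?I. lborel))"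
      by (simp add: F_def ldet_rows_scale)
    finally show ?thesis .
  qed
  show ?thesis unfolding fredholm_det_ldet terms ..
qed

text \<open>Transposition does not change the determinants, and \<open>t \<mapsto> - t\<close> preserves the counting measure.\<close>

lemma fredholm_det_reflect:
  assumes T: "finite T" and k: "case_prod k \<in>
      borel_measurable ((count_space (uminus ` T) \<Otimes>\<^sub>M lborel) \<Otimes>\<^sub>M (count_space (uminus ` T) \<Otimes>\<^sub>M lborel))"
  shows "fredholm_det (count_space T \<Otimes>\<^sub>M lborel) (\<lambda>(t, x) (t', y). k (- t', y) (- t, x)) =
    fredholm_det (count_space (uminus ` T :: real set) \<Otimes>\<^sub>M (lborel :: real measure)) k"
proof -
  let ?Z = "count_space T \<Otimes>\<^sub>M (lborel :: real measure)"
  let ?Z' = "count_space (uminus ` T) \<Otimes>\<^sub>M (lborel :: real measure)"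
  define f where "f = (\<lambda>z :: real \<times> real. (- fst z, snd z))"
  have T': "finite (uminus ` T)" using T by simp
  have fm: "f \<in> measurable ?Z ?Z'"
  proof -
    have "(\<lambda>z. - fst z) \<in> measurable ?Z (count_space (uminus ` T))"
      by (rule measurable_compose[OF measurable_fst]) auto
    then show ?thesis unfolding f_def by measurable
  qed
  have df: "distr ?Z ?Z' f = ?Z'"
  proof -
    have "distr (count_space T) (count_space (uminus ` T)) uminus = count_space (uminus ` T)"
      by (rule distr_bij_count_space) (auto simp: bij_betw_def)
    moreover have "distr lborel lborel (\<lambda>x. x) = (lborel :: real measure)" by (rule distr_id2) simp
    moreover have "distr (count_space T) (count_space (uminus ` T)) uminus \<Otimes>\<^sub>M distr lborel lborel (\<lambda>x. x :: real) =
        distr ?Z ?Z' (\<lambda>(t, x). (- t, x))"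
      using T T' by (intro pair_measure_distr)
        (auto simp: \<open>distr lborel lborel (\<lambda>x. x) = lborel\<close> sigma_finite_lborel)
    ultimately show ?thesis by (simp add: f_def case_prod_beta')
  qed
  have terms: "(\<integral>z. ldet {..<m} (\<lambda>i j. (\<lambda>(t, x) (t', y). k (- t', y) (- t, x)) (z i) (z j)) \<partial>(\<Pi>\<^sub>M i\<in>{..<m}. ?Z)) =
      (\<integral>z. ldet {..<m} (\<lambda>i j. k (z i) (z j)) \<partial>(\<Pi>\<^sub>M i\<in>{..<m}. ?Z'))" for m :: nat
  proof -
    let ?I = "{..<m}"
    let ?p = "\<lambda>z. \<lambda>i\<in>?I. f (z i)"
    have pm: "?p \<in> measurable (\<Pi>\<^sub>M i\<in>?I. ?Z) (\<Pi>\<^sub>M i\<in>?I. ?Z')"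
    proof (rule measurable_restrict)
      fix i assume "i \<in> ?I"
      from measurable_component_singleton[OF this, of "\<lambda>_. ?Z"]
      have "(\<lambda>z. z i) \<in> measurable (\<Pi>\<^sub>M i\<in>?I. ?Z) ?Z" .
      from measurable_compose[OF this fm] show "(\<lambda>z. f (z i)) \<in> measurable (\<Pi>\<^sub>M i\<in>?I. ?Z) ?Z'" .
    qed
    have Fm: "(\<lambda>z. ldet ?I (\<lambda>i j. k (z i) (z j))) \<in> borel_measurable (\<Pi>\<^sub>M i\<in>?I. ?Z')"
    proof -
      have "(\<lambda>z. k (z i) (z j)) \<in> borel_measurable (\<Pi>\<^sub>M i\<in>?I. ?Z')" if "i \<in> ?I" "j \<in> ?I" for i j
        using measurable_compose[OF measurable_Pair[OF measurable_component_singleton[OF that(1)]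
            measurable_component_singleton[OF that(2)]] k] by simp
      then show ?thesis
        unfolding ldet_def
        by (intro borel_measurable_sum borel_measurable_times borel_measurable_const borel_measurable_prod)
          (auto simp: permutes_nat_less)
    qed
    have d: "(\<Pi>\<^sub>M i\<in>?I. ?Z') = distr (\<Pi>\<^sub>M i\<in>?I. ?Z) (\<Pi>\<^sub>M i\<in>?I. ?Z') ?p"
      using distr_PiM_reindex_map[of ?Z ?Z' f ?I "\<lambda>i. i" ?I] count_pair_sigma_finite[OF T]
        count_pair_sigma_finite[OF T'] fm by (simp add: df bij_betw_def)
    have "(\<integral>z. ldet ?I (\<lambda>i j. k (z i) (z j)) \<partial>(\<Pi>\<^sub>M i\<in>?I. ?Z')) =
        (\<integral>z. ldet ?I (\<lambda>i j. k (?p z i) (?p z j)) \<partial>(\<Pi>\<^sub>M i\<in>?I. ?Z))"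
      by (subst d, rule integral_distr[OF pm Fm])
    also have "\<dots> = (\<integral>z. ldet ?I (\<lambda>i j. (\<lambda>(t, x) (t', y). k (- t', y) (- t, x)) (z i) (z j)) \<partial>(\<Pi>\<^sub>M i\<in>?I. ?Z))"
    proof (intro Bochner_Integration.integral_cong refl)
      fix z :: "nat \<Rightarrow> real \<times> real"
      have "ldet ?I (\<lambda>i j. k (?p z i) (?p z j)) = ldet ?I (\<lambda>i j. k (f (z i)) (f (z j)))"
        by (intro ldet_cong) auto
      also have "\<dots> = ldet ?I (\<lambda>i j. k (f (z j)) (f (z i)))"
        using ldet_transpose[of ?I "\<lambda>i j. k (f (z i)) (f (z j))"] by simp
      finally show "ldet ?I (\<lambda>i j. k (?p z i) (?p z j)) =
          ldet ?I (\<lambda>i j. (\<lambda>(t, x) (t', y). k (- t', y) (- t, x)) (z i) (z j))"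
        by (simp add: f_def case_prod_beta)
    qed
    finally show ?thesis by simp
  qed
  show ?thesis unfolding fredholm_det_ldet terms ..
qed

section \<open>Reduction to the line for small time differences\<close>

lemma (in prob_space) expectation_strip:
  fixes X Y :: "'a \<Rightarrow> real"
  assumes [measurable]: "X \<in> borel_measurable M" "Y \<in> borel_measurable M"
    and X: "\<And>\<omega>. 0 \<le> X \<omega>" and int: "integrable M (\<lambda>\<omega>. X \<omega> * \<bar>Y \<omega>\<bar>)"
  shows "integrable lborel (\<lambda>x. indicator {a<..} x * expectation (\<lambda>\<omega>. X \<omega> * indicator {..a + Y \<omega>} x))"
    and "(\<integral>x. indicator {a<..} x * expectation (\<lambda>\<omega>. X \<omega> * indicator {..a + Y \<omega>} x) \<partial>lborel) \<le>
      expectation (\<lambda>\<omega>. X \<omega> * \<bar>Y \<omega>\<bar>)"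
proof -
  interpret P: pair_sigma_finite M "lborel :: real measure"
    by (intro pair_sigma_finite.intro sigma_finite_lborel sigma_finite_measure_axioms)
  define f where "f \<omega> x = X \<omega> * indicator {a<..a + Y \<omega>} x" for \<omega> x
  have eq: "indicator {a<..} x * expectation (\<lambda>\<omega>. X \<omega> * indicator {..a + Y \<omega>} x) = expectation (\<lambda>\<omega>. f \<omega> x)" for x
    unfolding f_def integral_mult_right_zero[symmetric]
    by (intro Bochner_Integration.integral_cong refl) (auto simp: indicator_def)
  have meas: "case_prod f \<in> borel_measurable (M \<Otimes>\<^sub>M lborel)"
    unfolding f_def indicator_def greaterThanAtMost_iff by measurable
  have inner_int: "integrable lborel (f \<omega>)" for \<omega>
    unfolding f_def by (cases "0 \<le> Y \<omega>") (auto intro!: integrable_mult_right integrable_real_indicator)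
  have inner: "(\<integral>x. f \<omega> x \<partial>lborel) = X \<omega> * max 0 (Y \<omega>)" for \<omega>
    by (cases "0 \<le> Y \<omega>") (auto simp: f_def)
  have max_int: "integrable M (\<lambda>\<omega>. X \<omega> * max 0 (Y \<omega>))"
    by (rule Bochner_Integration.integrable_bound[OF int])
      (use X in \<open>auto simp: abs_mult intro!: mult_left_mono\<close>)
  have f0: "0 \<le> f \<omega> x" for \<omega> x using X by (simp add: f_def)
  have f_int: "integrable (M \<Otimes>\<^sub>M lborel) (case_prod f)"
  proof (rule P.Fubini_integrable[OF meas])
    show "integrable M (\<lambda>\<omega>. \<integral>x. norm (case (\<omega>, x) of (\<omega>, x) \<Rightarrow> f \<omega> x) \<partial>lborel)"
      using max_int f0 by (simp add: inner)
  qed (simp add: inner_int)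
  show "integrable lborel (\<lambda>x. indicator {a<..} x * expectation (\<lambda>\<omega>. X \<omega> * indicator {..a + Y \<omega>} x))"
    unfolding eq by (rule P.integrable_snd[OF f_int])
  have "(\<integral>x. indicator {a<..} x * expectation (\<lambda>\<omega>. X \<omega> * indicator {..a + Y \<omega>} x) \<partial>lborel) =
      (\<integral>x. expectation (\<lambda>\<omega>. f \<omega> x) \<partial>lborel)"
    unfolding eq ..
  also have "\<dots> = expectation (\<lambda>\<omega>. \<integral>x. f \<omega> x \<partial>lborel)" by (rule P.Fubini_integral[OF f_int])
  also have "\<dots> = expectation (\<lambda>\<omega>. X \<omega> * max 0 (Y \<omega>))" unfolding inner ..
  also have "\<dots> \<le> expectation (\<lambda>\<omega>. X \<omega> * \<bar>Y \<omega>\<bar>)"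
    using X by (intro integral_mono max_int int mult_left_mono) auto
  finally show "(\<integral>x. indicator {a<..} x * expectation (\<lambda>\<omega>. X \<omega> * indicator {..a + Y \<omega>} x) \<partial>lborel) \<le>
      expectation (\<lambda>\<omega>. X \<omega> * \<bar>Y \<omega>\<bar>)" .
qed

text \<open>\<open>\<delta>\<close> is a time difference and \<open>d\<close> a displacement of the walk, of the order of the square root of
  the time. The error is therefore not small enough by itself; it is so after integration, because
  displacements matter only in a strip whose width is of the same order.\<close>

lemma airy_shift_displacement:
  assumes "\<bar>\<delta>\<bar> \<le> 1 / 4"
  shows "\<bar>airy_shift \<delta> (u + d) - airy_Ai u\<bar> \<le> airy_const * exp (- u) * (\<bar>\<delta>\<bar> * exp \<bar>d\<bar> + \<bar>d\<bar> * exp \<bar>d\<bar>)"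
proof -
  have "\<bar>airy_shift \<delta> (u + d) - airy_Ai (u + d)\<bar> \<le> \<bar>\<delta>\<bar> * airy_const * exp (- (u + d))"
    by (rule airy_shift_time_lipschitz[OF assms])
  also have "\<dots> \<le> \<bar>\<delta>\<bar> * airy_const * exp (- u + \<bar>d\<bar>)"
    using airy_const_nonneg by (intro mult_left_mono) auto
  also have "\<dots> = airy_const * exp (- u) * (\<bar>\<delta>\<bar> * exp \<bar>d\<bar>)"
    by (simp only: exp_add mult_ac)
  finally have 1: "\<bar>airy_shift \<delta> (u + d) - airy_Ai (u + d)\<bar> \<le> airy_const * exp (- u) * (\<bar>\<delta>\<bar> * exp \<bar>d\<bar>)" .
  have "\<bar>airy_Ai (u + d) - airy_Ai u\<bar> \<le> \<bar>d\<bar> * exp \<bar>d\<bar> * airy_const * exp (- u)"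
    using airy_Ai_lipschitz[of "u + d" u] by (simp only: add_diff_cancel_left')
  also have "\<dots> = airy_const * exp (- u) * (\<bar>d\<bar> * exp \<bar>d\<bar>)"
    by (simp only: mult_ac)
  finally have 2: "\<bar>airy_Ai (u + d) - airy_Ai u\<bar> \<le> airy_const * exp (- u) * (\<bar>d\<bar> * exp \<bar>d\<bar>)" .
  have "\<bar>airy_shift \<delta> (u + d) - airy_Ai u\<bar> \<le> \<bar>airy_shift \<delta> (u + d) - airy_Ai (u + d)\<bar> + \<bar>airy_Ai (u + d) - airy_Ai u\<bar>"
    by linarith
  also have "\<dots> \<le> airy_const * exp (- u) * (\<bar>\<delta>\<bar> * exp \<bar>d\<bar>) + airy_const * exp (- u) * (\<bar>d\<bar> * exp \<bar>d\<bar>)"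
    by (rule add_mono[OF 1 2])
  finally show ?thesis by (simp only: distrib_left)
qed

lemma exp_abs_bound: "(1 + v\<^sup>2) * exp \<bar>v\<bar> \<le> 2 * (exp (2 * v) + exp (- 2 * v))" for v :: real
proof -
  have "1 + \<bar>v\<bar> + \<bar>v\<bar>\<^sup>2 / 2 \<le> exp \<bar>v\<bar>" by (rule exp_lower_Taylor_quadratic) simp
  then have "1 + v\<^sup>2 \<le> 2 * exp \<bar>v\<bar>" by simp
  then have "(1 + v\<^sup>2) * exp \<bar>v\<bar> \<le> 2 * exp \<bar>v\<bar> * exp \<bar>v\<bar>" by (intro mult_right_mono) auto
  also have "\<dots> = 2 * exp (2 * \<bar>v\<bar>)" by (simp add: mult_exp_exp)
  also have "\<dots> \<le> 2 * (exp (2 * v) + exp (- 2 * v))" by (cases "0 \<le> v") auto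
  finally show ?thesis .
qed

lemma normal_exp_abs_integrable:
  assumes "0 < \<sigma>"
  shows "integrable lborel (\<lambda>v. normal_density 0 \<sigma> v * ((1 + v\<^sup>2) * exp \<bar>v\<bar>))"
proof (rule Bochner_Integration.integrable_bound)
  show "integrable lborel (\<lambda>v. 2 * (normal_density 0 \<sigma> v * exp (2 * v) + normal_density 0 \<sigma> v * exp (- 2 * v)))"
    by (intro integrable_mult_right Bochner_Integration.integrable_add normal_density_exp_integrable assms)
  show "AE v in lborel. norm (normal_density 0 \<sigma> v * ((1 + v\<^sup>2) * exp \<bar>v\<bar>)) \<le>
      norm (2 * (normal_density 0 \<sigma> v * exp (2 * v) + normal_density 0 \<sigma> v * exp (- 2 * v)))"
  proof (rule AE_I2)
    fix v
    have "normal_density 0 \<sigma> v * ((1 + v\<^sup>2) * exp \<bar>v\<bar>) \<le>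
        normal_density 0 \<sigma> v * (2 * (exp (2 * v) + exp (- 2 * v)))"
      by (intro mult_left_mono exp_abs_bound) simp
    then show "norm (normal_density 0 \<sigma> v * ((1 + v\<^sup>2) * exp \<bar>v\<bar>)) \<le>
        norm (2 * (normal_density 0 \<sigma> v * exp (2 * v) + normal_density 0 \<sigma> v * exp (- 2 * v)))"
      by (simp add: abs_mult algebra_simps)
  qed
qed measurable

definition exp_tail :: "real \<Rightarrow> real" where
  "exp_tail R = (\<integral>x. exp (- (2 * x)) * indicator {- R<..} x \<partial>lborel)"

lemma exp_tail_nonneg: "0 \<le> exp_tail R"
  unfolding exp_tail_def by (intro integral_nonneg_AE) auto

context airy_walk
begin

definition stay_prob :: "real \<Rightarrow> real \<Rightarrow> real" where
  "stay_prob t x = expectation (\<lambda>\<omega>. of_bool (stays t x \<omega>))"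

text \<open>To leading order row \<open>t\<close> of the reduced kernel is \<open>chi t x * stay_prob t x * airy_Ai (x + y)\<close>,
  and the rows for the different times add up.\<close>

definition line_density :: "real \<Rightarrow> real" where
  "line_density x = (\<Sum>t\<in>T. chi t x * stay_prob t x)"

definition displacement :: "real \<Rightarrow> 'b \<Rightarrow> real" where
  "displacement t \<omega> = W last_time \<omega> - W t \<omega>"

text \<open>\<open>h\<close> bounds the time differences and \<open>2 * \<gamma>\<close> the distances of the levels. For times and levels on
  the Brownian scale all contributions are of the order of the time differences.\<close>

definition error_size :: "real \<Rightarrow> real \<Rightarrow> real \<Rightarrow> real" where
  "error_size R h \<gamma> = airy_const * (\<Sum>t\<in>T. h * expectation (\<lambda>\<omega>. exp \<bar>displacement t \<omega>\<bar>) * exp_tail R +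
     exp (2 * R) * (2 * \<gamma> * expectation (\<lambda>\<omega>. \<bar>displacement t \<omega>\<bar> * exp \<bar>displacement t \<omega>\<bar>) +
       expectation (\<lambda>\<omega>. (displacement t \<omega>)\<^sup>2 * exp \<bar>displacement t \<omega>\<bar>)))"

lemma displacement_measurable[measurable]: "t \<in> T \<Longrightarrow> displacement t \<in> borel_measurable N"
  unfolding displacement_def[abs_def] by (intro W_diff_measurable last_time)

lemma displacement_moments:
  assumes t: "t \<in> T"
  shows "integrable N (\<lambda>\<omega>. exp \<bar>displacement t \<omega>\<bar>)"
    and "integrable N (\<lambda>\<omega>. \<bar>displacement t \<omega>\<bar> * exp \<bar>displacement t \<omega>\<bar>)"
    and "integrable N (\<lambda>\<omega>. (displacement t \<omega>)\<^sup>2 * exp \<bar>displacement t \<omega>\<bar>)"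
    and "integrable N (\<lambda>\<omega>. \<bar>displacement t \<omega>\<bar>)"
proof -
  note [measurable] = displacement_measurable[OF t]
  have I: "integrable N (\<lambda>\<omega>. (1 + (displacement t \<omega>)\<^sup>2) * exp \<bar>displacement t \<omega>\<bar>)"
  proof (cases "t = last_time")
    case True
    then show ?thesis by (simp add: displacement_def)
  next
    case False
    then have tl: "t < last_time" using last_time(2)[OF t] by simp
    have s: "0 < sqrt (2 * (last_time - t))" using tl by simp
    show ?thesis
      unfolding displacement_def using normal_exp_abs_integrable[OF s]
      by (subst distributed_integrable[OF W_density[OF t last_time(1) tl], symmetric]) auto
  qed
  have bd: "integrable N (\<lambda>\<omega>. f (displacement t \<omega>))"
    if "f \<in> borel_measurable borel" "\<And>v. \<bar>f v\<bar> \<le> (1 + v\<^sup>2) * exp \<bar>v\<bar>" for f :: "real \<Rightarrow> real"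
    by (rule Bochner_Integration.integrable_bound[OF I])
      (use that in \<open>auto simp: abs_mult intro!: measurable_compose[OF displacement_measurable[OF t]]\<close>)
  show "integrable N (\<lambda>\<omega>. exp \<bar>displacement t \<omega>\<bar>)"
    by (rule bd) (auto simp: distrib_right)
  have abs_le: "\<bar>v\<bar> \<le> 1 + v\<^sup>2" for v :: real
  proof -
    have "0 \<le> (\<bar>v\<bar> - 1 / 2)\<^sup>2" by simp
    then show ?thesis by (simp add: power2_diff power_divide)
  qed
  show "integrable N (\<lambda>\<omega>. \<bar>displacement t \<omega>\<bar> * exp \<bar>displacement t \<omega>\<bar>)"
    using abs_le by (intro bd) (auto simp: abs_mult intro!: mult_right_mono)
  show "integrable N (\<lambda>\<omega>. (displacement t \<omega>)\<^sup>2 * exp \<bar>displacement t \<omega>\<bar>)"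
    by (intro bd) (auto simp: abs_mult intro!: mult_right_mono)
  show "integrable N (\<lambda>\<omega>. \<bar>displacement t \<omega>\<bar>)"
  proof (intro bd)
    fix v :: real
    have "\<bar>v\<bar> * 1 \<le> (1 + v\<^sup>2) * exp \<bar>v\<bar>" using abs_le by (intro mult_mono) auto
    then show "\<bar>\<bar>v\<bar>\<bar> \<le> (1 + v\<^sup>2) * exp \<bar>v\<bar>" by simp
  qed simp
qed

lemma stays_integrable: "t \<in> T \<Longrightarrow> integrable N (\<lambda>\<omega>. of_bool (stays t x \<omega>) :: real)"
  using stays_pred[of t "\<lambda>_. x" N "\<lambda>\<omega>. \<omega>"]
  by (intro integrable_const_bound[where B = 1]) (auto simp: of_bool_def)

lemma stay_prob_nonneg: "0 \<le> stay_prob t x"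
  unfolding stay_prob_def by (intro integral_nonneg_AE) auto

lemma stay_prob_le_1:
  assumes "t \<in> T"
  shows "stay_prob t x \<le> 1"
proof -
  have "stay_prob t x \<le> expectation (\<lambda>_. 1)"
    unfolding stay_prob_def using assms by (intro integral_mono stays_integrable) auto
  then show ?thesis by (simp add: prob_space)
qed

lemma stay_prob_last: "stay_prob last_time x = 1"
proof -
  have "stays last_time x \<omega>" for \<omega> using last_time(2) by (auto simp: stays_def dest: leD)
  then show ?thesis by (simp add: stay_prob_def prob_space)
qed

lemma stay_prob_measurable[measurable]:
  assumes "t \<in> T"
  shows "stay_prob t \<in> borel_measurable borel"
  unfolding stay_prob_def[abs_def]
proof (rule borel_measurable_lebesgue_integral)
  note [measurable] = stays_pred[OF assms]
  show "(\<lambda>(x, \<omega>). of_bool (stays t x \<omega>) :: real) \<in> borel_measurable (borel \<Otimes>\<^sub>M N)"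
    unfolding of_bool_def case_prod_beta by measurable
qed

lemma line_density_measurable[measurable]: "line_density \<in> borel_measurable borel"
  unfolding line_density_def[abs_def] by (intro borel_measurable_sum borel_measurable_times) auto

lemma stays_displacement:
  assumes "t \<in> T" "stays t x \<omega>" "displacement t \<omega> \<noteq> 0"
  shows "x \<le> \<xi> last_time - displacement t \<omega>"
proof -
  have "t \<noteq> last_time" using assms(3) by (auto simp: displacement_def)
  then have "t < last_time" using last_time(2)[OF assms(1)] by simp
  then show ?thesis using assms(2) last_time(1) by (auto simp: stays_def displacement_def)
qed

text \<open>If the walk stays below the levels, it does so at the last time; this is the origin of the
  indicator, unless the displacement vanishes.\<close>

lemma reduced_approx:
  assumes t: "t \<in> T" and t': "t' \<in> T" and h: "\<And>s s'. s \<in> T \<Longrightarrow> s' \<in> T \<Longrightarrow> \<bar>s' - s\<bar> \<le> h"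
  shows "\<bar>reduced t t' x y - stay_prob t x * airy_Ai (x + y)\<bar> \<le> airy_const * exp (- x) * exp (- y) *
    (h * expectation (\<lambda>\<omega>. exp \<bar>displacement t \<omega>\<bar>) +
     expectation (\<lambda>\<omega>. \<bar>displacement t \<omega>\<bar> * exp \<bar>displacement t \<omega>\<bar> * indicator {..\<xi> last_time - displacement t \<omega>} x))"
proof -
  let ?D = "displacement t"
  note [measurable] = displacement_measurable[OF t]
  define \<delta> where "\<delta> = t' - last_time"
  have \<delta>: "\<bar>\<delta>\<bar> \<le> 1 / 4" "\<bar>\<delta>\<bar> \<le> h" using T_diam[OF last_time(1) t'] h[OF last_time(1) t'] by (auto simp: \<delta>_def)
  have h0: "0 \<le> h" using h[OF t t] by simp
  have int2: "integrable N (\<lambda>\<omega>. \<bar>?D \<omega>\<bar> * exp \<bar>?D \<omega>\<bar> * indicator {..\<xi> last_time - ?D \<omega>} x)"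
  proof (rule Bochner_Integration.integrable_bound[OF displacement_moments(2)[OF t]])
    show "(\<lambda>\<omega>. \<bar>?D \<omega>\<bar> * exp \<bar>?D \<omega>\<bar> * indicator {..\<xi> last_time - ?D \<omega>} x) \<in> borel_measurable N"
      unfolding indicator_def atMost_iff by measurable
  qed (auto simp: abs_mult indicator_def)
  have bint: "integrable N (\<lambda>\<omega>. airy_const * exp (- x) * exp (- y) *
      (h * exp \<bar>?D \<omega>\<bar> + \<bar>?D \<omega>\<bar> * exp \<bar>?D \<omega>\<bar> * indicator {..\<xi> last_time - ?D \<omega>} x))"
    by (intro integrable_mult_right Bochner_Integration.integrable_add int2 displacement_moments(1)[OF t])
  have st: "Measurable.pred N (stays t x)"
    using stays_pred[OF t, of "\<lambda>_. x" N "\<lambda>\<omega>. \<omega>"] by simp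
  have i1: "integrable N (\<lambda>\<omega>. airy_shift (t' - last_time) (x + (W last_time \<omega> - W t \<omega>) + y) * of_bool (stays t x \<omega>))"
    by (rule airy_walk_integrable[OF t t' last_time(1) last_time(2)[OF t] st])
  have i2: "integrable N (\<lambda>\<omega>. of_bool (stays t x \<omega>) * airy_Ai (x + y))"
    by (intro integrable_mult_left stays_integrable t)
  have eq: "reduced t t' x y - stay_prob t x * airy_Ai (x + y) =
      expectation (\<lambda>\<omega>. airy_shift \<delta> (x + ?D \<omega> + y) * of_bool (stays t x \<omega>) - of_bool (stays t x \<omega>) * airy_Ai (x + y))"
    unfolding reduced_def stay_prob_def \<delta>_def displacement_def
    by (simp only: Bochner_Integration.integral_diff[OF i1 i2] integral_mult_left_zero)
  have "\<bar>reduced t t' x y - stay_prob t x * airy_Ai (x + y)\<bar> \<le> expectation (\<lambda>\<omega>. airy_const * exp (- x) * exp (- y) *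
      (h * exp \<bar>?D \<omega>\<bar> + \<bar>?D \<omega>\<bar> * exp \<bar>?D \<omega>\<bar> * indicator {..\<xi> last_time - ?D \<omega>} x))"
    unfolding eq
  proof (rule integral_abs_le[OF bint])
    fix \<omega>
    let ?b = "h * exp \<bar>?D \<omega>\<bar> + \<bar>?D \<omega>\<bar> * exp \<bar>?D \<omega>\<bar> * indicator {..\<xi> last_time - ?D \<omega>} x"
    have b0: "0 \<le> airy_const * exp (- x) * exp (- y) * ?b"
      using airy_const_nonneg h0 by (intro mult_nonneg_nonneg add_nonneg_nonneg) auto
    show "\<bar>airy_shift \<delta> (x + ?D \<omega> + y) * of_bool (stays t x \<omega>) - of_bool (stays t x \<omega>) * airy_Ai (x + y)\<bar> \<le>
        airy_const * exp (- x) * exp (- y) * ?b"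
    proof (cases "stays t x \<omega>")
      case False
      then show ?thesis using b0 by (simp only: of_bool_eq mult_zero_left mult_zero_right diff_zero abs_zero)
    next
      case True
      have ind: "\<bar>?D \<omega>\<bar> * exp \<bar>?D \<omega>\<bar> = \<bar>?D \<omega>\<bar> * exp \<bar>?D \<omega>\<bar> * indicator {..\<xi> last_time - ?D \<omega>} x"
      proof (cases "?D \<omega> = 0")
        case False
        then have "x \<in> {..\<xi> last_time - ?D \<omega>}" using stays_displacement[OF t True] by (simp only: atMost_iff not_False_eq_True simp_thms)
        then show ?thesis by (simp only: indicator_simps mult_1_right)
      next
        case True
        then show ?thesis by (simp only: abs_zero mult_zero_left)
      qed
      have xy: "x + ?D \<omega> + y = (x + y) + ?D \<omega>" by (simp only: add_ac)
      have ee: "exp (- (x + y)) = exp (- x) * exp (- y)" by (simp only: minus_add_distrib exp_add)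
      have "\<bar>airy_shift \<delta> ((x + y) + ?D \<omega>) - airy_Ai (x + y)\<bar> \<le>
          airy_const * exp (- (x + y)) * (\<bar>\<delta>\<bar> * exp \<bar>?D \<omega>\<bar> + \<bar>?D \<omega>\<bar> * exp \<bar>?D \<omega>\<bar>)"
        by (rule airy_shift_displacement[OF \<delta>(1)])
      also have "\<dots> \<le> airy_const * exp (- (x + y)) * (h * exp \<bar>?D \<omega>\<bar> + \<bar>?D \<omega>\<bar> * exp \<bar>?D \<omega>\<bar>)"
        using airy_const_nonneg \<delta>(2) by (intro mult_left_mono add_right_mono mult_right_mono) auto
      finally have le: "\<bar>airy_shift \<delta> ((x + y) + ?D \<omega>) - airy_Ai (x + y)\<bar> \<le>
        airy_const * exp (- (x + y)) * (h * exp \<bar>?D \<omega>\<bar> + \<bar>?D \<omega>\<bar> * exp \<bar>?D \<omega>\<bar>)" .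
      have b: "airy_const * exp (- x) * exp (- y) * ?b =
          airy_const * exp (- (x + y)) * (h * exp \<bar>?D \<omega>\<bar> + \<bar>?D \<omega>\<bar> * exp \<bar>?D \<omega>\<bar>)"
        unfolding ind[symmetric] ee by (simp only: mult.assoc)
      have o: "of_bool (stays t x \<omega>) = (1 :: real)" using True by simp
      show ?thesis unfolding b o xy mult_1_left mult_1_right by (rule le)
    qed
  qed
  also have "\<dots> = airy_const * exp (- x) * exp (- y) *
    (h * expectation (\<lambda>\<omega>. exp \<bar>?D \<omega>\<bar>) +
     expectation (\<lambda>\<omega>. \<bar>?D \<omega>\<bar> * exp \<bar>?D \<omega>\<bar> * indicator {..\<xi> last_time - ?D \<omega>} x))"
    using int2 displacement_moments(1)[OF t] by simp
  finally show ?thesis .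
qed

text \<open>Above the level at time \<open>t\<close> and below the displaced level at the last time there is only a strip
  of width \<open>\<gamma> + \<bar>displacement t\<bar>\<close>.\<close>

lemma displacement_strip:
  assumes t: "t \<in> T" and X: "X \<in> borel_measurable borel" "\<And>v. 0 \<le> X v"
    and \<gamma>: "\<bar>\<xi> last_time - \<xi> t\<bar> \<le> \<gamma>"
    and int: "integrable N (\<lambda>\<omega>. X (displacement t \<omega>))" "integrable N (\<lambda>\<omega>. X (displacement t \<omega>) * \<bar>displacement t \<omega>\<bar>)"
  shows "integrable lborel (\<lambda>x. chi t x * expectation (\<lambda>\<omega>. X (displacement t \<omega>) * indicator {..\<xi> last_time - displacement t \<omega>} x))"
    and "(\<integral>x. chi t x * expectation (\<lambda>\<omega>. X (displacement t \<omega>) * indicator {..\<xi> last_time - displacement t \<omega>} x) \<partial>lborel) \<le>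
      \<gamma> * expectation (\<lambda>\<omega>. X (displacement t \<omega>)) + expectation (\<lambda>\<omega>. X (displacement t \<omega>) * \<bar>displacement t \<omega>\<bar>)"
proof -
  let ?D = "displacement t"
  note [measurable] = displacement_measurable[OF t] X(1)
  define Y where "Y \<omega> = \<xi> last_time - \<xi> t - ?D \<omega>" for \<omega>
  have Ym: "Y \<in> borel_measurable N" unfolding Y_def[abs_def] by measurable
  have Xm: "(\<lambda>\<omega>. X (?D \<omega>)) \<in> borel_measurable N" by measurable
  have Yeq: "\<xi> last_time - ?D \<omega> = \<xi> t + Y \<omega>" for \<omega> by (simp add: Y_def)
  have Ybd: "X (?D \<omega>) * \<bar>Y \<omega>\<bar> \<le> \<gamma> * X (?D \<omega>) + X (?D \<omega>) * \<bar>?D \<omega>\<bar>" for \<omega>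
  proof -
    have "X (?D \<omega>) * \<bar>Y \<omega>\<bar> \<le> X (?D \<omega>) * (\<gamma> + \<bar>?D \<omega>\<bar>)"
      using \<gamma> X(2) by (intro mult_left_mono) (auto simp: Y_def)
    then show ?thesis by (simp add: algebra_simps)
  qed
  have bint: "integrable N (\<lambda>\<omega>. \<gamma> * X (?D \<omega>) + X (?D \<omega>) * \<bar>?D \<omega>\<bar>)" using int by simp
  have Yint: "integrable N (\<lambda>\<omega>. X (?D \<omega>) * \<bar>Y \<omega>\<bar>)"
  proof (rule Bochner_Integration.integrable_bound[OF bint])
    show "(\<lambda>\<omega>. X (?D \<omega>) * \<bar>Y \<omega>\<bar>) \<in> borel_measurable N" using Ym Xm by measurable
    show "AE \<omega> in N. norm (X (?D \<omega>) * \<bar>Y \<omega>\<bar>) \<le> norm (\<gamma> * X (?D \<omega>) + X (?D \<omega>) * \<bar>?D \<omega>\<bar>)"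
      using Ybd X(2) by (intro AE_I2) (simp add: abs_mult order_trans[OF _ abs_ge_self])
  qed
  note strip = expectation_strip[OF Xm Ym X(2) Yint, of "\<xi> t", folded Yeq chi_def]
  show "integrable lborel (\<lambda>x. chi t x * expectation (\<lambda>\<omega>. X (?D \<omega>) * indicator {..\<xi> last_time - ?D \<omega>} x))"
    by (rule strip(1))
  have "expectation (\<lambda>\<omega>. X (?D \<omega>) * \<bar>Y \<omega>\<bar>) \<le> expectation (\<lambda>\<omega>. \<gamma> * X (?D \<omega>) + X (?D \<omega>) * \<bar>?D \<omega>\<bar>)"
    by (intro integral_mono Yint bint Ybd)
  also have "\<dots> = \<gamma> * expectation (\<lambda>\<omega>. X (?D \<omega>)) + expectation (\<lambda>\<omega>. X (?D \<omega>) * \<bar>?D \<omega>\<bar>)"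
    using int by simp
  finally show "(\<integral>x. chi t x * expectation (\<lambda>\<omega>. X (?D \<omega>) * indicator {..\<xi> last_time - ?D \<omega>} x) \<partial>lborel) \<le>
      \<gamma> * expectation (\<lambda>\<omega>. X (?D \<omega>)) + expectation (\<lambda>\<omega>. X (?D \<omega>) * \<bar>?D \<omega>\<bar>)"
    using strip(2) by linarith
qed

lemma chi_above: "t \<in> T \<Longrightarrow> - R \<le> \<xi> t \<Longrightarrow> chi t x \<le> indicator {- R<..} x"
  by (auto simp: chi_def indicator_def)

lemma chi_exp_bound: "- R \<le> \<xi> t \<Longrightarrow> exp (- (2 * x)) * chi t x \<le> exp (2 * R) * chi t x"
  by (auto simp: chi_def indicator_def)

text \<open>After the elimination the kernel is dominated by exponentials, and \<open>fredholm_lipschitz\<close> turns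
  the pointwise estimate \<open>reduced_approx\<close> into an estimate of the determinants.\<close>

lemma fredholm_line_approx:
  assumes R: "0 \<le> R" "\<And>t. t \<in> T \<Longrightarrow> - R \<le> \<xi> t"
    and h: "\<And>s s'. s \<in> T \<Longrightarrow> s' \<in> T \<Longrightarrow> \<bar>s' - s\<bar> \<le> h"
    and \<gamma>: "\<And>t. t \<in> T \<Longrightarrow> \<bar>\<xi> last_time - \<xi> t\<bar> \<le> 2 * \<gamma>"
  shows "\<bar>fredholm_det (count_space T \<Otimes>\<^sub>M lborel) (elim_kernel {}) -
      fredholm_det lborel (\<lambda>x y. line_density x * airy_Ai (x + y))\<bar> \<le>
    fred_const (2 * airy_const * real (card T) * exp_tail R) * error_size R h \<gamma>"
proof -
  let ?\<mu> = "count_space T \<Otimes>\<^sub>M (lborel :: real measure)"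
  define k where "k = (\<lambda>(t, x) (t', y). if t \<in> T then reduced t t' x y else K1_ext (t, x) (t', y))"
  define c where "c = (\<lambda>(t, x). chi t x)"
  define E1 where "E1 = (\<lambda>z z'. c z * k z z')"
  define E2 where "E2 = (\<lambda>(t, x) (t' :: real, y). chi t x * stay_prob t x * airy_Ai (x + y))"
  have "fredholm_det ?\<mu> (elim_kernel {}) = fredholm_det ?\<mu> (elim_kernel T)"
    by (rule fredholm_elimination[OF R])
  also have "\<dots> = fredholm_det ?\<mu> (\<lambda>z z'. c z * k z z' * c z')"
    by (simp add: elim_kernel_def c_def k_def case_prod_beta')
  also have "\<dots> = fredholm_det ?\<mu> E1"
    unfolding E1_def by (rule fredholm_det_drop_columns) (auto simp: c_def chi_def indicator_def split: prod.split)
  finally have 1: "fredholm_det ?\<mu> (elim_kernel {}) = fredholm_det ?\<mu> E1" .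
  have 2: "fredholm_det ?\<mu> E2 = fredholm_det lborel (\<lambda>x y. line_density x * airy_Ai (x + y))"
    unfolding E2_def line_density_def
    by (rule fredholm_det_collapse[OF finite_T]) (use stay_prob_nonneg in auto)
  define a where "a = (\<lambda>(t, x). 2 * airy_const * (exp (- x) * chi t x))"
  define b where "b = (\<lambda>(t :: real, x :: real). exp (- x))"
  let ?m1 = "\<lambda>t. expectation (\<lambda>\<omega>. exp \<bar>displacement t \<omega>\<bar>)"
  define S where "S t x = expectation (\<lambda>\<omega>. \<bar>displacement t \<omega>\<bar> * exp \<bar>displacement t \<omega>\<bar> *
    indicator {..\<xi> last_time - displacement t \<omega>} x)" for t x
  have S0: "0 \<le> S t x" for t x unfolding S_def by (intro integral_nonneg_AE) auto
  have m10: "0 \<le> ?m1 t" for t by (intro integral_nonneg_AE) auto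
  have h0: "0 \<le> h" using h[OF last_time(1) last_time(1)] by simp
  define \<eta> where "\<eta> = (\<lambda>(t, x). airy_const * (exp (- x) * chi t x * (h * ?m1 t + S t x)))"
  have ee: "exp (- x) * exp (- x) = exp (- (2 * x))" for x :: real by (simp add: mult_exp_exp)
  have chi_int: "integrable lborel (\<lambda>x. exp (- (2 * x)) * chi t x)" for t
    unfolding chi_def by (rule integrable_exp_half_line) simp
  have chi_val: "(\<integral>x. exp (- (2 * x)) * chi t x \<partial>lborel) \<le> exp_tail R" if "t \<in> T" for t
    unfolding exp_tail_def
    by (intro integral_mono chi_int integrable_exp_half_line mult_left_mono chi_above R that) auto
  have ab: "(\<lambda>z. a z * b z) = (\<lambda>(t, x). 2 * airy_const * (exp (- (2 * x)) * chi t x))"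
    unfolding a_def b_def fun_eq_iff split_paired_All split_conv ee[symmetric] by (simp only: mult_ac simp_thms)
  interpret dominating_pair ?\<mu> a b
  proof (intro dominating_pair.intro count_pair_sigma_finite finite_T dominating_pair_axioms.intro)
    show "a \<in> borel_measurable ?\<mu>" "b \<in> borel_measurable ?\<mu>"
      unfolding a_def b_def by (auto intro!: count_pair_measurable finite_T)
    show "0 \<le> a z" "0 \<le> b z" for z using airy_const_nonneg by (auto simp: a_def b_def split: prod.split)
    show "integrable ?\<mu> (\<lambda>z. a z * b z)"
      unfolding ab by (intro count_pair_integral(1) finite_T integrable_mult_right chi_int)
  qed
  have mass_le: "mass \<le> 2 * airy_const * real (card T) * exp_tail R"
  proof -
    have "mass = (\<Sum>t\<in>T. \<integral>x. 2 * airy_const * (exp (- (2 * x)) * chi t x) \<partial>lborel)"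
      unfolding mass_def ab by (intro count_pair_integral(2) finite_T integrable_mult_right chi_int)
    also have "\<dots> \<le> (\<Sum>t\<in>T. 2 * airy_const * exp_tail R)"
      using chi_val airy_const_nonneg by (intro sum_mono) (auto intro!: mult_left_mono)
    finally show ?thesis by (simp add: mult_ac)
  qed
  have E1_dom: "dominated E1"
    unfolding dominated_def
  proof (intro conjI ballI)
    have "case_prod (\<lambda>(t, x) (t', y). chi t x * (if t \<in> T then reduced t t' x y else K1_ext (t, x) (t', y))) \<in>
        borel_measurable (?\<mu> \<Otimes>\<^sub>M ?\<mu>)"
    proof (rule count_pair_kernel_measurable[OF finite_T])
      fix t t' assume t: "t \<in> T"
      note [measurable] = reduced_measurable[OF t]
      show "(\<lambda>(x, y). chi t x * (if t \<in> T then reduced t t' x y else K1_ext (t, x) (t', y))) \<in>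
          borel_measurable (borel \<Otimes>\<^sub>M borel)"
        using t by (simp add: case_prod_beta)
    qed
    then show "case_prod E1 \<in> borel_measurable (?\<mu> \<Otimes>\<^sub>M ?\<mu>)"
      by (simp add: E1_def c_def k_def case_prod_beta')
    fix z z' assume z: "z \<in> space ?\<mu>" "z' \<in> space ?\<mu>"
    obtain t x t' y where zz: "z = (t, x)" "z' = (t', y)" by (metis prod.collapse)
    have t: "t \<in> T" "t' \<in> T" using z by (auto simp: zz space_pair_measure)
    have "chi t x * \<bar>reduced t t' x y\<bar> \<le> chi t x * (2 * airy_const * exp (- x) * exp (- y))"
      by (intro mult_left_mono reduced_bound t) simp
    then show "\<bar>E1 z z'\<bar> \<le> a z * b z'"
      using t by (simp add: zz E1_def c_def k_def a_def b_def abs_mult mult_ac)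
  qed
  have E2_dom: "dominated E2"
    unfolding dominated_def
  proof (intro conjI ballI)
    show "case_prod E2 \<in> borel_measurable (?\<mu> \<Otimes>\<^sub>M ?\<mu>)"
      unfolding E2_def
    proof (rule count_pair_kernel_measurable[OF finite_T])
      fix t assume t: "t \<in> T"
      note [measurable] = stay_prob_measurable[OF t]
      show "(\<lambda>(x, y). chi t x * stay_prob t x * airy_Ai (x + y)) \<in> borel_measurable (borel \<Otimes>\<^sub>M borel)"
        by (simp add: case_prod_beta)
    qed
    fix z z' assume z: "z \<in> space ?\<mu>" "z' \<in> space ?\<mu>"
    obtain t x t' y where zz: "z = (t, x)" "z' = (t', y)" by (metis prod.collapse)
    have t: "t \<in> T" "t' \<in> T" using z by (auto simp: zz space_pair_measure)
    have "stay_prob t x * \<bar>airy_Ai (x + y)\<bar> \<le> 1 * (airy_const * exp (- (x + y)))"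
      by (intro mult_mono stay_prob_le_1 t airy_Ai_bound) (auto simp: stay_prob_nonneg)
    also have "\<dots> \<le> 2 * airy_const * (exp (- x) * exp (- y))"
      using airy_const_nonneg by (simp add: mult_exp_exp)
    finally have "chi t x * (stay_prob t x * \<bar>airy_Ai (x + y)\<bar>) \<le> chi t x * (2 * airy_const * (exp (- x) * exp (- y)))"
      by (intro mult_left_mono) auto
    then show "\<bar>E2 z z'\<bar> \<le> a z * b z'"
      using stay_prob_nonneg[of t x] by (simp add: zz E2_def a_def b_def abs_mult mult_ac)
  qed
  have strip: "integrable lborel (\<lambda>x. chi t x * S t x) \<and>
      (\<integral>x. chi t x * S t x \<partial>lborel) \<le>
        2 * \<gamma> * expectation (\<lambda>\<omega>. \<bar>displacement t \<omega>\<bar> * exp \<bar>displacement t \<omega>\<bar>) +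
        expectation (\<lambda>\<omega>. (displacement t \<omega>)\<^sup>2 * exp \<bar>displacement t \<omega>\<bar>)" if t: "t \<in> T" for t
  proof -
    have sq: "\<bar>v\<bar> * exp \<bar>v\<bar> * \<bar>v\<bar> = v\<^sup>2 * exp \<bar>v\<bar>" for v :: real
    proof -
      have "\<bar>v\<bar> * exp \<bar>v\<bar> * \<bar>v\<bar> = (\<bar>v\<bar> * \<bar>v\<bar>) * exp \<bar>v\<bar>" by (simp only: mult_ac)
      then show ?thesis by (simp only: power2_eq_square abs_mult_self_eq)
    qed
    have m: "(\<lambda>v :: real. \<bar>v\<bar> * exp \<bar>v\<bar>) \<in> borel_measurable borel" by measurable
    have nn: "0 \<le> \<bar>v\<bar> * exp \<bar>v\<bar>" for v :: real by simp
    have i3: "integrable N (\<lambda>\<omega>. \<bar>displacement t \<omega>\<bar> * exp \<bar>displacement t \<omega>\<bar> * \<bar>displacement t \<omega>\<bar>)"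
      unfolding sq by (rule displacement_moments(3)[OF t])
    note ds = displacement_strip[OF t m nn \<gamma>[OF t] displacement_moments(2)[OF t] i3]
    show ?thesis unfolding S_def using ds(1) ds(2)[unfolded sq] by (rule conjI)
  qed
  define g where "g t x = airy_const * (h * ?m1 t * (exp (- (2 * x)) * chi t x) + exp (- (2 * x)) * (chi t x * S t x))" for t x
  have \<eta>b: "(\<lambda>z. \<eta> z * b z) = (\<lambda>(t, x). g t x)"
    unfolding \<eta>_def b_def g_def fun_eq_iff split_paired_All split_conv ee[symmetric] by (simp add: algebra_simps)
  have cS_int: "integrable lborel (\<lambda>x. exp (- (2 * x)) * (chi t x * S t x))"
    and cS_val: "(\<integral>x. exp (- (2 * x)) * (chi t x * S t x) \<partial>lborel) \<le> exp (2 * R) *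
        (2 * \<gamma> * expectation (\<lambda>\<omega>. \<bar>displacement t \<omega>\<bar> * exp \<bar>displacement t \<omega>\<bar>) +
        expectation (\<lambda>\<omega>. (displacement t \<omega>)\<^sup>2 * exp \<bar>displacement t \<omega>\<bar>))" if t: "t \<in> T" for t
  proof -
    have le: "exp (- (2 * x)) * (chi t x * S t x) \<le> exp (2 * R) * (chi t x * S t x)" for x
      using mult_right_mono[OF chi_exp_bound[OF R(2)[OF t], of x] S0[of t x]] by (simp add: mult.assoc)
    have i: "integrable lborel (\<lambda>x. exp (2 * R) * (chi t x * S t x))" using strip[OF t] by simp
    show int: "integrable lborel (\<lambda>x. exp (- (2 * x)) * (chi t x * S t x))"
    proof (rule Bochner_Integration.integrable_bound[OF i])
      have "(\<lambda>x. chi t x * S t x) \<in> borel_measurable lborel" using strip[OF t] by auto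
      then show "(\<lambda>x. exp (- (2 * x)) * (chi t x * S t x)) \<in> borel_measurable lborel" by measurable
      show "AE x in lborel. norm (exp (- (2 * x)) * (chi t x * S t x)) \<le> norm (exp (2 * R) * (chi t x * S t x))"
        using le S0 by (intro AE_I2) (simp add: abs_mult)
    qed
    have "(\<integral>x. exp (- (2 * x)) * (chi t x * S t x) \<partial>lborel) \<le> (\<integral>x. exp (2 * R) * (chi t x * S t x) \<partial>lborel)"
      by (intro integral_mono int i le)
    also have "\<dots> = exp (2 * R) * (\<integral>x. chi t x * S t x \<partial>lborel)" by simp
    also have "\<dots> \<le> exp (2 * R) * (2 * \<gamma> * expectation (\<lambda>\<omega>. \<bar>displacement t \<omega>\<bar> * exp \<bar>displacement t \<omega>\<bar>) +
        expectation (\<lambda>\<omega>. (displacement t \<omega>)\<^sup>2 * exp \<bar>displacement t \<omega>\<bar>))"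
      using strip[OF t] by (intro mult_left_mono) auto
    finally show "(\<integral>x. exp (- (2 * x)) * (chi t x * S t x) \<partial>lborel) \<le> exp (2 * R) *
        (2 * \<gamma> * expectation (\<lambda>\<omega>. \<bar>displacement t \<omega>\<bar> * exp \<bar>displacement t \<omega>\<bar>) +
        expectation (\<lambda>\<omega>. (displacement t \<omega>)\<^sup>2 * exp \<bar>displacement t \<omega>\<bar>))" .
  qed
  have g_int: "integrable lborel (g t)" if "t \<in> T" for t
    unfolding g_def[abs_def]
    by (intro integrable_mult_right Bochner_Integration.integrable_add chi_int cS_int[OF that])
  have \<eta>_int: "integrable ?\<mu> (\<lambda>z. \<eta> z * b z)"
    unfolding \<eta>b by (rule count_pair_integral(1)[OF finite_T g_int])
  have "(\<integral>z. \<eta> z * b z \<partial>?\<mu>) = (\<Sum>t\<in>T. \<integral>x. g t x \<partial>lborel)"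
    unfolding \<eta>b by (rule count_pair_integral(2)[OF finite_T g_int])
  also have "\<dots> \<le> (\<Sum>t\<in>T. airy_const * (h * ?m1 t * exp_tail R + exp (2 * R) *
      (2 * \<gamma> * expectation (\<lambda>\<omega>. \<bar>displacement t \<omega>\<bar> * exp \<bar>displacement t \<omega>\<bar>) +
        expectation (\<lambda>\<omega>. (displacement t \<omega>)\<^sup>2 * exp \<bar>displacement t \<omega>\<bar>))))"
  proof (intro sum_mono)
    fix t assume t: "t \<in> T"
    have "(\<integral>x. g t x \<partial>lborel) = airy_const * (h * ?m1 t * (\<integral>x. exp (- (2 * x)) * chi t x \<partial>lborel) +
        (\<integral>x. exp (- (2 * x)) * (chi t x * S t x) \<partial>lborel))"
      unfolding g_def using chi_int cS_int[OF t]
      by (subst integral_mult_right_zero, subst Bochner_Integration.integral_add) auto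
    also have "\<dots> \<le> airy_const * (h * ?m1 t * exp_tail R + exp (2 * R) *
      (2 * \<gamma> * expectation (\<lambda>\<omega>. \<bar>displacement t \<omega>\<bar> * exp \<bar>displacement t \<omega>\<bar>) +
        expectation (\<lambda>\<omega>. (displacement t \<omega>)\<^sup>2 * exp \<bar>displacement t \<omega>\<bar>)))"
      using h0 m10 by (intro mult_left_mono add_mono chi_val cS_val t airy_const_nonneg) auto
    finally show "(\<integral>x. g t x \<partial>lborel) \<le> airy_const * (h * ?m1 t * exp_tail R + exp (2 * R) *
      (2 * \<gamma> * expectation (\<lambda>\<omega>. \<bar>displacement t \<omega>\<bar> * exp \<bar>displacement t \<omega>\<bar>) +
        expectation (\<lambda>\<omega>. (displacement t \<omega>)\<^sup>2 * exp \<bar>displacement t \<omega>\<bar>)))" .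
  qed
  also have "\<dots> = error_size R h \<gamma>" by (simp add: error_size_def sum_distrib_left)
  finally have \<eta>_le: "(\<integral>z. \<eta> z * b z \<partial>?\<mu>) \<le> error_size R h \<gamma>" .
  have \<eta>0: "0 \<le> \<eta> z" for z
    using airy_const_nonneg h0 m10 S0 by (auto simp: \<eta>_def split: prod.split)
  have "\<bar>fredholm_det ?\<mu> E1 - fredholm_det ?\<mu> E2\<bar> \<le> fred_const mass * (\<integral>z. \<eta> z * b z \<partial>?\<mu>)"
  proof (rule fredholm_lipschitz[OF E1_dom E2_dom \<eta>0 \<eta>_int])
    fix z z' assume z: "z \<in> space ?\<mu>" "z' \<in> space ?\<mu>"
    obtain t x t' y where zz: "z = (t, x)" "z' = (t', y)" by (metis prod.collapse)
    have t: "t \<in> T" "t' \<in> T" using z by (auto simp: zz space_pair_measure)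
    have "\<bar>E1 z z' - E2 z z'\<bar> = chi t x * \<bar>reduced t t' x y - stay_prob t x * airy_Ai (x + y)\<bar>"
      using t by (simp add: zz E1_def E2_def c_def k_def mult.assoc right_diff_distrib[symmetric] abs_mult)
    also have "\<dots> \<le> chi t x * (airy_const * exp (- x) * exp (- y) * (h * ?m1 t + S t x))"
      unfolding S_def by (intro mult_left_mono reduced_approx t h) auto
    also have "\<dots> = \<eta> z * b z'" by (simp add: zz \<eta>_def b_def mult_ac)
    finally show "\<bar>E1 z z' - E2 z z'\<bar> \<le> \<eta> z * b z'" .
  qed
  also have "\<dots> \<le> fred_const (2 * airy_const * real (card T) * exp_tail R) * error_size R h \<gamma>"
  proof (rule mult_mono)
    show "0 \<le> (\<integral>z. \<eta> z * b z \<partial>?\<mu>)"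
      using \<eta>0 b_nonneg by (intro integral_nonneg_AE AE_I2 mult_nonneg_nonneg) auto
    show "0 \<le> fred_const (2 * airy_const * real (card T) * exp_tail R)"
      using airy_const_nonneg exp_tail_nonneg by (intro fred_const_nonneg) auto
  qed (rule fred_const_mono[OF mass_nonneg mass_le], rule \<eta>_le)
  finally show ?thesis unfolding 1 2[symmetric] .
qed

lemma line_density_bounds:
  assumes "\<And>t. t \<in> T \<Longrightarrow> - R \<le> \<xi> t"
  shows "0 \<le> line_density x" "line_density x \<le> real (card T) * indicator {- R<..} x"
proof -
  show "0 \<le> line_density x"
    unfolding line_density_def by (intro sum_nonneg mult_nonneg_nonneg stay_prob_nonneg) simp
  have "line_density x \<le> (\<Sum>t\<in>T. indicator {- R<..} x * 1)"
    unfolding line_density_def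
    by (intro sum_mono mult_mono chi_above stay_prob_le_1 stay_prob_nonneg) (use assms in auto)
  then show "line_density x \<le> real (card T) * indicator {- R<..} x" by simp
qed

text \<open>The last time contributes its full half-line, all other times only a strip next to their
  level.\<close>

lemma line_density_distance:
  assumes R: "\<And>t. t \<in> T \<Longrightarrow> - R \<le> \<xi> t" "- R \<le> x0"
    and \<gamma>: "\<And>t. t \<in> T \<Longrightarrow> \<bar>\<xi> t - x0\<bar> \<le> \<gamma>"
  shows "(\<integral>x. \<bar>line_density x - indicator {x0<..} x\<bar> * exp (- (2 * x)) \<partial>lborel) \<le>
    exp (2 * R) * ((\<Sum>t\<in>T. 2 * \<gamma> + expectation (\<lambda>\<omega>. \<bar>displacement t \<omega>\<bar>)) + 2 * \<gamma>)"
proof -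
  have \<gamma>0: "0 \<le> \<gamma>" using \<gamma>[OF last_time(1)] by simp
  define S where "S t x = expectation (\<lambda>\<omega>. (1 :: real) * indicator {..\<xi> last_time - displacement t \<omega>} x)" for t x
  have S0: "0 \<le> S t x" for t x unfolding S_def by (intro integral_nonneg_AE) auto
  have strip: "integrable lborel (\<lambda>x. chi t x * S t x)"
    "(\<integral>x. chi t x * S t x \<partial>lborel) \<le> 2 * \<gamma> + expectation (\<lambda>\<omega>. \<bar>displacement t \<omega>\<bar>)" if t: "t \<in> T" for t
  proof -
    have "\<bar>\<xi> last_time - \<xi> t\<bar> \<le> 2 * \<gamma>" using \<gamma>[OF t] \<gamma>[OF last_time(1)] by linarith
    note ds = displacement_strip[where X = "\<lambda>_. 1", OF t borel_measurable_const zero_le_one this integrable_const,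
        unfolded mult_1_left, OF displacement_moments(4)[OF t]]
    show "integrable lborel (\<lambda>x. chi t x * S t x)"
      unfolding S_def mult_1_left by (rule ds(1))
    have "expectation (\<lambda>\<omega>. 1 :: real) = 1" by (simp add: prob_space)
    with ds(2) show "(\<integral>x. chi t x * S t x \<partial>lborel) \<le> 2 * \<gamma> + expectation (\<lambda>\<omega>. \<bar>displacement t \<omega>\<bar>)"
      unfolding S_def mult_1_left by simp
  qed
  have stay_le: "stay_prob t x \<le> S t x" if t: "t \<in> T" "t \<noteq> last_time" for t x
    unfolding stay_prob_def S_def
  proof (rule integral_mono[OF stays_integrable[OF t(1)]])
    note [measurable] = displacement_measurable[OF t(1)]
    show "integrable N (\<lambda>\<omega>. 1 * indicator {..\<xi> last_time - displacement t \<omega>} x :: real)"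
      by (intro integrable_const_bound[where B = 1]) (auto simp: indicator_def)
    fix \<omega>
    have "t < last_time" using last_time(2)[OF t(1)] t(2) by simp
    then show "of_bool (stays t x \<omega>) \<le> (1 * indicator {..\<xi> last_time - displacement t \<omega>} x :: real)"
      using last_time(1) by (auto simp: stays_def displacement_def indicator_def)
  qed
  define B where "B x = (\<Sum>t\<in>T. chi t x * S t x) + indicator {x0 - \<gamma><..x0 + \<gamma>} x" for x
  have pt: "\<bar>line_density x - indicator {x0<..} x\<bar> * exp (- (2 * x)) \<le> exp (2 * R) * B x" for x
  proof -
    have "line_density x = chi last_time x + (\<Sum>t\<in>T-{last_time}. chi t x * stay_prob t x)"
      unfolding line_density_def using finite_T last_time(1)
      by (subst sum.remove[of _ last_time]) (auto simp: stay_prob_last)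
    moreover have "\<bar>\<Sum>t\<in>T-{last_time}. chi t x * stay_prob t x\<bar> \<le> (\<Sum>t\<in>T. chi t x * S t x)"
    proof -
      have "\<bar>\<Sum>t\<in>T-{last_time}. chi t x * stay_prob t x\<bar> = (\<Sum>t\<in>T-{last_time}. chi t x * stay_prob t x)"
        by (intro abs_of_nonneg sum_nonneg mult_nonneg_nonneg stay_prob_nonneg) simp
      also have "\<dots> \<le> (\<Sum>t\<in>T-{last_time}. chi t x * S t x)"
        by (intro sum_mono mult_left_mono stay_le) auto
      also have "\<dots> \<le> (\<Sum>t\<in>T. chi t x * S t x)"
        using finite_T S0 by (intro sum_mono2) auto
      finally show ?thesis .
    qed
    moreover have "\<bar>chi last_time x - indicator {x0<..} x\<bar> \<le> indicator {x0 - \<gamma><..x0 + \<gamma>} x"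
      using \<gamma>[OF last_time(1)] by (auto simp: chi_def indicator_def)
    ultimately have B: "\<bar>line_density x - indicator {x0<..} x\<bar> \<le> B x" by (simp add: B_def)
    show ?thesis
    proof (cases "- R < x")
      case True
      then have "exp (- (2 * x)) \<le> exp (2 * R)" by simp
      with B have "\<bar>line_density x - indicator {x0<..} x\<bar> * exp (- (2 * x)) \<le> B x * exp (2 * R)"
        by (intro mult_mono) auto
      then show ?thesis by (simp add: mult.commute)
    next
      case False
      then have "line_density x = 0" using line_density_bounds[OF R(1), of x] by simp
      moreover have "indicator {x0<..} x = (0::real)" using False R(2) by simp
      moreover have "0 \<le> B x" unfolding B_def using S0 by (intro add_nonneg_nonneg sum_nonneg) auto
      ultimately show ?thesis by simp
    qed
  qed
  have ind_int: "integrable lborel (indicator {x0 - \<gamma><..x0 + \<gamma>} :: real \<Rightarrow> real)"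
    using \<gamma>0 by (intro integrable_real_indicator) auto
  have B_int: "integrable lborel (\<lambda>x. exp (2 * R) * B x)"
    unfolding B_def[abs_def] using strip(1) ind_int by auto
  have "(\<integral>x. \<bar>line_density x - indicator {x0<..} x\<bar> * exp (- (2 * x)) \<partial>lborel) \<le> (\<integral>x. exp (2 * R) * B x \<partial>lborel)"
    by (rule integral_mono'[OF B_int pt]) (rule order_trans[OF _ pt], simp)
  also have "\<dots> = exp (2 * R) * ((\<Sum>t\<in>T. \<integral>x. chi t x * S t x \<partial>lborel) + 2 * \<gamma>)"
    unfolding B_def using strip(1) ind_int \<gamma>0 by (simp add: Bochner_Integration.integral_sum)
  also have "\<dots> \<le> exp (2 * R) * ((\<Sum>t\<in>T. 2 * \<gamma> + expectation (\<lambda>\<omega>. \<bar>displacement t \<omega>\<bar>)) + 2 * \<gamma>)"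
    by (intro mult_left_mono add_mono sum_mono strip(2)) auto
  finally show ?thesis .
qed

end

section \<open>Raising the level at the first time\<close>

definition level_det :: "real set \<Rightarrow> (real \<Rightarrow> real) \<Rightarrow> real" where
  "level_det T \<xi> = fredholm_det (count_space T \<Otimes>\<^sub>M lborel)
     (\<lambda>(t, x) (t', y). indicator {\<xi> t<..} x * K1_ext (t, x) (t', y) * indicator {\<xi> t'<..} y)"

lemma level_det_kernel:
  "fredholm_det (count_space T \<Otimes>\<^sub>M lborel) (\<lambda>z z'. sqrt (case z of (t, x) \<Rightarrow> indicator {\<xi> t<..} x) * K1_ext z z' *
      sqrt (case z' of (t, x) \<Rightarrow> indicator {\<xi> t<..} x)) = level_det T \<xi>"
proof -
  have "sqrt (indicator S x) = indicator S x" for S and x :: real by (simp add: indicator_def)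
  then show ?thesis
    unfolding level_det_def by (intro arg_cong[where f = "fredholm_det _"]) (simp add: fun_eq_iff split_paired_All)
qed

lemma airy1_process_iff:
  "airy1_process M A \<longleftrightarrow> prob_space M \<and> (\<forall>t. A t \<in> borel_measurable M) \<and>
    (\<forall>T \<xi>. finite T \<longrightarrow> T \<noteq> {} \<longrightarrow> measure M {\<omega> \<in> space M. \<forall>t\<in>T. A t \<omega> \<le> \<xi> t} = level_det T \<xi>)"
  unfolding airy1_process_def Let_def level_det_kernel ..

lemma airy1_level_det:
  assumes "airy1_process M A" "finite T" "T \<noteq> {}"
  shows "measure M {\<omega> \<in> space M. \<forall>t\<in>T. A t \<omega> \<le> \<xi> t} = level_det T \<xi>"
  using conjunct2[OF conjunct2[OF iffD1[OF airy1_process_iff assms(1)]], rule_format, OF assms(2,3)] .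

lemma (in airy_walk) level_det_elim: "level_det T \<xi> = fredholm_det (count_space T \<Otimes>\<^sub>M lborel) (elim_kernel {})"
  by (simp add: level_det_def elim_kernel_def chi_def)

definition line_const :: "real \<Rightarrow> real \<Rightarrow> real" where
  "line_const R c = fred_const (1 + 18 * dominating_pair.mass lborel (airy_line.line_a R c) airy_line.line_b)"

lemma line_const_nonneg:
  assumes "0 \<le> R" "2 \<le> c"
  shows "0 \<le> line_const R c"
proof -
  interpret airy_line R c by unfold_locales fact+
  show ?thesis unfolding line_const_def using mass_nonneg by (intro fred_const_nonneg) simp
qed

context airy_walk
begin

lemma stay_prob_antimono:
  assumes "t \<in> T" "x \<le> y"
  shows "stay_prob t y \<le> stay_prob t x"
  unfolding stay_prob_def using assms
  by (intro integral_mono stays_integrable) (auto simp: stays_def of_bool_def intro: order_trans[rotated])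

end

text \<open>For a single time all errors in \<open>fredholm_line_approx\<close> vanish, since nothing moves.\<close>

lemma single_time_level_det:
  assumes "airy_walk N T W" "t0 \<in> T" and R: "0 \<le> R" "- R \<le> \<xi> t0"
  shows "level_det {t0} \<xi> = fredholm_det lborel (\<lambda>x y. indicator {\<xi> t0<..} x * airy_Ai (x + y))"
proof -
  interpret T: airy_walk N T W \<xi> by fact
  interpret airy_walk N "{t0}" W \<xi>
    by unfold_locales (use assms(2) T.W_measurable in auto)
  have l: "last_time = t0" using last_time(1) by simp
  have e: "error_size R 0 0 = 0" by (simp add: error_size_def displacement_def l)
  have "line_density x = indicator {\<xi> t0<..} x" for x
    using stay_prob_last[of x] unfolding l by (simp add: line_density_def chi_def)
  moreover have "\<bar>fredholm_det (count_space {t0} \<Otimes>\<^sub>M lborel) (elim_kernel {}) -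
      fredholm_det lborel (\<lambda>x y. line_density x * airy_Ai (x + y))\<bar> \<le>
    fred_const (2 * airy_const * real (card {t0}) * exp_tail R) * error_size R 0 0"
    by (rule fredholm_line_approx) (use R l in auto)
  ultimately show ?thesis unfolding level_det_elim e by simp
qed

text \<open>Raising the level at the first time affects none of the staying probabilities, since these
  concern later times only. It removes the piece \<open>stay_prob t0\<close> on \<open>(x0, x0 + \<kappa>]\<close> from the line
  density, while for the single time \<open>t0\<close> the full indicator of this interval is removed. So \<open>q\<close> is the
  average of \<open>stay_prob t0\<close> over the interval.\<close>

lemma level_increment:
  assumes walk: "airy_walk N T W" and t0: "t0 \<in> T" "\<And>t. t \<in> T \<Longrightarrow> t0 \<le> t"
    and R: "0 \<le> R" "\<And>t. t \<in> T \<Longrightarrow> - R \<le> \<xi> t"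
    and h: "\<And>t t'. t \<in> T \<Longrightarrow> t' \<in> T \<Longrightarrow> \<bar>t' - t\<bar> \<le> h"
    and \<gamma>: "\<And>t. t \<in> T \<Longrightarrow> \<bar>\<xi> t - \<xi> t0\<bar> \<le> \<gamma>"
    and \<kappa>: "0 < \<kappa>" "\<kappa> \<le> \<gamma>" "\<kappa> \<le> 1"
    and E: "airy_const * (exp (2 * R) *
      ((\<Sum>t\<in>T. 2 * \<gamma> + (\<integral>\<omega>. \<bar>airy_walk.displacement T W t \<omega>\<bar> \<partial>N)) + 2 * \<gamma>)) \<le> E"
  shows "\<exists>q. airy_walk.stay_prob N T W \<xi> t0 (\<xi> t0 + \<kappa>) \<le> q \<and> q \<le> airy_walk.stay_prob N T W \<xi> t0 (\<xi> t0) \<and>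
    \<bar>(level_det T (\<xi>(t0 := \<xi> t0 + \<kappa>)) - level_det T \<xi>) -
      q * (level_det {t0} (\<xi>(t0 := \<xi> t0 + \<kappa>)) - level_det {t0} \<xi>)\<bar> \<le>
    2 * (fred_const (2 * airy_const * real (card T) * exp_tail R) * airy_walk.error_size N T W R h \<gamma>) +
    line_const R (real (card T) + 1) * (airy_const * exp (2 * R) * \<kappa> * (2 * E + 36 * \<kappa>))"
proof -
  define \<xi>' where "\<xi>' = \<xi>(t0 := \<xi> t0 + \<kappa>)"
  define x0 where "x0 = \<xi> t0"
  interpret w0: airy_walk N T W \<xi> by (rule walk)
  interpret w1: airy_walk N T W \<xi>' by (rule walk)
  have card: "2 \<le> real (card T) + 1"
    using w0.finite_T w0.T_nonempty by (simp add: Suc_le_eq card_gt_0_iff)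
  interpret L: airy_line R "real (card T) + 1" by unfold_locales (use R card in auto)
  have x0: "- R \<le> x0" using R(2)[OF t0(1)] by (simp add: x0_def)
  have \<xi>'_ge: "- R \<le> \<xi>' t" if "t \<in> T" for t using R(2)[OF that] R(2)[OF t0(1)] \<kappa> by (auto simp: \<xi>'_def)
  have \<xi>'_t0: "\<xi>' t0 = x0 + \<kappa>" by (simp add: \<xi>'_def x0_def)
  have \<gamma>0: "\<bar>\<xi> t - x0\<bar> \<le> \<gamma>" if "t \<in> T" for t using \<gamma>[OF that] by (simp add: x0_def)
  have \<gamma>1: "\<bar>\<xi>' t - x0\<bar> \<le> \<gamma>" if "t \<in> T" for t using \<gamma>0[OF that] \<kappa> by (auto simp: \<xi>'_def x0_def)
  have stay_eq: "w1.stay_prob t = w0.stay_prob t" if "t \<in> T" for t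
  proof -
    have "w1.stays t x \<omega> = w0.stays t x \<omega>" for x \<omega>
      unfolding w1.stays_def w0.stays_def using t0(2)[OF that] by (auto simp: \<xi>'_def)
    then show ?thesis by (simp add: w1.stay_prob_def[abs_def] w0.stay_prob_def[abs_def])
  qed
  define S where "S x = indicator {x0<..x0 + \<kappa>} x * w0.stay_prob t0 x" for x
  have dens: "w1.line_density x - w0.line_density x = - S x" for x
  proof -
    have chi: "w1.chi t x = w0.chi t x" if "t \<in> T - {t0}" for t
      unfolding w1.chi_def w0.chi_def using that by (simp add: \<xi>'_def)
    have "w1.line_density x - w0.line_density x = (\<Sum>t\<in>T. w1.chi t x * w0.stay_prob t x - w0.chi t x * w0.stay_prob t x)"
      unfolding w1.line_density_def w0.line_density_def sum_subtractf
      by (intro arg_cong2[where f = minus] sum.cong refl) (simp add: stay_eq)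
    also have "\<dots> = w1.chi t0 x * w0.stay_prob t0 x - w0.chi t0 x * w0.stay_prob t0 x"
      using w0.finite_T t0(1) chi by (subst sum.remove[of _ t0]) auto
    also have "\<dots> = - S x"
      using \<kappa>(1) by (auto simp: S_def w1.chi_def w0.chi_def \<xi>'_t0 x0_def[symmetric] indicator_def)
    finally show ?thesis .
  qed
  note sp[measurable] = w0.stay_prob_measurable[OF t0(1)]
  have S_bd: "0 \<le> S x" "S x \<le> indicator {x0<..x0 + \<kappa>} x" for x
    using w0.stay_prob_nonneg[of t0 x] w0.stay_prob_le_1[OF t0(1), of x] by (auto simp: S_def indicator_def)
  have strip_int: "integrable lborel (indicator {x0<..x0 + \<kappa>} :: real \<Rightarrow> real)"
    "(\<integral>x. indicator {x0<..x0 + \<kappa>} x \<partial>lborel) = \<kappa>"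
    using \<kappa>(1) by auto
  have S_int: "integrable lborel S"
    by (rule Bochner_Integration.integrable_bound[OF strip_int(1)])
      (use S_bd in \<open>auto simp: S_def[abs_def]\<close>)
  define q where "q = (\<integral>x. S x \<partial>lborel) / \<kappa>"
  have q_lower: "w0.stay_prob t0 (x0 + \<kappa>) \<le> q"
  proof -
    have "(\<integral>x. w0.stay_prob t0 (x0 + \<kappa>) * indicator {x0<..x0 + \<kappa>} x \<partial>lborel) \<le> (\<integral>x. S x \<partial>lborel)"
    proof (rule integral_mono[OF integrable_mult_right[OF strip_int(1)] S_int])
      show "w0.stay_prob t0 (x0 + \<kappa>) * indicator {x0<..x0 + \<kappa>} x \<le> S x" for x
        using w0.stay_prob_antimono[OF t0(1)] by (auto simp: S_def indicator_def)
    qed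
    then show ?thesis using \<kappa>(1) strip_int(2) by (simp add: q_def field_simps)
  qed
  have q_upper: "q \<le> w0.stay_prob t0 x0"
  proof -
    have "(\<integral>x. S x \<partial>lborel) \<le> (\<integral>x. w0.stay_prob t0 x0 * indicator {x0<..x0 + \<kappa>} x \<partial>lborel)"
    proof (rule integral_mono[OF S_int integrable_mult_right[OF strip_int(1)]])
      show "S x \<le> w0.stay_prob t0 x0 * indicator {x0<..x0 + \<kappa>} x" for x
        using w0.stay_prob_antimono[OF t0(1)] by (auto simp: S_def indicator_def)
    qed
    then show ?thesis using \<kappa>(1) strip_int(2) by (simp add: q_def field_simps)
  qed
  have q01: "0 \<le> q" "q \<le> 1"
    using q_lower q_upper w0.stay_prob_nonneg[of t0 "x0 + \<kappa>"] w0.stay_prob_le_1[OF t0(1), of x0] by linarith+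
  let ?v0 = "indicator {x0<..} :: real \<Rightarrow> real" and ?v1 = "indicator {x0 + \<kappa><..} :: real \<Rightarrow> real"
  have dv: "?v1 x - ?v0 x = - indicator {x0<..x0 + \<kappa>} x" for x
    using \<kappa>(1) by (auto simp: indicator_def)
  have weights: "L.weight w0.line_density" "L.weight w1.line_density"
  proof -
    have "\<bar>w0.line_density x\<bar> \<le> (real (card T) + 1) * indicator {- R<..} x" for x
      using w0.line_density_bounds[OF R(2), of x] by (auto simp: indicator_def)
    then show "L.weight w0.line_density" by (simp add: L.weight_def)
    have "\<bar>w1.line_density x\<bar> \<le> (real (card T) + 1) * indicator {- R<..} x" for x
      using w1.line_density_bounds[OF \<xi>'_ge, of x] by (auto simp: indicator_def)
    then show "L.weight w1.line_density" by (simp add: L.weight_def)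
  qed
  have half_weights: "L.weight ?v0" "L.weight ?v1"
    unfolding L.weight_def using x0 \<kappa> by (auto simp: indicator_def)
  have E_w: "L.wnorm (\<lambda>x. w0.line_density x - ?v0 x) \<le> E" "L.wnorm (\<lambda>x. w1.line_density x - ?v0 x) \<le> E"
  proof -
    show "L.wnorm (\<lambda>x. w0.line_density x - ?v0 x) \<le> E"
      unfolding L.wnorm_def
      by (rule order_trans[OF mult_left_mono[OF w0.line_density_distance[OF R(2) x0 \<gamma>0] airy_const_nonneg] E])
    show "L.wnorm (\<lambda>x. w1.line_density x - ?v0 x) \<le> E"
      unfolding L.wnorm_def
      by (rule order_trans[OF mult_left_mono[OF w1.line_density_distance[OF \<xi>'_ge x0 \<gamma>1] airy_const_nonneg] E])
  qed
  have E_v: "L.wnorm (\<lambda>x. ?v1 x - ?v0 x) \<le> E"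
  proof -
    have "L.wnorm (\<lambda>x. ?v1 x - ?v0 x) \<le> airy_const * exp (2 * R) * \<kappa>"
      by (rule L.wnorm_short[where ?x0.0 = x0]) (use \<kappa> x0 in \<open>auto simp: dv\<close>)
    also have "\<dots> = airy_const * (exp (2 * R) * \<kappa>)" by (rule mult.assoc)
    also have "\<dots> \<le> airy_const * (exp (2 * R) *
      ((\<Sum>t\<in>T. 2 * \<gamma> + (\<integral>\<omega>. \<bar>w0.displacement t \<omega>\<bar> \<partial>N)) + 2 * \<gamma>))"
    proof (intro mult_left_mono airy_const_nonneg)
      have "0 \<le> (\<Sum>t\<in>T. 2 * \<gamma> + (\<integral>\<omega>. \<bar>w0.displacement t \<omega>\<bar> \<partial>N))"
        using \<kappa> by (intro sum_nonneg add_nonneg_nonneg integral_nonneg_AE) auto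
      then show "\<kappa> \<le> (\<Sum>t\<in>T. 2 * \<gamma> + (\<integral>\<omega>. \<bar>w0.displacement t \<omega>\<bar> \<partial>N)) + 2 * \<gamma>"
        using \<kappa> by linarith
    qed simp
    also have "\<dots> \<le> E" by (rule E)
    finally show ?thesis .
  qed
  have q_int: "(\<integral>x. w1.line_density x - w0.line_density x \<partial>lborel) = q * (\<integral>x. ?v1 x - ?v0 x \<partial>lborel)"
    unfolding dens dv using \<kappa>(1) strip_int(2) by (simp add: q_def)
  have dw: "\<bar>w1.line_density x - w0.line_density x\<bar> \<le> indicator {x0<..x0 + \<kappa>} x" for x
    unfolding dens using S_bd[of x] by simp
  have dv': "\<bar>?v1 x - ?v0 x\<bar> \<le> indicator {x0<..x0 + \<kappa>} x" for x
    unfolding dv by simp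
  have fo: "\<bar>(fredholm_det lborel (L.weighted w1.line_density) - fredholm_det lborel (L.weighted w0.line_density)) -
      q * (fredholm_det lborel (L.weighted ?v1) - fredholm_det lborel (L.weighted ?v0))\<bar> \<le>
    line_const R (real (card T) + 1) * (airy_const * exp (2 * R) * \<kappa> * (2 * E + 36 * \<kappa>))"
    unfolding line_const_def
    by (rule L.first_order_comparison[OF weights half_weights dw dv' q01 q_int less_imp_le[OF \<kappa>(1)] \<kappa>(3) x0 E_w E_v])
  have two: "\<bar>\<xi> w0.last_time - \<xi> t\<bar> \<le> 2 * \<gamma>" "\<bar>\<xi>' w1.last_time - \<xi>' t\<bar> \<le> 2 * \<gamma>" if t: "t \<in> T" for t
    using \<gamma>0[OF t] \<gamma>0[OF w0.last_time(1)] \<gamma>1[OF t] \<gamma>1[OF w1.last_time(1)] by linarith+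
  let ?err = "fred_const (2 * airy_const * real (card T) * exp_tail R) * w0.error_size R h \<gamma>"
  have a0: "\<bar>level_det T \<xi> - fredholm_det lborel (L.weighted w0.line_density)\<bar> \<le> ?err"
    unfolding w0.level_det_elim L.weighted_def by (rule w0.fredholm_line_approx[OF R h two(1)])
  have a1: "\<bar>level_det T \<xi>' - fredholm_det lborel (L.weighted w1.line_density)\<bar> \<le> ?err"
    unfolding w1.level_det_elim L.weighted_def by (rule w1.fredholm_line_approx[OF R(1) \<xi>'_ge h two(2)])
  have b0: "level_det {t0} \<xi> = fredholm_det lborel (L.weighted ?v0)"
    unfolding L.weighted_def x0_def by (rule single_time_level_det[where \<xi> = \<xi>, OF walk t0(1) R(1) R(2)[OF t0(1)]])
  have b1: "level_det {t0} \<xi>' = fredholm_det lborel (L.weighted ?v1)"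
    unfolding L.weighted_def \<xi>'_t0[symmetric] by (rule single_time_level_det[where \<xi> = \<xi>', OF walk t0(1) R(1) \<xi>'_ge[OF t0(1)]])
  have "\<bar>(level_det T \<xi>' - level_det T \<xi>) - q * (level_det {t0} \<xi>' - level_det {t0} \<xi>)\<bar> \<le>
    2 * ?err + line_const R (real (card T) + 1) * (airy_const * exp (2 * R) * \<kappa> * (2 * E + 36 * \<kappa>))"
    using fo a0 a1 unfolding b0 b1 by linarith
  then show ?thesis using q_lower q_upper unfolding \<xi>'_def x0_def by blast
qed

section \<open>Brownian scaling\<close>

lemma (in prob_space) independent_increments_product_law:
  fixes W :: "real \<Rightarrow> 'a \<Rightarrow> real"
  assumes ind: "\<And>n (\<tau> :: nat \<Rightarrow> real). s \<le> \<tau> 0 \<Longrightarrow> (\<And>i. i < n \<Longrightarrow> \<tau> i < \<tau> (Suc i)) \<Longrightarrow>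
      indep_vars (\<lambda>_. borel) (\<lambda>i \<omega>. W (\<tau> (Suc i)) \<omega> - W (\<tau> i) \<omega>) {..<n}"
    and ab: "s \<le> a" "a < b" and L: "finite L" "\<And>m. m \<in> L \<Longrightarrow> b < m"
  shows "distr M (borel \<Otimes>\<^sub>M (\<Pi>\<^sub>M m\<in>L. borel)) (\<lambda>\<omega>. (W b \<omega> - W a \<omega>, \<lambda>m\<in>L. W m \<omega> - W b \<omega>)) =
    distr M borel (\<lambda>\<omega>. W b \<omega> - W a \<omega>) \<Otimes>\<^sub>M distr M (\<Pi>\<^sub>M m\<in>L. borel) (\<lambda>\<omega>. \<lambda>m\<in>L. W m \<omega> - W b \<omega>)"
proof -
  define xs where "xs = sorted_list_of_set L"
  have xs: "set xs = L" "sorted_wrt (<) xs"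
    using L(1) by (auto simp: xs_def)
  define ys where "ys = a # b # xs"
  have ys: "sorted_wrt (<) ys" using xs L(2) ab(2) by (auto simp: ys_def intro: less_trans)
  \<comment> \<open>All later increments are functions of the increments of \<open>W\<close> along the sorted list of times.\<close>
  define \<tau> where "\<tau> i = ys ! i" for i
  define n where "n = Suc (length xs)"
  define X where "X i \<omega> = W (\<tau> (Suc i)) \<omega> - W (\<tau> i) \<omega>" for i \<omega>
  have "indep_vars (\<lambda>_. borel) X {..<n}"
    unfolding X_def[abs_def]
  proof (rule ind)
    show "s \<le> \<tau> 0" using ab(1) by (simp add: \<tau>_def ys_def)
    fix i assume "i < n"
    then show "\<tau> i < \<tau> (Suc i)"
      unfolding \<tau>_def using sorted_wrt_nth_less[OF ys, of i "Suc i"] by (simp add: ys_def n_def)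
  qed
  then have "indep_var (PiM {0} (\<lambda>_. borel)) (\<lambda>\<omega>. restrict (\<lambda>i. X i \<omega>) {0})
      (PiM {1..<n} (\<lambda>_. borel)) (\<lambda>\<omega>. restrict (\<lambda>i. X i \<omega>) {1..<n})"
    by (rule indep_var_restrict) (auto simp: n_def)
  moreover define R0 where "R0 \<omega> = restrict (\<lambda>i. X i \<omega>) {0}" for \<omega>
  moreover define R1 where "R1 \<omega> = restrict (\<lambda>i. X i \<omega>) {1..<n}" for \<omega>
  moreover define S0 where "S0 = PiM {0 :: nat} (\<lambda>_. borel :: real measure)"
  moreover define S1 where "S1 = PiM {1..<n} (\<lambda>_. borel :: real measure)"
  ultimately have "indep_var S0 R0 S1 R1" by (simp add: R0_def[abs_def] R1_def[abs_def])
  then have rv[measurable]: "R0 \<in> measurable M S0" "R1 \<in> measurable M S1"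
    and law: "distr M S0 R0 \<Otimes>\<^sub>M distr M S1 R1 = distr M (S0 \<Otimes>\<^sub>M S1) (\<lambda>\<omega>. (R0 \<omega>, R1 \<omega>))"
    unfolding indep_var_distribution_eq by auto
  have "\<forall>m\<in>L. \<exists>i. i < length xs \<and> xs ! i = m" using xs(1) by (auto simp: in_set_conv_nth)
  then obtain idx where idx: "\<And>m. m \<in> L \<Longrightarrow> idx m < length xs" "\<And>m. m \<in> L \<Longrightarrow> xs ! idx m = m" by metis
  define f where "f v = v 0" for v :: "nat \<Rightarrow> real"
  define g where "g v = (\<lambda>m\<in>L. \<Sum>i<Suc (idx m). v (Suc i))" for v :: "nat \<Rightarrow> real"
  have f[measurable]: "f \<in> measurable S0 borel" unfolding f_def[abs_def] S0_def by measurable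
  have g[measurable]: "g \<in> measurable S1 (\<Pi>\<^sub>M m\<in>L. borel)"
    unfolding g_def[abs_def] S1_def
  proof (rule measurable_restrict)
    fix m assume m: "m \<in> L"
    have "(\<lambda>v. v (Suc i)) \<in> measurable (PiM {1..<n} (\<lambda>_. borel :: real measure)) borel" if "i < Suc (idx m)" for i
    proof -
      have "Suc i \<in> {1..<n}" using that idx(1)[OF m] by (simp add: n_def)
      then show ?thesis by (rule measurable_component_singleton[where M = "\<lambda>_. borel"])
    qed
    then show "(\<lambda>v. \<Sum>i<Suc (idx m). v (Suc i)) \<in> measurable (PiM {1..<n} (\<lambda>_. borel :: real measure)) borel"
      by (intro borel_measurable_sum) simp
  qed
  have f_R: "f (R0 \<omega>) = W b \<omega> - W a \<omega>" for \<omega>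
    by (simp add: f_def R0_def X_def \<tau>_def ys_def)
  have g_R: "g (R1 \<omega>) = (\<lambda>m\<in>L. W m \<omega> - W b \<omega>)" for \<omega>
  proof (rule ext)
    fix m
    show "g (R1 \<omega>) m = (\<lambda>m\<in>L. W m \<omega> - W b \<omega>) m"
    proof (cases "m \<in> L")
      case True
      have "(\<Sum>i<Suc (idx m). R1 \<omega> (Suc i)) = (\<Sum>i<Suc (idx m). W (\<tau> (Suc (Suc i))) \<omega> - W (\<tau> (Suc i)) \<omega>)"
        using idx(1)[OF True] by (intro sum.cong refl) (auto simp: R1_def n_def X_def)
      also have "\<dots> = W (\<tau> (Suc (Suc (idx m)))) \<omega> - W (\<tau> (Suc 0)) \<omega>"
        by (rule sum_lessThan_telescope)
      also have "\<dots> = W m \<omega> - W b \<omega>" using idx(2)[OF True] by (simp add: \<tau>_def ys_def)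
      finally show ?thesis using True by (simp add: g_def)
    qed (simp add: g_def)
  qed
  interpret D1: prob_space "distr (distr M S1 R1) (\<Pi>\<^sub>M m\<in>L. borel) g"
    by (intro prob_space.prob_space_distr prob_space_distr) auto
  have "distr M (borel \<Otimes>\<^sub>M (\<Pi>\<^sub>M m\<in>L. borel)) (\<lambda>\<omega>. (f (R0 \<omega>), g (R1 \<omega>))) =
      distr (distr M (S0 \<Otimes>\<^sub>M S1) (\<lambda>\<omega>. (R0 \<omega>, R1 \<omega>))) (borel \<Otimes>\<^sub>M (\<Pi>\<^sub>M m\<in>L. borel)) (\<lambda>(x, y). (f x, g y))"
    by (subst distr_distr) (auto simp: comp_def)
  also have "\<dots> = distr (distr M S0 R0) borel f \<Otimes>\<^sub>M distr (distr M S1 R1) (\<Pi>\<^sub>M m\<in>L. borel) g"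
    unfolding law[symmetric] by (subst pair_measure_distr) (auto intro: D1.sigma_finite_measure_axioms)
  also have "\<dots> = distr M borel (\<lambda>\<omega>. f (R0 \<omega>)) \<Otimes>\<^sub>M distr M (\<Pi>\<^sub>M m\<in>L. borel) (\<lambda>\<omega>. g (R1 \<omega>))"
    by (subst (1 2) distr_distr) (auto simp: comp_def)
  finally show ?thesis unfolding f_R g_R .
qed

lemma brownian_airy_walk:
  assumes bm: "brownian_motion 2 N B" and \<epsilon>: "0 < \<epsilon>"
    and T: "finite T" "T \<noteq> {}" "\<And>t. t \<in> T \<Longrightarrow> s \<le> t" "\<And>t. t \<in> T \<Longrightarrow> t \<le> s + 1 / 4"
  shows "airy_walk N T (\<lambda>t \<omega>. sqrt \<epsilon> * B ((t - s) / \<epsilon>) \<omega>)"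
proof -
  interpret prob_space N using bm by (simp add: brownian_motion_def)
  have nonneg: "0 \<le> (t - s) / \<epsilon>" if "t \<in> T" for t using T(3)[OF that] \<epsilon> by simp
  have indB: "indep_vars (\<lambda>_. borel) (\<lambda>i \<omega>. B (\<tau> (Suc i)) \<omega> - B (\<tau> i) \<omega>) {..<n}"
    if "0 \<le> \<tau> 0" "\<And>i. i < n \<Longrightarrow> \<tau> i < \<tau> (Suc i)" for n and \<tau> :: "nat \<Rightarrow> real"
    using bm that unfolding brownian_motion_def by blast
  have ind: "indep_vars (\<lambda>_. borel)
      (\<lambda>i \<omega>. sqrt \<epsilon> * B ((\<tau> (Suc i) - s) / \<epsilon>) \<omega> - sqrt \<epsilon> * B ((\<tau> i - s) / \<epsilon>) \<omega>) {..<n}"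
    if "s \<le> \<tau> 0" "\<And>i. i < n \<Longrightarrow> \<tau> i < \<tau> (Suc i)" for n and \<tau> :: "nat \<Rightarrow> real"
  proof -
    have "indep_vars (\<lambda>_. borel) (\<lambda>i \<omega>. B ((\<tau> (Suc i) - s) / \<epsilon>) \<omega> - B ((\<tau> i - s) / \<epsilon>) \<omega>) {..<n}"
      using indB[of "\<lambda>i. (\<tau> i - s) / \<epsilon>" n] that \<epsilon> by (simp add: divide_strict_right_mono)
    then have "indep_vars (\<lambda>_. borel) (\<lambda>i \<omega>. sqrt \<epsilon> * (B ((\<tau> (Suc i) - s) / \<epsilon>) \<omega> - B ((\<tau> i - s) / \<epsilon>) \<omega>)) {..<n}"
      by (rule indep_vars_compose2[where Y = "\<lambda>_ x. sqrt \<epsilon> * x"]) simp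
    then show ?thesis by (simp only: right_diff_distrib)
  qed
  show ?thesis
  proof
    show "finite T" "T \<noteq> {}" by fact+
    fix t assume t: "t \<in> T"
    have "B ((t - s) / \<epsilon>) \<in> borel_measurable N" using bm nonneg[OF t] unfolding brownian_motion_def by blast
    then show "(\<lambda>\<omega>. sqrt \<epsilon> * B ((t - s) / \<epsilon>) \<omega>) \<in> borel_measurable N" by measurable
    fix l assume l: "l \<in> T"
    show "\<bar>l - t\<bar> \<le> 1 / 4" using T(3,4)[OF t] T(3,4)[OF l] by linarith
    assume tl: "t < l"
    have lt: "(t - s) / \<epsilon> < (l - s) / \<epsilon>" using tl \<epsilon> by (simp add: divide_strict_right_mono)
    have "distributed N lborel (\<lambda>\<omega>. B ((l - s) / \<epsilon>) \<omega> - B ((t - s) / \<epsilon>) \<omega>)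
        (normal_density 0 (sqrt (2 * ((l - s) / \<epsilon> - (t - s) / \<epsilon>))))"
      using bm nonneg[OF t] lt unfolding brownian_motion_def by blast
    moreover have "0 < sqrt (2 * ((l - s) / \<epsilon> - (t - s) / \<epsilon>))"
    proof (rule real_sqrt_gt_zero)
      have "0 < (l - s) / \<epsilon> - (t - s) / \<epsilon>" using lt by (simp only: diff_gt_0_iff_gt)
      then show "0 < 2 * ((l - s) / \<epsilon> - (t - s) / \<epsilon>)" by (rule mult_pos_pos[OF zero_less_numeral])
    qed
    ultimately have "distributed N lborel (\<lambda>\<omega>. 0 + sqrt \<epsilon> * (B ((l - s) / \<epsilon>) \<omega> - B ((t - s) / \<epsilon>) \<omega>))
        (normal_density (0 + sqrt \<epsilon> * 0) (\<bar>sqrt \<epsilon>\<bar> * sqrt (2 * ((l - s) / \<epsilon> - (t - s) / \<epsilon>))))"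
      using \<epsilon> by (intro normal_density_affine) simp_all
    then
    have "distributed N lborel (\<lambda>\<omega>. sqrt \<epsilon> * (B ((l - s) / \<epsilon>) \<omega> - B ((t - s) / \<epsilon>) \<omega>))
        (normal_density 0 (sqrt \<epsilon> * sqrt (2 * ((l - s) / \<epsilon> - (t - s) / \<epsilon>))))"
      using \<epsilon> by (simp only: add_0_left mult_zero_right abs_of_nonneg real_sqrt_ge_zero less_imp_le)
    moreover have "sqrt \<epsilon> * sqrt (2 * ((l - s) / \<epsilon> - (t - s) / \<epsilon>)) = sqrt (2 * (l - t))"
      using \<epsilon> by (simp add: real_sqrt_mult[symmetric] field_simps)
    ultimately show "distributed N lborel (\<lambda>\<omega>. sqrt \<epsilon> * B ((l - s) / \<epsilon>) \<omega> - sqrt \<epsilon> * B ((t - s) / \<epsilon>) \<omega>)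
        (\<lambda>x. ennreal (normal_density 0 (sqrt (2 * (l - t))) x))"
      by (simp only: right_diff_distrib)
    show "distr N (borel \<Otimes>\<^sub>M (\<Pi>\<^sub>M m\<in>{m \<in> T. l < m}. borel))
        (\<lambda>\<omega>. (sqrt \<epsilon> * B ((l - s) / \<epsilon>) \<omega> - sqrt \<epsilon> * B ((t - s) / \<epsilon>) \<omega>,
          \<lambda>m\<in>{m \<in> T. l < m}. sqrt \<epsilon> * B ((m - s) / \<epsilon>) \<omega> - sqrt \<epsilon> * B ((l - s) / \<epsilon>) \<omega>)) =
      distr N borel (\<lambda>\<omega>. sqrt \<epsilon> * B ((l - s) / \<epsilon>) \<omega> - sqrt \<epsilon> * B ((t - s) / \<epsilon>) \<omega>) \<Otimes>\<^sub>M
      distr N (\<Pi>\<^sub>M m\<in>{m \<in> T. l < m}. borel)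
        (\<lambda>\<omega>. \<lambda>m\<in>{m \<in> T. l < m}. sqrt \<epsilon> * B ((m - s) / \<epsilon>) \<omega> - sqrt \<epsilon> * B ((l - s) / \<epsilon>) \<omega>)"
      by (rule independent_increments_product_law[where s = s and W = "\<lambda>t \<omega>. sqrt \<epsilon> * B ((t - s) / \<epsilon>) \<omega>", OF ind])
        (use T t tl in auto)
  qed
qed

lemma scaled_exp_moments:
  fixes a d :: real
  assumes "0 \<le> a" "a \<le> 1"
  shows "exp \<bar>a * d\<bar> \<le> (1 + d\<^sup>2) * exp \<bar>d\<bar>"
    and "\<bar>a * d\<bar> * exp \<bar>a * d\<bar> \<le> a * ((1 + d\<^sup>2) * exp \<bar>d\<bar>)"
    and "(a * d)\<^sup>2 * exp \<bar>a * d\<bar> \<le> a\<^sup>2 * ((1 + d\<^sup>2) * exp \<bar>d\<bar>)"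
    and "\<bar>a * d\<bar> \<le> a * ((1 + d\<^sup>2) * exp \<bar>d\<bar>)"
proof -
  have ad: "\<bar>a * d\<bar> = a * \<bar>d\<bar>" using assms by (simp add: abs_mult)
  have e: "exp \<bar>a * d\<bar> \<le> exp \<bar>d\<bar>" using assms mult_right_mono[of a 1 "\<bar>d\<bar>"] by (simp add: ad)
  have d1: "\<bar>d\<bar> \<le> 1 + d\<^sup>2"
  proof -
    have "0 \<le> (\<bar>d\<bar> - 1 / 2)\<^sup>2" by simp
    then show ?thesis by (simp add: power2_diff power_divide)
  qed
  have "1 * exp \<bar>d\<bar> \<le> (1 + d\<^sup>2) * exp \<bar>d\<bar>" by (intro mult_right_mono) auto
  then show "exp \<bar>a * d\<bar> \<le> (1 + d\<^sup>2) * exp \<bar>d\<bar>" using e by (simp only: mult_1_left)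
  have 1: "\<bar>d\<bar> * exp \<bar>a * d\<bar> \<le> (1 + d\<^sup>2) * exp \<bar>d\<bar>" using d1 e by (intro mult_mono) auto
  show "\<bar>a * d\<bar> * exp \<bar>a * d\<bar> \<le> a * ((1 + d\<^sup>2) * exp \<bar>d\<bar>)"
    using mult_left_mono[OF 1 assms(1)] by (simp only: ad mult.assoc)
  have 2: "d\<^sup>2 * exp \<bar>a * d\<bar> \<le> (1 + d\<^sup>2) * exp \<bar>d\<bar>" using e by (intro mult_mono) auto
  show "(a * d)\<^sup>2 * exp \<bar>a * d\<bar> \<le> a\<^sup>2 * ((1 + d\<^sup>2) * exp \<bar>d\<bar>)"
    using mult_left_mono[OF 2, of "a\<^sup>2"] by (simp only: power_mult_distrib mult.assoc zero_le_power2 simp_thms)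
  have 3: "\<bar>d\<bar> * 1 \<le> (1 + d\<^sup>2) * exp \<bar>d\<bar>" using d1 by (intro mult_mono) auto
  show "\<bar>a * d\<bar> \<le> a * ((1 + d\<^sup>2) * exp \<bar>d\<bar>)"
    using mult_left_mono[OF 3 assms(1)] by (simp only: ad mult_1_right)
qed

lemma brownian_increment_moment:
  assumes bm: "brownian_motion 2 N B" and rt: "0 \<le> r" "r \<le> t"
  shows "integrable N (\<lambda>\<omega>. (1 + (B t \<omega> - B r \<omega>)\<^sup>2) * exp \<bar>B t \<omega> - B r \<omega>\<bar>)"
proof -
  interpret prob_space N using bm by (simp add: brownian_motion_def)
  show ?thesis
  proof (cases "r = t")
    case False
    then have "r < t" using rt by simp
    then have d: "distributed N lborel (\<lambda>\<omega>. B t \<omega> - B r \<omega>) (normal_density 0 (sqrt (2 * (t - r))))"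
      using bm rt unfolding brownian_motion_def by blast
    have s: "0 < sqrt (2 * (t - r))" using \<open>r < t\<close> by simp
    show ?thesis
      using normal_exp_abs_integrable[OF s] by (subst distributed_integrable[OF d, symmetric]) auto
  qed simp
qed

section \<open>Increments of the process given its value at the base time\<close>

definition orthant_prob :: "'b measure \<Rightarrow> (real \<Rightarrow> 'b \<Rightarrow> real) \<Rightarrow> real set \<Rightarrow> (real \<Rightarrow> real) \<Rightarrow> real" where
  "orthant_prob N B J z = measure N {\<omega> \<in> space N. \<forall>\<tau>\<in>J. B \<tau> \<omega> - B 0 \<omega> \<le> z \<tau>}"

text \<open>The joint law of the process at \<open>s\<close> and at the times \<open>s + \<epsilon> \<tau>\<close>, with levels that differ by multiples
  of \<open>sqrt \<epsilon>\<close>. Given that the process at \<open>s\<close> lies in an interval of length \<open>h * sqrt \<epsilon>\<close>, the other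
  values stay below their levels with a probability close to that for Brownian increments. The error
  \<open>C * \<epsilon>\<close> is uniform in \<open>x\<close> and small compared with the length of the interval; this allows summation
  over a partition of a bounded range into about \<open>1 / sqrt \<epsilon>\<close> intervals.\<close>

lemma local_increment_estimate:
  fixes A :: "real \<Rightarrow> 'a \<Rightarrow> real" and B :: "real \<Rightarrow> 'b \<Rightarrow> real" and z :: "real \<Rightarrow> real"
  assumes airy: "airy1_process M A" and bm: "brownian_motion 2 N B"
    and J: "finite J" "J \<subseteq> {0<..}" and R: "0 \<le> R" and h: "0 < h"
  shows "\<exists>C \<epsilon>0. 0 \<le> C \<and> 0 < \<epsilon>0 \<and> (\<forall>\<epsilon> x. 0 < \<epsilon> \<longrightarrow> \<epsilon> < \<epsilon>0 \<longrightarrow> - R \<le> x \<longrightarrow>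
    (\<exists>q. orthant_prob N B J (\<lambda>\<tau>. z \<tau> - h) \<le> q \<and> q \<le> orthant_prob N B J z \<and>
      \<bar>measure M {\<omega> \<in> space M. x < A s \<omega> \<and> A s \<omega> \<le> x + sqrt \<epsilon> * h \<and> (\<forall>\<tau>\<in>J. A (s + \<epsilon> * \<tau>) \<omega> \<le> x + sqrt \<epsilon> * z \<tau>)} -
        q * measure M {\<omega> \<in> space M. x < A s \<omega> \<and> A s \<omega> \<le> x + sqrt \<epsilon> * h}\<bar> \<le> C * \<epsilon>))"
proof -
  interpret M: prob_space M using airy by (simp add: airy1_process_def)
  interpret N: prob_space N using bm by (simp add: brownian_motion_def)
  have Am[measurable]: "A t \<in> borel_measurable M" for t using airy by (simp add: airy1_process_def)
  define K where "K = insert 0 J"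
  have K: "finite K" "0 \<in> K" "\<And>\<tau>. \<tau> \<in> K \<Longrightarrow> 0 \<le> \<tau>" using J by (auto simp: K_def)
  have J0: "0 \<notin> J" using J(2) by auto
  define m where "m = Max K"
  have m: "m \<in> K" "\<And>\<tau>. \<tau> \<in> K \<Longrightarrow> \<tau> \<le> m" "0 \<le> m"
  proof -
    have "K \<noteq> {}" using K(2) by blast
    then show "m \<in> K" unfolding m_def using K(1) by (rule Max_in[rotated])
    show le: "\<tau> \<le> m" if "\<tau> \<in> K" for \<tau> unfolding m_def using K(1) that by (rule Max_ge)
    show "0 \<le> m" by (rule le[OF K(2)])
  qed
  define g where "g = h + (\<Sum>\<tau>\<in>J. \<bar>z \<tau>\<bar>)"
  have g: "h \<le> g" "\<And>\<tau>. \<tau> \<in> J \<Longrightarrow> \<bar>z \<tau>\<bar> \<le> g"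
  proof -
    show "h \<le> g" by (simp add: g_def sum_nonneg)
    fix \<tau> assume "\<tau> \<in> J"
    then have "\<bar>z \<tau>\<bar> \<le> (\<Sum>\<tau>\<in>J. \<bar>z \<tau>\<bar>)" using J(1) by (intro member_le_sum) auto
    then show "\<bar>z \<tau>\<bar> \<le> g" using h by (simp add: g_def)
  qed
  have g0: "0 \<le> g" using g(1) h by simp
  define R' where "R' = R + g"
  have R': "0 \<le> R'" using R g0 by (simp add: R'_def)
  define Z where "Z \<tau> \<omega> = (1 + (B m \<omega> - B \<tau> \<omega>)\<^sup>2) * exp \<bar>B m \<omega> - B \<tau> \<omega>\<bar>" for \<tau> \<omega>
  define c where "c \<tau> = N.expectation (Z \<tau>)" for \<tau>
  have Z0: "0 \<le> Z \<tau> \<omega>" for \<tau> \<omega> by (simp add: Z_def)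
  have c0: "0 \<le> c \<tau>" for \<tau> unfolding c_def using Z0 by (intro integral_nonneg_AE) auto
  have Z_int: "integrable N (Z \<tau>)" if "\<tau> \<in> K" for \<tau>
    unfolding Z_def[abs_def] by (rule brownian_increment_moment[OF bm K(3)[OF that] m(2)[OF that]])
  define E1 where "E1 = airy_const * (exp (2 * R') * ((\<Sum>\<tau>\<in>K. 2 * g + c \<tau>) + 2 * g))"
  define S1 where "S1 = airy_const * (\<Sum>\<tau>\<in>K. m * c \<tau> * exp_tail R' + exp (2 * R') * (2 * g * c \<tau> + c \<tau>))"
  define fc where "fc = fred_const (2 * airy_const * real (card K) * exp_tail R')"
  define lc where "lc = line_const R' (real (card K) + 1)"
  define C where "C = 2 * (fc * S1) + lc * (airy_const * exp (2 * R') * h * (2 * E1 + 36 * h))"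
  have E10: "0 \<le> E1"
    unfolding E1_def using airy_const_nonneg g0 c0 by (intro mult_nonneg_nonneg add_nonneg_nonneg sum_nonneg) auto
  have S10: "0 \<le> S1"
    unfolding S1_def using airy_const_nonneg g0 c0 m(3) exp_tail_nonneg
    by (intro mult_nonneg_nonneg add_nonneg_nonneg sum_nonneg) auto
  have fc0: "0 \<le> fc"
    unfolding fc_def using airy_const_nonneg exp_tail_nonneg by (intro fred_const_nonneg) auto
  have cardK: "2 \<le> real (card K) + 1" using K by (simp add: Suc_le_eq card_gt_0_iff) auto
  have lc0: "0 \<le> lc" unfolding lc_def by (rule line_const_nonneg[OF R' cardK])
  have C0: "0 \<le> C"
    unfolding C_def using fc0 lc0 S10 E10 h airy_const_nonneg by (intro add_nonneg_nonneg mult_nonneg_nonneg) auto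
  define \<epsilon>0 where "\<epsilon>0 = min (1 / (4 * (m + 1))) ((1 / (h + 1))\<^sup>2)"
  have \<epsilon>0: "0 < \<epsilon>0" using m(3) h by (simp add: \<epsilon>0_def)
  have main: "\<exists>q. orthant_prob N B J (\<lambda>\<tau>. z \<tau> - h) \<le> q \<and> q \<le> orthant_prob N B J z \<and>
      \<bar>measure M {\<omega> \<in> space M. x < A s \<omega> \<and> A s \<omega> \<le> x + sqrt \<epsilon> * h \<and> (\<forall>\<tau>\<in>J. A (s + \<epsilon> * \<tau>) \<omega> \<le> x + sqrt \<epsilon> * z \<tau>)} -
        q * measure M {\<omega> \<in> space M. x < A s \<omega> \<and> A s \<omega> \<le> x + sqrt \<epsilon> * h}\<bar> \<le> C * \<epsilon>"
    if \<epsilon>: "0 < \<epsilon>" "\<epsilon> < \<epsilon>0" and x: "- R \<le> x" for \<epsilon> x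
  proof -
    let ?r = "sqrt \<epsilon>"
    have "\<epsilon> * (4 * (m + 1)) < 1"
      using \<epsilon>(2) m(3) by (simp add: \<epsilon>0_def pos_less_divide_eq)
    then have "4 * (\<epsilon> * m) + 4 * \<epsilon> < 1" by (simp add: algebra_simps)
    moreover have "0 \<le> \<epsilon> * m" using \<epsilon>(1) m(3) by (intro mult_nonneg_nonneg) auto
    ultimately have \<epsilon>m: "\<epsilon> * m \<le> 1 / 4" and \<epsilon>1: "\<epsilon> \<le> 1" using \<epsilon>(1) by linarith+
    have r: "0 < ?r" "?r \<le> 1" "?r * ?r = \<epsilon>" using \<epsilon>(1) \<epsilon>1 by auto
    have "?r \<le> 1 / (h + 1)"
      using \<epsilon> h by (intro real_le_lsqrt) (auto simp: \<epsilon>0_def)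
    then have "?r * (h + 1) \<le> 1" using h by (simp add: pos_le_divide_eq)
    then have rh: "?r * h \<le> 1" using r(1) unfolding distrib_left mult_1_right by linarith
    define T where "T = (\<lambda>\<tau>. s + \<epsilon> * \<tau>) ` K"
    define W where "W t \<omega> = ?r * B ((t - s) / \<epsilon>) \<omega>" for t \<omega>
    define \<xi> where "\<xi> t = x + ?r * (z(0 := 0)) ((t - s) / \<epsilon>)" for t
    have inj: "inj_on (\<lambda>\<tau>. s + \<epsilon> * \<tau>) K" using \<epsilon>(1) by (auto simp: inj_on_def)
    have T: "finite T" "T \<noteq> {}" "s \<in> T" "\<And>t. t \<in> T \<Longrightarrow> s \<le> t" "\<And>t. t \<in> T \<Longrightarrow> t \<le> s + \<epsilon> * m"
      using K m(2) \<epsilon>(1) by (auto simp: T_def intro: image_eqI[of _ _ 0])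
    have cardT: "card T = card K" unfolding T_def by (rule card_image[OF inj])
    have walk: "airy_walk N T W"
      unfolding W_def[abs_def] using brownian_airy_walk[OF bm \<epsilon>(1) T(1,2,4)] T(5) \<epsilon>m by fastforce
    interpret w: airy_walk N T W \<xi> by (rule walk)
    have \<xi>s: "\<xi> s = x" and \<xi>J: "\<And>\<tau>. \<tau> \<in> J \<Longrightarrow> \<xi> (s + \<epsilon> * \<tau>) = x + ?r * z \<tau>"
      using \<epsilon>(1) J0 by (auto simp: \<xi>_def)
    have \<xi>_near: "\<bar>\<xi> t - \<xi> s\<bar> \<le> ?r * g" if t: "t \<in> T" for t
    proof -
      obtain \<tau> where \<tau>: "\<tau> \<in> K" "t = s + \<epsilon> * \<tau>" using t by (auto simp: T_def)
      show ?thesis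
      proof (cases "\<tau> = 0")
        case True
        then show ?thesis using \<tau> g0 r by simp
      next
        case False
        then have "\<tau> \<in> J" using \<tau> by (simp add: K_def)
        then show ?thesis using \<tau>(2) g(2)[of \<tau>] r by (simp add: \<xi>s \<xi>J abs_mult)
      qed
    qed
    have \<xi>_ge: "- R' \<le> \<xi> t" if "t \<in> T" for t
    proof -
      have "?r * g \<le> 1 * g" using r g0 by (intro mult_right_mono) auto
      then show ?thesis using \<xi>_near[OF that] x unfolding \<xi>s R'_def by linarith
    qed
    have last: "w.last_time = s + \<epsilon> * m"
    proof (rule antisym)
      show "w.last_time \<le> s + \<epsilon> * m" by (rule T(5)[OF w.last_time(1)])
      show "s + \<epsilon> * m \<le> w.last_time" by (rule w.last_time(2)) (unfold T_def, rule imageI[OF m(1)])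
    qed
    have disp: "w.displacement (s + \<epsilon> * \<tau>) \<omega> = ?r * (B m \<omega> - B \<tau> \<omega>)" for \<tau> \<omega>
      using \<epsilon>(1) by (simp add: w.displacement_def last W_def right_diff_distrib)
    have sumT: "(\<Sum>t\<in>T. f t) = (\<Sum>\<tau>\<in>K. f (s + \<epsilon> * \<tau>))" for f :: "real \<Rightarrow> real"
      unfolding T_def sum.reindex[OF inj] by simp
    note mom = scaled_exp_moments[OF less_imp_le[OF r(1)] r(2)]
    have m1: "N.expectation (\<lambda>\<omega>. exp \<bar>w.displacement (s + \<epsilon> * \<tau>) \<omega>\<bar>) \<le> c \<tau>"
      and m2: "N.expectation (\<lambda>\<omega>. \<bar>w.displacement (s + \<epsilon> * \<tau>) \<omega>\<bar> * exp \<bar>w.displacement (s + \<epsilon> * \<tau>) \<omega>\<bar>) \<le> ?r * c \<tau>"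
      and m3: "N.expectation (\<lambda>\<omega>. (w.displacement (s + \<epsilon> * \<tau>) \<omega>)\<^sup>2 * exp \<bar>w.displacement (s + \<epsilon> * \<tau>) \<omega>\<bar>) \<le> \<epsilon> * c \<tau>"
      and m4: "N.expectation (\<lambda>\<omega>. \<bar>w.displacement (s + \<epsilon> * \<tau>) \<omega>\<bar>) \<le> ?r * c \<tau>" if \<tau>: "\<tau> \<in> K" for \<tau>
    proof -
      have bd: "N.expectation f \<le> a * c \<tau>" if "\<And>\<omega>. f \<omega> \<le> a * Z \<tau> \<omega>" "0 \<le> a" for f a
        unfolding c_def integral_mult_right_zero[symmetric]
        by (rule integral_mono'[OF integrable_mult_right[OF Z_int[OF \<tau>]] that(1)]) (use Z0 that(2) in auto)
      show "N.expectation (\<lambda>\<omega>. exp \<bar>w.displacement (s + \<epsilon> * \<tau>) \<omega>\<bar>) \<le> c \<tau>"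
        using bd[of "\<lambda>\<omega>. exp \<bar>w.displacement (s + \<epsilon> * \<tau>) \<omega>\<bar>" 1] mom(1) by (simp add: disp Z_def)
      show "N.expectation (\<lambda>\<omega>. \<bar>w.displacement (s + \<epsilon> * \<tau>) \<omega>\<bar> * exp \<bar>w.displacement (s + \<epsilon> * \<tau>) \<omega>\<bar>) \<le> ?r * c \<tau>"
        unfolding disp by (rule bd) (use mom(2) r in \<open>simp_all add: Z_def\<close>)
      show "N.expectation (\<lambda>\<omega>. (w.displacement (s + \<epsilon> * \<tau>) \<omega>)\<^sup>2 * exp \<bar>w.displacement (s + \<epsilon> * \<tau>) \<omega>\<bar>) \<le> \<epsilon> * c \<tau>"
      proof -
        have "?r\<^sup>2 = \<epsilon>" using \<epsilon>(1) by simp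
        then show ?thesis unfolding disp by - (rule bd, use mom(3) \<epsilon> in \<open>simp_all add: Z_def\<close>)
      qed
      show "N.expectation (\<lambda>\<omega>. \<bar>w.displacement (s + \<epsilon> * \<tau>) \<omega>\<bar>) \<le> ?r * c \<tau>"
        unfolding disp by (rule bd) (use mom(4) r in \<open>simp_all add: Z_def\<close>)
    qed
    have E: "airy_const * (exp (2 * R') * ((\<Sum>t\<in>T. 2 * (?r * g) + N.expectation (\<lambda>\<omega>. \<bar>w.displacement t \<omega>\<bar>)) + 2 * (?r * g))) \<le> ?r * E1"
    proof -
      have "(\<Sum>t\<in>T. 2 * (?r * g) + N.expectation (\<lambda>\<omega>. \<bar>w.displacement t \<omega>\<bar>)) \<le> (\<Sum>\<tau>\<in>K. 2 * (?r * g) + ?r * c \<tau>)"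
        unfolding sumT by (intro sum_mono add_left_mono m4)
      also have "\<dots> = ?r * (\<Sum>\<tau>\<in>K. 2 * g + c \<tau>)" by (simp add: sum_distrib_left algebra_simps)
      finally have "(\<Sum>t\<in>T. 2 * (?r * g) + N.expectation (\<lambda>\<omega>. \<bar>w.displacement t \<omega>\<bar>)) + 2 * (?r * g) \<le>
          ?r * ((\<Sum>\<tau>\<in>K. 2 * g + c \<tau>) + 2 * g)" by (simp add: algebra_simps)
      then have "airy_const * (exp (2 * R') * ((\<Sum>t\<in>T. 2 * (?r * g) + N.expectation (\<lambda>\<omega>. \<bar>w.displacement t \<omega>\<bar>)) + 2 * (?r * g))) \<le>
          airy_const * (exp (2 * R') * (?r * ((\<Sum>\<tau>\<in>K. 2 * g + c \<tau>) + 2 * g)))"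
        using airy_const_nonneg by (intro mult_left_mono) auto
      also have "\<dots> = ?r * E1" unfolding E1_def by (simp only: mult_ac)
      finally show ?thesis .
    qed
    have S: "w.error_size R' (\<epsilon> * m) (?r * g) \<le> \<epsilon> * S1"
    proof -
      have "w.error_size R' (\<epsilon> * m) (?r * g) \<le> airy_const * (\<Sum>\<tau>\<in>K. \<epsilon> * m * c \<tau> * exp_tail R' +
          exp (2 * R') * (2 * (?r * g) * (?r * c \<tau>) + \<epsilon> * c \<tau>))"
        unfolding w.error_size_def sumT
      proof (intro mult_left_mono sum_mono add_mono airy_const_nonneg mult_right_mono exp_tail_nonneg)
        show "0 \<le> \<epsilon> * m" "0 \<le> 2 * (?r * g)" "0 \<le> exp (2 * R')" using \<epsilon>(1) m(3) r g0 by auto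
      qed (use m1 m2 m3 in auto)
      also have "\<dots> = \<epsilon> * S1"
      proof -
        have rr: "2 * (?r * g) * (?r * c \<tau>) = \<epsilon> * (2 * g * c \<tau>)" for \<tau>
        proof -
          have "2 * (?r * g) * (?r * c \<tau>) = (?r * ?r) * (2 * g * c \<tau>)" by (simp only: mult_ac)
          then show ?thesis by (simp only: r(3))
        qed
        show ?thesis unfolding rr by (simp add: S1_def sum_distrib_left algebra_simps)
      qed
      finally show ?thesis .
    qed
    have diam: "\<bar>t' - t\<bar> \<le> \<epsilon> * m" if "t \<in> T" "t' \<in> T" for t t'
      using T(4,5)[OF that(1)] T(4,5)[OF that(2)] by linarith
    have rhg: "?r * h \<le> ?r * g" using r g(1) by simp
    have rh0: "0 < ?r * h" using r(1) h by (rule mult_pos_pos)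
    obtain q where q: "w.stay_prob s (\<xi> s + ?r * h) \<le> q" "q \<le> w.stay_prob s (\<xi> s)"
      and q_err: "\<bar>(level_det T (\<xi>(s := \<xi> s + ?r * h)) - level_det T \<xi>) -
        q * (level_det {s} (\<xi>(s := \<xi> s + ?r * h)) - level_det {s} \<xi>)\<bar> \<le>
      2 * (fred_const (2 * airy_const * real (card T) * exp_tail R') * w.error_size R' (\<epsilon> * m) (?r * g)) +
      line_const R' (real (card T) + 1) * (airy_const * exp (2 * R') * (?r * h) * (2 * (?r * E1) + 36 * (?r * h)))"
      using level_increment[where \<xi> = \<xi>, OF walk T(3,4) R' \<xi>_ge diam \<xi>_near rh0 rhg rh E] by blast
    have stay: "w.stay_prob s (x + ?r * u) = orthant_prob N B J (\<lambda>\<tau>. z \<tau> - u)" for u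
    proof -
      have "w.stays s (x + ?r * u) \<omega> = (\<forall>\<tau>\<in>J. B \<tau> \<omega> - B 0 \<omega> \<le> z \<tau> - u)" for \<omega>
      proof -
        have later: "{t \<in> T. s < t} = (\<lambda>\<tau>. s + \<epsilon> * \<tau>) ` J"
          using J(2) \<epsilon>(1) by (auto simp: T_def K_def)
        have "w.stays s (x + ?r * u) \<omega> \<longleftrightarrow> (\<forall>t\<in>{t \<in> T. s < t}. x + ?r * u + (W t \<omega> - W s \<omega>) \<le> \<xi> t)"
          by (auto simp: w.stays_def)
        also have "\<dots> \<longleftrightarrow> (\<forall>\<tau>\<in>J. x + ?r * u + (W (s + \<epsilon> * \<tau>) \<omega> - W s \<omega>) \<le> \<xi> (s + \<epsilon> * \<tau>))"
          unfolding later by blast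
        also have "\<dots> \<longleftrightarrow> (\<forall>\<tau>\<in>J. ?r * (B \<tau> \<omega> - B 0 \<omega>) \<le> ?r * (z \<tau> - u))"
        proof (rule ball_cong[OF refl])
          fix \<tau> assume \<tau>: "\<tau> \<in> J"
          have W: "W (s + \<epsilon> * \<tau>) \<omega> = ?r * B \<tau> \<omega>" "W s \<omega> = ?r * B 0 \<omega>"
            using \<epsilon>(1) by (simp_all add: W_def)
          show "(x + ?r * u + (W (s + \<epsilon> * \<tau>) \<omega> - W s \<omega>) \<le> \<xi> (s + \<epsilon> * \<tau>)) = (?r * (B \<tau> \<omega> - B 0 \<omega>) \<le> ?r * (z \<tau> - u))"
            unfolding \<xi>J[OF \<tau>] W right_diff_distrib by (rule iffI) linarith+
        qed
        also have "\<dots> \<longleftrightarrow> (\<forall>\<tau>\<in>J. B \<tau> \<omega> - B 0 \<omega> \<le> z \<tau> - u)"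
          using r(1) by (simp only: mult_le_cancel_left_pos)
        finally show ?thesis .
      qed
      then have "w.stay_prob s (x + ?r * u) =
          N.expectation (indicator {\<omega> \<in> space N. \<forall>\<tau>\<in>J. B \<tau> \<omega> - B 0 \<omega> \<le> z \<tau> - u})"
        unfolding w.stay_prob_def by (intro Bochner_Integration.integral_cong refl) (simp add: indicator_def)
      moreover have "{\<omega> \<in> space N. \<forall>\<tau>\<in>J. B \<tau> \<omega> - B 0 \<omega> \<le> z \<tau> - u} \<inter> space N =
          {\<omega> \<in> space N. \<forall>\<tau>\<in>J. B \<tau> \<omega> - B 0 \<omega> \<le> z \<tau> - u}" by blast
      ultimately show ?thesis by (simp only: orthant_prob_def Bochner_Integration.integral_indicator)
    qed
    have P_T: "M.prob {\<omega> \<in> space M. \<forall>t\<in>T. A t \<omega> \<le> \<xi>' t} = level_det T \<xi>'" for \<xi>'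
      by (rule airy1_level_det[OF airy T(1,2)])
    have P_s: "M.prob {\<omega> \<in> space M. A s \<omega> \<le> \<xi>' s} = level_det {s} \<xi>'" for \<xi>'
      using airy1_level_det[OF airy, of "{s}" \<xi>'] by simp
    have J_all: "(\<forall>t\<in>T. A t \<omega> \<le> (\<xi>(s := v)) t) \<longleftrightarrow> A s \<omega> \<le> v \<and> (\<forall>\<tau>\<in>J. A (s + \<epsilon> * \<tau>) \<omega> \<le> x + ?r * z \<tau>)" for v \<omega>
      unfolding T_def K_def ball_simps using J0 \<epsilon>(1) by (auto simp: \<xi>J)
    let ?P = "\<lambda>v. {\<omega> \<in> space M. A s \<omega> \<le> v \<and> (\<forall>\<tau>\<in>J. A (s + \<epsilon> * \<tau>) \<omega> \<le> x + ?r * z \<tau>)}"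
    let ?F = "\<lambda>v. {\<omega> \<in> space M. A s \<omega> \<le> v}"
    have P_meas: "?P v \<in> sets M" for v using J(1) by measurable
    have F_meas: "?F v \<in> sets M" for v by measurable
    have xk: "x \<le> x + ?r * h" using r h by simp
    have "level_det T (\<xi>(s := \<xi> s + ?r * h)) - level_det T \<xi> = M.prob (?P (x + ?r * h)) - M.prob (?P x)"
      using P_T[of "\<xi>(s := \<xi> s + ?r * h)"] P_T[of "\<xi>(s := \<xi> s)"] unfolding J_all \<xi>s fun_upd_triv
      by (simp add: \<xi>s[symmetric])
    also have "\<dots> = M.prob (?P (x + ?r * h) - ?P x)"
      using P_meas xk by (intro M.finite_measure_Diff[symmetric]) auto
    also have "?P (x + ?r * h) - ?P x = {\<omega> \<in> space M. x < A s \<omega> \<and> A s \<omega> \<le> x + ?r * h \<and> (\<forall>\<tau>\<in>J. A (s + \<epsilon> * \<tau>) \<omega> \<le> x + ?r * z \<tau>)}"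
      by auto
    finally have D1: "level_det T (\<xi>(s := \<xi> s + ?r * h)) - level_det T \<xi> = M.prob \<dots>" .
    have "level_det {s} (\<xi>(s := \<xi> s + ?r * h)) - level_det {s} \<xi> = M.prob (?F (x + ?r * h)) - M.prob (?F x)"
      using P_s[of "\<xi>(s := \<xi> s + ?r * h)"] P_s[of \<xi>] by (simp add: \<xi>s)
    also have "\<dots> = M.prob (?F (x + ?r * h) - ?F x)"
      using F_meas xk by (intro M.finite_measure_Diff[symmetric]) auto
    also have "?F (x + ?r * h) - ?F x = {\<omega> \<in> space M. x < A s \<omega> \<and> A s \<omega> \<le> x + ?r * h}"
      by auto
    finally have D2: "level_det {s} (\<xi>(s := \<xi> s + ?r * h)) - level_det {s} \<xi> = M.prob \<dots>" .
    have e1: "2 * (fc * w.error_size R' (\<epsilon> * m) (?r * g)) \<le> 2 * (fc * (\<epsilon> * S1))"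
      using fc0 S by (intro mult_left_mono) auto
    have e2: "airy_const * exp (2 * R') * (?r * h) * (2 * (?r * E1) + 36 * (?r * h)) =
        \<epsilon> * (airy_const * exp (2 * R') * h * (2 * E1 + 36 * h))"
    proof -
      have "a * e * (r * h) * (2 * (r * u) + 36 * (r * h)) = (r * r) * (a * e * h * (2 * u + 36 * h))" for a e r u :: real
        by (simp add: algebra_simps)
      then show ?thesis by (simp only: r(3))
    qed
    have e3: "C * \<epsilon> = 2 * (fc * (\<epsilon> * S1)) + lc * (\<epsilon> * (airy_const * exp (2 * R') * h * (2 * E1 + 36 * h)))"
      unfolding C_def distrib_right by (simp only: mult_ac)
    have "\<bar>(level_det T (\<xi>(s := \<xi> s + ?r * h)) - level_det T \<xi>) -
        q * (level_det {s} (\<xi>(s := \<xi> s + ?r * h)) - level_det {s} \<xi>)\<bar> \<le> C * \<epsilon>"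
      unfolding e3 by (rule order_trans[OF q_err[unfolded cardT, folded fc_def lc_def, unfolded e2] add_right_mono[OF e1]])
    then have "\<bar>measure M {\<omega> \<in> space M. x < A s \<omega> \<and> A s \<omega> \<le> x + ?r * h \<and> (\<forall>\<tau>\<in>J. A (s + \<epsilon> * \<tau>) \<omega> \<le> x + ?r * z \<tau>)} -
        q * measure M {\<omega> \<in> space M. x < A s \<omega> \<and> A s \<omega> \<le> x + ?r * h}\<bar> \<le> C * \<epsilon>"
      unfolding D1 D2 .
    moreover have "orthant_prob N B J (\<lambda>\<tau>. z \<tau> - h) \<le> q" using q(1) stay[of h] by (simp add: \<xi>s)
    moreover have "q \<le> orthant_prob N B J z" using q(2) stay[of 0] by (simp add: \<xi>s)
    ultimately show ?thesis by blast
  qed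
  show ?thesis using C0 \<epsilon>0 main by blast
qed

section \<open>From orthant probabilities to weak convergence\<close>

lemma product_topology_continuous_delta:
  fixes f :: "('i \<Rightarrow> real) \<Rightarrow> real"
  assumes J: "finite J" and f: "continuous_map (product_topology (\<lambda>_. euclideanreal) J) euclideanreal f"
    and x: "x \<in> (\<Pi>\<^sub>E j\<in>J. UNIV)" and \<eta>: "0 < \<eta>"
  obtains \<delta> where "0 < \<delta>" "\<And>y. y \<in> (\<Pi>\<^sub>E j\<in>J. UNIV) \<Longrightarrow> (\<And>j. j \<in> J \<Longrightarrow> \<bar>y j - x j\<bar> < \<delta>) \<Longrightarrow> \<bar>f y - f x\<bar> < \<eta>"
proof -
  let ?X = "product_topology (\<lambda>_ :: 'i. euclideanreal) J"
  have op: "openin ?X {y \<in> topspace ?X. f y \<in> ball (f x) \<eta>}"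
    using f by (rule openin_continuous_map_preimage) simp
  have xS: "x \<in> {y \<in> topspace ?X. f y \<in> ball (f x) \<eta>}" using x \<eta> by simp
  from bspec[OF iffD1[OF openin_product_topology_alt op] xS]
  obtain U where U': "\<forall>j\<in>J. openin euclideanreal (U j)" and U: "x \<in> Pi\<^sub>E J U"
      "Pi\<^sub>E J U \<subseteq> {y \<in> topspace ?X. f y \<in> ball (f x) \<eta>}"
    by blast
  have "\<forall>j\<in>J. \<exists>d>0. \<forall>u. \<bar>u - x j\<bar> < d \<longrightarrow> u \<in> U j"
  proof
    fix j assume j: "j \<in> J"
    then have "x j \<in> U j" using U(1) by (simp add: PiE_mem)
    moreover have "open (U j)" using U' j by simp
    ultimately obtain d where "0 < d" "\<forall>u. dist u (x j) < d \<longrightarrow> u \<in> U j"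
      unfolding open_dist by blast
    then show "\<exists>d>0. \<forall>u. \<bar>u - x j\<bar> < d \<longrightarrow> u \<in> U j"
      unfolding dist_real_def by blast
  qed
  then obtain d where d: "\<And>j. j \<in> J \<Longrightarrow> 0 < d j" "\<And>j u. j \<in> J \<Longrightarrow> \<bar>u - x j\<bar> < d j \<Longrightarrow> u \<in> U j"
    by metis
  define \<delta> where "\<delta> = Min (insert 1 (d ` J))"
  have fin: "finite (insert 1 (d ` J))" using J by simp
  show thesis
  proof
    show "0 < \<delta>" using fin d(1) by (simp add: \<delta>_def)
    fix y assume y: "y \<in> (\<Pi>\<^sub>E j\<in>J. UNIV :: real set)" "\<And>j. j \<in> J \<Longrightarrow> \<bar>y j - x j\<bar> < \<delta>"
    have le: "\<delta> \<le> d j" if "j \<in> J" for j unfolding \<delta>_def using fin that by (intro Min_le) auto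
    have "y \<in> Pi\<^sub>E J U"
    proof (rule PiE_I)
      show "y j \<in> U j" if "j \<in> J" for j
        by (rule d(2)[OF that less_le_trans[OF y(2)[OF that] le[OF that]]])
      show "y j = undefined" if "j \<notin> J" for j using y(1) that by (rule PiE_arb)
    qed
    then show "\<bar>f y - f x\<bar> < \<eta>" using U(2) by (auto simp: dist_real_def abs_minus_commute)
  qed
qed

text \<open>Cubes of side \<open>1 / n\<close> are taken half-open at the bottom, so that their indicators are combinations
  of indicators of orthants.\<close>

definition grid_index :: "'i set \<Rightarrow> nat \<Rightarrow> ('i \<Rightarrow> real) \<Rightarrow> 'i \<Rightarrow> int" where
  "grid_index J n x = (\<lambda>j\<in>J. \<lceil>real n * x j\<rceil> - 1)"

text \<open>Cubes of side \<open>1 / n\<close> that fill the window \<open>(- n, n]\<close> in every coordinate; a single parameter thus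
  controls mesh and window.\<close>

definition grid_window :: "'i set \<Rightarrow> nat \<Rightarrow> ('i \<Rightarrow> int) set" where
  "grid_window J n = (\<Pi>\<^sub>E j\<in>J. {- (int n)\<^sup>2..<(int n)\<^sup>2})"

lemma finite_grid_window: "finite J \<Longrightarrow> finite (grid_window J n)"
  unfolding grid_window_def by (intro finite_PiE) auto

lemma grid_index_eq_iff:
  assumes "0 < n" "v \<in> grid_window J n"
  shows "grid_index J n x = v \<longleftrightarrow> (\<forall>j\<in>J. real_of_int (v j) / n < x j \<and> x j \<le> real_of_int (v j + 1) / n)"
proof -
  have v: "v \<in> extensional J" using assms(2) by (simp add: grid_window_def PiE_def)
  have cell: "\<lceil>y\<rceil> - 1 = k \<longleftrightarrow> real_of_int k < y \<and> y \<le> real_of_int (k + 1)" for y :: real and k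
    using ceiling_eq_iff[of y "k + 1"] by (simp add: diff_eq_eq)
  have "grid_index J n x = v \<longleftrightarrow> (\<forall>j\<in>J. \<lceil>real n * x j\<rceil> - 1 = v j)"
  proof
    assume "\<forall>j\<in>J. \<lceil>real n * x j\<rceil> - 1 = v j"
    then show "grid_index J n x = v"
      unfolding grid_index_def by (intro extensionalityI[OF restrict_extensional v]) simp
  qed (auto simp: grid_index_def)
  also have "\<dots> \<longleftrightarrow> (\<forall>j\<in>J. real_of_int (v j) < real n * x j \<and> real n * x j \<le> real_of_int (v j + 1))"
    by (intro ball_cong refl cell)
  also have "\<dots> \<longleftrightarrow> (\<forall>j\<in>J. real_of_int (v j) / n < x j \<and> x j \<le> real_of_int (v j + 1) / n)"
    using assms(1) by (intro ball_cong refl) (simp add: pos_divide_less_eq pos_le_divide_eq mult.commute[of "real n"])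
  finally show ?thesis .
qed

definition grid_step :: "'i set \<Rightarrow> nat \<Rightarrow> (('i \<Rightarrow> int) \<Rightarrow> real) \<Rightarrow> ('i \<Rightarrow> real) \<Rightarrow> real" where
  "grid_step J n g x = (if grid_index J n x \<in> grid_window J n then g (grid_index J n x) else 0)"

lemma grid_step_sum:
  assumes "finite J"
  shows "grid_step J n g x = (\<Sum>v\<in>grid_window J n. g v * of_bool (grid_index J n x = v))"
proof -
  have "(\<Sum>v\<in>grid_window J n. g v * of_bool (grid_index J n x = v)) =
      (\<Sum>v\<in>grid_window J n. if grid_index J n x = v then g v else 0)"
    by (intro sum.cong refl) auto
  then show ?thesis
    unfolding grid_step_def using finite_grid_window[OF assms] by (simp add: sum.delta)
qed

lemma (in prob_space) grid_step_expectation: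
  assumes J: "finite J" and n: "0 < n" and X[measurable]: "\<And>j. j \<in> J \<Longrightarrow> X j \<in> borel_measurable M"
  shows "(\<lambda>\<omega>. grid_step J n g (\<lambda>j\<in>J. X j \<omega>)) \<in> borel_measurable M"
    and "integrable M (\<lambda>\<omega>. grid_step J n g (\<lambda>j\<in>J. X j \<omega>))"
    and "expectation (\<lambda>\<omega>. grid_step J n g (\<lambda>j\<in>J. X j \<omega>)) =
      (\<Sum>v\<in>grid_window J n. g v * prob {\<omega> \<in> space M. \<forall>j\<in>J. real_of_int (v j) / n < X j \<omega> \<and> X j \<omega> \<le> real_of_int (v j + 1) / n})"
proof -
  let ?C = "\<lambda>v. {\<omega> \<in> space M. \<forall>j\<in>J. real_of_int (v j) / n < X j \<omega> \<and> X j \<omega> \<le> real_of_int (v j + 1) / n}"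
  have C[measurable]: "?C v \<in> sets M" for v using J by measurable
  have eq: "grid_step J n g (\<lambda>j\<in>J. X j \<omega>) = (\<Sum>v\<in>grid_window J n. g v * indicator (?C v) \<omega>)"
    if "\<omega> \<in> space M" for \<omega>
    unfolding grid_step_sum[OF J]
  proof (intro sum.cong refl arg_cong2[where f = times])
    fix v assume "v \<in> grid_window J n"
    from grid_index_eq_iff[OF n this, of "\<lambda>j\<in>J. X j \<omega>"]
    have "grid_index J n (\<lambda>j\<in>J. X j \<omega>) = v \<longleftrightarrow> \<omega> \<in> ?C v" using that by simp
    then show "of_bool (grid_index J n (\<lambda>j\<in>J. X j \<omega>) = v) = (indicator (?C v) \<omega> :: real)"
      by (simp only: indicator_def)
  qed
  have int: "integrable M (\<lambda>\<omega>. \<Sum>v\<in>grid_window J n. g v * indicator (?C v) \<omega>)"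
    by (intro Bochner_Integration.integrable_sum integrable_mult_right integrable_real_indicator C) (simp add: emeasure_eq_measure)
  then show i: "integrable M (\<lambda>\<omega>. grid_step J n g (\<lambda>j\<in>J. X j \<omega>))"
    by (subst Bochner_Integration.integrable_cong[OF refl eq])
  then show "(\<lambda>\<omega>. grid_step J n g (\<lambda>j\<in>J. X j \<omega>)) \<in> borel_measurable M" by simp
  have "expectation (\<lambda>\<omega>. grid_step J n g (\<lambda>j\<in>J. X j \<omega>)) = expectation (\<lambda>\<omega>. \<Sum>v\<in>grid_window J n. g v * indicator (?C v) \<omega>)"
    by (rule Bochner_Integration.integral_cong[OF refl eq])
  also have "\<dots> = (\<Sum>v\<in>grid_window J n. expectation (\<lambda>\<omega>. g v * indicator (?C v) \<omega>))"
    by (intro Bochner_Integration.integral_sum integrable_mult_right integrable_real_indicator C) (simp add: emeasure_eq_measure)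
  also have "\<dots> = (\<Sum>v\<in>grid_window J n. g v * prob (?C v))"
  proof (intro sum.cong refl)
    fix v
    have "?C v \<inter> space M = ?C v" by blast
    then show "expectation (\<lambda>\<omega>. g v * indicator (?C v) \<omega>) = g v * prob (?C v)"
      by (simp only: integral_mult_right_zero Bochner_Integration.integral_indicator)
  qed
  finally show "expectation (\<lambda>\<omega>. grid_step J n g (\<lambda>j\<in>J. X j \<omega>)) = (\<Sum>v\<in>grid_window J n. g v * prob (?C v))" .
qed

text \<open>A continuous function on \<open>\<real>\<^sup>J\<close> is compared with its values at one representative of each cube;
  the error is the oscillation over the cube, which tends to \<open>0\<close> pointwise, but not uniformly.\<close>

definition grid_rep :: "'i set \<Rightarrow> nat \<Rightarrow> ('i \<Rightarrow> int) \<Rightarrow> 'i \<Rightarrow> real" where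
  "grid_rep J n v = (SOME y. y \<in> (\<Pi>\<^sub>E j\<in>J. UNIV) \<and> grid_index J n y = v)"

definition grid_osc :: "'i set \<Rightarrow> nat \<Rightarrow> (('i \<Rightarrow> real) \<Rightarrow> real) \<Rightarrow> ('i \<Rightarrow> int) \<Rightarrow> real" where
  "grid_osc J n f v = (SUP y\<in>{y \<in> (\<Pi>\<^sub>E j\<in>J. UNIV). grid_index J n y = v}. \<bar>f y - f (grid_rep J n v)\<bar>)"

definition grid_approx :: "'i set \<Rightarrow> nat \<Rightarrow> (('i \<Rightarrow> real) \<Rightarrow> real) \<Rightarrow> ('i \<Rightarrow> real) \<Rightarrow> real" where
  "grid_approx J n f = grid_step J n (\<lambda>v. f (grid_rep J n v))"

definition grid_error :: "'i set \<Rightarrow> real \<Rightarrow> nat \<Rightarrow> (('i \<Rightarrow> real) \<Rightarrow> real) \<Rightarrow> ('i \<Rightarrow> real) \<Rightarrow> real" where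
  "grid_error J b n f x = b + grid_step J n (\<lambda>v. grid_osc J n f v - b) x"

locale bounded_continuous_fun =
  fixes J :: "'i set" and f :: "('i \<Rightarrow> real) \<Rightarrow> real" and b :: real
  assumes J: "finite J" and cont: "continuous_map (product_topology (\<lambda>_. euclideanreal) J) euclideanreal f"
    and bound: "\<And>x. x \<in> (\<Pi>\<^sub>E j\<in>J. UNIV) \<Longrightarrow> \<bar>f x\<bar> \<le> b"
begin

lemma bound_nonneg: "0 \<le> b"
  using order_trans[OF abs_ge_zero bound[of "\<lambda>j\<in>J. 0"]] by simp

lemma grid_rep:
  assumes "x \<in> (\<Pi>\<^sub>E j\<in>J. UNIV)"
  shows "grid_rep J n (grid_index J n x) \<in> (\<Pi>\<^sub>E j\<in>J. UNIV)" "grid_index J n (grid_rep J n (grid_index J n x)) = grid_index J n x"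
proof -
  have "grid_rep J n (grid_index J n x) \<in> (\<Pi>\<^sub>E j\<in>J. UNIV) \<and>
      grid_index J n (grid_rep J n (grid_index J n x)) = grid_index J n x"
    unfolding grid_rep_def by (rule someI[where x = x]) (use assms in blast)
  then show "grid_rep J n (grid_index J n x) \<in> (\<Pi>\<^sub>E j\<in>J. UNIV)"
    "grid_index J n (grid_rep J n (grid_index J n x)) = grid_index J n x" by blast+
qed

lemma osc_diff_le:
  assumes "x \<in> (\<Pi>\<^sub>E j\<in>J. UNIV)" "y \<in> (\<Pi>\<^sub>E j\<in>J. UNIV)"
  shows "\<bar>f y - f (grid_rep J n (grid_index J n x))\<bar> \<le> 2 * b"
  using bound[OF assms(2)] bound[OF grid_rep(1)[OF assms(1), of n]] by linarith

lemma osc_upper: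
  assumes x: "x \<in> (\<Pi>\<^sub>E j\<in>J. UNIV)"
  shows "\<bar>f x - f (grid_rep J n (grid_index J n x))\<bar> \<le> grid_osc J n f (grid_index J n x)"
  unfolding grid_osc_def
proof (rule cSUP_upper)
  show "x \<in> {y \<in> (\<Pi>\<^sub>E j\<in>J. UNIV). grid_index J n y = grid_index J n x}" using x by simp
  show "bdd_above ((\<lambda>y. \<bar>f y - f (grid_rep J n (grid_index J n x))\<bar>) ` {y \<in> (\<Pi>\<^sub>E j\<in>J. UNIV). grid_index J n y = grid_index J n x})"
    by (rule bdd_aboveI2[where M = "2 * b"]) (use osc_diff_le[OF x] in blast)
qed

lemma osc_least:
  assumes x: "x \<in> (\<Pi>\<^sub>E j\<in>J. UNIV)"
    and le: "\<And>y. y \<in> (\<Pi>\<^sub>E j\<in>J. UNIV) \<Longrightarrow> grid_index J n y = grid_index J n x \<Longrightarrow>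
      \<bar>f y - f (grid_rep J n (grid_index J n x))\<bar> \<le> a"
  shows "grid_osc J n f (grid_index J n x) \<le> a"
  unfolding grid_osc_def by (rule cSUP_least) (use x le in auto)

lemma grid_approx_error:
  assumes x: "x \<in> (\<Pi>\<^sub>E j\<in>J. UNIV)"
  shows "\<bar>f x - grid_approx J n f x\<bar> \<le> grid_error J b n f x"
  using osc_upper[OF x, of n] bound[OF x] by (simp add: grid_approx_def grid_error_def grid_step_def)

lemma grid_error_le:
  assumes x: "x \<in> (\<Pi>\<^sub>E j\<in>J. UNIV)"
  shows "\<bar>grid_error J b n f x\<bar> \<le> 2 * b"
proof -
  have "grid_osc J n f (grid_index J n x) \<le> 2 * b"
    by (rule osc_least[OF x]) (rule osc_diff_le[OF x])
  moreover have "0 \<le> grid_osc J n f (grid_index J n x)"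
    by (rule order_trans[OF abs_ge_zero osc_upper[OF x]])
  ultimately show ?thesis using bound_nonneg by (simp add: grid_error_def grid_step_def)
qed

lemma grid_error_tendsto:
  assumes x: "x \<in> (\<Pi>\<^sub>E j\<in>J. UNIV)"
  shows "(\<lambda>n. grid_error J b (Suc n) f x) \<longlonglongrightarrow> 0"
proof (rule LIMSEQ_I)
  fix \<eta> :: real assume \<eta>: "0 < \<eta>"
  then have "0 < \<eta> / 3" by simp
  from product_topology_continuous_delta[OF J cont x this] obtain \<delta> where
    \<delta>: "0 < \<delta>" "\<And>y. y \<in> (\<Pi>\<^sub>E j\<in>J. UNIV) \<Longrightarrow> (\<And>j. j \<in> J \<Longrightarrow> \<bar>y j - x j\<bar> < \<delta>) \<Longrightarrow> \<bar>f y - f x\<bar> < \<eta> / 3"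
    by metis
  obtain k where k: "1 / \<delta> + (\<Sum>j\<in>J. \<bar>x j\<bar>) < real k" using reals_Archimedean2 by blast
  show "\<exists>n0. \<forall>n\<ge>n0. norm (grid_error J b (Suc n) f x - 0) < \<eta>"
  proof (intro exI allI impI)
    fix n assume "k \<le> n"
    then have nk: "1 / \<delta> + (\<Sum>j\<in>J. \<bar>x j\<bar>) < real (Suc n)" using k by simp
    have n\<delta>: "1 / real (Suc n) < \<delta>"
    proof -
      have "0 \<le> (\<Sum>j\<in>J. \<bar>x j\<bar>)" by (intro sum_nonneg) simp
      then have "1 / \<delta> < real (Suc n)" using nk by linarith
      then show ?thesis using \<delta>(1) by (simp add: field_simps)
    qed
    have xn: "\<bar>x j\<bar> < real (Suc n)" if "j \<in> J" for j
    proof -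
      have "\<bar>x j\<bar> \<le> (\<Sum>j\<in>J. \<bar>x j\<bar>)" using J that by (intro member_le_sum) auto
      moreover have "0 < 1 / \<delta>" using \<delta>(1) by simp
      ultimately show ?thesis using nk by linarith
    qed
    have win: "grid_index J (Suc n) x \<in> grid_window J (Suc n)"
      unfolding grid_index_def grid_window_def restrict_PiE_iff
    proof
      fix j assume j: "j \<in> J"
      have "real (Suc n) * \<bar>x j\<bar> < real (Suc n) * real (Suc n)"
        using xn[OF j] by (intro mult_strict_left_mono) auto
      then have "\<bar>real (Suc n) * x j\<bar> < real_of_int ((int (Suc n))\<^sup>2)"
        by (simp add: abs_mult power2_eq_square)
      then have "\<lceil>real (Suc n) * x j\<rceil> \<le> (int (Suc n))\<^sup>2" "- (int (Suc n))\<^sup>2 < \<lceil>real (Suc n) * x j\<rceil>"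
        unfolding ceiling_le_iff less_ceiling_iff of_int_minus by linarith+
      then show "\<lceil>real (Suc n) * x j\<rceil> - 1 \<in> {- (int (Suc n))\<^sup>2..<(int (Suc n))\<^sup>2}" by simp
    qed
    have same: "\<bar>f y - f x\<bar> < \<eta> / 3" if y: "y \<in> (\<Pi>\<^sub>E j\<in>J. UNIV)" "grid_index J (Suc n) y = grid_index J (Suc n) x" for y
    proof (rule \<delta>(2)[OF y(1)])
      fix j assume j: "j \<in> J"
      let ?v = "grid_index J (Suc n) x"
      have "real_of_int (?v j) / Suc n < x j \<and> x j \<le> real_of_int (?v j + 1) / Suc n"
        "real_of_int (?v j) / Suc n < y j \<and> y j \<le> real_of_int (?v j + 1) / Suc n"
        using grid_index_eq_iff[OF zero_less_Suc win, THEN iffD1] y(2) j by blast+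
      then have "\<bar>y j - x j\<bar> < real_of_int (?v j + 1) / Suc n - real_of_int (?v j) / Suc n" by linarith
      also have "\<dots> = 1 / real (Suc n)" by (simp add: diff_divide_distrib[symmetric])
      finally show "\<bar>y j - x j\<bar> < \<delta>" using n\<delta> by linarith
    qed
    have "grid_osc J (Suc n) f (grid_index J (Suc n) x) \<le> 2 * (\<eta> / 3)"
    proof (rule osc_least[OF x])
      fix y assume y: "y \<in> (\<Pi>\<^sub>E j\<in>J. UNIV)" "grid_index J (Suc n) y = grid_index J (Suc n) x"
      show "\<bar>f y - f (grid_rep J (Suc n) (grid_index J (Suc n) x))\<bar> \<le> 2 * (\<eta> / 3)"
        using same[OF y] same[OF grid_rep[OF x]] by linarith
    qed
    moreover have "0 \<le> grid_osc J (Suc n) f (grid_index J (Suc n) x)"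
      by (rule order_trans[OF abs_ge_zero osc_upper[OF x]])
    ultimately show "norm (grid_error J b (Suc n) f x - 0) < \<eta>"
      using win \<eta> by (simp add: grid_error_def grid_step_def)
  qed
qed

lemma grid_approx_tendsto:
  assumes x: "x \<in> (\<Pi>\<^sub>E j\<in>J. UNIV)"
  shows "(\<lambda>n. grid_approx J (Suc n) f x) \<longlonglongrightarrow> f x"
proof -
  have "norm (f x - grid_approx J (Suc n) f x) \<le> grid_error J b (Suc n) f x" for n
    using grid_approx_error[OF x] by simp
  then have "(\<lambda>n. f x - grid_approx J (Suc n) f x) \<longlonglongrightarrow> 0"
    by (intro Lim_null_comparison[OF _ grid_error_tendsto[OF x]]) auto
  from tendsto_diff[OF tendsto_const[of "f x"] this] show ?thesis by simp
qed

end

lemma (in prob_space) grid_approx_expectation: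
  fixes X :: "'i \<Rightarrow> 'a \<Rightarrow> real"
  assumes f: "bounded_continuous_fun J f b" and X: "\<And>j. j \<in> J \<Longrightarrow> X j \<in> borel_measurable M"
  shows "\<bar>expectation (\<lambda>\<omega>. f (\<lambda>j\<in>J. X j \<omega>)) - expectation (\<lambda>\<omega>. grid_approx J (Suc n) f (\<lambda>j\<in>J. X j \<omega>))\<bar> \<le>
      expectation (\<lambda>\<omega>. grid_error J b (Suc n) f (\<lambda>j\<in>J. X j \<omega>))"
    and "(\<lambda>n. expectation (\<lambda>\<omega>. grid_error J b (Suc n) f (\<lambda>j\<in>J. X j \<omega>))) \<longlonglongrightarrow> 0"
proof -
  interpret bounded_continuous_fun J f b by (rule f)
  have mem: "(\<lambda>j\<in>J. X j \<omega>) \<in> (\<Pi>\<^sub>E j\<in>J. UNIV)" for \<omega> by simp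
  note step = grid_step_expectation[OF J zero_less_Suc X]
  have app: "(\<lambda>\<omega>. grid_approx J (Suc n) f (\<lambda>j\<in>J. X j \<omega>)) \<in> borel_measurable M"
    "integrable M (\<lambda>\<omega>. grid_approx J (Suc n) f (\<lambda>j\<in>J. X j \<omega>))" for n
    unfolding grid_approx_def by (rule step(1), assumption) (rule step(2), assumption)
  have err: "integrable M (\<lambda>\<omega>. grid_error J b (Suc n) f (\<lambda>j\<in>J. X j \<omega>))" for n
    unfolding grid_error_def by (intro Bochner_Integration.integrable_add step(2)) auto
  have f_meas: "(\<lambda>\<omega>. f (\<lambda>j\<in>J. X j \<omega>)) \<in> borel_measurable M"
    by (rule borel_measurable_LIMSEQ_real[OF grid_approx_tendsto[OF mem] app(1)])
  have f_int: "integrable M (\<lambda>\<omega>. f (\<lambda>j\<in>J. X j \<omega>))"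
    using bound[OF mem] f_meas by (intro integrable_const_bound[where B = b]) auto
  have "expectation (\<lambda>\<omega>. f (\<lambda>j\<in>J. X j \<omega>)) - expectation (\<lambda>\<omega>. grid_approx J (Suc n) f (\<lambda>j\<in>J. X j \<omega>)) =
      expectation (\<lambda>\<omega>. f (\<lambda>j\<in>J. X j \<omega>) - grid_approx J (Suc n) f (\<lambda>j\<in>J. X j \<omega>))"
    by (rule Bochner_Integration.integral_diff[OF f_int app(2), symmetric])
  moreover have "\<bar>expectation (\<lambda>\<omega>. f (\<lambda>j\<in>J. X j \<omega>) - grid_approx J (Suc n) f (\<lambda>j\<in>J. X j \<omega>))\<bar> \<le>
      expectation (\<lambda>\<omega>. \<bar>f (\<lambda>j\<in>J. X j \<omega>) - grid_approx J (Suc n) f (\<lambda>j\<in>J. X j \<omega>)\<bar>)"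
    by (rule integral_abs_bound)
  moreover have "expectation (\<lambda>\<omega>. \<bar>f (\<lambda>j\<in>J. X j \<omega>) - grid_approx J (Suc n) f (\<lambda>j\<in>J. X j \<omega>)\<bar>) \<le>
      expectation (\<lambda>\<omega>. grid_error J b (Suc n) f (\<lambda>j\<in>J. X j \<omega>))"
    by (rule integral_mono[OF integrable_abs[OF Bochner_Integration.integrable_diff[OF f_int app(2)]] err grid_approx_error[OF mem]])
  ultimately show "\<bar>expectation (\<lambda>\<omega>. f (\<lambda>j\<in>J. X j \<omega>)) - expectation (\<lambda>\<omega>. grid_approx J (Suc n) f (\<lambda>j\<in>J. X j \<omega>))\<bar> \<le>
      expectation (\<lambda>\<omega>. grid_error J b (Suc n) f (\<lambda>j\<in>J. X j \<omega>))" by linarith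
  have "(\<lambda>n. expectation (\<lambda>\<omega>. grid_error J b (Suc n) f (\<lambda>j\<in>J. X j \<omega>))) \<longlonglongrightarrow> expectation (\<lambda>_. 0)"
  proof (rule integral_dominated_convergence[where w = "\<lambda>_. 2 * b"])
    show "AE \<omega> in M. (\<lambda>n. grid_error J b (Suc n) f (\<lambda>j\<in>J. X j \<omega>)) \<longlonglongrightarrow> 0"
      using grid_error_tendsto[OF mem] by simp
    show "AE \<omega> in M. norm (grid_error J b (Suc n) f (\<lambda>j\<in>J. X j \<omega>)) \<le> 2 * b" for n
      using grid_error_le[OF mem] by simp
  qed (use err in auto)
  then show "(\<lambda>n. expectation (\<lambda>\<omega>. grid_error J b (Suc n) f (\<lambda>j\<in>J. X j \<omega>))) \<longlonglongrightarrow> 0" by simp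
qed

locale orthant_convergence = M: prob_space M + N: prob_space N
  for M :: "'a measure" and N :: "'b measure" +
  fixes F :: "'e filter" and J :: "'i set" and X :: "'e \<Rightarrow> 'i \<Rightarrow> 'a \<Rightarrow> real" and Y :: "'i \<Rightarrow> 'b \<Rightarrow> real"
  assumes J: "finite J"
    and X[measurable]: "\<And>e j. j \<in> J \<Longrightarrow> X e j \<in> borel_measurable M"
    and Y[measurable]: "\<And>j. j \<in> J \<Longrightarrow> Y j \<in> borel_measurable N"
    and orthants: "\<And>z. ((\<lambda>e. M.prob {\<omega> \<in> space M. \<forall>j\<in>J. X e j \<omega> \<le> z j}) \<longlongrightarrow> N.prob {\<omega> \<in> space N. \<forall>j\<in>J. Y j \<omega> \<le> z j}) F"
begin

text \<open>Inclusion and exclusion, one coordinate at a time: imposing a lower bound on the coordinate \<open>k\<close>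
  subtracts a probability in which \<open>b k\<close> is replaced by \<open>a k\<close>.\<close>

lemma box_convergence:
  assumes "S \<subseteq> J" "\<And>j. j \<in> S \<Longrightarrow> a j \<le> b j"
  shows "((\<lambda>e. M.prob {\<omega> \<in> space M. (\<forall>j\<in>S. a j < X e j \<omega>) \<and> (\<forall>j\<in>J. X e j \<omega> \<le> b j)}) \<longlongrightarrow>
    N.prob {\<omega> \<in> space N. (\<forall>j\<in>S. a j < Y j \<omega>) \<and> (\<forall>j\<in>J. Y j \<omega> \<le> b j)}) F"
  using finite_subset[OF assms(1) J] assms
proof (induction S arbitrary: b rule: finite_induct)
  case empty
  show ?case using orthants[of b] by simp
next
  case (insert k S)
  have k: "k \<in> J" and S: "S \<subseteq> J" using insert.prems by auto
  let ?b = "b(k := a k)"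
  have fin: "finite S" by fact
  have split: "{\<omega> \<in> space L. (\<forall>j\<in>insert k S. a j < Z j \<omega>) \<and> (\<forall>j\<in>J. Z j \<omega> \<le> b j)} =
      {\<omega> \<in> space L. (\<forall>j\<in>S. a j < Z j \<omega>) \<and> (\<forall>j\<in>J. Z j \<omega> \<le> b j)} -
      {\<omega> \<in> space L. (\<forall>j\<in>S. a j < Z j \<omega>) \<and> (\<forall>j\<in>J. Z j \<omega> \<le> ?b j)}"
    and sub: "{\<omega> \<in> space L. (\<forall>j\<in>S. a j < Z j \<omega>) \<and> (\<forall>j\<in>J. Z j \<omega> \<le> ?b j)} \<subseteq>
      {\<omega> \<in> space L. (\<forall>j\<in>S. a j < Z j \<omega>) \<and> (\<forall>j\<in>J. Z j \<omega> \<le> b j)}"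
    for L :: "'c measure" and Z
  proof -
    have ab: "a k \<le> b k" using insert.prems by simp
    have low: "(\<forall>j\<in>J. Z j \<omega> \<le> ?b j) \<longleftrightarrow> (\<forall>j\<in>J. Z j \<omega> \<le> b j) \<and> Z k \<omega> \<le> a k" for \<omega>
    proof
      assume l: "\<forall>j\<in>J. Z j \<omega> \<le> ?b j"
      have "Z k \<omega> \<le> a k" using bspec[OF l k] by simp
      moreover have "Z j \<omega> \<le> b j" if "j \<in> J" for j
        using bspec[OF l that] ab by (cases "j = k") auto
      ultimately show "(\<forall>j\<in>J. Z j \<omega> \<le> b j) \<and> Z k \<omega> \<le> a k" by blast
    qed auto
    show "{\<omega> \<in> space L. (\<forall>j\<in>insert k S. a j < Z j \<omega>) \<and> (\<forall>j\<in>J. Z j \<omega> \<le> b j)} =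
        {\<omega> \<in> space L. (\<forall>j\<in>S. a j < Z j \<omega>) \<and> (\<forall>j\<in>J. Z j \<omega> \<le> b j)} -
        {\<omega> \<in> space L. (\<forall>j\<in>S. a j < Z j \<omega>) \<and> (\<forall>j\<in>J. Z j \<omega> \<le> ?b j)}"
      unfolding low by (auto simp: not_le)
    show "{\<omega> \<in> space L. (\<forall>j\<in>S. a j < Z j \<omega>) \<and> (\<forall>j\<in>J. Z j \<omega> \<le> ?b j)} \<subseteq>
        {\<omega> \<in> space L. (\<forall>j\<in>S. a j < Z j \<omega>) \<and> (\<forall>j\<in>J. Z j \<omega> \<le> b j)}"
      unfolding low by auto
  qed
  have meas: "{\<omega> \<in> space L. (\<forall>j\<in>S. a j < Z j \<omega>) \<and> (\<forall>j\<in>J. Z j \<omega> \<le> c j)} \<in> sets L"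
    if "\<And>j. j \<in> J \<Longrightarrow> Z j \<in> borel_measurable L" for L :: "'c measure" and Z c
  proof -
    note [measurable] = that
    have [measurable]: "Z j \<in> borel_measurable L" if "j \<in> S" for j using S that by auto
    show ?thesis using fin J by measurable
  qed
  have ab': "\<And>j. j \<in> S \<Longrightarrow> a j \<le> ?b j" using insert.prems(2) insert.hyps(2) by auto
  have "((\<lambda>e. M.prob {\<omega> \<in> space M. (\<forall>j\<in>S. a j < X e j \<omega>) \<and> (\<forall>j\<in>J. X e j \<omega> \<le> b j)} -
      M.prob {\<omega> \<in> space M. (\<forall>j\<in>S. a j < X e j \<omega>) \<and> (\<forall>j\<in>J. X e j \<omega> \<le> ?b j)}) \<longlongrightarrow>
    N.prob {\<omega> \<in> space N. (\<forall>j\<in>S. a j < Y j \<omega>) \<and> (\<forall>j\<in>J. Y j \<omega> \<le> b j)} -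
      N.prob {\<omega> \<in> space N. (\<forall>j\<in>S. a j < Y j \<omega>) \<and> (\<forall>j\<in>J. Y j \<omega> \<le> ?b j)}) F"
    using insert.prems by (intro tendsto_diff insert.IH S ab') auto
  moreover have "M.prob {\<omega> \<in> space M. (\<forall>j\<in>S. a j < X e j \<omega>) \<and> (\<forall>j\<in>J. X e j \<omega> \<le> b j)} -
      M.prob {\<omega> \<in> space M. (\<forall>j\<in>S. a j < X e j \<omega>) \<and> (\<forall>j\<in>J. X e j \<omega> \<le> ?b j)} =
    M.prob {\<omega> \<in> space M. (\<forall>j\<in>insert k S. a j < X e j \<omega>) \<and> (\<forall>j\<in>J. X e j \<omega> \<le> b j)}" for e
    unfolding split[of M "X e"] by (rule M.finite_measure_Diff[symmetric]) (intro meas X sub; assumption)+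
  moreover have "N.prob {\<omega> \<in> space N. (\<forall>j\<in>S. a j < Y j \<omega>) \<and> (\<forall>j\<in>J. Y j \<omega> \<le> b j)} -
      N.prob {\<omega> \<in> space N. (\<forall>j\<in>S. a j < Y j \<omega>) \<and> (\<forall>j\<in>J. Y j \<omega> \<le> ?b j)} =
    N.prob {\<omega> \<in> space N. (\<forall>j\<in>insert k S. a j < Y j \<omega>) \<and> (\<forall>j\<in>J. Y j \<omega> \<le> b j)}"
    unfolding split[of N Y] by (rule N.finite_measure_Diff[symmetric]) (intro meas Y sub; assumption)+
  ultimately show ?case by simp
qed

lemma grid_step_convergence:
  assumes n: "0 < n"
  shows "((\<lambda>e. M.expectation (\<lambda>\<omega>. grid_step J n g (\<lambda>j\<in>J. X e j \<omega>))) \<longlongrightarrow>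
    N.expectation (\<lambda>\<omega>. grid_step J n g (\<lambda>j\<in>J. Y j \<omega>))) F"
proof -
  have box: "((\<lambda>e. M.prob {\<omega> \<in> space M. \<forall>j\<in>J. real_of_int (v j) / n < X e j \<omega> \<and> X e j \<omega> \<le> real_of_int (v j + 1) / n}) \<longlongrightarrow>
      N.prob {\<omega> \<in> space N. \<forall>j\<in>J. real_of_int (v j) / n < Y j \<omega> \<and> Y j \<omega> \<le> real_of_int (v j + 1) / n}) F" for v
    using box_convergence[OF subset_refl, of "\<lambda>j. real_of_int (v j) / n" "\<lambda>j. real_of_int (v j + 1) / n"]
    by (simp add: divide_right_mono ball_conj_distrib)
  have "((\<lambda>e. \<Sum>v\<in>grid_window J n. g v * M.prob {\<omega> \<in> space M. \<forall>j\<in>J. real_of_int (v j) / n < X e j \<omega> \<and> X e j \<omega> \<le> real_of_int (v j + 1) / n}) \<longlongrightarrow>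
      (\<Sum>v\<in>grid_window J n. g v * N.prob {\<omega> \<in> space N. \<forall>j\<in>J. real_of_int (v j) / n < Y j \<omega> \<and> Y j \<omega> \<le> real_of_int (v j + 1) / n})) F"
    by (intro tendsto_sum tendsto_mult tendsto_const box)
  moreover have "M.expectation (\<lambda>\<omega>. grid_step J n g (\<lambda>j\<in>J. X e j \<omega>)) =
      (\<Sum>v\<in>grid_window J n. g v * M.prob {\<omega> \<in> space M. \<forall>j\<in>J. real_of_int (v j) / n < X e j \<omega> \<and> X e j \<omega> \<le> real_of_int (v j + 1) / n})" for e
    by (rule M.grid_step_expectation(3)[OF J n]) (rule X)
  moreover have "N.expectation (\<lambda>\<omega>. grid_step J n g (\<lambda>j\<in>J. Y j \<omega>)) =
      (\<Sum>v\<in>grid_window J n. g v * N.prob {\<omega> \<in> space N. \<forall>j\<in>J. real_of_int (v j) / n < Y j \<omega> \<and> Y j \<omega> \<le> real_of_int (v j + 1) / n})"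
    by (rule N.grid_step_expectation(3)[OF J n]) (rule Y)
  ultimately show ?thesis by (simp only:)
qed

text \<open>Expectations of grid functions converge because they are finite combinations of box
  probabilities. The error of the approximation by a grid function is itself controlled by a grid
  function, whose expectation under the limit law is small.\<close>

lemma weak_convergence:
  assumes cont: "continuous_map (product_topology (\<lambda>_. euclideanreal) J) euclideanreal f"
    and bdd: "bounded (f ` (\<Pi>\<^sub>E j\<in>J. UNIV))"
  shows "((\<lambda>e. M.expectation (\<lambda>\<omega>. f (\<lambda>j\<in>J. X e j \<omega>))) \<longlongrightarrow> N.expectation (\<lambda>\<omega>. f (\<lambda>j\<in>J. Y j \<omega>))) F"
proof -
  obtain b where "\<And>x. x \<in> (\<Pi>\<^sub>E j\<in>J. UNIV) \<Longrightarrow> \<bar>f x\<bar> \<le> b"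
    using bdd unfolding bounded_iff by auto
  then have bc: "bounded_continuous_fun J f b"
    by (intro bounded_continuous_fun.intro J cont)
  note Mx = M.grid_approx_expectation(1)[where X = "X e" for e, OF bc X]
  note Ny = N.grid_approx_expectation[where X = Y, OF bc Y]
  show ?thesis
  proof (rule tendstoI)
    fix \<eta> :: real assume \<eta>: "0 < \<eta>"
    have "\<forall>\<^sub>F n in sequentially. N.expectation (\<lambda>\<omega>. grid_error J b (Suc n) f (\<lambda>j\<in>J. Y j \<omega>)) < \<eta> / 4"
      using order_tendstoD(2)[OF Ny(2), of "\<eta> / 4"] \<eta> by simp
    then obtain n where n: "N.expectation (\<lambda>\<omega>. grid_error J b (Suc n) f (\<lambda>j\<in>J. Y j \<omega>)) < \<eta> / 4"
      unfolding eventually_sequentially by blast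
    let ?a = "grid_approx J (Suc n) f" and ?r = "grid_error J b (Suc n) f"
    have app: "((\<lambda>e. M.expectation (\<lambda>\<omega>. ?a (\<lambda>j\<in>J. X e j \<omega>))) \<longlongrightarrow> N.expectation (\<lambda>\<omega>. ?a (\<lambda>j\<in>J. Y j \<omega>))) F"
      unfolding grid_approx_def by (rule grid_step_convergence) simp
    have err: "((\<lambda>e. M.expectation (\<lambda>\<omega>. ?r (\<lambda>j\<in>J. X e j \<omega>))) \<longlongrightarrow> N.expectation (\<lambda>\<omega>. ?r (\<lambda>j\<in>J. Y j \<omega>))) F"
    proof -
      have "M.expectation (\<lambda>\<omega>. ?r (\<lambda>j\<in>J. X e j \<omega>)) =
          b + M.expectation (\<lambda>\<omega>. grid_step J (Suc n) (\<lambda>v. grid_osc J (Suc n) f v - b) (\<lambda>j\<in>J. X e j \<omega>))" for e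
        unfolding grid_error_def
        by (subst Bochner_Integration.integral_add) (auto simp: M.prob_space intro!: M.grid_step_expectation(2)[OF J] X)
      moreover have "N.expectation (\<lambda>\<omega>. ?r (\<lambda>j\<in>J. Y j \<omega>)) =
          b + N.expectation (\<lambda>\<omega>. grid_step J (Suc n) (\<lambda>v. grid_osc J (Suc n) f v - b) (\<lambda>j\<in>J. Y j \<omega>))"
        unfolding grid_error_def
        by (subst Bochner_Integration.integral_add) (auto simp: N.prob_space intro!: N.grid_step_expectation(2)[OF J] Y)
      ultimately show ?thesis by (simp only:) (intro tendsto_add tendsto_const grid_step_convergence, simp)
    qed
    have "0 < \<eta> / 4" using \<eta> by simp
    from tendstoD[OF app this] tendstoD[OF err this]
    show "\<forall>\<^sub>F e in F. dist (M.expectation (\<lambda>\<omega>. f (\<lambda>j\<in>J. X e j \<omega>))) (N.expectation (\<lambda>\<omega>. f (\<lambda>j\<in>J. Y j \<omega>))) < \<eta>"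
    proof eventually_elim
      case (elim e)
      then show ?case
        using Mx[of e n] Ny(1)[of n] n unfolding dist_real_def by linarith
    qed
  qed
qed

end

section \<open>Convergence of the finite-dimensional distributions\<close>

lemma (in prob_space) grid_interval_sum:
  assumes [measurable]: "X \<in> borel_measurable M" "S \<in> sets M" and \<kappa>: "0 \<le> \<kappa>"
  shows "(\<Sum>k<n. prob {\<omega> \<in> space M. a + real k * \<kappa> < X \<omega> \<and> X \<omega> \<le> a + real k * \<kappa> + \<kappa> \<and> \<omega> \<in> S}) =
    prob {\<omega> \<in> space M. a < X \<omega> \<and> X \<omega> \<le> a + real n * \<kappa> \<and> \<omega> \<in> S}"
proof (induction n)
  case 0
  have "{\<omega> \<in> space M. a < X \<omega> \<and> X \<omega> \<le> a + real 0 * \<kappa> \<and> \<omega> \<in> S} = {}" by auto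
  then show ?case by (simp only: measure_empty lessThan_0 sum.empty)
next
  case (Suc n)
  define c where "c = a + real n * \<kappa>"
  have ac: "a \<le> c" using \<kappa> by (simp add: c_def)
  have suc: "a + real (Suc n) * \<kappa> = c + \<kappa>" by (simp add: c_def distrib_right)
  have eq: "{\<omega> \<in> space M. a < X \<omega> \<and> X \<omega> \<le> a + real (Suc n) * \<kappa> \<and> \<omega> \<in> S} =
      {\<omega> \<in> space M. a < X \<omega> \<and> X \<omega> \<le> c \<and> \<omega> \<in> S} \<union>
      {\<omega> \<in> space M. c < X \<omega> \<and> X \<omega> \<le> c + \<kappa> \<and> \<omega> \<in> S}"
    unfolding suc using ac \<kappa> by auto
  show ?case
    unfolding eq sum.lessThan_Suc Suc.IH c_def[symmetric]
    by (rule finite_measure_Union[symmetric]) auto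
qed

lemma (in prob_space) normal_interval_le:
  assumes X: "distributed M lborel X (\<lambda>x. ennreal (normal_density 0 \<sigma> x))" and \<sigma>: "0 < \<sigma>" and ab: "a \<le> b"
  shows "prob {\<omega> \<in> space M. a < X \<omega> \<and> X \<omega> \<le> b} \<le> (b - a) / sqrt (2 * pi * \<sigma>\<^sup>2)"
proof -
  let ?d = "1 / sqrt (2 * pi * \<sigma>\<^sup>2)"
  have le: "normal_density 0 \<sigma> x \<le> ?d" for x
  proof -
    have "?d * exp (- (x - 0)\<^sup>2 / (2 * \<sigma>\<^sup>2)) \<le> ?d * 1"
      using \<sigma> by (intro mult_left_mono) auto
    then show ?thesis by (simp only: normal_density_def mult_1_right)
  qed
  have i: "integrable lborel (\<lambda>x. ?d * indicator {a<..b} x)"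
    using ab by (intro integrable_mult_right integrable_real_indicator) auto
  have "X \<in> measurable M lborel" using X by (simp add: distributed_def)
  then have [measurable]: "X \<in> borel_measurable M" by simp
  have "prob {\<omega> \<in> space M. a < X \<omega> \<and> X \<omega> \<le> b} = expectation (\<lambda>\<omega>. indicator {a<..b} (X \<omega>))"
  proof -
    have "expectation (\<lambda>\<omega>. indicator {a<..b} (X \<omega>) :: real) = expectation (indicator {\<omega> \<in> space M. a < X \<omega> \<and> X \<omega> \<le> b})"
      by (intro Bochner_Integration.integral_cong refl) (simp add: indicator_def)
    moreover have "{\<omega> \<in> space M. a < X \<omega> \<and> X \<omega> \<le> b} \<inter> space M = {\<omega> \<in> space M. a < X \<omega> \<and> X \<omega> \<le> b}" by blast
    ultimately show ?thesis by (simp only: Bochner_Integration.integral_indicator)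
  qed
  also have "\<dots> = (\<integral>x. normal_density 0 \<sigma> x * indicator {a<..b} x \<partial>lborel)"
    by (rule distributed_integral[OF X, symmetric]) auto
  also have "\<dots> \<le> (\<integral>x. ?d * indicator {a<..b} x \<partial>lborel)"
    by (rule integral_mono'[OF i mult_right_mono[OF le]]) simp_all
  also have "\<dots> = (b - a) / sqrt (2 * pi * \<sigma>\<^sup>2)" using ab by simp
  finally show ?thesis .
qed

text \<open>Brownian increments have bounded densities, so orthant probabilities are Lipschitz in the
  levels.\<close>

lemma orthant_prob_modulus:
  assumes bm: "brownian_motion 2 N B" and J: "finite J" "J \<subseteq> {0<..}"
  shows "\<exists>L\<ge>0. \<forall>z h. 0 \<le> h \<longrightarrow> orthant_prob N B J (\<lambda>\<tau>. z \<tau> + h) - orthant_prob N B J (\<lambda>\<tau>. z \<tau> - h) \<le> L * h"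
proof (intro exI conjI allI impI)
  interpret prob_space N using bm by (simp add: brownian_motion_def)
  define l where "l \<tau> = 1 / sqrt (2 * pi * (sqrt (2 * \<tau>))\<^sup>2)" for \<tau>
  show "0 \<le> (\<Sum>\<tau>\<in>J. 2 * l \<tau>)" by (intro sum_nonneg) (simp add: l_def)
  fix z :: "real \<Rightarrow> real" and h :: real assume h: "0 \<le> h"
  have Bm: "B \<tau> \<in> borel_measurable N" if "0 \<le> \<tau>" for \<tau> using bm that by (simp add: brownian_motion_def)
  have [measurable]: "(\<lambda>\<omega>. B \<tau> \<omega> - B 0 \<omega>) \<in> borel_measurable N" if "\<tau> \<in> J" for \<tau>
    using that J(2) Bm[of \<tau>] Bm[of 0] by (intro borel_measurable_diff) auto
  have O: "{\<omega> \<in> space N. \<forall>\<tau>\<in>J. B \<tau> \<omega> - B 0 \<omega> \<le> z' \<tau>} \<in> events" for z' :: "real \<Rightarrow> real"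
    using J(1) by measurable
  let ?I = "\<lambda>\<tau>. {\<omega> \<in> space N. z \<tau> - h < B \<tau> \<omega> - B 0 \<omega> \<and> B \<tau> \<omega> - B 0 \<omega> \<le> z \<tau> + h}"
  have I: "?I \<tau> \<in> events" if "\<tau> \<in> J" for \<tau> using that by measurable
  have "orthant_prob N B J (\<lambda>\<tau>. z \<tau> + h) - orthant_prob N B J (\<lambda>\<tau>. z \<tau> - h) =
      prob ({\<omega> \<in> space N. \<forall>\<tau>\<in>J. B \<tau> \<omega> - B 0 \<omega> \<le> z \<tau> + h} - {\<omega> \<in> space N. \<forall>\<tau>\<in>J. B \<tau> \<omega> - B 0 \<omega> \<le> z \<tau> - h})"
    unfolding orthant_prob_def using h
    by (intro finite_measure_Diff[symmetric] O) (auto intro: order_trans)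
  also have "\<dots> \<le> prob (\<Union>\<tau>\<in>J. ?I \<tau>)"
    using I J(1) by (intro finite_measure_mono) (auto simp: not_le)
  also have "\<dots> \<le> (\<Sum>\<tau>\<in>J. prob (?I \<tau>))"
    using I J(1) by (intro finite_measure_subadditive_finite) auto
  also have "\<dots> \<le> (\<Sum>\<tau>\<in>J. 2 * l \<tau> * h)"
  proof (intro sum_mono)
    fix \<tau> assume "\<tau> \<in> J"
    then have \<tau>: "0 < \<tau>" using J(2) by auto
    have "distributed N lborel (\<lambda>\<omega>. B \<tau> \<omega> - B 0 \<omega>) (normal_density 0 (sqrt (2 * (\<tau> - 0))))"
      using bm \<tau> unfolding brownian_motion_def by blast
    then have "distributed N lborel (\<lambda>\<omega>. B \<tau> \<omega> - B 0 \<omega>) (normal_density 0 (sqrt (2 * \<tau>)))" by simp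
    then have "prob (?I \<tau>) \<le> (z \<tau> + h - (z \<tau> - h)) / sqrt (2 * pi * (sqrt (2 * \<tau>))\<^sup>2)"
      by (rule normal_interval_le) (use \<tau> h in auto)
    also have "\<dots> = 2 * l \<tau> * h" unfolding l_def by simp
    finally show "prob (?I \<tau>) \<le> 2 * l \<tau> * h" .
  qed
  finally show "orthant_prob N B J (\<lambda>\<tau>. z \<tau> + h) - orthant_prob N B J (\<lambda>\<tau>. z \<tau> - h) \<le> (\<Sum>\<tau>\<in>J. 2 * l \<tau>) * h"
    by (simp only: sum_distrib_right)
qed

lemma (in prob_space) tight_interval:
  assumes [measurable]: "X \<in> borel_measurable M" and e: "0 < e"
  obtains R :: real where "0 \<le> R" "1 - e < prob {\<omega> \<in> space M. - R < X \<omega> \<and> X \<omega> \<le> R}"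
proof -
  let ?S = "\<lambda>n :: nat. {\<omega> \<in> space M. - real n < X \<omega> \<and> X \<omega> \<le> real n}"
  have "(\<lambda>n. prob (?S n)) \<longlonglongrightarrow> prob (\<Union>n. ?S n)"
    by (intro finite_Lim_measure_incseq) (auto simp: incseq_def)
  moreover have "(\<Union>n. ?S n) = space M"
  proof (intro equalityI subsetI)
    fix \<omega> assume \<omega>: "\<omega> \<in> space M"
    obtain n where "\<bar>X \<omega>\<bar> < real n" using reals_Archimedean2 by blast
    then show "\<omega> \<in> (\<Union>n. ?S n)" using \<omega> by (auto intro!: exI[of _ n])
  qed auto
  ultimately have "(\<lambda>n. prob (?S n)) \<longlonglongrightarrow> 1" by (simp only: prob_space)
  then have "\<forall>\<^sub>F n in sequentially. 1 - e < prob (?S n)" using e by (intro order_tendstoD(1)) auto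
  then obtain n where "1 - e < prob (?S n)" unfolding eventually_sequentially by blast
  then show thesis by (intro that[of "real n"]) auto
qed

text \<open>Partition the range of the process at time \<open>s\<close> into intervals of length \<open>h * sqrt \<epsilon>\<close>. On one of
  them the unknown value at \<open>s\<close> may be replaced by the lower end point, at the price of changing the
  levels of the increments by at most \<open>h\<close>; then \<open>local_increment_estimate\<close> applies. There are of the
  order of \<open>1 / sqrt \<epsilon>\<close> intervals and the error on each is of order \<open>\<epsilon>\<close>.\<close>

lemma orthant_limit:
  assumes airy: "airy1_process M A" and bm: "brownian_motion 2 N B" and J: "finite J" "J \<subseteq> {0<..}"
  shows "((\<lambda>\<epsilon>. measure M {\<omega> \<in> space M. \<forall>\<tau>\<in>J. rescaled_increment A s \<epsilon> \<tau> \<omega> \<le> z \<tau>}) \<longlongrightarrow>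
    orthant_prob N B J z) (at_right 0)"
proof (rule tendstoI)
  interpret M: prob_space M using airy by (simp add: airy1_process_def)
  interpret N: prob_space N using bm by (simp add: brownian_motion_def)
  have Am[measurable]: "A t \<in> borel_measurable M" for t using airy by (simp add: airy1_process_def)
  let ?Q = "orthant_prob N B J"
  fix e :: real assume e: "0 < e"
  obtain L where L: "0 \<le> L" "\<And>z h. 0 \<le> h \<Longrightarrow> ?Q (\<lambda>\<tau>. z \<tau> + h) - ?Q (\<lambda>\<tau>. z \<tau> - h) \<le> L * h"
    using orthant_prob_modulus[OF bm J] by blast
  \<comment> \<open>The error budget: \<open>e / 8\<close> for the levels, \<open>e / 4\<close> for the tails and \<open>e / 4\<close> for the sum over the partition.\<close>
  define h where "h = e / (8 * (L + 1))"
  have h: "0 < h" using e L(1) by (simp add: h_def)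
  have Lh: "L * h \<le> e / 8" using e L(1) by (simp add: h_def field_simps)
  obtain R where R: "0 \<le> R" "1 - e / 4 < M.prob {\<omega> \<in> space M. - R < A s \<omega> \<and> A s \<omega> \<le> R}"
    by (rule M.tight_interval[of "A s" "e / 4"]) (use e in auto)
  obtain C1 \<epsilon>1 where C1: "0 \<le> C1" "0 < \<epsilon>1"
    and est1: "\<And>\<epsilon> x. 0 < \<epsilon> \<Longrightarrow> \<epsilon> < \<epsilon>1 \<Longrightarrow> - R \<le> x \<Longrightarrow> \<exists>q. ?Q (\<lambda>\<tau>. z \<tau> - h) \<le> q \<and> q \<le> ?Q z \<and>
      \<bar>M.prob {\<omega> \<in> space M. x < A s \<omega> \<and> A s \<omega> \<le> x + sqrt \<epsilon> * h \<and> (\<forall>\<tau>\<in>J. A (s + \<epsilon> * \<tau>) \<omega> \<le> x + sqrt \<epsilon> * z \<tau>)} -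
        q * M.prob {\<omega> \<in> space M. x < A s \<omega> \<and> A s \<omega> \<le> x + sqrt \<epsilon> * h}\<bar> \<le> C1 * \<epsilon>"
    using local_increment_estimate[where s = s and z = z, OF airy bm J R(1) h] by blast
  obtain C2 \<epsilon>2 where C2: "0 \<le> C2" "0 < \<epsilon>2"
    and est2: "\<And>\<epsilon> x. 0 < \<epsilon> \<Longrightarrow> \<epsilon> < \<epsilon>2 \<Longrightarrow> - R \<le> x \<Longrightarrow> \<exists>q. ?Q (\<lambda>\<tau>. z \<tau> + h - h) \<le> q \<and> q \<le> ?Q (\<lambda>\<tau>. z \<tau> + h) \<and>
      \<bar>M.prob {\<omega> \<in> space M. x < A s \<omega> \<and> A s \<omega> \<le> x + sqrt \<epsilon> * h \<and> (\<forall>\<tau>\<in>J. A (s + \<epsilon> * \<tau>) \<omega> \<le> x + sqrt \<epsilon> * (z \<tau> + h))} -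
        q * M.prob {\<omega> \<in> space M. x < A s \<omega> \<and> A s \<omega> \<le> x + sqrt \<epsilon> * h}\<bar> \<le> C2 * \<epsilon>"
    using local_increment_estimate[where s = s and z = "\<lambda>\<tau>. z \<tau> + h", OF airy bm J R(1) h] by blast
  define C where "C = C1 + C2"
  have Q_mono: "?Q z1 \<le> ?Q z2" if "\<And>\<tau>. \<tau> \<in> J \<Longrightarrow> z1 \<tau> \<le> z2 \<tau>" for z1 z2
  proof -
    have Bm: "B \<tau> \<in> borel_measurable N" if "0 \<le> \<tau>" for \<tau> using bm that by (simp add: brownian_motion_def)
    have [measurable]: "(\<lambda>\<omega>. B \<tau> \<omega> - B 0 \<omega>) \<in> borel_measurable N" if "\<tau> \<in> J" for \<tau>
      using that J(2) Bm[of \<tau>] Bm[of 0] by (intro borel_measurable_diff) auto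
    have "{\<omega> \<in> space N. \<forall>\<tau>\<in>J. B \<tau> \<omega> - B 0 \<omega> \<le> z2 \<tau>} \<in> sets N" using J(1) by measurable
    then show ?thesis
      unfolding orthant_prob_def using that by (intro N.finite_measure_mono) (auto intro: order_trans)
  qed
  have Q01: "0 \<le> ?Q z'" "?Q z' \<le> 1" for z' by (auto simp: orthant_prob_def)
  have lim: "((\<lambda>\<epsilon>. C * (2 * R / h * sqrt \<epsilon> + \<epsilon>)) \<longlongrightarrow> 0) (at_right 0)"
    using h by (auto intro!: tendsto_eq_intros)
  have ev: "\<forall>\<^sub>F \<epsilon> in at_right 0. 0 < \<epsilon> \<and> \<epsilon> < min \<epsilon>1 \<epsilon>2 \<and> C * (2 * R / h * sqrt \<epsilon> + \<epsilon>) < e / 4"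
  proof -
    have "0 < min \<epsilon>1 \<epsilon>2" "0 < e / 4" using C1(2) C2(2) e by auto
    then show ?thesis
      by (intro eventually_conj eventually_at_right_less order_tendstoD(2)[OF tendsto_ident_at] order_tendstoD(2)[OF lim])
  qed
  then show "\<forall>\<^sub>F \<epsilon> in at_right 0. dist (M.prob {\<omega> \<in> space M. \<forall>\<tau>\<in>J. rescaled_increment A s \<epsilon> \<tau> \<omega> \<le> z \<tau>}) (?Q z) < e"
  proof (rule eventually_mono)
    fix \<epsilon> assume "0 < \<epsilon> \<and> \<epsilon> < min \<epsilon>1 \<epsilon>2 \<and> C * (2 * R / h * sqrt \<epsilon> + \<epsilon>) < e / 4"
    then have \<epsilon>: "0 < \<epsilon>" "\<epsilon> < \<epsilon>1" "\<epsilon> < \<epsilon>2" and small: "C * (2 * R / h * sqrt \<epsilon> + \<epsilon>) < e / 4" by auto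
    let ?r = "sqrt \<epsilon>"
    have r: "0 < ?r" "?r * ?r = \<epsilon>" using \<epsilon>(1) by auto
    define \<kappa> where "\<kappa> = ?r * h"
    have \<kappa>: "0 < \<kappa>" using r(1) h by (simp add: \<kappa>_def)
    define n where "n = nat \<lceil>2 * R / \<kappa>\<rceil>"
    have R\<kappa>: "0 \<le> 2 * R / \<kappa>" using R(1) \<kappa> by simp
    have n: "2 * R / \<kappa> \<le> real n" "real n \<le> 2 * R / \<kappa> + 1"
      using R\<kappa> unfolding n_def by linarith+
    have n\<kappa>: "2 * R \<le> real n * \<kappa>" using n(1) \<kappa> by (simp add: pos_divide_le_eq)
    have n\<epsilon>: "real n * (C * \<epsilon>) < e / 4"
    proof -
      have "real n * (C * \<epsilon>) \<le> (2 * R / \<kappa> + 1) * (C * \<epsilon>)"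
        using n(2) \<epsilon>(1) C1(1) C2(1) by (intro mult_right_mono) (auto simp: C_def)
      also have "\<dots> = C * (2 * R / h * (\<epsilon> / ?r) + \<epsilon>)" by (simp add: \<kappa>_def field_simps)
      also have "\<epsilon> / ?r = ?r" using r by (simp add: field_simps)
      finally show ?thesis using small by linarith
    qed
    define S where "S = {\<omega> \<in> space M. \<forall>\<tau>\<in>J. rescaled_increment A s \<epsilon> \<tau> \<omega> \<le> z \<tau>}"
    have resc: "rescaled_increment A s \<epsilon> \<tau> \<omega> \<le> z \<tau> \<longleftrightarrow> A (s + \<epsilon> * \<tau>) \<omega> \<le> A s \<omega> + ?r * z \<tau>" for \<tau> \<omega>
    proof -
      have "\<epsilon> powr (- 1 / 2) = 1 / ?r"
        using \<epsilon>(1) by (simp add: powr_minus_divide powr_half_sqrt[symmetric])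
      then have "rescaled_increment A s \<epsilon> \<tau> \<omega> = (A (s + \<epsilon> * \<tau>) \<omega> - A s \<omega>) / ?r"
        by (simp add: rescaled_increment_def)
      then show ?thesis using r(1) by (simp add: pos_divide_le_eq algebra_simps)
    qed
    have S_meas[measurable]: "S \<in> sets M"
      unfolding S_def resc using J(1) by measurable
    let ?x = "\<lambda>k. - R + real k * \<kappa>"
    let ?E = "\<lambda>k. {\<omega> \<in> space M. ?x k < A s \<omega> \<and> A s \<omega> \<le> ?x k + \<kappa> \<and> \<omega> \<in> space M}"
    let ?ES = "\<lambda>k. {\<omega> \<in> space M. ?x k < A s \<omega> \<and> A s \<omega> \<le> ?x k + \<kappa> \<and> \<omega> \<in> S}"
    let ?U = "{\<omega> \<in> space M. - R < A s \<omega> \<and> A s \<omega> \<le> - R + real n * \<kappa> \<and> \<omega> \<in> space M}"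
    let ?US = "{\<omega> \<in> space M. - R < A s \<omega> \<and> A s \<omega> \<le> - R + real n * \<kappa> \<and> \<omega> \<in> S}"
    have sumE: "(\<Sum>k<n. M.prob (?E k)) = M.prob ?U"
      using \<kappa> by (intro M.grid_interval_sum) auto
    have sumES: "(\<Sum>k<n. M.prob (?ES k)) = M.prob ?US"
      using \<kappa> by (intro M.grid_interval_sum) auto
    have xR: "- R \<le> ?x k" for k using \<kappa> by simp
    have E_eq: "?E k = {\<omega> \<in> space M. ?x k < A s \<omega> \<and> A s \<omega> \<le> ?x k + ?r * h}" for k by (auto simp: \<kappa>_def)
    have lower: "?Q (\<lambda>\<tau>. z \<tau> - h) * M.prob (?E k) - C * \<epsilon> \<le> M.prob (?ES k)" for k
    proof -
      let ?G = "{\<omega> \<in> space M. ?x k < A s \<omega> \<and> A s \<omega> \<le> ?x k + ?r * h \<and> (\<forall>\<tau>\<in>J. A (s + \<epsilon> * \<tau>) \<omega> \<le> ?x k + ?r * z \<tau>)}"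
      obtain q where q: "?Q (\<lambda>\<tau>. z \<tau> - h) \<le> q" "\<bar>M.prob ?G - q * M.prob (?E k)\<bar> \<le> C1 * \<epsilon>"
        using est1[OF \<epsilon>(1,2) xR[of k]] unfolding E_eq by blast
      have "?Q (\<lambda>\<tau>. z \<tau> - h) * M.prob (?E k) \<le> q * M.prob (?E k)"
        using q(1) by (intro mult_right_mono) auto
      moreover have "M.prob ?G \<le> M.prob (?ES k)"
      proof (rule M.finite_measure_mono)
        show "?ES k \<in> sets M" by measurable
        show "?G \<subseteq> ?ES k"
          unfolding S_def resc \<kappa>_def by (auto intro: order_trans less_imp_le)
      qed
      moreover have "C1 * \<epsilon> \<le> C * \<epsilon>" using C2(1) \<epsilon>(1) by (simp add: C_def)
      ultimately show ?thesis using q(2) by linarith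
    qed
    have upper: "M.prob (?ES k) \<le> ?Q (\<lambda>\<tau>. z \<tau> + h) * M.prob (?E k) + C * \<epsilon>" for k
    proof -
      let ?G = "{\<omega> \<in> space M. ?x k < A s \<omega> \<and> A s \<omega> \<le> ?x k + ?r * h \<and> (\<forall>\<tau>\<in>J. A (s + \<epsilon> * \<tau>) \<omega> \<le> ?x k + ?r * (z \<tau> + h))}"
      obtain q where q: "q \<le> ?Q (\<lambda>\<tau>. z \<tau> + h)" "\<bar>M.prob ?G - q * M.prob (?E k)\<bar> \<le> C2 * \<epsilon>"
        using est2[OF \<epsilon>(1,3) xR[of k]] unfolding E_eq by blast
      have "q * M.prob (?E k) \<le> ?Q (\<lambda>\<tau>. z \<tau> + h) * M.prob (?E k)"
        using q(1) by (intro mult_right_mono) auto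
      moreover have "M.prob (?ES k) \<le> M.prob ?G"
      proof (rule M.finite_measure_mono)
        show "?G \<in> sets M" using J(1) by measurable
        show "?ES k \<subseteq> ?G"
        proof
          fix \<omega> assume "\<omega> \<in> ?ES k"
          then have \<omega>: "\<omega> \<in> space M" "?x k < A s \<omega>" "A s \<omega> \<le> ?x k + ?r * h" "\<And>\<tau>. \<tau> \<in> J \<Longrightarrow> A (s + \<epsilon> * \<tau>) \<omega> \<le> A s \<omega> + ?r * z \<tau>"
            by (auto simp: S_def resc \<kappa>_def)
          have "A (s + \<epsilon> * \<tau>) \<omega> \<le> ?x k + ?r * (z \<tau> + h)" if "\<tau> \<in> J" for \<tau>
            using \<omega>(3) \<omega>(4)[OF that] unfolding distrib_left by linarith
          then show "\<omega> \<in> ?G" using \<omega> by blast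
        qed
      qed
      moreover have "C2 * \<epsilon> \<le> C * \<epsilon>" using C1(1) \<epsilon>(1) by (simp add: C_def)
      ultimately show ?thesis using q(2) by linarith
    qed
    have lowS: "?Q (\<lambda>\<tau>. z \<tau> - h) * M.prob ?U - real n * (C * \<epsilon>) \<le> M.prob ?US"
    proof -
      have "(\<Sum>k<n. ?Q (\<lambda>\<tau>. z \<tau> - h) * M.prob (?E k) - C * \<epsilon>) \<le> (\<Sum>k<n. M.prob (?ES k))"
        by (intro sum_mono lower)
      moreover have "(\<Sum>k<n. C * \<epsilon>) = real n * (C * \<epsilon>)" by simp
      ultimately show ?thesis unfolding sum_subtractf by (simp only: sum_distrib_left[symmetric] sumE sumES)
    qed
    have uppS: "M.prob ?US \<le> ?Q (\<lambda>\<tau>. z \<tau> + h) * M.prob ?U + real n * (C * \<epsilon>)"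
    proof -
      have "(\<Sum>k<n. M.prob (?ES k)) \<le> (\<Sum>k<n. ?Q (\<lambda>\<tau>. z \<tau> + h) * M.prob (?E k) + C * \<epsilon>)"
        by (intro sum_mono upper)
      moreover have "(\<Sum>k<n. C * \<epsilon>) = real n * (C * \<epsilon>)" by simp
      ultimately show ?thesis unfolding sum.distrib by (simp only: sum_distrib_left[symmetric] sumE sumES)
    qed
    have U: "1 - e / 4 < M.prob ?U" "M.prob ?U \<le> 1"
    proof -
      have "M.prob {\<omega> \<in> space M. - R < A s \<omega> \<and> A s \<omega> \<le> R} \<le> M.prob ?U"
        using n\<kappa> by (intro M.finite_measure_mono) auto
      then show "1 - e / 4 < M.prob ?U" using R(2) by linarith
    qed simp
    have SU: "M.prob ?US \<le> M.prob S" "M.prob S \<le> M.prob ?US + (1 - M.prob ?U)"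
    proof -
      show "M.prob ?US \<le> M.prob S" by (intro M.finite_measure_mono) auto
      have "M.prob S \<le> M.prob (?US \<union> (space M - ?U))"
        using sets.sets_into_space[OF S_meas] by (intro M.finite_measure_mono) auto
      also have "\<dots> \<le> M.prob ?US + M.prob (space M - ?U)" by (intro measure_Un_le) auto
      also have "M.prob (space M - ?U) = 1 - M.prob ?U" by (rule M.prob_compl) measurable
      finally show "M.prob S \<le> M.prob ?US + (1 - M.prob ?U)" .
    qed
    have Qz: "?Q (\<lambda>\<tau>. z \<tau> - h) \<le> ?Q z" "?Q z \<le> ?Q (\<lambda>\<tau>. z \<tau> + h)" using h by (auto intro!: Q_mono)
    have Qd: "?Q (\<lambda>\<tau>. z \<tau> + h) - ?Q (\<lambda>\<tau>. z \<tau> - h) \<le> e / 8" using L(2)[of h z] Lh h by linarith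
    have p1: "?Q (\<lambda>\<tau>. z \<tau> - h) * (1 - M.prob ?U) \<le> 1 * (1 - M.prob ?U)"
      using U(2) Q01 by (intro mult_right_mono) auto
    then have p1': "?Q (\<lambda>\<tau>. z \<tau> - h) - (1 - M.prob ?U) \<le> ?Q (\<lambda>\<tau>. z \<tau> - h) * M.prob ?U"
      by (simp add: algebra_simps)
    have p2: "?Q (\<lambda>\<tau>. z \<tau> + h) * M.prob ?U \<le> ?Q (\<lambda>\<tau>. z \<tau> + h) * 1"
      using U(2) Q01 by (intro mult_left_mono) auto
    have "\<bar>M.prob S - ?Q z\<bar> < e"
      using lowS uppS U SU Qz Qd p1' p2 n\<epsilon> e by linarith
    then show "dist (M.prob {\<omega> \<in> space M. \<forall>\<tau>\<in>J. rescaled_increment A s \<epsilon> \<tau> \<omega> \<le> z \<tau>}) (?Q z) < e"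
      by (simp add: dist_real_def S_def)
  qed
qed

text \<open>\<open>orthant_prob\<close> refers to increments from time \<open>0\<close>, and Brownian motion starts at \<open>0\<close> only almost surely.\<close>

lemma airy1_forward_fdd:
  assumes airy: "airy1_process M A" and bm: "brownian_motion 2 N B"
  shows "fdd_converges (at_right 0) {0<..} M (\<lambda>\<epsilon> t. rescaled_increment A s \<epsilon> t) N B"
  unfolding fdd_converges_def
proof (intro allI impI)
  fix J :: "real set" and f :: "(real \<Rightarrow> real) \<Rightarrow> real"
  assume J: "finite J" "J \<subseteq> {0<..}"
    and f: "continuous_map (product_topology (\<lambda>_. euclideanreal) J) euclideanreal f" "bounded (f ` (\<Pi>\<^sub>E j\<in>J. UNIV))"
  interpret M: prob_space M using airy by (simp add: airy1_process_def)
  interpret N: prob_space N using bm by (simp add: brownian_motion_def)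
  have Am[measurable]: "A t \<in> borel_measurable M" for t using airy by (simp add: airy1_process_def)
  have Bm[measurable]: "B \<tau> \<in> borel_measurable N" if "\<tau> \<in> J" for \<tau>
  proof -
    have "0 \<le> \<tau>" using J(2) that by auto
    then show ?thesis using bm by (simp add: brownian_motion_def)
  qed
  have B0[measurable]: "B 0 \<in> borel_measurable N" using bm by (simp add: brownian_motion_def)
  have zero: "AE \<omega> in N. B 0 \<omega> = 0" using bm by (simp add: brownian_motion_def)
  have orth: "orthant_prob N B J z = N.prob {\<omega> \<in> space N. \<forall>j\<in>J. B j \<omega> \<le> z j}" for z
    unfolding orthant_prob_def
  proof (rule N.finite_measure_eq_AE)
    show "AE \<omega> in N. (\<omega> \<in> {\<omega> \<in> space N. \<forall>\<tau>\<in>J. B \<tau> \<omega> - B 0 \<omega> \<le> z \<tau>}) = (\<omega> \<in> {\<omega> \<in> space N. \<forall>j\<in>J. B j \<omega> \<le> z j})"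
      using zero by eventually_elim simp
    show "{\<omega> \<in> space N. \<forall>\<tau>\<in>J. B \<tau> \<omega> - B 0 \<omega> \<le> z \<tau>} \<in> sets N" "{\<omega> \<in> space N. \<forall>j\<in>J. B j \<omega> \<le> z j} \<in> sets N"
      using J(1) by measurable
  qed
  interpret orthant_convergence M N "at_right 0" J "\<lambda>\<epsilon> t. rescaled_increment A s \<epsilon> t" B
  proof
    show "(\<lambda>\<omega>. rescaled_increment A s \<epsilon> j \<omega>) \<in> borel_measurable M" for \<epsilon> j
      unfolding rescaled_increment_def by measurable
    show "((\<lambda>\<epsilon>. M.prob {\<omega> \<in> space M. \<forall>j\<in>J. rescaled_increment A s \<epsilon> j \<omega> \<le> z j}) \<longlongrightarrow>
        N.prob {\<omega> \<in> space N. \<forall>j\<in>J. B j \<omega> \<le> z j}) (at_right 0)" for z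
      using orthant_limit[OF airy bm J] unfolding orth .
  qed (use J(1) Bm in auto)
  show "((\<lambda>\<epsilon>. \<integral>\<omega>. f (\<lambda>j\<in>J. rescaled_increment A s \<epsilon> j \<omega>) \<partial>M) \<longlongrightarrow> (\<integral>\<omega>. f (\<lambda>j\<in>J. B j \<omega>) \<partial>N)) (at_right 0)"
    by (rule weak_convergence[OF f])
qed

lemma K1_ext_reverse: "K1_ext (- t', y) (- t, x) = K1_ext (t, x) (t', y)"
  by (simp add: K1_ext_def power2_commute add.commute)

lemma level_det_reverse:
  assumes T: "finite T"
  shows "level_det (uminus ` T) (\<lambda>t. \<xi> (- t)) = level_det T \<xi>"
proof -
  let ?k = "\<lambda>(t, x) (t', y). indicator {\<xi> (- t)<..} x * K1_ext (t, x) (t', y) * indicator {\<xi> (- t')<..} y"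
  have "case_prod ?k \<in> borel_measurable ((count_space (uminus ` T) \<Otimes>\<^sub>M lborel) \<Otimes>\<^sub>M (count_space (uminus ` T) \<Otimes>\<^sub>M lborel))"
  proof (rule count_pair_kernel_measurable)
    fix t t' :: real
    have [measurable]: "(\<lambda>z. normal_density (fst z) s (snd z)) \<in> borel_measurable (borel \<Otimes>\<^sub>M borel)" for s
      unfolding normal_density_def by measurable
    show "(\<lambda>(x, y). indicator {\<xi> (- t)<..} x * K1_ext (t, x) (t', y) * indicator {\<xi> (- t')<..} y) \<in> borel_measurable (borel \<Otimes>\<^sub>M borel)"
      unfolding K1_ext_eq case_prod_beta by measurable
  qed (use T in simp)
  from fredholm_det_reflect[OF T this]
  have "level_det (uminus ` T) (\<lambda>t. \<xi> (- t)) = fredholm_det (count_space T \<Otimes>\<^sub>M lborel) (\<lambda>(t, x) (t', y). ?k (- t', y) (- t, x))"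
    by (simp add: level_det_def)
  also have "(\<lambda>(t, x) (t', y). ?k (- t', y) (- t, x)) =
      (\<lambda>(t, x) (t', y). indicator {\<xi> t<..} x * K1_ext (t, x) (t', y) * indicator {\<xi> t'<..} y)"
    by (auto simp: fun_eq_iff K1_ext_reverse mult_ac)
  finally show ?thesis by (simp add: level_det_def)
qed

text \<open>The process is reversible in law, because reversing the times transposes the kernel. This
  reduces the increments to the left of \<open>s\<close> to those to the right of \<open>- s\<close>.\<close>

lemma airy1_process_reverse:
  assumes "airy1_process M A"
  shows "airy1_process M (\<lambda>t. A (- t))"
  unfolding airy1_process_iff
proof (intro conjI allI impI)
  show "prob_space M" "A (- t) \<in> borel_measurable M" for t using assms by (auto simp: airy1_process_iff)
  fix T :: "real set" and \<xi> :: "real \<Rightarrow> real"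
  assume T: "finite T" "T \<noteq> {}"
  have "measure M {\<omega> \<in> space M. \<forall>t\<in>uminus ` T. A t \<omega> \<le> \<xi> (- t)} = level_det (uminus ` T) (\<lambda>t. \<xi> (- t))"
  proof -
    have "finite (uminus ` T)" "uminus ` T \<noteq> {}" using T by auto
    from conjunct2[OF conjunct2[OF iffD1[OF airy1_process_iff assms]], rule_format, OF this]
    show ?thesis .
  qed
  then show "measure M {\<omega> \<in> space M. \<forall>t\<in>T. A (- t) \<omega> \<le> \<xi> t} = level_det T \<xi>"
    by (simp add: level_det_reverse[OF T(1)])
qed

theorem theorem3:
  fixes A :: "real \<Rightarrow> 'a \<Rightarrow> real" and M :: "'a measure"
    and B :: "real \<Rightarrow> 'b \<Rightarrow> real" and N :: "'b measure"
    and s :: real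
  assumes "airy1_process M A"
    and "brownian_motion 2 N B"
  shows "fdd_converges (at_right 0) {0<..} M (\<lambda>\<epsilon> t. rescaled_increment A s \<epsilon> t) N B \<and>
         fdd_converges (at_right 0) {0<..} M (\<lambda>\<epsilon> t. rescaled_increment A s \<epsilon> (- t)) N B"
proof
  show "fdd_converges (at_right 0) {0<..} M (\<lambda>\<epsilon> t. rescaled_increment A s \<epsilon> t) N B"
    by (rule airy1_forward_fdd[OF assms])
  have "fdd_converges (at_right 0) {0<..} M (\<lambda>\<epsilon> t. rescaled_increment (\<lambda>t. A (- t)) (- s) \<epsilon> t) N B"
    by (rule airy1_forward_fdd[OF airy1_process_reverse[OF assms(1)] assms(2)])
  moreover have "rescaled_increment (\<lambda>t. A (- t)) (- s) \<epsilon> t = rescaled_increment A s \<epsilon> (- t)" for \<epsilon> t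
    by (simp add: rescaled_increment_def fun_eq_iff)
  ultimately show "fdd_converges (at_right 0) {0<..} M (\<lambda>\<epsilon> t. rescaled_increment A s \<epsilon> (- t)) N B" by simp
qed

end
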